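(* The fibration (over $\mathbf{Set}$) of multicategories with non-standard amalgamation is equivalent to the following fibration over $\mathbf{Set}$. Its objects over a set $O$ are the finitary cartesian monads on $\mathbf{Set}_{/O}$ whose functor part preserves wide pullbacks; a morphism over a function $u:O\to Q$ between a monad on $\mathbf{Set}_{/O}$ and a monad on $\mathbf{Set}_{/Q}$ is a cartesian morphism of monads whose functor part is the pullback functor $u^*:\mathbf{Set}_{/Q}\to\mathbf{Set}_{/O}$ (counted as a morphism from the monad on $\mathbf{Set}_{/O}$ to the monad on $\mathbf{Set}_{/Q}$).
   Context: Notation: $[n]=\{0,\dots,n\}$, $(n]=\{1,\dots,n\}$; $S_n$ is the group of permutations of $[n]$ fixing $0$. Amalgamated signatures. An object of $Sig_a$ over a set $O$ is a set $A$ together with, for each $a\in A$, a natural number $|a|$ and a function $\partial_a:[|a|]\to O$. A morphism $(f,\sigma,u):(A,\partial,O)\to(B,\partial,Q)$ over $u:O\to Q$ consists of a function $f:A\to B$ and, for each $a\in A$, a permutation $\sigma_a\in S_{|a|}$, such that $|f(a)|=|a|$ and $u\circ\partial_a\circ\sigma_a=\partial_{f(a)}$. Composition: $(g,\tau,v)\circ(f,\sigma,u)=(gf,(\sigma_a\circ\tau_{f(a)})_a,vu)$. The functor $p_a:Sig_a\to\mathbf{Set}$ sends $(f,\sigma,u)$ to $u$ and is a fibration. Tensor over $O$: $A\otimes_O B=\{\langle a,b_i\rangle_{i\in(|a|]}: a\in A,\ b_i\in B,\ \partial_a(i)=\partial_{b_i}(0)\}$, where $\langle a,b_i\rangle_i$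 has arity $\sum_i|b_i|$, value $\partial_a(0)$ at $0$, and on positive arguments the concatenation (blocks in order $i=1,\dots,|a|$) of the restrictions of $\partial_{b_i}$ to $(|b_i|]$. For $(f,\sigma,u):A\to A'$ and $(g,\tau,u):B\to B'$ over the same $u$, the tensor sends $\langle a,b_i\rangle_i$ to $\langle f(a),g(b_{\sigma_a(j)})\rangle_{j}$, with permutation sending the $j$-th block to the $\sigma_a(j)$-th block via $\tau_{b_{\sigma_a(j)}}$. The unit is $I_O=(O,\partial,O)$ with $\partial_x:[1]\to O$ constant equal to $x$. Associativity and unit isomorphisms are the evident ones (with identity permutations). Multicategories with non-standard amalgamation ((1-level) multicategories) are the monoids in the fibres of $p_a$: a monoid over $O$ is $(M,m:M\otimes_O M\to M,e:I_O\to M)$ in the fibre over $O$ satisfying the usual associativity and unit laws; a morphism over $u$ is a morphism $f$ of $Sig_a$ over $u$ with $f\circ m=m'\circ(f\otimes_u f)$ and $f\circ e=e'\circ I_u$. They form a fibration over $\mathbf{Set}$. Monads. A cartesian monad is one whose functor preserves pullbacks and whose unit and multiplication are cartesian natural transformations; finitary means preserving filtered colimits. For monads $(M',\eta',\mu')$ on $\mathbf{Set}_{/O}$ and $(M,\eta,\mu)$ on $\mathbf{Set}_{/Q}$, a cartesian morphism of monads with functor part $u^*$ is a cartesian natural transformation $f:M'u^*\to u^*M$ such that $f\circ\eta'_{u^*}=u^*\eta$ and $f\circ\mu'_{u^*}=u^*\mu\circ f_M\circ M'f$. A natural transformation is cartesian if all its naturality squares are pullbacks. Equivalence of fibrations means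 equivalence of total categories over $\mathbf{Set}$. *)

theory Defs
  imports "HOL-Library.FuncSet" "HOL-Library.Equipollence" "HOL-Combinatorics.Permutations"
begin

section \<open>The universe\<close>

text \<open>
  The category of sets is the category of small subsets of a type \<open>'v\<close>, where small means: of
  cardinality strictly below that of \<open>'v\<close>. The type plays the role of a Grothendieck universe when its
  cardinality is an uncountable, regular strong limit; this is assumed of it explicitly where needed.
  Functions between sets, and all operations on them, are kept extensional (\<open>undefined\<close> outside
  their domain), so that equality of morphisms is equality in HOL.
\<close>

definition small :: "'v set \<Rightarrow> bool" where
  "small X \<longleftrightarrow> X \<prec> (UNIV :: 'v set)"

definition grothendieck_universe :: "'v itself \<Rightarrow> bool" where
  "grothendieck_universe (_ :: 'v itself) \<longleftrightarrow>
     (\<exists>X :: 'v set. infinite X \<and> small X) \<and>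
     (\<forall>X :: 'v set. small X \<longrightarrow> Pow X \<prec> (UNIV :: 'v set)) \<and>
     (\<forall>(I :: 'v set) (F :: 'v \<Rightarrow> 'v set).
        small I \<and> (\<forall>i\<in>I. small (F i)) \<longrightarrow> small (\<Union>i\<in>I. F i))"

text \<open>
  An arbitrary fixed injective coding of ordered pairs; one exists for every infinite \<open>'v\<close>. It is
  only used to write down the standard pullback \<open>{(o, x). u o = \<pi> x}\<close> as a subset of \<open>'v\<close>.
\<close>

definition vpair :: "'v \<times> 'v \<Rightarrow> 'v" where
  "vpair = (SOME f. inj f)"

definition vfst :: "'v \<Rightarrow> 'v" where
  "vfst z = fst (inv vpair z)"

definition vsnd :: "'v \<Rightarrow> 'v" where
  "vsnd z = snd (inv vpair z)"


section \<open>Categories, functors, natural transformations\<close>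

record ('o, 'a) cat =
  Obj :: "'o set"
  Arr :: "'a set"
  Src :: "'a \<Rightarrow> 'o"
  Tgt :: "'a \<Rightarrow> 'o"
  Idn :: "'o \<Rightarrow> 'a"
  Cmp :: "'a \<Rightarrow> 'a \<Rightarrow> 'a" (infixr "\<odot>\<index>" 70)

definition Hom :: "('o, 'a) cat \<Rightarrow> 'o \<Rightarrow> 'o \<Rightarrow> 'a set" where
  "Hom C x y = {f \<in> Arr C. Src C f = x \<and> Tgt C f = y}"

locale category =
  fixes C :: "('o, 'a) cat" (structure)
  assumes Src_Obj: "f \<in> Arr C \<Longrightarrow> Src C f \<in> Obj C"
    and Tgt_Obj: "f \<in> Arr C \<Longrightarrow> Tgt C f \<in> Obj C"
    and Idn_Hom: "x \<in> Obj C \<Longrightarrow> Idn C x \<in> Hom C x x"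
    and Cmp_Hom: "f \<in> Hom C x y \<Longrightarrow> g \<in> Hom C y z \<Longrightarrow> g \<odot> f \<in> Hom C x z"
    and Cmp_Idn: "f \<in> Hom C x y \<Longrightarrow> f \<odot> Idn C x = f"
    and Idn_Cmp: "f \<in> Hom C x y \<Longrightarrow> Idn C y \<odot> f = f"
    and Cmp_assoc: "f \<in> Hom C w x \<Longrightarrow> g \<in> Hom C x y \<Longrightarrow> h \<in> Hom C y z \<Longrightarrow>
                    (h \<odot> g) \<odot> f = h \<odot> (g \<odot> f)"

record ('o, 'a, 'p, 'b) fctr =
  omap :: "'o \<Rightarrow> 'p"
  amap :: "'a \<Rightarrow> 'b"

definition is_functor ::
    "('o, 'a) cat \<Rightarrow> ('p, 'b) cat \<Rightarrow> ('o, 'a, 'p, 'b) fctr \<Rightarrow> bool" where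
  "is_functor C D F \<longleftrightarrow>
     category C \<and> category D \<and>
     omap F \<in> Obj C \<rightarrow>\<^sub>E Obj D \<and> amap F \<in> Arr C \<rightarrow>\<^sub>E Arr D \<and>
     (\<forall>f\<in>Arr C. Src D (amap F f) = omap F (Src C f) \<and> Tgt D (amap F f) = omap F (Tgt C f)) \<and>
     (\<forall>x\<in>Obj C. amap F (Idn C x) = Idn D (omap F x)) \<and>
     (\<forall>f\<in>Arr C. \<forall>g\<in>Arr C. Tgt C f = Src C g \<longrightarrow>
        amap F (g \<odot>\<^bsub>C\<^esub> f) = amap F g \<odot>\<^bsub>D\<^esub> amap F f)"

definition id_functor :: "('o, 'a) cat \<Rightarrow> ('o, 'a, 'o, 'a) fctr" where
  "id_functor C = \<lparr>omap = (\<lambda>x\<in>Obj C. x), amap = (\<lambda>f\<in>Arr C. f)\<rparr>"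

definition comp_functor ::
    "('o, 'a) cat \<Rightarrow> ('p, 'b, 'q, 'c) fctr \<Rightarrow> ('o, 'a, 'p, 'b) fctr \<Rightarrow> ('o, 'a, 'q, 'c) fctr" where
  "comp_functor C G F =
     \<lparr>omap = (\<lambda>x\<in>Obj C. omap G (omap F x)), amap = (\<lambda>f\<in>Arr C. amap G (amap F f))\<rparr>"

definition nat_trans ::
    "('o, 'a) cat \<Rightarrow> ('p, 'b) cat \<Rightarrow> ('o, 'a, 'p, 'b) fctr \<Rightarrow> ('o, 'a, 'p, 'b) fctr \<Rightarrow> ('o \<Rightarrow> 'b) \<Rightarrow> bool"
  where
  "nat_trans C D F G \<alpha> \<longleftrightarrow>
     is_functor C D F \<and> is_functor C D G \<and> \<alpha> \<in> extensional (Obj C) \<and>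
     (\<forall>x\<in>Obj C. \<alpha> x \<in> Hom D (omap F x) (omap G x)) \<and>
     (\<forall>f\<in>Arr C. amap G f \<odot>\<^bsub>D\<^esub> \<alpha> (Src C f) = \<alpha> (Tgt C f) \<odot>\<^bsub>D\<^esub> amap F f)"

definition is_iso :: "('o, 'a) cat \<Rightarrow> 'a \<Rightarrow> bool" where
  "is_iso C f \<longleftrightarrow> f \<in> Arr C \<and>
     (\<exists>g\<in>Hom C (Tgt C f) (Src C f). g \<odot>\<^bsub>C\<^esub> f = Idn C (Src C f) \<and> f \<odot>\<^bsub>C\<^esub> g = Idn C (Tgt C f))"

definition nat_iso ::
    "('o, 'a) cat \<Rightarrow> ('p, 'b) cat \<Rightarrow> ('o, 'a, 'p, 'b) fctr \<Rightarrow> ('o, 'a, 'p, 'b) fctr \<Rightarrow> ('o \<Rightarrow> 'b) \<Rightarrow> bool"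
  where
  "nat_iso C D F G \<alpha> \<longleftrightarrow> nat_trans C D F G \<alpha> \<and> (\<forall>x\<in>Obj C. is_iso D (\<alpha> x))"


section \<open>Limits and colimits\<close>

definition is_pullback :: "('o, 'a) cat \<Rightarrow> 'a \<Rightarrow> 'a \<Rightarrow> 'a \<Rightarrow> 'a \<Rightarrow> bool" where
  "is_pullback C f g p q \<longleftrightarrow>
     f \<in> Arr C \<and> g \<in> Arr C \<and> p \<in> Arr C \<and> q \<in> Arr C \<and>
     Tgt C f = Tgt C g \<and> Src C p = Src C q \<and> Tgt C p = Src C f \<and> Tgt C q = Src C g \<and>
     f \<odot>\<^bsub>C\<^esub> p = g \<odot>\<^bsub>C\<^esub> q \<and>
     (\<forall>r\<in>Arr C. \<forall>s\<in>Arr C.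
        Src C r = Src C s \<and> Tgt C r = Src C f \<and> Tgt C s = Src C g \<and> f \<odot>\<^bsub>C\<^esub> r = g \<odot>\<^bsub>C\<^esub> s \<longrightarrow>
        (\<exists>!h. h \<in> Hom C (Src C r) (Src C p) \<and> p \<odot>\<^bsub>C\<^esub> h = r \<and> q \<odot>\<^bsub>C\<^esub> h = s))"

definition preserves_pullbacks ::
    "('o, 'a) cat \<Rightarrow> ('p, 'b) cat \<Rightarrow> ('o, 'a, 'p, 'b) fctr \<Rightarrow> bool" where
  "preserves_pullbacks C D F \<longleftrightarrow>
     (\<forall>f g p q. is_pullback C f g p q \<longrightarrow>
        is_pullback D (amap F f) (amap F g) (amap F p) (amap F q))"

definition cartesian_nat_trans ::
    "('o, 'a) cat \<Rightarrow> ('p, 'b) cat \<Rightarrow> ('o, 'a, 'p, 'b) fctr \<Rightarrow> ('o, 'a, 'p, 'b) fctr \<Rightarrow> ('o \<Rightarrow> 'b) \<Rightarrow> bool"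
  where
  "cartesian_nat_trans C D F G \<alpha> \<longleftrightarrow>
     nat_trans C D F G \<alpha> \<and>
     (\<forall>f\<in>Arr C. is_pullback D (amap G f) (\<alpha> (Tgt C f)) (\<alpha> (Src C f)) (amap F f))"

text \<open>The limit of a family \<open>f i\<close> (\<open>i \<in> I\<close>) of arrows into \<open>y\<close>: projections \<open>p i\<close> and diagonal \<open>d\<close>.\<close>

definition is_wide_pullback ::
    "'i set \<Rightarrow> ('o, 'a) cat \<Rightarrow> ('i \<Rightarrow> 'a) \<Rightarrow> 'o \<Rightarrow> ('i \<Rightarrow> 'a) \<Rightarrow> 'a \<Rightarrow> bool" where
  "is_wide_pullback I C f y p d \<longleftrightarrow>
     d \<in> Arr C \<and> Tgt C d = y \<and>
     (\<forall>i\<in>I. f i \<in> Arr C \<and> Tgt C (f i) = y \<and>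
            p i \<in> Hom C (Src C d) (Src C (f i)) \<and> f i \<odot>\<^bsub>C\<^esub> p i = d) \<and>
     (\<forall>e s. e \<in> Arr C \<and> Tgt C e = y \<and>
            (\<forall>i\<in>I. s i \<in> Hom C (Src C e) (Src C (f i)) \<and> f i \<odot>\<^bsub>C\<^esub> s i = e) \<longrightarrow>
        (\<exists>!h. h \<in> Hom C (Src C e) (Src C d) \<and> d \<odot>\<^bsub>C\<^esub> h = e \<and> (\<forall>i\<in>I. p i \<odot>\<^bsub>C\<^esub> h = s i)))"

definition preserves_wide_pullbacks_of_shape ::
    "'i set \<Rightarrow> ('o, 'a) cat \<Rightarrow> ('p, 'b) cat \<Rightarrow> ('o, 'a, 'p, 'b) fctr \<Rightarrow> bool" where
  "preserves_wide_pullbacks_of_shape I C D F \<longleftrightarrow>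
     (\<forall>f y p d. is_wide_pullback I C f y p d \<longrightarrow>
        is_wide_pullback I D (\<lambda>i. amap F (f i)) (omap F y) (\<lambda>i. amap F (p i)) (amap F d))"

definition filtered :: "('j, 'k) cat \<Rightarrow> bool" where
  "filtered J \<longleftrightarrow> category J \<and> Obj J \<noteq> {} \<and>
     (\<forall>i\<in>Obj J. \<forall>j\<in>Obj J. \<exists>k\<in>Obj J. Hom J i k \<noteq> {} \<and> Hom J j k \<noteq> {}) \<and>
     (\<forall>i\<in>Obj J. \<forall>j\<in>Obj J. \<forall>f\<in>Hom J i j. \<forall>g\<in>Hom J i j.
        \<exists>k\<in>Obj J. \<exists>h\<in>Hom J j k. h \<odot>\<^bsub>J\<^esub> f = h \<odot>\<^bsub>J\<^esub> g)"

definition is_cocone ::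
    "('j, 'k) cat \<Rightarrow> ('o, 'a) cat \<Rightarrow> ('j, 'k, 'o, 'a) fctr \<Rightarrow> 'o \<Rightarrow> ('j \<Rightarrow> 'a) \<Rightarrow> bool" where
  "is_cocone J C D c l \<longleftrightarrow>
     is_functor J C D \<and> c \<in> Obj C \<and>
     (\<forall>j\<in>Obj J. l j \<in> Hom C (omap D j) c) \<and>
     (\<forall>k\<in>Arr J. l (Tgt J k) \<odot>\<^bsub>C\<^esub> amap D k = l (Src J k))"

definition is_colimit ::
    "('j, 'k) cat \<Rightarrow> ('o, 'a) cat \<Rightarrow> ('j, 'k, 'o, 'a) fctr \<Rightarrow> 'o \<Rightarrow> ('j \<Rightarrow> 'a) \<Rightarrow> bool" where
  "is_colimit J C D c l \<longleftrightarrow>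
     is_cocone J C D c l \<and>
     (\<forall>c' l'. is_cocone J C D c' l' \<longrightarrow>
        (\<exists>!h. h \<in> Hom C c c' \<and> (\<forall>j\<in>Obj J. h \<odot>\<^bsub>C\<^esub> l j = l' j)))"

definition preserves_colimits_of_shape ::
    "('j, 'k) cat \<Rightarrow> ('o, 'a) cat \<Rightarrow> ('p, 'b) cat \<Rightarrow> ('o, 'a, 'p, 'b) fctr \<Rightarrow> bool" where
  "preserves_colimits_of_shape J C D F \<longleftrightarrow>
     (\<forall>X c l. is_colimit J C X c l \<longrightarrow>
        is_colimit J D (comp_functor J F X) (omap F c) (\<lambda>j. amap F (l j)))"


section \<open>Fibrations\<close>

definition cartesian_arrow ::
    "('o, 'a) cat \<Rightarrow> ('p, 'b) cat \<Rightarrow> ('o, 'a, 'p, 'b) fctr \<Rightarrow> 'a \<Rightarrow> bool" where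
  "cartesian_arrow E B P f \<longleftrightarrow>
     f \<in> Arr E \<and>
     (\<forall>g\<in>Arr E. \<forall>w \<in> Hom B (omap P (Src E g)) (omap P (Src E f)).
        Tgt E g = Tgt E f \<and> amap P g = amap P f \<odot>\<^bsub>B\<^esub> w \<longrightarrow>
        (\<exists>!h. h \<in> Hom E (Src E g) (Src E f) \<and> amap P h = w \<and> f \<odot>\<^bsub>E\<^esub> h = g))"

definition fibration :: "('o, 'a) cat \<Rightarrow> ('p, 'b) cat \<Rightarrow> ('o, 'a, 'p, 'b) fctr \<Rightarrow> bool" where
  "fibration E B P \<longleftrightarrow>
     is_functor E B P \<and>
     (\<forall>x\<in>Obj E. \<forall>u\<in>Arr B. Tgt B u = omap P x \<longrightarrow>
        (\<exists>f. cartesian_arrow E B P f \<and> Tgt E f = x \<and> amap P f = u))"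

text \<open>
  Equivalence of the total categories over the base \<open>B\<close>: the two functors commute with the projections
  and the two natural isomorphisms are vertical.
\<close>

definition equivalent_over ::
    "('p, 'b) cat \<Rightarrow> ('o, 'a) cat \<Rightarrow> ('o, 'a, 'p, 'b) fctr \<Rightarrow>
     ('q, 'c) cat \<Rightarrow> ('q, 'c, 'p, 'b) fctr \<Rightarrow> bool" where
  "equivalent_over B E P E' P' \<longleftrightarrow>
     (\<exists>F G \<alpha> \<beta>.
        is_functor E E' F \<and> is_functor E' E G \<and>
        comp_functor E P' F = P \<and> comp_functor E' P G = P' \<and>
        nat_iso E E (id_functor E) (comp_functor E G F) \<alpha> \<and>
        nat_iso E' E' (comp_functor E' F G) (id_functor E') \<beta> \<and>
        (\<forall>x\<in>Obj E. amap P (\<alpha> x) = Idn B (omap P x)) \<and>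
        (\<forall>x\<in>Obj E'. amap P' (\<beta> x) = Idn B (omap P' x)))"


section \<open>Sets and slices\<close>

type_synonym 'v fn = "'v set \<times> ('v \<Rightarrow> 'v) \<times> 'v set"

definition fn_map :: "'v fn \<Rightarrow> 'v \<Rightarrow> 'v" where
  "fn_map f = fst (snd f)"

definition SetC :: "('v set, 'v fn) cat" where
  "SetC = \<lparr>
     Obj = {X. small X},
     Arr = {(X, f, Y). small X \<and> small Y \<and> f \<in> X \<rightarrow>\<^sub>E Y},
     Src = (\<lambda>(X, f, Y). X),
     Tgt = (\<lambda>(X, f, Y). Y),
     Idn = (\<lambda>X. (X, \<lambda>x\<in>X. x, X)),
     Cmp = (\<lambda>(Y', g, Z) (X, f, Y). (X, compose X g f, Z))\<rparr>"

definition slice :: "('o, 'a) cat \<Rightarrow> 'o \<Rightarrow> ('a, 'a \<times> 'a \<times> 'a) cat" where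
  "slice C c = \<lparr>
     Obj = {p \<in> Arr C. Tgt C p = c},
     Arr = {(p, h, q). p \<in> Arr C \<and> Tgt C p = c \<and> q \<in> Arr C \<and> Tgt C q = c \<and>
                       h \<in> Hom C (Src C p) (Src C q) \<and> q \<odot>\<^bsub>C\<^esub> h = p},
     Src = (\<lambda>(p, h, q). p),
     Tgt = (\<lambda>(p, h, q). q),
     Idn = (\<lambda>p. (p, Idn C (Src C p), p)),
     Cmp = (\<lambda>(q', k, r) (p, h, q). (p, k \<odot>\<^bsub>C\<^esub> h, r))\<rparr>"

type_synonym 'v sarr = "'v fn \<times> 'v fn \<times> 'v fn"

abbreviation SetOver :: "'v set \<Rightarrow> ('v fn, 'v sarr) cat" where
  "SetOver \<equiv> slice SetC"

definition slice_map :: "'v fn \<Rightarrow> ('v \<Rightarrow> 'v) \<Rightarrow> 'v fn \<Rightarrow> 'v sarr" where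
  "slice_map p h q = (p, (Src SetC p, restrict h (Src SetC p), Src SetC q), q)"

definition pb_obj :: "'v fn \<Rightarrow> 'v fn \<Rightarrow> 'v fn" where
  "pb_obj u p =
     (let P = vpair ` {(a, x). a \<in> Src SetC u \<and> x \<in> Src SetC p \<and> fn_map u a = fn_map p x}
      in (P, restrict vfst P, Src SetC u))"

definition pb_functor :: "'v fn \<Rightarrow> ('v fn, 'v sarr, 'v fn, 'v sarr) fctr" where
  "pb_functor u = \<lparr>
     omap = (\<lambda>p \<in> Obj (SetOver (Tgt SetC u)). pb_obj u p),
     amap = (\<lambda>(p, h, q) \<in> Arr (SetOver (Tgt SetC u)).
               slice_map (pb_obj u p) (\<lambda>z. vpair (vfst z, fn_map h (vsnd z))) (pb_obj u q))\<rparr>"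

text \<open>
  The canonical isomorphisms \<open>p \<cong> id\<^sup>* p\<close> and \<open>(v u)\<^sup>* p \<cong> u\<^sup>* (v\<^sup>* p)\<close> and their inverses; on elements,
  \<open>x \<mapsto> (p x, x)\<close> and \<open>(a, x) \<mapsto> (a, (u a, x))\<close>.
\<close>

definition pb_id_to :: "'v fn \<Rightarrow> 'v sarr" where
  "pb_id_to p = slice_map p (\<lambda>x. vpair (fn_map p x, x)) (pb_obj (Idn SetC (Tgt SetC p)) p)"

definition pb_id_from :: "'v fn \<Rightarrow> 'v sarr" where
  "pb_id_from p = slice_map (pb_obj (Idn SetC (Tgt SetC p)) p) vsnd p"

definition pb_comp_to :: "'v fn \<Rightarrow> 'v fn \<Rightarrow> 'v fn \<Rightarrow> 'v sarr" where
  "pb_comp_to v u p =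
     slice_map (pb_obj (v \<odot>\<^bsub>SetC\<^esub> u) p)
       (\<lambda>z. vpair (vfst z, vpair (fn_map u (vfst z), vsnd z)))
       (pb_obj u (pb_obj v p))"

definition pb_comp_from :: "'v fn \<Rightarrow> 'v fn \<Rightarrow> 'v fn \<Rightarrow> 'v sarr" where
  "pb_comp_from v u p =
     slice_map (pb_obj u (pb_obj v p))
       (\<lambda>z. vpair (vfst z, vsnd (vsnd z)))
       (pb_obj (v \<odot>\<^bsub>SetC\<^esub> u) p)"


section \<open>The fibration of monads\<close>

record ('o, 'a) mnd =
  mfun :: "('o, 'a, 'o, 'a) fctr"
  eta :: "'o \<Rightarrow> 'a"
  mu :: "'o \<Rightarrow> 'a"

definition is_monad :: "('o, 'a) cat \<Rightarrow> ('o, 'a) mnd \<Rightarrow> bool" where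
  "is_monad C T \<longleftrightarrow>
     is_functor C C (mfun T) \<and>
     nat_trans C C (id_functor C) (mfun T) (eta T) \<and>
     nat_trans C C (comp_functor C (mfun T) (mfun T)) (mfun T) (mu T) \<and>
     (\<forall>x\<in>Obj C.
        mu T x \<odot>\<^bsub>C\<^esub> amap (mfun T) (eta T x) = Idn C (omap (mfun T) x) \<and>
        mu T x \<odot>\<^bsub>C\<^esub> eta T (omap (mfun T) x) = Idn C (omap (mfun T) x) \<and>
        mu T x \<odot>\<^bsub>C\<^esub> amap (mfun T) (mu T x) = mu T x \<odot>\<^bsub>C\<^esub> mu T (omap (mfun T) x))"

definition cartesian_monad :: "('o, 'a) cat \<Rightarrow> ('o, 'a) mnd \<Rightarrow> bool" where
  "cartesian_monad C T \<longleftrightarrow>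
     is_monad C T \<and>
     preserves_pullbacks C C (mfun T) \<and>
     cartesian_nat_trans C C (id_functor C) (mfun T) (eta T) \<and>
     cartesian_nat_trans C C (comp_functor C (mfun T) (mfun T)) (mfun T) (mu T)"

text \<open>Small shapes are categories and index sets living in small subsets of the universe \<open>'v\<close>.\<close>

definition finitary :: "'v set \<Rightarrow> ('v fn, 'v sarr, 'v fn, 'v sarr) fctr \<Rightarrow> bool" where
  "finitary A F \<longleftrightarrow>
     (\<forall>J :: ('v, 'v) cat. filtered J \<and> small (Obj J) \<and> small (Arr J) \<longrightarrow>
        preserves_colimits_of_shape J (SetOver A) (SetOver A) F)"

definition preserves_wide_pullbacks ::
    "'v set \<Rightarrow> ('v fn, 'v sarr, 'v fn, 'v sarr) fctr \<Rightarrow> bool" where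
  "preserves_wide_pullbacks A F \<longleftrightarrow>
     (\<forall>I :: 'v set. small I \<longrightarrow>
        preserves_wide_pullbacks_of_shape I (SetOver A) (SetOver A) F)"

type_synonym 'v mobj = "'v set \<times> ('v fn, 'v sarr) mnd"
type_synonym 'v marr = "'v mobj \<times> 'v fn \<times> ('v fn \<Rightarrow> 'v sarr) \<times> 'v mobj"

definition monad_obj :: "'v mobj \<Rightarrow> bool" where
  "monad_obj = (\<lambda>(A, T). small A \<and> cartesian_monad (SetOver A) T \<and>
                         finitary A (mfun T) \<and> preserves_wide_pullbacks A (mfun T))"

text \<open>Cartesian morphisms of monads \<open>f : M' u\<^sup>* \<rightarrow> u\<^sup>* M\<close> with functor part \<open>u\<^sup>*\<close>.\<close>

definition cartesian_monad_mor ::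
    "'v fn \<Rightarrow> ('v fn, 'v sarr) mnd \<Rightarrow> ('v fn, 'v sarr) mnd \<Rightarrow> ('v fn \<Rightarrow> 'v sarr) \<Rightarrow> bool" where
  "cartesian_monad_mor u M' M f \<longleftrightarrow>
     (let S = SetOver (Src SetC u); S' = SetOver (Tgt SetC u); U = pb_functor u in
        cartesian_nat_trans S' S (comp_functor S' (mfun M') U) (comp_functor S' U (mfun M)) f \<and>
        (\<forall>x\<in>Obj S'.
           f x \<odot>\<^bsub>S\<^esub> eta M' (omap U x) = amap U (eta M x) \<and>
           f x \<odot>\<^bsub>S\<^esub> mu M' (omap U x) =
             amap U (mu M x) \<odot>\<^bsub>S\<^esub> f (omap (mfun M) x) \<odot>\<^bsub>S\<^esub> amap (mfun M') (f x)))"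

text \<open>
  Since \<open>u \<mapsto> u\<^sup>*\<close> is only pseudofunctorial, identities and composites involve the canonical
  isomorphisms: the composite of \<open>f : L u\<^sup>* \<rightarrow> u\<^sup>* M\<close> and \<open>g : M v\<^sup>* \<rightarrow> v\<^sup>* N\<close> is
  \<open>L (v u)\<^sup>* \<cong> L u\<^sup>* v\<^sup>* \<rightarrow> u\<^sup>* M v\<^sup>* \<rightarrow> u\<^sup>* v\<^sup>* N \<cong> (v u)\<^sup>* N\<close>.
\<close>

definition mon_id :: "'v mobj \<Rightarrow> 'v fn \<Rightarrow> 'v sarr" where
  "mon_id = (\<lambda>(A, T).
     \<lambda>x \<in> Obj (SetOver A).
       pb_id_to (omap (mfun T) x) \<odot>\<^bsub>SetOver A\<^esub> amap (mfun T) (pb_id_from x))"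

definition mon_comp ::
    "'v fn \<Rightarrow> ('v fn \<Rightarrow> 'v sarr) \<Rightarrow> 'v fn \<Rightarrow> ('v fn \<Rightarrow> 'v sarr) \<Rightarrow>
     ('v fn, 'v sarr) mnd \<Rightarrow> ('v fn, 'v sarr) mnd \<Rightarrow> 'v fn \<Rightarrow> 'v sarr" where
  "mon_comp v g u f L N =
     (let S = SetOver (Src SetC u) in
      (\<lambda>x \<in> Obj (SetOver (Tgt SetC v)).
        pb_comp_from v u (omap (mfun N) x) \<odot>\<^bsub>S\<^esub>
        amap (pb_functor u) (g x) \<odot>\<^bsub>S\<^esub>
        f (omap (pb_functor v) x) \<odot>\<^bsub>S\<^esub>
        amap (mfun L) (pb_comp_to v u x)))"

definition MonC :: "('v mobj, 'v marr) cat" where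
  "MonC = \<lparr>
     Obj = {X. monad_obj X},
     Arr = {((A, M'), u, f, (B, M)). monad_obj (A, M') \<and> monad_obj (B, M) \<and>
              u \<in> Hom SetC A B \<and> cartesian_monad_mor u M' M f},
     Src = (\<lambda>(X, u, f, Y). X),
     Tgt = (\<lambda>(X, u, f, Y). Y),
     Idn = (\<lambda>X. (X, Idn SetC (fst X), mon_id X, X)),
     Cmp = (\<lambda>(Y', v, g, Z) (X, u, f, Y).
              (X, v \<odot>\<^bsub>SetC\<^esub> u, mon_comp v g u f (snd X) (snd Z), Z))\<rparr>"

definition mon_proj :: "('v mobj, 'v marr, 'v set, 'v fn) fctr" where
  "mon_proj = \<lparr>omap = (\<lambda>X \<in> Obj MonC. fst X), amap = (\<lambda>(X, u, f, Y) \<in> Arr MonC. u)\<rparr>"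


section \<open>Amalgamated signatures\<close>

text \<open>
  The type of operations is a parameter, so that a tensor product can be formed on the type
  \<open>'a \<times> 'b list\<close>, with \<open>\<langle>a, b\<^sub>1, \<dots>, b\<^sub>n\<rangle>\<close> represented by \<open>(a, [b\<^sub>1, \<dots>, b\<^sub>n])\<close>. List positions count
  from 0, hence the shifts by one below.
\<close>

record ('a, 'o) sig =
  ops :: "'a set"
  ar :: "'a \<Rightarrow> nat"
  bd :: "'a \<Rightarrow> nat \<Rightarrow> 'o"

definition sig_over :: "'o set \<Rightarrow> ('a, 'o) sig \<Rightarrow> bool" where
  "sig_over Q A \<longleftrightarrow>
     ar A \<in> extensional (ops A) \<and>
     bd A \<in> (\<Pi>\<^sub>E a\<in>ops A. {0..ar A a} \<rightarrow>\<^sub>E Q)"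

record ('a, 'b, 'o, 'q) sigmor =
  fop :: "'a \<Rightarrow> 'b"
  perm :: "'a \<Rightarrow> nat \<Rightarrow> nat"
  fob :: "'o \<Rightarrow> 'q"

definition sig_mor ::
    "'o set \<Rightarrow> ('a, 'o) sig \<Rightarrow> 'q set \<Rightarrow> ('b, 'q) sig \<Rightarrow> ('a, 'b, 'o, 'q) sigmor \<Rightarrow> bool" where
  "sig_mor R A Q B \<phi> \<longleftrightarrow>
     fob \<phi> \<in> R \<rightarrow>\<^sub>E Q \<and> fop \<phi> \<in> ops A \<rightarrow>\<^sub>E ops B \<and> perm \<phi> \<in> extensional (ops A) \<and>
     (\<forall>a\<in>ops A.
        perm \<phi> a permutes {1..ar A a} \<and>
        ar B (fop \<phi> a) = ar A a \<and>
        (\<forall>i\<in>{0..ar A a}. fob \<phi> (bd A a (perm \<phi> a i)) = bd B (fop \<phi> a) i))"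

text \<open>Identities and composites take the source signature and its set of objects as arguments.\<close>

definition sig_id :: "'o set \<Rightarrow> ('a, 'o) sig \<Rightarrow> ('a, 'a, 'o, 'o) sigmor" where
  "sig_id R A = \<lparr>fop = (\<lambda>a\<in>ops A. a), perm = (\<lambda>a\<in>ops A. id), fob = (\<lambda>x\<in>R. x)\<rparr>"

definition sig_comp ::
    "'o set \<Rightarrow> ('a, 'o) sig \<Rightarrow> ('b, 'c, 'q, 's) sigmor \<Rightarrow> ('a, 'b, 'o, 'q) sigmor \<Rightarrow>
     ('a, 'c, 'o, 's) sigmor" where
  "sig_comp R A \<psi> \<phi> = \<lparr>
     fop = compose (ops A) (fop \<psi>) (fop \<phi>),
     perm = (\<lambda>a\<in>ops A. perm \<phi> a \<circ> perm \<psi> (fop \<phi> a)),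
     fob = compose R (fob \<psi>) (fob \<phi>)\<rparr>"

definition tensor :: "('a, 'o) sig \<Rightarrow> ('b, 'o) sig \<Rightarrow> ('a \<times> 'b list, 'o) sig" where
  "tensor A B =
     (let T = {(a, bs). a \<in> ops A \<and> length bs = ar A a \<and>
                 (\<forall>i\<in>{1..ar A a}. bs ! (i - 1) \<in> ops B \<and> bd A a i = bd B (bs ! (i - 1)) 0)};
          n = (\<lambda>bs. sum_list (map (ar B) bs))
      in \<lparr>ops = T,
          ar = (\<lambda>(a, bs)\<in>T. n bs),
          bd = (\<lambda>(a, bs)\<in>T. \<lambda>i\<in>{0..n bs}.
                  if i = 0 then bd A a 0
                  else concat (map (\<lambda>b. map (bd B b) [1..<Suc (ar B b)]) bs) ! (i - 1))\<rparr>)"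

text \<open>
  For a list \<open>ns\<close> of block sizes, \<open>block_perm ns \<sigma> \<tau>\<close> has as its \<open>j\<close>-th block the positions of the
  \<open>\<sigma> j\<close>-th block of \<open>ns\<close>, permuted by \<open>\<tau> (\<sigma> j)\<close>: it maps the \<open>k\<close>-th position of its \<open>j\<close>-th
  block to position \<open>\<tau> (\<sigma> j) k\<close> of the \<open>\<sigma> j\<close>-th block of \<open>ns\<close>.
\<close>

definition block_perm :: "nat list \<Rightarrow> (nat \<Rightarrow> nat) \<Rightarrow> (nat \<Rightarrow> nat \<Rightarrow> nat) \<Rightarrow> nat \<Rightarrow> nat" where
  "block_perm ns \<sigma> \<tau> =
     (let L = concat (map (\<lambda>j. map (\<lambda>k. sum_list (take (\<sigma> j - 1) ns) + \<tau> (\<sigma> j) k)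
                                   [1..<Suc (ns ! (\<sigma> j - 1))])
                          [1..<Suc (length ns)])
      in (\<lambda>p. if p \<in> {1..length L} then L ! (p - 1) else p))"

definition tensor_mor ::
    "('a, 'o) sig \<Rightarrow> ('b, 'o) sig \<Rightarrow> ('a, 'c, 'o, 'q) sigmor \<Rightarrow> ('b, 'd, 'o, 'q) sigmor \<Rightarrow>
     ('a \<times> 'b list, 'c \<times> 'd list, 'o, 'q) sigmor" where
  "tensor_mor A B \<phi> \<psi> = \<lparr>
     fop = (\<lambda>(a, bs) \<in> ops (tensor A B).
              (fop \<phi> a, map (\<lambda>j. fop \<psi> (bs ! (perm \<phi> a j - 1))) [1..<Suc (ar A a)])),
     perm = (\<lambda>(a, bs) \<in> ops (tensor A B).
              block_perm (map (ar B) bs) (perm \<phi> a) (\<lambda>i. perm \<psi> (bs ! (i - 1)))),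
     fob = fob \<phi>\<rparr>"

definition unit_sig :: "'o set \<Rightarrow> ('o, 'o) sig" where
  "unit_sig R = \<lparr>ops = R, ar = (\<lambda>x\<in>R. 1), bd = (\<lambda>x\<in>R. \<lambda>i\<in>{0..1}. x)\<rparr>"

definition unit_mor :: "'o set \<Rightarrow> ('o \<Rightarrow> 'q) \<Rightarrow> ('o, 'q, 'o, 'q) sigmor" where
  "unit_mor R u = \<lparr>fop = restrict u R, perm = (\<lambda>x\<in>R. id), fob = restrict u R\<rparr>"

text \<open>The associativity isomorphism \<open>(A \<otimes> B) \<otimes> C \<rightarrow> A \<otimes> (B \<otimes> C)\<close> and the unit isomorphisms.\<close>

fun chunks :: "nat list \<Rightarrow> 'c list \<Rightarrow> 'c list list" where
  "chunks [] cs = []"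
| "chunks (n # ns) cs = take n cs # chunks ns (drop n cs)"

definition assoc_mor ::
    "'o set \<Rightarrow> ('a, 'o) sig \<Rightarrow> ('b, 'o) sig \<Rightarrow> ('c, 'o) sig \<Rightarrow>
     (('a \<times> 'b list) \<times> 'c list, 'a \<times> ('b \<times> 'c list) list, 'o, 'o) sigmor" where
  "assoc_mor R A B C = \<lparr>
     fop = (\<lambda>((a, bs), cs) \<in> ops (tensor (tensor A B) C). (a, zip bs (chunks (map (ar B) bs) cs))),
     perm = (\<lambda>_ \<in> ops (tensor (tensor A B) C). id),
     fob = (\<lambda>x\<in>R. x)\<rparr>"

definition lunit_mor :: "'o set \<Rightarrow> ('a, 'o) sig \<Rightarrow> ('o \<times> 'a list, 'a, 'o, 'o) sigmor" where
  "lunit_mor R A = \<lparr>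
     fop = (\<lambda>(x, as) \<in> ops (tensor (unit_sig R) A). hd as),
     perm = (\<lambda>_ \<in> ops (tensor (unit_sig R) A). id),
     fob = (\<lambda>x\<in>R. x)\<rparr>"

definition runit_mor :: "'o set \<Rightarrow> ('a, 'o) sig \<Rightarrow> ('a \<times> 'o list, 'a, 'o, 'o) sigmor" where
  "runit_mor R A = \<lparr>
     fop = (\<lambda>(a, xs) \<in> ops (tensor A (unit_sig R)). a),
     perm = (\<lambda>_ \<in> ops (tensor A (unit_sig R)). id),
     fob = (\<lambda>x\<in>R. x)\<rparr>"


section \<open>The fibration of multicategories with non-standard amalgamation\<close>

record 'v mcat =
  base :: "'v set"
  msig :: "('v, 'v) sig"
  mmul :: "('v \<times> 'v list, 'v, 'v, 'v) sigmor"
  munit :: "('v, 'v, 'v, 'v) sigmor"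

text \<open>Monoids in the fibre over \<open>R = base M\<close>, with a small set of operations.\<close>

definition multicategory :: "'v mcat \<Rightarrow> bool" where
  "multicategory M \<longleftrightarrow>
     (let R = base M; A = msig M; m = mmul M; e = munit M; i = sig_id R A in
        small R \<and> small (ops A) \<and> sig_over R A \<and>
        sig_mor R (tensor A A) R A m \<and> fob m = (\<lambda>x\<in>R. x) \<and>
        sig_mor R (unit_sig R) R A e \<and> fob e = (\<lambda>x\<in>R. x) \<and>
        sig_comp R (tensor (tensor A A) A) m (tensor_mor (tensor A A) A m i) =
          sig_comp R (tensor (tensor A A) A)
            (sig_comp R (tensor A (tensor A A)) m (tensor_mor A (tensor A A) i m))
            (assoc_mor R A A A) \<and>
        sig_comp R (tensor (unit_sig R) A) m (tensor_mor (unit_sig R) A e i) = lunit_mor R A \<and>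
        sig_comp R (tensor A (unit_sig R)) m (tensor_mor A (unit_sig R) i e) = runit_mor R A)"

definition multicat_mor :: "'v mcat \<Rightarrow> 'v mcat \<Rightarrow> ('v, 'v, 'v, 'v) sigmor \<Rightarrow> bool" where
  "multicat_mor M N \<phi> \<longleftrightarrow>
     (let R = base M; A = msig M in
        sig_mor R A (base N) (msig N) \<phi> \<and>
        sig_comp R (tensor A A) \<phi> (mmul M) =
          sig_comp R (tensor A A) (mmul N) (tensor_mor A A \<phi> \<phi>) \<and>
        sig_comp R (unit_sig R) \<phi> (munit M) =
          sig_comp R (unit_sig R) (munit N) (unit_mor R (fob \<phi>)))"

type_synonym 'v mcarr = "'v mcat \<times> ('v, 'v, 'v, 'v) sigmor \<times> 'v mcat"

definition MultC :: "('v mcat, 'v mcarr) cat" where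
  "MultC = \<lparr>
     Obj = {M. multicategory M},
     Arr = {(M, \<phi>, N). multicategory M \<and> multicategory N \<and> multicat_mor M N \<phi>},
     Src = (\<lambda>(M, \<phi>, N). M),
     Tgt = (\<lambda>(M, \<phi>, N). N),
     Idn = (\<lambda>M. (M, sig_id (base M) (msig M), M)),
     Cmp = (\<lambda>(N', \<psi>, P) (M, \<phi>, N). (M, sig_comp (base M) (msig M) \<psi> \<phi>, P))\<rparr>"

definition mult_proj :: "('v mcat, 'v mcarr, 'v set, 'v fn) fctr" where
  "mult_proj = \<lparr>
     omap = (\<lambda>M \<in> Obj MultC. base M),
     amap = (\<lambda>(M, \<phi>, N) \<in> Arr MultC. (base M, fob \<phi>, base N))\<rparr>"

end

theory Submission
 imports Defs
begin

text \<open>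
 An operation of a signature with its inputs labelled by elements of \<open>t : X -> O\<close> is an element of a
 polynomial functor on \<open>Set/O\<close>. A multicategory thus yields a cartesian monad, and conversely a
 finitary functor \<open>T\<close> that preserves wide pullbacks is polynomial: over every element of \<open>T 1\<close> there is a
 generic one with finitely many labels, obtained from a wide pullback and finiteness of support. A cartesian
 transformation of polynomial functors sends generic elements to generic ones, hence is a map of operations
 together with a bijection of inputs for each operation. That bijection is the non-standard amalgamation.
 So the functor from multicategories to monads is fully faithful and, up to vertical isomorphism,
 surjective on objects. Multicategories are pulled back along \<open>u\<close> by lifting boundaries, and the
 equivalence carries cartesian lifts over to monads.
\<close>

text \<open>Permutations are hardly ever composed by hand. A morphism of signatures acts on
  operations with labelled inputs and is determined by its action on distinct labels, so equations
  between morphisms, in particular the monoid laws with their block permutations, are proved as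
  equations between labelled operations; tensor products become nested labellings through
  \<open>flat\<close>. The representation result \<open>cartesian_transformation_act\<close> then
  serves three times: for fullness, and for the multiplication and the unit of the multicategory
  extracted from a monad. Two obstacles shape the rest. Elements of a polynomial functor have to be
  elements of \<open>'v\<close>, whence the codes \<open>enc\<close> and \<open>dec\<close>. And
  \<open>u^*\<close> depends on \<open>u\<close> functorially only up to isomorphism; but an arrow
  into a pulled back object is known from its second component, and there the outer canonical
  isomorphism of a composite disappears. Monad morphisms are therefore compared on second components
  throughout.\<close>

declare split_paired_All [simp del] split_paired_Ex [simp del]

notation (input) extensional_funcset (infixr "->E" 60)
notation (input) iff (infixr "<->" 25)
abbreviation "SO \<equiv> SetOver"
abbreviation "fn \<equiv> fn_map"
abbreviation "pb \<equiv> pb_obj"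
abbreviation "cF \<equiv> comp_functor"

section \<open>Smallness\<close>

text \<open>Elements of a polynomial functor are operations with lists of labels, while carriers in
  the slices consist of elements of \<open>'v\<close>. An unspecified injection suffices as a code;
  \<open>inj_enc\<close> shows that one exists.\<close>

definition enc :: "'v * 'v list => 'v" where "enc = (SOME f. inj f)"

definition dec :: "'v => 'v * 'v list" where "dec = inv enc"

lemma small_mono: "small Y ==> X <= Y ==> small X" unfolding small_def by (meson lesspoll_trans1 subset_imp_lepoll)

lemma small_lepoll: "small (Y :: 'v set) ==> X \<lesssim> Y ==> small (X :: 'v set)" unfolding small_def by (meson lesspoll_trans1)

lemma small_image: "small (X :: 'v set) ==> small (f ` X :: 'v set)" using small_lepoll image_lepoll by blast

locale universe =
 fixes V :: "'v itself" assumes gu: "grothendieck_universe V"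
begin

lemma infinite_small: obtains N :: "'v set" where "infinite N" "small N" using gu unfolding grothendieck_universe_def by auto

lemma infinite_UNIV: "infinite (UNIV :: 'v set)" using infinite_small by (metis finite_subset subset_UNIV)

lemma small_finite: "finite X ==> small (X :: 'v set)" unfolding small_def using infinite_UNIV finite_lesspoll_infinite by blast

lemma small_UN: "small (I :: 'v set) ==> (!!i. i \<in> I ==> small (F i :: 'v set)) ==> small (\<Union>i\<in>I. F i)" using gu unfolding grothendieck_universe_def by auto

lemma small_Pow: "small (X :: 'v set) ==> Pow X \<prec> (UNIV :: 'v set)" using gu unfolding grothendieck_universe_def by auto

lemma small_Un: assumes "small (X :: 'v set)" "small Y" shows "small (X \<union> Y)"
proof -
 obtain a b :: 'v where "a ~= b" using infinite_UNIV by (metis (full_types) ex_new_if_finite finite.emptyI finite.insertI insertI1)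
 then have "X \<union> Y = (\<Union>i\<in>{a,b}. if i = a then X else Y)" by auto
 then show ?thesis using small_UN[of "{a,b}" "%i. if i = a then X else Y"] assms small_finite by auto
qed

lemma inj_vpair: "inj (vpair :: 'v * 'v => 'v)"
proof -
 have "(UNIV :: 'v set) \<times> (UNIV :: 'v set) \<lesssim> (UNIV :: 'v set)"
  using card_of_Times_same_infinite[OF infinite_UNIV] eqpoll_iff_card_of_ordIso eqpoll_imp_lepoll by blast
 then obtain f :: "'v * 'v => 'v" where "inj f" unfolding lepoll_def by auto
 then show ?thesis unfolding vpair_def by (rule someI[where P = inj])
qed

lemma vpair_eq [simp]: "vpair (a, b) = vpair (c, d) <-> (a :: 'v) = c & b = d" using inj_vpair by (auto dest: injD)

lemma vfst_vpair [simp]: "vfst (vpair (a, b)) = (a :: 'v)" and vsnd_vpair [simp]: "vsnd (vpair (a, b)) = (b :: 'v)" unfolding vfst_def vsnd_def using inj_vpair by auto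

lemma small_times: assumes "small (X :: 'v set)" "small Y" shows "small (vpair ` (X \<times> Y))"
proof -
 have "vpair ` (X \<times> Y) = (\<Union>x\<in>X. (%y. vpair (x, y)) ` Y)" by auto
 then show ?thesis using small_UN[OF assms(1), of "%x. (%y. vpair (x, y)) ` Y"] small_image[OF assms(2)] by simp
qed

text \<open>Iterated pairing with an arbitrary end marker. Codes of lists of different lengths may
  coincide, so wherever injectivity matters the length is stored next to the code.\<close>

primrec list_code :: "'v => 'v list => 'v" where "list_code z [] = z"
| "list_code z (x # xs) = vpair (x, list_code z xs)"

lemma list_code_inj: "length xs = length ys ==> list_code z xs = list_code z ys ==> xs = ys" by (induction xs ys rule: list_induct2) auto

lemma nat_code: obtains f :: "nat => 'v" where "inj f" "small (range f)"
proof -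
 obtain N :: "'v set" where N: "infinite N" "small N" by (rule infinite_small)
 then obtain f :: "nat => 'v" where "inj f" "range f <= N" using infinite_countable_subset by blast
 then show ?thesis using that N small_mono by blast
qed

lemma inj_enc: "inj (enc :: 'v * 'v list => 'v)"
proof -
 obtain n :: "nat => 'v" where n: "inj n" by (rule nat_code)
 define f :: "'v * 'v list => 'v" where "f = (%(a, xs). vpair (a, vpair (n (length xs), list_code undefined xs)))"
 have "inj f" unfolding f_def using n list_code_inj by (auto simp: inj_def)
 then show ?thesis unfolding enc_def by (rule someI[where P = inj])
qed

lemma dec_enc [simp]: "dec (enc (w :: 'v * 'v list)) = w" unfolding dec_def using inj_enc by auto

lemma enc_eq [simp]: "enc (w :: 'v * 'v list) = enc w' <-> w = w'" using inj_enc by (auto dest: injD)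

text \<open>Lists of one fixed length are small by induction on the length, and the lengths are
  indexed by the small set \<open>range n\<close>, so the closure of the universe under small unions
  applies.\<close>

lemma small_enc: assumes "small (A :: 'v set)" "small X" shows "small (enc ` (A \<times> lists X))"
proof -
 obtain n :: "nat => 'v" where n: "inj n" "small (range n)" by (rule nat_code)
 define L where "L k = list_code undefined ` {xs \<in> lists X. length xs = k}" for k
 have "small (L k)" for k
 proof (induction k)
  case 0
  have "L 0 <= {undefined}" unfolding L_def by auto
  then show ?case using small_finite finite_subset by blast
 next
  case (Suc k)
  have "L (Suc k) <= vpair ` (X \<times> L k)" unfolding L_def by (force simp: length_Suc_conv)
  then show ?case using small_mono[OF small_times[OF assms(2) Suc]] by simp
 qed
 then have *: "small (\<Union>i\<in>range n. L (inv n i))" using small_UN[OF n(2), of "%i. L (inv n i)"] by simp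
 have "list_code undefined ` lists X <= (\<Union>i\<in>range n. L (inv n i))" unfolding L_def using n(1) by auto
 then have L: "small (list_code undefined ` lists X)" using * small_mono by blast
 define f :: "'v * 'v list => 'v" where "f = (%(a, xs). vpair (a, vpair (n (length xs), list_code undefined xs)))"
 have "inj f" unfolding f_def using n list_code_inj by (auto simp: inj_def)
 have "f ` (A \<times> lists X) <= vpair ` (A \<times> vpair ` (range n \<times> list_code undefined ` lists X))" unfolding f_def by auto
 then have s: "small (f ` (A \<times> lists X))" using small_mono small_times n L assms by meson
 \<comment> \<open>Nothing but injectivity is known about \<open>enc\<close>; smallness is therefore
   proved for the explicit code \<open>f\<close> and transported along
   \<open>enc o inv f\<close>.\<close>
 have "enc ` (A \<times> lists X) = (enc o inv f) ` (f ` (A \<times> lists X))" using \<open>inj f\<close> by (simp add: image_image)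
 then show ?thesis using small_image[OF s] by (simp only:)
qed

text \<open>Graphs embed the function space into the power set of a small set, which is strictly
  below the universe. The coding \<open>k\<close> makes it possible to form a power with exponent
  \<open>I\<close> inside \<open>'v\<close>.\<close>

lemma small_funcs: assumes "small (I :: 'v set)" "small (X :: 'v set)" obtains k :: "('v => 'v) => 'v" where "inj_on k (I ->E X)" "small (k ` (I ->E X))"
proof -
 define g where "g = (%h :: 'v => 'v. (%i. vpair (i, h i)) ` I)"
 have "inj_on g (I ->E X)"
 proof (rule inj_onI)
  fix h h' assume *: "h \<in> I ->E X" "h' \<in> I ->E X" "g h = g h'"
  have "h i = h' i" if "i \<in> I" for i
  proof -
   have "vpair (i, h i) \<in> g h'" using *(3) that unfolding g_def by blast
   then show ?thesis unfolding g_def by auto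
  qed
  then show "h = h'" using * by (meson PiE_ext)
 qed
 moreover have "g ` (I ->E X) <= Pow (vpair ` (I \<times> X))" unfolding g_def by auto
 ultimately have "(I ->E X) \<lesssim> Pow (vpair ` (I \<times> X))" unfolding lepoll_def by blast
 then have l: "(I ->E X) \<prec> (UNIV :: 'v set)" using small_Pow[OF small_times[OF assms]] lesspoll_trans1 by blast
 then obtain k :: "('v => 'v) => 'v" where k: "inj_on k (I ->E X)" unfolding lesspoll_def lepoll_def by blast
 have "small (k ` (I ->E X))" unfolding small_def using l image_lepoll lesspoll_trans1 by blast
 then show ?thesis using that k by blast
qed

end


section \<open>Slices elementwise\<close>

lemma Hom_iff: "f \<in> Hom C x y <-> f \<in> Arr C & Src C f = x & Tgt C f = y" unfolding Hom_def by auto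

lemma Arr_Hom: "f \<in> Arr C <-> f \<in> Hom C (Src C f) (Tgt C f)" unfolding Hom_def by auto

definition car :: "'v fn => 'v set" where "car x = fst x"

definition ap :: "'v sarr => 'v => 'v" where "ap f = fn (fst (snd f))"

abbreviation "mO T \<equiv> omap (mfun T)"
abbreviation "mA T \<equiv> amap (mfun T)"
abbreviation "mE T x \<equiv> car (mO T x)"
abbreviation "mV T f \<equiv> ap (mA T f)"
abbreviation "uA u \<equiv> amap (pb_functor u)"
abbreviation "iO A \<equiv> Idn (SO A)"
abbreviation "sF A B \<equiv> is_functor (SO A) (SO B)"
abbreviation cmp ("_ *[_]/ _" [71, 0, 70] 70) where "g *[C] f \<equiv> Cmp C g f"
abbreviation scmp ("_ \<cdot>[_]/ _" [71, 0, 70] 70) where "g \<cdot>[A] f \<equiv> Cmp (SO A) g f"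

abbreviation "OB A \<equiv> Obj (SO A)"
abbreviation "HOM A \<equiv> Hom (SO A)"

lemma fn_map_simp [simp]: "fn (X, f, Y) = f" unfolding fn_map_def by simp

lemma Src_SetC [simp]: "Src SetC f = fst f" and Tgt_SetC [simp]: "Tgt SetC f = snd (snd f)" unfolding SetC_def by (auto split: prod.splits)

lemma Obj_SetC: "Obj SetC = {X. small X}" and Idn_SetC: "Idn SetC X = (X, \<lambda>x\<in>X. x, X)" and Cmp_SetC: "Cmp SetC (Y', g, Z) (X, f, Y) = (X, compose X g f, Z)"
 unfolding SetC_def by auto

lemma Arr_SetC: "f \<in> Arr SetC <-> small (fst f) & small (snd (snd f)) & fn f \<in> fst f ->E snd (snd f)" unfolding SetC_def by (cases f) auto

lemma Hom_SetC: "f \<in> Hom SetC X Y <-> (EX h. f = (X, h, Y) & small X & small Y & h \<in> X ->E Y)" unfolding Hom_def by (cases f) (auto simp: Arr_SetC)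

lemma category_SetC: "category (SetC :: ('v set, 'v fn) cat)"
proof
 fix f x y g z assume "f \<in> Hom (SetC :: ('v set, 'v fn) cat) x y" "g \<in> Hom SetC y z"
 then show "g *[SetC] f \<in> Hom SetC x z" by (auto simp: Hom_SetC Cmp_SetC compose_def PiE_iff)
next
 fix w x y z f g h
 assume a: "f \<in> Hom (SetC :: ('v set, 'v fn) cat) w x" "g \<in> Hom SetC x y" "h \<in> Hom SetC y z"
 obtain f' g' h' where "f = (w, f', x)" "g = (x, g', y)" "h = (y, h', z)" "f' \<in> w ->E x" using a by (auto simp: Hom_SetC)
 then show "(h *[SetC] g) *[SetC] f = h *[SetC] g *[SetC] f" by (auto simp: Cmp_SetC compose_def fun_eq_iff)
next
 fix f x y assume "f \<in> Hom (SetC :: ('v set, 'v fn) cat) x y"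
 then obtain h where h: "f = (x, h, y)" "h \<in> x ->E y" by (auto simp: Hom_SetC)
 then have "h a \<in> y" if "a \<in> x" for a using that by auto
 moreover have "h a = undefined" if "a \<notin> x" for a using that h(2) by auto
 ultimately show "f *[SetC] Idn SetC x = f" "Idn SetC y *[SetC] f = f" by (auto simp: h(1) Idn_SetC Cmp_SetC compose_def fun_eq_iff)
next
 fix f assume "f \<in> Arr (SetC :: ('v set, 'v fn) cat)"
 then show "Src SetC f \<in> Obj SetC" "Tgt SetC f \<in> Obj SetC" by (simp_all add: Arr_SetC Obj_SetC)
next
 fix x assume "x \<in> Obj (SetC :: ('v set, 'v fn) cat)"
 then show "Idn SetC x \<in> Hom SetC x x" by (simp add: Hom_SetC Idn_SetC Obj_SetC)
qed

lemma fn_map_Cmp_SetC: "f \<in> Hom SetC X Y ==> g \<in> Hom SetC Y Z ==> a \<in> X ==> fn (g *[SetC] f) a = fn g (fn f a)" by (auto simp: Hom_SetC Cmp_SetC compose_def)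

lemma OB_iff: "x \<in> OB A <-> (EX X p. x = (X, p, A) & small X & small A & p \<in> X ->E A)" unfolding slice_def by (cases x) (auto simp: Arr_SetC)

lemma OB_D: assumes "x \<in> OB A" shows "x = (car x, fn x, A)" "small (car x)" "small A" "fn x \<in> car x ->E A" "!!z. z \<in> car x ==> fn x z \<in> A"
 using assms by (auto simp: OB_iff car_def)

lemma OB_I: "small X ==> small A ==> (!!z. z \<in> X ==> p z \<in> A) ==> (X, restrict p X, A) \<in> OB A" by (auto simp: OB_iff)

lemma car_simp [simp]: "car (X, p, A) = X" by (simp add: car_def)

lemma Src_slice [simp]: "Src (slice C c) f = fst f" and Tgt_slice [simp]: "Tgt (slice C c) f = snd (snd f)" unfolding slice_def by (auto split: prod.splits)

lemma HOM_iff: "f \<in> HOM A x y <-> x \<in> OB A & y \<in> OB A & (EX h:car x ->E car y. (ALL z:car x. fn y (h z) = fn x z) & f = (x, (car x, h, car y), y))"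
proof (cases "x \<in> OB A & y \<in> OB A")
 case True
 then obtain X p Y q where xy: "x = (X, p, A)" "small X" "small A" "p \<in> X ->E A" "y = (Y, q, A)" "small Y" "q \<in> Y ->E A" by (auto simp: OB_iff)
 have "compose X q h = p <-> (ALL z:X. q (h z) = p z)" for h using xy(4) by (auto simp: compose_def fun_eq_iff PiE_iff extensional_def)
 then show ?thesis using xy True by (auto simp: Hom_iff[of f] slice_def Arr_SetC Hom_SetC Cmp_SetC)
next
 case False
 then show ?thesis by (auto simp: Hom_iff[of f] slice_def)
qed

lemma HOM_D: assumes "f \<in> HOM A x y" shows "x \<in> OB A" "y \<in> OB A" "f \<in> Arr (SO A)" "fst f = x" "snd (snd f) = y"
  "!!z. z \<in> car x ==> ap f z \<in> car y" "!!z. z \<in> car x ==> fn y (ap f z) = fn x z"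
proof -
 show "f \<in> Arr (SO A)" using assms by (simp add: Hom_iff)
qed (use assms in "auto simp: HOM_iff ap_def")

lemma Arr_HOM: "f \<in> Arr (SO A) <-> f \<in> HOM A (fst f) (snd (snd f))" by (simp add: Hom_def)

lemma HOM_eqI: assumes "f \<in> HOM A x y" "g \<in> HOM A x y" "!!z. z \<in> car x ==> ap f z = ap g z" shows "f = g"
proof -
 obtain h k where hk: "h \<in> car x ->E car y" "f = (x, (car x, h, car y), y)" "k \<in> car x ->E car y" "g = (x, (car x, k, car y), y)"
  using assms(1,2) unfolding HOM_iff by blast
 have "h = k" by (rule PiE_ext[OF hk(1,3)]) (use assms(3) hk in "simp add: ap_def")
 then show ?thesis by (simp add: hk)
qed

lemma slice_map_HOM: "x \<in> OB A ==> y \<in> OB A ==> (!!z. z \<in> car x ==> h z \<in> car y & fn y (h z) = fn x z) ==> slice_map x h y \<in> HOM A x y"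
 unfolding slice_map_def by (auto simp: HOM_iff car_def)

lemma ap_slice_map [simp]: "z \<in> car x ==> ap (slice_map x h y) z = h z" unfolding slice_map_def ap_def by (auto simp: car_def)

lemma Cmp_HOM: assumes "f \<in> HOM A x y" "g \<in> HOM A y z" shows "g \<cdot>[A] f \<in> HOM A x z" and "!!a. a \<in> car x ==> ap (g \<cdot>[A] f) a = ap g (ap f a)"
proof -
 have c: "Cmp (SO A) (q', k, r) (p, h, q) = (p, Cmp SetC k h, r)" for p h q q' k r unfolding slice_def by simp
 show "g \<cdot>[A] f \<in> HOM A x z" and "!!a. a \<in> car x ==> ap (g \<cdot>[A] f) a = ap g (ap f a)"
  using assms by (auto simp: HOM_iff ap_def c Cmp_SetC compose_def PiE_iff)
qed

lemma Idn_HOM: assumes "x \<in> OB A" shows "iO A x \<in> HOM A x x" "!!a. a \<in> car x ==> ap (iO A x) a = a"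
proof -
 have "iO A x = slice_map x (%a. a) x" unfolding slice_def slice_map_def by (simp add: Idn_SetC car_def)
 then show "iO A x \<in> HOM A x x" "!!a. a \<in> car x ==> ap (iO A x) a = a" using slice_map_HOM[OF assms assms, of "%a. a"] by auto
qed

lemma category_SetOver: "category (SO A :: ('v fn, 'v sarr) cat)"
proof
 fix w x y z f g h
 assume a: "f \<in> HOM A w x" "g \<in> HOM A x y" "h \<in> HOM A y z"
 note gf = Cmp_HOM[OF a(1,2)] and hg = Cmp_HOM[OF a(2,3)]
 show "(h \<cdot>[A] g) \<cdot>[A] f = h \<cdot>[A] g \<cdot>[A] f" by (rule HOM_eqI[OF Cmp_HOM(1)[OF a(1) hg(1)] Cmp_HOM(1)[OF gf(1) a(3)]])
   (simp add: Cmp_HOM(2)[OF a(1) hg(1)] Cmp_HOM(2)[OF gf(1) a(3)] hg(2) gf(2) HOM_D(6)[OF a(1)])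
next
 fix f x y assume a: "f \<in> HOM A x y"
 note d = HOM_D[OF a]
 note ix = Cmp_HOM[OF Idn_HOM(1)[OF d(1)] a] and iy = Cmp_HOM[OF a Idn_HOM(1)[OF d(2)]]
 show "f \<cdot>[A] iO A x = f" by (rule HOM_eqI[OF ix(1) a]) (simp add: ix(2) Idn_HOM(2)[OF d(1)])
 show "iO A y \<cdot>[A] f = f" by (rule HOM_eqI[OF iy(1) a]) (simp add: iy(2) Idn_HOM(2)[OF d(2)] d(6))
next
 fix f x y z g assume "f \<in> HOM A x y" "g \<in> HOM A y z"
 then show "g \<cdot>[A] f \<in> HOM A x z" by (rule Cmp_HOM)
next
 fix f assume "f \<in> Arr (SO A)"
 then have "f \<in> HOM A (fst f) (snd (snd f))" by (simp add: Arr_HOM)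
 then show "Src (SO A) f \<in> OB A" "Tgt (SO A) f \<in> OB A" using HOM_D(1,2)[of f A "fst f" "snd (snd f)"] by simp_all
qed (simp add: Idn_HOM)

section \<open>Functors, and functors between slices given on elements\<close>

lemma functor_Hom: assumes "is_functor C D F" shows "f \<in> Hom C x y ==> amap F f \<in> Hom D (omap F x) (omap F y)"
  "x \<in> Obj C ==> omap F x \<in> Obj D" "x \<in> Obj C ==> amap F (Idn C x) = Idn D (omap F x)"
  "f \<in> Hom C x y ==> g \<in> Hom C y z ==> amap F (g *[C] f) = amap F g *[D] amap F f" using assms unfolding is_functor_def by (auto simp: Hom_def PiE_iff)

lemma (in category) Hom_Obj: "f \<in> Hom C x y ==> x \<in> Obj C" "f \<in> Hom C x y ==> y \<in> Obj C" using Src_Obj Tgt_Obj by (auto simp: Hom_def)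

lemma functor_HomI: assumes "category C" "category D" "omap F \<in> Obj C ->E Obj D" "amap F \<in> extensional (Arr C)"
  and h: "!!f x y. f \<in> Hom C x y ==> amap F f \<in> Hom D (omap F x) (omap F y)" and "!!x. x \<in> Obj C ==> amap F (Idn C x) = Idn D (omap F x)"
  and c: "!!f g x y z. f \<in> Hom C x y ==> g \<in> Hom C y z ==> amap F (g *[C] f) = amap F g *[D] amap F f" shows "is_functor C D F"
proof -
 have H: "f \<in> Hom C (Src C f) (Tgt C f)" if "f \<in> Arr C" for f using that by (simp add: Hom_def)
 have "amap F (g *[C] f) = amap F g *[D] amap F f" if "f \<in> Arr C" "g \<in> Arr C" "Tgt C f = Src C g" for f g
  by (rule c[OF H[OF that(1)]]) (use H[OF that(2)] that(3) in simp)
 then show ?thesis unfolding is_functor_def using assms h[OF H] by (auto simp: PiE_iff Hom_def)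
qed

lemma id_functor: "category C ==> is_functor C C (id_functor C)"
proof -
 assume C: "category C"
 interpret C: category C by (rule C)
 have o: "omap (id_functor C) x = x" if "x \<in> Obj C" for x using that by (simp add: id_functor_def)
 have a: "amap (id_functor C) f = f" if "f \<in> Hom C x y" for f x y using that by (simp add: id_functor_def Hom_def)
 show ?thesis
 proof (rule functor_HomI[OF C C])
  show "amap (id_functor C) f \<in> Hom C (omap (id_functor C) x) (omap (id_functor C) y)" if "f \<in> Hom C x y" for f x y
   using that by (simp add: a[OF that] o C.Hom_Obj[OF that])
  show "amap (id_functor C) (Idn C x) = Idn C (omap (id_functor C) x)" if "x \<in> Obj C" for x using a[OF C.Idn_Hom[OF that]] o[OF that] by simp
  show "amap (id_functor C) (h *[C] f) = amap (id_functor C) h *[C] amap (id_functor C) f" if "f \<in> Hom C x y" "h \<in> Hom C y z" for f h x y z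
   using a[OF C.Cmp_Hom[OF that]] a[OF that(1)] a[OF that(2)] by simp
 qed (simp_all add: id_functor_def)
qed

lemma functor_compose: assumes "is_functor C D H" "is_functor D D' K" shows "is_functor C D' (cF C K H)"
proof -
 have C: "category C" "category D" "category D'" using assms by (simp_all add: is_functor_def)
 interpret C: category C by (rule C)
 note h = functor_Hom[OF assms(1)] and k = functor_Hom[OF assms(2)]
 have s: "omap (cF C K H) x = omap K (omap H x)" if "x \<in> Obj C" for x using that by (simp add: comp_functor_def)
 have a: "amap (cF C K H) f = amap K (amap H f)" if "f \<in> Hom C x y" for f x y using that by (simp add: comp_functor_def Hom_def)
 show ?thesis
 proof (rule functor_HomI[OF C(1,3)])
  show "omap (cF C K H) \<in> Obj C ->E Obj D'" using k(2)[OF h(2)] by (auto simp: comp_functor_def)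
  show "amap (cF C K H) f \<in> Hom D' (omap (cF C K H) x) (omap (cF C K H) y)" if f: "f \<in> Hom C x y" for f x y
   unfolding a[OF f] s[OF C.Hom_Obj(1)[OF f]] s[OF C.Hom_Obj(2)[OF f]] by (rule k(1)[OF h(1)[OF f]])
  show "amap (cF C K H) (Idn C x) = Idn D' (omap (cF C K H) x)" if x: "x \<in> Obj C" for x
   unfolding a[OF C.Idn_Hom[OF x]] s[OF x] h(3)[OF x] by (rule k(3)[OF h(2)[OF x]])
  show "amap (cF C K H) (h *[C] f) = amap (cF C K H) h *[D'] amap (cF C K H) f" if f: "f \<in> Hom C x y" and g: "h \<in> Hom C y z" for f h x y z
   unfolding a[OF f] a[OF g] a[OF C.Cmp_Hom[OF f g]] h(4)[OF f g] by (rule k(4)[OF h(1)[OF f] h(1)[OF g]])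
 qed (simp add: comp_functor_def)
qed

text \<open>A functor between slices is specified by objects and by functions on elements;
  \<open>slice_map\<close> supplies the extensional arrows, so that the functor laws become
  equations on carriers.\<close>

definition mk_functor :: "'v set => ('v fn => 'v fn) => ('v sarr => 'v => 'v) => ('v fn, 'v sarr, 'v fn, 'v sarr) fctr" where
 "mk_functor A Fo Fh = \<lparr>omap = (\<lambda>x\<in>OB A. Fo x), amap = (\<lambda>f\<in>Arr (SO A). slice_map (Fo (fst f)) (Fh f) (Fo (snd (snd f))))\<rparr>"

lemma omap_mk [simp]: "x \<in> OB A ==> omap (mk_functor A Fo Fh) x = Fo x"
 and amap_mk: "f \<in> HOM A x y ==> amap (mk_functor A Fo Fh) f = slice_map (Fo x) (Fh f) (Fo y)"
 and ap_amap_mk: "f \<in> HOM A x y ==> t \<in> car (Fo x) ==> ap (amap (mk_functor A Fo Fh) f) t = Fh f t" unfolding mk_functor_def using HOM_D[of f A x y] by auto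

lemma functor_D: assumes "sF A B F" shows "!!x. x \<in> OB A ==> omap F x \<in> OB B" "!!f x y. f \<in> HOM A x y ==> amap F f \<in> HOM B (omap F x) (omap F y)"
  "!!x. x \<in> OB A ==> amap F (iO A x) = iO B (omap F x)" "!!f g x y z. f \<in> HOM A x y ==> g \<in> HOM A y z ==>
    amap F (g \<cdot>[A] f) = amap F g \<cdot>[B] amap F f" "omap F \<in> extensional (OB A)" "amap F \<in> extensional (Arr (SO A))"
  "!!x t. x \<in> OB A ==> t \<in> car (omap F x) ==> ap (amap F (iO A x)) t = t" "!!f g x y z t. f \<in> HOM A x y ==> g \<in> HOM A y z ==> t \<in> car (omap F x) ==>
    ap (amap F (g \<cdot>[A] f)) t = ap (amap F g) (ap (amap F f) t)"
proof -
 note d = assms[unfolded is_functor_def] and h = functor_Hom[OF assms]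
 show "omap F \<in> extensional (OB A)" "amap F \<in> extensional (Arr (SO A))" using d by (simp_all add: PiE_iff)
 show "!!x t. x \<in> OB A ==> t \<in> car (omap F x) ==> ap (amap F (iO A x)) t = t" by (simp add: h(2,3) Idn_HOM(2))
 show "!!f g x y z t. f \<in> HOM A x y ==> g \<in> HOM A y z ==> t \<in> car (omap F x) ==>
    ap (amap F (g \<cdot>[A] f)) t = ap (amap F g) (ap (amap F f) t)" by (simp add: h(4) Cmp_HOM(2)[OF h(1) h(1)])
qed (rule functor_Hom[OF assms]; assumption)+

lemma functor_I: assumes "omap F \<in> extensional (OB A)" "amap F \<in> extensional (Arr (SO A))" and "!!x. x \<in> OB A ==> omap F x \<in> OB B"
  and h: "!!f x y. f \<in> HOM A x y ==> amap F f \<in> HOM B (omap F x) (omap F y)"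
  and i: "!!x t. x \<in> OB A ==> t \<in> car (omap F x) ==> ap (amap F (iO A x)) t = t"
  and c: "!!f g x y z t. f \<in> HOM A x y ==> g \<in> HOM A y z ==> t \<in> car (omap F x) ==> ap (amap F (g \<cdot>[A] f)) t = ap (amap F g) (ap (amap F f) t)"
 shows "sF A B F"
proof (rule functor_HomI[OF category_SetOver category_SetOver])
 show "amap F (iO A x) = iO B (omap F x)" if "x \<in> OB A" for x
  by (rule HOM_eqI[OF h[OF Idn_HOM(1)[OF that]] Idn_HOM(1)[OF assms(3)[OF that]]]) (simp add: i[OF that] Idn_HOM(2)[OF assms(3)[OF that]])
 show "amap F (g \<cdot>[A] f) = amap F g \<cdot>[B] amap F f" if fg: "f \<in> HOM A x y" "g \<in> HOM A y z" for f g x y z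
  by (rule HOM_eqI[OF h[OF Cmp_HOM(1)[OF fg]] Cmp_HOM(1)[OF h[OF fg(1)] h[OF fg(2)]]]) (simp add: c[OF fg] Cmp_HOM(2)[OF h[OF fg(1)] h[OF fg(2)]])
qed (use assms(1-3) in "auto simp: PiE_iff intro: h")

lemma mk_functor_is_functor: assumes o: "!!x. x \<in> OB A ==> Fo x \<in> OB B" and h: "!!f x y t. f \<in> HOM A x y ==> t \<in> car (Fo x) ==>
       Fh f t \<in> car (Fo y) & fn (Fo y) (Fh f t) = fn (Fo x) t" and i: "!!x t. x \<in> OB A ==> t \<in> car (Fo x) ==> Fh (iO A x) t = t"
  and c: "!!f g x y z t. f \<in> HOM A x y ==> g \<in> HOM A y z ==> t \<in> car (Fo x) ==> Fh (g \<cdot>[A] f) t = Fh g (Fh f t)" shows "sF A B (mk_functor A Fo Fh)"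
proof (rule functor_I)
 fix f g x y z t assume a: "f \<in> HOM A x y" "g \<in> HOM A y z" "t \<in> car (omap (mk_functor A Fo Fh) x)"
 then show "ap (amap (mk_functor A Fo Fh) (g \<cdot>[A] f)) t = ap (amap (mk_functor A Fo Fh) g) (ap (amap (mk_functor A Fo Fh) f) t)"
  using ap_amap_mk[OF Cmp_HOM(1)[OF a(1,2)]] ap_amap_mk[OF a(1)] ap_amap_mk[OF a(2)] c[OF a(1,2)]
   h[OF a(1)] HOM_D(1)[OF a(1)] by auto
next
 fix f x y assume f: "f \<in> HOM A x y"
 have "slice_map (Fo x) (Fh f) (Fo y) \<in> HOM B (Fo x) (Fo y)" by (rule slice_map_HOM) (use o h f HOM_D in blast)+
 then show "amap (mk_functor A Fo Fh) f \<in> HOM B (omap (mk_functor A Fo Fh) x) (omap (mk_functor A Fo Fh) y)" using amap_mk[OF f] HOM_D[OF f] by auto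
next
 fix x t assume "x \<in> OB A" "t \<in> car (omap (mk_functor A Fo Fh) x)"
 then show "ap (amap (mk_functor A Fo Fh) (iO A x)) t = t" by (simp add: ap_amap_mk[OF Idn_HOM(1)] i)
qed (use o in "auto simp: mk_functor_def")

lemma functor_comp: assumes "sF A B F" "sF B C G" shows "sF A C (cF (SO A) G F)" and "!!x. x \<in> OB A ==> omap (cF (SO A) G F) x = omap G (omap F x)"
  and "!!f x y. f \<in> HOM A x y ==> amap (cF (SO A) G F) f = amap G (amap F f)" using functor_compose[OF assms] by (auto simp: comp_functor_def dest: HOM_D)

lemma functor_id: "sF A A (id_functor (SO A))" and omap_id [simp]: "x \<in> OB A ==> omap (id_functor (SO A)) x = x"
 and amap_id: "f \<in> HOM A x y ==> amap (id_functor (SO A)) f = f" using id_functor[OF category_SetOver] by (auto simp: id_functor_def dest: HOM_D)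

section \<open>The pullback functor\<close>

context universe
begin

abbreviation "MU \<equiv> (MultC :: ('v mcat, 'v mcarr) cat)"
abbreviation "MO \<equiv> (MonC :: ('v mobj, 'v marr) cat)"

lemma pb_obj_OB: assumes "u \<in> Hom SetC A B" "x \<in> OB B" shows "pb (u :: 'v fn) x \<in> OB A"
proof -
 obtain h where u: "u = (A, h, B)" "small A" "h \<in> A ->E B" using assms by (auto simp: Hom_SetC)
 have "vpair ` {(a, z). a \<in> A & z \<in> car x & h a = fn x z} <= vpair ` (A \<times> car x)" by auto
 then have "small (vpair ` {(a, z). a \<in> A & z \<in> car x & h a = fn x z})" using small_times[OF u(2) OB_D(2)[OF assms(2)]] small_mono by blast
 then show ?thesis using u unfolding pb_obj_def Let_def by (auto intro!: OB_I simp: car_def)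
qed

lemma car_pb: "u \<in> Hom SetC A B ==> z \<in> car (pb (u :: 'v fn) x) <-> (EX a c. z = vpair (a, c) & a \<in> A & c \<in> car x & fn u a = fn x c)"
 by (auto simp: pb_obj_def Let_def Hom_SetC car_def)

lemma vpair_car_pb [simp]: "u \<in> Hom SetC A B ==> vpair (a, c) \<in> car (pb (u :: 'v fn) x) <-> a \<in> A & c \<in> car x & fn u a = fn x c" by (simp add: car_pb)

lemma ty_pb: "z \<in> car (pb (u :: 'v fn) x) ==> fn (pb u x) z = vfst z" by (auto simp: pb_obj_def Let_def car_def)

lemma pb_D: assumes "u \<in> Hom SetC A B" "z \<in> car (pb (u :: 'v fn) x)"
 shows "vfst z \<in> A" "vsnd z \<in> car x" "fn u (vfst z) = fn x (vsnd z)" "vpair (vfst z, vsnd z) = z" "fn (pb u x) z = vfst z"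
 using assms ty_pb[OF assms(2)] by (auto simp: car_pb)

lemma pb_functor_mk: "u \<in> Hom SetC A B ==> pb_functor (u :: 'v fn) = mk_functor B (pb u) (%f z. vpair (vfst z, ap f (vsnd z)))"
 unfolding pb_functor_def mk_functor_def by (auto simp: Hom_SetC ap_def fun_eq_iff)

lemma pb_functor: assumes "u \<in> Hom SetC A B" shows "sF B A (pb_functor (u :: 'v fn))" "!!x. x \<in> OB B ==> omap (pb_functor u) x = pb u x"
  "!!f x y z. f \<in> HOM B x y ==> z \<in> car (pb u x) ==> ap (uA u f) z = vpair (vfst z, ap f (vsnd z))"
  "!!f x y. f \<in> HOM B x y ==> uA u f \<in> HOM A (pb u x) (pb u y)"
proof -
 note e = pb_functor_mk[OF assms]
 show *: "sF B A (pb_functor u)" unfolding e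
 proof (rule mk_functor_is_functor)
  fix f x y t assume f: "f \<in> HOM B x y" and t: "t \<in> car (pb u x)"
  note d = HOM_D(6,7)[OF f pb_D(2)[OF assms t]] and p = pb_D[OF assms t]
  have "vpair (vfst t, ap f (vsnd t)) \<in> car (pb u y)" by (simp add: vpair_car_pb[OF assms] d p)
  then show "vpair (vfst t, ap f (vsnd t)) \<in> car (pb u y) & fn (pb u y) (vpair (vfst t, ap f (vsnd t))) = fn (pb u x) t" by (simp add: ty_pb p(5))
 next
  fix f g x y z t assume f: "f \<in> HOM B x y" "g \<in> HOM B y z" and t: "t \<in> car (pb u x)"
  then show "vpair (vfst t, ap (g \<cdot>[B] f) (vsnd t)) = vpair (vfst (vpair (vfst t, ap f (vsnd t))), ap g (vsnd (vpair (vfst t, ap f (vsnd t)))))"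
   by (simp add: Cmp_HOM(2)[OF f] pb_D[OF assms t])
 qed (simp_all add: pb_obj_OB[OF assms] pb_D[OF assms] Idn_HOM(2))
 show o: "!!x. x \<in> OB B ==> omap (pb_functor u) x = pb u x" and "!!f x y z. f \<in> HOM B x y ==> z \<in> car (pb u x) ==>
   ap (uA u f) z = vpair (vfst z, ap f (vsnd z))" unfolding e by (auto simp: ap_amap_mk)
 show "uA u f \<in> HOM A (pb u x) (pb u y)" if "f \<in> HOM B x y" for f x y using functor_D(2)[OF * that] o HOM_D[OF that] by auto
qed

end

section \<open>Limits and filtered colimits elementwise\<close>

context universe
begin

text \<open>These objects generate the slice: an arrow from \<open>point A a\<close> to
  \<open>x\<close> is an element of \<open>x\<close> over \<open>a\<close> (\<open>elt_HOM\<close>,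
  \<open>point_HOM_eq\<close>). Testing universal properties on them yields their elementwise
  form.\<close>

definition point :: "'v set => 'v => 'v fn" where "point A a = ({undefined}, \<lambda>_\<in>{undefined}. a, A)"

definition elt :: "'v set => 'v fn => 'v => 'v sarr" where "elt A x c = slice_map (point A (fn x c)) (%_. c) x"

lemma car_point [simp]: "car (point A a) = {undefined}" and ty_point [simp]: "fn (point A a) undefined = a" unfolding point_def by auto

lemma point_OB: "small A ==> a \<in> A ==> point A a \<in> OB A" unfolding point_def by (auto simp: OB_iff small_finite)

lemma elt_HOM: assumes "x \<in> OB A" "c \<in> car x" shows "elt A x c \<in> HOM A (point A (fn x c)) x" "ap (elt A x c) undefined = c"
 unfolding elt_def using assms OB_D[OF assms(1)] by (auto intro!: slice_map_HOM point_OB)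

lemma point_HOM_eq: assumes "f \<in> HOM A (point A a) x" "ap f undefined = c" shows "f = elt A x c" "c \<in> car x" "fn x c = a"
proof -
 show c: "c \<in> car x" "fn x c = a" using HOM_D(6,7)[OF assms(1), of undefined] assms(2) by auto
 show "f = elt A x c" by (rule HOM_eqI[OF assms(1)]) (use elt_HOM[OF HOM_D(2)[OF assms(1)] c(1)] c assms(2) in auto)
qed

lemma Cmp_elt: assumes "f \<in> HOM A x y" "c \<in> car x" shows "f \<cdot>[A] elt A x c = elt A y (ap f c)"
proof -
 note e = elt_HOM[OF HOM_D(1)[OF assms(1)] assms(2)]
 note c = Cmp_HOM[OF e(1) assms(1)]
 show ?thesis by (rule point_HOM_eq(1)[OF c(1)]) (simp add: c(2) e(2))
qed

text \<open>With the booleans as index set, a commutative square becomes a cone with diagonal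
  \<open>f *[C] p\<close>. Only wide pullbacks then have to be analysed in slices.\<close>

lemma pullback_wide: assumes "category C" and f: "f \<in> Hom C x z" and g: "g \<in> Hom C y z" and p: "p \<in> Hom C w x" and q: "q \<in> Hom C w y"
 shows "is_pullback C f g p q <-> f *[C] p = g *[C] q & is_wide_pullback UNIV C (%i. if i then f else g) z (%i. if i then p else q) (f *[C] p)" (is "?P <-> ?E & ?W")
proof -
 interpret category C by (rule assms)
 note h = f g p q Cmp_Hom[OF p f] note st = h[unfolded Hom_iff]
 let ?U = "%r s. EX! h. h \<in> Hom C (Src C r) w & p *[C] h = r & q *[C] h = s"
 let ?R = "ALL r:Arr C. ALL s:Arr C. Src C r = Src C s & Tgt C r = x & Tgt C s = y & f *[C] r = g *[C] s --> ?U r s"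
 have P: "?P <-> ?E & ?R" unfolding is_pullback_def using st by simp
 have "?W <-> ?R" if E: ?E
 proof -
  have d: "(f *[C] p) *[C] h = f *[C] (p *[C] h)" if "h \<in> Hom C v w" for h v by (rule Cmp_assoc[OF that p f])
  have "?W <-> (ALL e s. e \<in> Arr C & Tgt C e = z & (ALL i. s i \<in> Hom C (Src C e) (if i then x else y) & (if i then f else g) *[C] s i = e) -->
    (EX! h. h \<in> Hom C (Src C e) w & (f *[C] p) *[C] h = e & (ALL i. (if i then p else q) *[C] h = s i)))" (is "_ <-> ?S")
   unfolding is_wide_pullback_def using st E by (simp add: all_bool_eq Hom_iff)
  also have "?S <-> ?R"
  proof (intro iffI ballI allI impI)
   fix r s assume S: ?S and rs: "r \<in> Arr C" "s \<in> Arr C" "Src C r = Src C s & Tgt C r = x & Tgt C s = y & f *[C] r = g *[C] s"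
   have r: "r \<in> Hom C (Src C r) x" using rs by (simp add: Hom_iff)
   note fr = Cmp_Hom[OF r f, unfolded Hom_iff]
   have "EX! h. h \<in> Hom C (Src C r) w & (f *[C] p) *[C] h = f *[C] r & p *[C] h = r & q *[C] h = s"
    using S[THEN spec, THEN spec, of "f *[C] r" "%i. if i then r else s"] rs fr r by (simp add: all_bool_eq Hom_iff)
   then show "?U r s" using d by metis
  next
   fix e s assume R: ?R and s: "e \<in> Arr C & Tgt C e = z & (ALL i. s i \<in> Hom C (Src C e) (if i then x else y) & (if i then f else g) *[C] s i = e)"
   then have t: "s True \<in> Arr C" "s False \<in> Arr C" "Src C (s True) = Src C (s False) & Tgt C (s True) = x & Tgt C (s False) = y &
     f *[C] s True = g *[C] s False" and "Src C (s True) = Src C e" "f *[C] s True = e" by (simp_all add: all_bool_eq Hom_iff)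
   moreover have "?U (s True) (s False)" by (rule R[rule_format, OF t])
   ultimately show "EX! h. h \<in> Hom C (Src C e) w & (f *[C] p) *[C] h = e & (ALL i. (if i then p else q) *[C] h = s i)" unfolding all_bool_eq using d by simp metis
  qed
  finally show ?thesis .
 qed
 with P show ?thesis by blast
qed

text \<open>Left to right, the universal property is tested on points; right to left, the unique
  elements form the mediating arrow. The condition on \<open>ap d c\<close> carries the information
  for an empty index set, where the limit is \<open>y\<close> itself.\<close>

lemma wide_pullback_iff: assumes y: "y \<in> OB (A :: 'v set)" and d: "d \<in> HOM A w y"
  and f0: "ALL i:I. f i \<in> HOM A (x i) y" and p0: "ALL i:I. p i \<in> HOM A w (x i)" shows "is_wide_pullback I (SO A) f y p d <->
  (ALL i:I. ALL c:car w. ap (f i) (ap (p i) c) = ap d c) & (ALL b:car y. ALL a. (ALL i:I. a i \<in> car (x i) & ap (f i) (a i) = b) -->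
   (EX! c. c \<in> car w & ap d c = b & (ALL i:I. ap (p i) c = a i)))" (is "?L <-> ?C & ?U")
proof -
 note f = f0[rule_format] and p = p0[rule_format]
 note dd = HOM_D[OF d] and fd = HOM_D[OF f] and pd = HOM_D[OF p]
 note fp = Cmp_HOM[OF p f]
 have C: "(ALL i:I. f i \<cdot>[A] p i = d) <-> ?C" (is "?Q <-> _")
 proof
  assume ?Q then show ?C using fp(2) by metis
 next
  assume ?C then show ?Q using HOM_eqI[OF fp(1) d] fp(2) by simp
 qed
 have univ: "(ALL e s. e \<in> Arr (SO A) & snd (snd e) = y & (ALL i:I. s i \<in> HOM A (fst e) (x i) & f i \<cdot>[A] s i = e) -->
    (EX! h. h \<in> HOM A (fst e) w & d \<cdot>[A] h = e & (ALL i:I. p i \<cdot>[A] h = s i))) <-> ?U" (is "?P <-> _")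
 proof
  assume P: ?P
  show ?U
  proof (intro ballI impI allI)
   fix b a assume b: "b \<in> car y" and a: "ALL i:I. a i \<in> car (x i) & ap (f i) (a i) = b"
   have t: "fn (x i) (a i) = fn y b" if "i \<in> I" for i using a that fd(7)[OF that] by metis
   note eb = elt_HOM[OF y b]
   have ea: "elt A (x i) (a i) \<in> HOM A (point A (fn y b)) (x i)"
    "f i \<cdot>[A] elt A (x i) (a i) = elt A y b" "ap (elt A (x i) (a i)) undefined = a i" if "i \<in> I" for i
   proof -
    have ai: "a i \<in> car (x i)" "ap (f i) (a i) = b" using a that by auto
    show "elt A (x i) (a i) \<in> HOM A (point A (fn y b)) (x i)" "ap (elt A (x i) (a i)) undefined = a i"
     using elt_HOM[OF fd(1)[OF that] ai(1)] by (simp_all add: t[OF that])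
    show "f i \<cdot>[A] elt A (x i) (a i) = elt A y b" by (simp add: Cmp_elt[OF f[OF that] ai(1)] ai(2))
   qed
   have "EX! h. h \<in> HOM A (point A (fn y b)) w & d \<cdot>[A] h = elt A y b & (ALL i:I. p i \<cdot>[A] h = elt A (x i) (a i))"
    using P[rule_format, of "elt A y b" "%i. elt A (x i) (a i)"] HOM_D[OF eb(1)] ea by simp
   then obtain h where h: "h \<in> HOM A (point A (fn y b)) w" "d \<cdot>[A] h = elt A y b" "!!i. i \<in> I ==> p i \<cdot>[A] h = elt A (x i) (a i)"
    and un: "!!h'. h' \<in> HOM A (point A (fn y b)) w ==> d \<cdot>[A] h' = elt A y b ==>
     (!!i. i \<in> I ==> p i \<cdot>[A] h' = elt A (x i) (a i)) ==> h' = h" by (metis (no_types, lifting))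
   note c = point_HOM_eq[OF h(1) refl]
   show "EX! c. c \<in> car w & ap d c = b & (ALL i:I. ap (p i) c = a i)"
   proof (rule ex1I[of _ "ap h undefined"])
    have "ap d (ap h undefined) = b" using h Cmp_HOM(2)[OF h(1) d, of undefined] eb(2) by simp
    moreover have "ap (p i) (ap h undefined) = a i" if "i \<in> I" for i using h(3)[OF that] Cmp_HOM(2)[OF h(1) p[OF that], of undefined] ea(3)[OF that] by simp
    ultimately show "ap h undefined \<in> car w & ap d (ap h undefined) = b & (ALL i:I. ap (p i) (ap h undefined) = a i)" using c(2) by simp
    fix c assume c: "c \<in> car w & ap d c = b & (ALL i:I. ap (p i) c = a i)"
    then have "fn w c = fn y b" using dd(7) by auto
    then have "elt A w c = h" using un[of "elt A w c"] elt_HOM[OF dd(1), of c] Cmp_elt[OF d] Cmp_elt[OF p] c by auto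
    then show "c = ap h undefined" using elt_HOM[OF dd(1), of c] c by auto
   qed
  qed
 next
  assume U: ?U
  show ?P
  proof (intro allI impI, elim conjE)
   fix e s assume e0: "e \<in> Arr (SO A)" "snd (snd e) = y" and s0: "ALL i:I. s i \<in> HOM A (fst e) (x i) & f i \<cdot>[A] s i = e"
   define v where "v = fst e"
   have e: "e \<in> HOM A v y" and s: "!!i. i \<in> I ==> s i \<in> HOM A v (x i)" and fs: "!!i. i \<in> I ==> f i \<cdot>[A] s i = e"
    using e0 s0 by (simp_all add: Arr_HOM v_def)
   note ed = HOM_D[OF e] and sd = HOM_D[OF s]
   have ex: "EX! c. c \<in> car w & ap d c = ap e z & (ALL i:I. ap (p i) c = ap (s i) z)" if z: "z \<in> car v" for z
   proof -
    have "ALL i:I. ap (s i) z \<in> car (x i) & ap (f i) (ap (s i) z) = ap e z" using sd(6)[OF _ z] Cmp_HOM(2)[OF s f z] fs by simp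
    then show ?thesis using U[rule_format, OF ed(6)[OF z], of "%i. ap (s i) z"] by blast
   qed
   \<comment> \<open>The pointwise unique solutions assemble into the mediating arrow.\<close>
   define h where "h z = (THE c. c \<in> car w & ap d c = ap e z & (ALL i:I. ap (p i) c = ap (s i) z))" for z
   have h: "h z \<in> car w" "ap d (h z) = ap e z" "!!i. i \<in> I ==> ap (p i) (h z) = ap (s i) z" if "z \<in> car v" for z
    using theI'[OF ex[OF that]] unfolding h_def by auto
   let ?h = "slice_map v h w"
   have hH: "?h \<in> HOM A v w" by (rule slice_map_HOM) (use h dd(1,7) ed(1,7) in "auto, metis")
   note dh = Cmp_HOM[OF hH d] and ph = Cmp_HOM[OF hH p]
   have "EX! h. h \<in> HOM A v w & d \<cdot>[A] h = e & (ALL i:I. p i \<cdot>[A] h = s i)"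
   proof (rule ex1I[of _ ?h], intro conjI ballI)
    show "d \<cdot>[A] ?h = e" by (rule HOM_eqI[OF dh(1) e]) (simp add: dh(2) h)
    show "p i \<cdot>[A] ?h = s i" if "i \<in> I" for i by (rule HOM_eqI[OF ph(1)[OF that] s[OF that]]) (simp add: ph(2)[OF that] h that)
    fix k assume k: "k \<in> HOM A v w & d \<cdot>[A] k = e & (ALL i:I. p i \<cdot>[A] k = s i)"
    then have k1: "k \<in> HOM A v w" by simp
    show "k = ?h"
    proof (rule HOM_eqI[OF k1 hH])
     fix z assume z: "z \<in> car v"
     have "ap d (ap k z) = ap e z" "ALL i:I. ap (p i) (ap k z) = ap (s i) z" using k Cmp_HOM(2)[OF k1 d z] Cmp_HOM(2)[OF k1 p z] by auto
     then have "ap k z \<in> car w & ap d (ap k z) = ap e z & (ALL i:I. ap (p i) (ap k z) = ap (s i) z)" using HOM_D(6)[OF k1 z] by (intro conjI)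
     moreover have "h z \<in> car w & ap d (h z) = ap e z & (ALL i:I. ap (p i) (h z) = ap (s i) z)" using h[OF z] by (intro conjI ballI)
     ultimately have "ap k z = h z" using ex[OF z] by (elim ex1E) metis
     then show "ap k z = ap ?h z" using z by simp
    qed
   qed (rule hH)
   then show "EX! h. h \<in> HOM A (fst e) w & d \<cdot>[A] h = e & (ALL i:I. p i \<cdot>[A] h = s i)" by (simp add: v_def)
  qed
 qed
 have s: "fst (f i) = x i" "f i \<in> Arr (SO A)" "snd (snd (f i)) = y" if "i \<in> I" for i using fd that by auto
 have "(ALL e s. e \<in> Arr (SO A) & snd (snd e) = y & (ALL i:I. s i \<in> HOM A (fst e) (fst (f i)) & f i \<cdot>[A] s i = e) -->
    (EX! h. h \<in> HOM A (fst e) w & d \<cdot>[A] h = e & (ALL i:I. p i \<cdot>[A] h = s i))) <-> ?P"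
 proof -
  have "(ALL i:I. t i \<in> HOM A v (fst (f i)) & f i \<cdot>[A] t i = e) <-> (ALL i:I. t i \<in> HOM A v (x i) & f i \<cdot>[A] t i = e)" for t v e
   by (rule ball_cong) (simp_all add: s(1))
  then show ?thesis by (simp only:)
 qed
 moreover have "(ALL i:I. f i \<in> Arr (SO A) & snd (snd (f i)) = y & p i \<in> HOM A w (fst (f i)) & f i \<cdot>[A] p i = d) <-> ?Q" by (simp add: s p cong: ball_cong)
 ultimately show ?thesis unfolding C[symmetric] univ[symmetric] is_wide_pullback_def using dd(3-5) by simp
qed

lemma pullback_iff: assumes f: "f \<in> HOM (A :: 'v set) x z" and g: "g \<in> HOM A y z" and p: "p \<in> HOM A w x" and q: "q \<in> HOM A w y"
 shows "is_pullback (SO A) f g p q <-> (ALL c:car w. ap f (ap p c) = ap g (ap q c)) &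
  (ALL a:car x. ALL b:car y. ap f a = ap g b --> (EX! c. c \<in> car w & ap p c = a & ap q c = b))"
proof -
 note d = Cmp_HOM[OF p f] and d' = Cmp_HOM[OF q g]
 have "f \<cdot>[A] p = g \<cdot>[A] q <-> (ALL c:car w. ap f (ap p c) = ap g (ap q c))" using HOM_eqI[OF d(1) d'(1)] d(2) d'(2) by metis
 moreover have "is_wide_pullback UNIV (SO A) (%i. if i then f else g) z (%i. if i then p else q) (f \<cdot>[A] p) <->
  (ALL a:car x. ALL b:car y. ap f a = ap g b --> (EX! c. c \<in> car w & ap p c = a & ap q c = b))" (is "_ <-> ?R") if E: "ALL c:car w. ap f (ap p c) = ap g (ap q c)"
 proof -
  have "is_wide_pullback UNIV (SO A) (%i. if i then f else g) z (%i. if i then p else q) (f \<cdot>[A] p) <->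
   (ALL b:car z. ALL a. (a True \<in> car x & ap f (a True) = b) & a False \<in> car y & ap g (a False) = b -->
    (EX! c. c \<in> car w & ap (f \<cdot>[A] p) c = b & ap p c = a True & ap q c = a False))" (is "_ <-> ?S")
   using wide_pullback_iff[OF HOM_D(2)[OF f] d(1), of UNIV "%i. if i then f else g" "%i. if i then x else y" "%i. if i then p else q"]
    f g p q d(2) E by (simp add: all_bool_eq)
  also have "?S <-> ?R"
  proof (intro iffI ballI allI impI)
   fix a b assume S: ?S and ab: "a \<in> car x" "b \<in> car y" "ap f a = ap g b"
   have "EX! c. c \<in> car w & ap (f \<cdot>[A] p) c = ap f a & ap p c = a & ap q c = b"
    using bspec[OF S HOM_D(6)[OF f ab(1)], THEN spec, of "%i. if i then a else b"] ab by simp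
   then show "EX! c. c \<in> car w & ap p c = a & ap q c = b" using d(2) by metis
  next
   fix b a assume ?R and "(a True \<in> car x & ap f (a True) = b) & a False \<in> car y & ap g (a False) = b"
   then have "EX! c. c \<in> car w & ap p c = a True & ap q c = a False" "ap f (a True) = b" by auto
   then show "EX! c. c \<in> car w & ap (f \<cdot>[A] p) c = b & ap p c = a True & ap q c = a False" using d(2) by metis
  qed
  finally show ?thesis .
 qed
 ultimately show ?thesis unfolding pullback_wide[OF category_SetOver f g p q] by blast
qed

section \<open>Cocones and filtered colimits\<close>

lemma functor_into_D: assumes "is_functor J (SO A) D" shows "!!j. j \<in> Obj J ==> omap D j \<in> OB A"
  "!!f i j. f \<in> Hom J i j ==> amap D f \<in> HOM A (omap D i) (omap D j)" "!!f g i j k a. f \<in> Hom J i j ==> g \<in> Hom J j k ==> a \<in> car (omap D i) ==>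
   ap (amap D (g *[J] f)) a = ap (amap D g) (ap (amap D f) a)" "!!j a. j \<in> Obj J ==> a \<in> car (omap D j) ==> ap (amap D (Idn J j)) a = a"
proof -
 note d = assms[unfolded is_functor_def]
 show o: "!!j. j \<in> Obj J ==> omap D j \<in> OB A" using d by (simp add: PiE_iff)
 show a: "!!f i j. f \<in> Hom J i j ==> amap D f \<in> HOM A (omap D i) (omap D j)" using d by (simp add: PiE_iff Hom_iff)
 show "!!f g i j k a. f \<in> Hom J i j ==> g \<in> Hom J j k ==> a \<in> car (omap D i) ==> ap (amap D (g *[J] f)) a = ap (amap D g) (ap (amap D f) a)"
  using d Cmp_HOM(2)[OF a a] by (simp add: Hom_iff)
 show "!!j a. j \<in> Obj J ==> a \<in> car (omap D j) ==> ap (amap D (Idn J j)) a = a" using d Idn_HOM(2)[OF o] by simp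
qed

lemma cocone_D: assumes "is_cocone J (SO A) D c l" shows "is_functor J (SO A) D" "c \<in> OB A" "!!j. j \<in> Obj J ==> l j \<in> HOM A (omap D j) c"
  "!!f i j a. f \<in> Hom J i j ==> i \<in> Obj J ==> j \<in> Obj J ==> a \<in> car (omap D i) ==> ap (l j) (ap (amap D f) a) = ap (l i) a"
proof -
 note d = assms[unfolded is_cocone_def]
 show 1: "is_functor J (SO A) D" "c \<in> OB A" and 2: "!!j. j \<in> Obj J ==> l j \<in> HOM A (omap D j) c" using d by simp_all
 show "ap (l j) (ap (amap D f) a) = ap (l i) a" if "f \<in> Hom J i j" "i \<in> Obj J" "j \<in> Obj J" "a \<in> car (omap D i)" for f i j a
 proof -
  have "l j \<cdot>[A] amap D f = l i" using d that(1) by (auto simp: Hom_iff[of f])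
  then show ?thesis using Cmp_HOM(2)[OF functor_into_D(2)[OF 1(1) that(1)] 2[OF that(3)] that(4)] by simp
 qed
qed

lemma cocone_I: assumes D: "is_functor J (SO A) D" and c: "c \<in> OB A" and l: "!!j. j \<in> Obj J ==> l j \<in> HOM A (omap D j) c"
 and n: "!!f i j a. f \<in> Hom J i j ==> i \<in> Obj J ==> j \<in> Obj J ==> a \<in> car (omap D i) ==> ap (l j) (ap (amap D f) a) = ap (l i) a"
 shows "is_cocone J (SO A) D c l"
proof -
 have "l (Tgt J k) \<cdot>[A] amap D k = l (Src J k)" if "k \<in> Arr J" for k
 proof -
  have k: "k \<in> Hom J (Src J k) (Tgt J k)" "Src J k \<in> Obj J" "Tgt J k \<in> Obj J"
   using that D unfolding is_functor_def by (auto simp: Arr_Hom[symmetric] category.Src_Obj category.Tgt_Obj)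
  note h = Cmp_HOM[OF functor_into_D(2)[OF D k(1)] l[OF k(3)]]
  show ?thesis by (rule HOM_eqI[OF h(1) l[OF k(2)]]) (simp add: h(2) n[OF k])
 qed
 then show ?thesis unfolding is_cocone_def using D c l by simp
qed

text \<open>The last item closes a span: \<open>j\<close> and \<open>k\<close> are mapped to a
  common object, and the two resulting arrows out of \<open>i\<close> are then coequalised.\<close>

lemma filtered_D: assumes "filtered J" shows "category J" "EX j. j \<in> Obj J"
  "!!i j. i \<in> Obj J ==> j \<in> Obj J ==> EX k f g. k \<in> Obj J & f \<in> Hom J i k & g \<in> Hom J j k"
  "!!i j f g. i \<in> Obj J ==> j \<in> Obj J ==> f \<in> Hom J i j ==> g \<in> Hom J i j ==> EX k h. k \<in> Obj J & h \<in> Hom J j k & h *[J] f = h *[J] g"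
  "!!i j k f g. i \<in> Obj J ==> j \<in> Obj J ==> k \<in> Obj J ==> f \<in> Hom J i j ==> g \<in> Hom J i k ==>
   EX m p q. m \<in> Obj J & p \<in> Hom J j m & q \<in> Hom J k m & p *[J] f = q *[J] g"
proof -
 note d = assms[unfolded filtered_def]
 show cat: "category J" "EX j. j \<in> Obj J" using d by auto
 show 3: "!!i j. i \<in> Obj J ==> j \<in> Obj J ==> EX k f g. k \<in> Obj J & f \<in> Hom J i k & g \<in> Hom J j k" using d by blast
 show 4: "!!i j f g. i \<in> Obj J ==> j \<in> Obj J ==> f \<in> Hom J i j ==> g \<in> Hom J i j ==> EX k h. k \<in> Obj J & h \<in> Hom J j k & h *[J] f = h *[J] g"
  using d by blast
 interpret category J by (rule cat(1))
 fix i j k f g assume o: "i \<in> Obj J" "j \<in> Obj J" "k \<in> Obj J" and f: "f \<in> Hom J i j" and g: "g \<in> Hom J i k"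
 obtain m p q where m: "m \<in> Obj J" "p \<in> Hom J j m" "q \<in> Hom J k m" using 3 o by blast
 obtain n h where n: "n \<in> Obj J" "h \<in> Hom J m n" "h *[J] (p *[J] f) = h *[J] (q *[J] g)" using 4[OF o(1) m(1) Cmp_Hom[OF f m(2)] Cmp_Hom[OF g m(3)]] by blast
 have "(h *[J] p) *[J] f = (h *[J] q) *[J] g" using n Cmp_assoc[OF f m(2) n(2)] Cmp_assoc[OF g m(3) n(2)] by simp
 then show "EX m p q. m \<in> Obj J & p \<in> Hom J j m & q \<in> Hom J k m & p *[J] f = q *[J] g" using n Cmp_Hom[OF m(2) n(2)] Cmp_Hom[OF m(3) n(2)] by blast
qed

text \<open>
 Necessity is tested on two cocones: one adjoining a second copy of a point outside the images of the
 injections, and one into two copies of \<open>A\<close> that separates the elements eventually equal to \<open>a\<close>.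
\<close>

lemma filtered_colimit_iff: assumes J: "filtered J" and co: "is_cocone J (SO (A :: 'v set)) D c l" shows "is_colimit J (SO A) D c l <->
  (ALL z:car c. EX j:Obj J. EX a:car (omap D j). ap (l j) a = z) & (ALL j:Obj J. ALL a:car (omap D j). ALL b:car (omap D j). ap (l j) a = ap (l j) b -->
   (EX k:Obj J. EX f:Hom J j k. ap (amap D f) a = ap (amap D f) b))" (is "_ <-> ?S & ?I")
proof -
 note D = cocone_D(1)[OF co] and c = cocone_D(2)[OF co] and l = cocone_D(3)[OF co] and ln = cocone_D(4)[OF co]
 note Do = functor_into_D(1)[OF D] and Da = functor_into_D(2)[OF D] and Dc = functor_into_D(3)[OF D] and Di = functor_into_D(4)[OF D]
 interpret category J by (rule filtered_D(1)[OF J])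
 show ?thesis
 proof
  assume col: "is_colimit J (SO A) D c l"
  have un: "h = h'" if hh: "h \<in> HOM A c c'" "h' \<in> HOM A c c'" and
    hl: "!!j a. j \<in> Obj J ==> a \<in> car (omap D j) ==> ap h (ap (l j) a) = ap h' (ap (l j) a)" for h h' c'
  proof -
   let ?l = "%j. h \<cdot>[A] l j"
   note lh = Cmp_HOM[OF l hh(1)] and lh' = Cmp_HOM[OF l hh(2)]
   have "is_cocone J (SO A) D c' ?l" by (rule cocone_I[OF D HOM_D(2)[OF hh(1)] lh(1)]) (simp_all add: lh(2) HOM_D(6)[OF Da] ln)
   then have "EX! h. h \<in> HOM A c c' & (ALL j:Obj J. h \<cdot>[A] l j = ?l j)" using col unfolding is_colimit_def by blast
   moreover have "h' \<cdot>[A] l j = ?l j" if j: "j \<in> Obj J" for j by (rule HOM_eqI[OF lh'(1)[OF j] lh(1)[OF j]]) (simp add: j lh(2)[OF j] lh'(2)[OF j] hl[OF j])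
   ultimately show ?thesis using hh by blast
  qed
  have ?S
  proof (rule ccontr)
   assume "~ ?S"
   then obtain z where z: "z \<in> car c" "!!j a. j \<in> Obj J ==> a \<in> car (omap D j) ==> ap (l j) a ~= z" by blast
   \<comment> \<open>A small carrier is not all of \<open>'v\<close>, which leaves room for
     \<open>w\<close>, the second copy of the point \<open>z\<close>.\<close>
   have "car c ~= UNIV" using OB_D(2)[OF c] unfolding small_def by auto
   then obtain w where w: "w \<notin> car c" by blast
   let ?c = "(insert w (car c), restrict (%y. if y = w then fn c z else fn c y) (insert w (car c)), A)"
   have "small (insert w (car c))" using small_Un[OF small_finite[of "{w}"] OB_D(2)[OF c]] by simp
   then have c': "?c \<in> OB A" by (rule OB_I[OF _ OB_D(3)[OF c]]) (use OB_D(5)[OF c] z(1) in auto)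
   have "slice_map c (%y. y) ?c \<in> HOM A c ?c" "slice_map c (%y. if y = z then w else y) ?c \<in> HOM A c ?c" by (rule slice_map_HOM[OF c c']; use w in auto)+
   then have "slice_map c (%y. y) ?c = slice_map c (%y. if y = z then w else y) ?c" by (rule un) (use z(2) HOM_D(6)[OF l] in auto)
   then have "ap (slice_map c (%y. y) ?c) z = ap (slice_map c (%y. if y = z then w else y) ?c) z" by simp
   then show False using z(1) w by auto
  qed
  moreover have ?I
  proof (intro ballI impI)
   fix i a b assume i: "i \<in> Obj J" and a: "a \<in> car (omap D i)" and b: "b \<in> car (omap D i)" and e: "ap (l i) a = ap (l i) b"
   \<comment> \<open>\<open>S j x\<close> says that \<open>x\<close> and \<open>a\<close> become
     equal at some later stage. Filteredness makes this invariant under the transition maps, so its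
     truth value, paired with the base point, is a cocone.\<close>
   define S where "S j x <-> (EX k f g. k \<in> Obj J & f \<in> Hom J i k & g \<in> Hom J j k & ap (amap D f) a = ap (amap D g) x)" for j x
   have Sh: "S j' (ap (amap D h) x) <-> S j x" if h: "h \<in> Hom J j j'" and j: "j \<in> Obj J" "j' \<in> Obj J" and x: "x \<in> car (omap D j)" for h j j' x
   proof
    assume "S j' (ap (amap D h) x)"
    then obtain k f g where k: "k \<in> Obj J" "f \<in> Hom J i k" "g \<in> Hom J j' k" "ap (amap D f) a = ap (amap D g) (ap (amap D h) x)" unfolding S_def by blast
    then show "S j x" unfolding S_def using Dc[OF h k(3) x] Cmp_Hom[OF h k(3)] by metis
   next
    assume "S j x"
    then obtain k f g where k: "k \<in> Obj J" "f \<in> Hom J i k" "g \<in> Hom J j k" "ap (amap D f) a = ap (amap D g) x" unfolding S_def by blast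
    obtain m p q where m: "m \<in> Obj J" "p \<in> Hom J k m" "q \<in> Hom J j' m" "p *[J] g = q *[J] h" using filtered_D(5)[OF J j(1) k(1) j(2) k(3) h] by blast
    have "ap (amap D (p *[J] f)) a = ap (amap D q) (ap (amap D h) x)" using Dc[OF k(2) m(2) a] Dc[OF k(3) m(2) x] Dc[OF h m(3) x] k(4) m(4) by simp
    then show "S j' (ap (amap D h) x)" unfolding S_def using m Cmp_Hom[OF k(2) m(2)] by blast
   qed
   obtain v0 v1 :: 'v where v: "v0 ~= v1" using infinite_UNIV by (metis (full_types) ex_new_if_finite finite.emptyI finite.insertI insertI1)
   let ?c = "(vpair ` (A \<times> {v0, v1}), restrict vfst (vpair ` (A \<times> {v0, v1})), A)"
   have c': "?c \<in> OB A" by (rule OB_I) (use small_times OB_D(3)[OF c] small_finite in auto)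
   define l' where "l' j = slice_map (omap D j) (%x. vpair (fn (omap D j) x, if S j x then v1 else v0)) ?c" for j
   have l': "l' j \<in> HOM A (omap D j) ?c" if "j \<in> Obj J" for j unfolding l'_def by (rule slice_map_HOM[OF Do[OF that] c']) (use OB_D(5)[OF Do[OF that]] in auto)
   have ap': "ap (l' j) x = vpair (fn (omap D j) x, if S j x then v1 else v0)" if "x \<in> car (omap D j)" for j x unfolding l'_def using that by simp
   have "is_cocone J (SO A) D ?c l'"
   proof (rule cocone_I[OF D c' l'])
    fix f j k x assume f: "f \<in> Hom J j k" and j: "j \<in> Obj J" "k \<in> Obj J" and x: "x \<in> car (omap D j)"
    show "ap (l' k) (ap (amap D f) x) = ap (l' j) x" using ap'[OF HOM_D(6)[OF Da[OF f] x]] ap'[OF x] Sh[OF f j x] HOM_D(7)[OF Da[OF f] x] by simp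
   qed
   then obtain h where h: "h \<in> HOM A c ?c" "!!j. j \<in> Obj J ==> h \<cdot>[A] l j = l' j" using col unfolding is_colimit_def by blast
   have "ap (l' i) x = ap h (ap (l i) x)" if "x \<in> car (omap D i)" for x using h(2)[OF i] Cmp_HOM(2)[OF l[OF i] h(1) that] by simp
   then have "ap (l' i) a = ap (l' i) b" using e a b by simp
   moreover have "S i a" unfolding S_def using i Idn_Hom by blast
   ultimately have "S i b" using ap' a b v by (auto split: if_splits)
   then obtain k f g where k: "k \<in> Obj J" "f \<in> Hom J i k" "g \<in> Hom J i k" "ap (amap D f) a = ap (amap D g) b" unfolding S_def by blast
   \<comment> \<open>\<open>S i b\<close> only provides two arrows \<open>f\<close> and
     \<open>g\<close> under which \<open>a\<close> and \<open>b\<close> get equal images;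
     coequalising them gives the single arrow that is wanted.\<close>
   obtain m h where m: "m \<in> Obj J" "h \<in> Hom J k m" "h *[J] f = h *[J] g" using filtered_D(4)[OF J i k(1-3)] by blast
   have "ap (amap D (h *[J] f)) a = ap (amap D (h *[J] f)) b" using Dc[OF k(2) m(2) a] Dc[OF k(3) m(2) b] k(4) m(3) by simp
   then show "EX k:Obj J. EX f:Hom J i k. ap (amap D f) a = ap (amap D f) b" using m Cmp_Hom[OF k(2) m(2)] by blast
  qed
  ultimately show "?S & ?I" ..
 next
  assume si: "?S & ?I"
  show "is_colimit J (SO A) D c l" unfolding is_colimit_def
  proof (intro conjI allI impI)
   fix c' l' assume co': "is_cocone J (SO A) D c' l'"
   note l' = cocone_D(3)[OF co'] and ln' = cocone_D(4)[OF co']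
   \<comment> \<open>Elements with the same image in \<open>c\<close> are already identified at some
     stage, so every other cocone agrees on them; this makes \<open>h\<close> below well
     defined.\<close>
   have wd: "ap (l' i) a = ap (l' j) b" if ij: "i \<in> Obj J" "j \<in> Obj J" and a: "a \<in> car (omap D i)"
    and b: "b \<in> car (omap D j)" and e: "ap (l i) a = ap (l j) b" for i j a b
   proof -
    obtain k f g where k: "k \<in> Obj J" "f \<in> Hom J i k" "g \<in> Hom J j k" using filtered_D(3)[OF J ij] by blast
    have "ap (l k) (ap (amap D f) a) = ap (l k) (ap (amap D g) b)" using ln[OF k(2) ij(1) k(1) a] ln[OF k(3) ij(2) k(1) b] e by simp
    then obtain m h where m: "m \<in> Obj J" "h \<in> Hom J k m" "ap (amap D h) (ap (amap D f) a) = ap (amap D h) (ap (amap D g) b)"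
     using si k(1) HOM_D(6)[OF Da[OF k(2)] a] HOM_D(6)[OF Da[OF k(3)] b] by blast
    then show ?thesis using ln'[OF k(2) ij(1) k(1) a] ln'[OF k(3) ij(2) k(1) b]
     ln'[OF m(2) k(1) m(1) HOM_D(6)[OF Da[OF k(2)] a]] ln'[OF m(2) k(1) m(1) HOM_D(6)[OF Da[OF k(3)] b]] by simp
   qed
   define h where "h z = (SOME y. EX j a. j \<in> Obj J & a \<in> car (omap D j) & ap (l j) a = z & y = ap (l' j) a)" for z
   have h: "h (ap (l j) a) = ap (l' j) a" if "j \<in> Obj J" "a \<in> car (omap D j)" for j a
   proof -
    have "EX y j' a'. j' \<in> Obj J & a' \<in> car (omap D j') & ap (l j') a' = ap (l j) a & y = ap (l' j') a'" using that by blast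
    from someI_ex[OF this] obtain j' a' where "j' \<in> Obj J" "a' \<in> car (omap D j')" "ap (l j') a' = ap (l j) a"
     "h (ap (l j) a) = ap (l' j') a'" unfolding h_def by blast
    then show ?thesis using wd that by metis
   qed
   let ?h = "slice_map c h c'"
   have hH: "?h \<in> HOM A c c'"
   proof (rule slice_map_HOM[OF c cocone_D(2)[OF co']])
    fix z assume "z \<in> car c"
    then obtain j a where j: "j \<in> Obj J" "a \<in> car (omap D j)" "z = ap (l j) a" using bspec[OF conjunct1[OF si] \<open>z \<in> car c\<close>] by auto
    then show "h z \<in> car c' & fn c' (h z) = fn c z" using h HOM_D(6,7)[OF l'[OF j(1)] j(2)] HOM_D(7)[OF l[OF j(1)] j(2)] by simp
   qed
   note hl = Cmp_HOM[OF l hH]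
   show "EX! h. h \<in> HOM A c c' & (ALL j:Obj J. h \<cdot>[A] l j = l' j)"
   proof (rule ex1I[of _ ?h], intro conjI ballI)
    show "?h \<cdot>[A] l j = l' j" if j: "j \<in> Obj J" for j by (rule HOM_eqI[OF hl(1)[OF j] l'[OF j]]) (simp add: hl(2)[OF j] HOM_D(6)[OF l[OF j]] h[OF j])
    fix k assume k: "k \<in> HOM A c c' & (ALL j:Obj J. k \<cdot>[A] l j = l' j)"
    then have kH: "k \<in> HOM A c c'" by simp
    show "k = ?h"
    proof (rule HOM_eqI[OF kH hH])
     fix z assume "z \<in> car c"
     then obtain j a where j: "j \<in> Obj J" "a \<in> car (omap D j)" "z = ap (l j) a" using bspec[OF conjunct1[OF si] \<open>z \<in> car c\<close>] by auto
     then show "ap k z = ap ?h z" using Cmp_HOM(2)[OF l[OF j(1)] kH j(2)] k h[OF j(1,2)] \<open>z \<in> car c\<close> by simp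
    qed
   qed (rule hH)
  qed (rule co)
 qed
qed

end

section \<open>Monads elementwise\<close>

context universe
begin

lemma nat_trans_D: assumes "nat_trans (SO A) (SO B) F G al" shows "sF A B F" "sF A B G"
  "al \<in> extensional (OB A)" "!!x. x \<in> OB A ==> al x \<in> HOM B (omap F x) (omap G x)" "!!f x y t. f \<in> HOM A x y ==> t \<in> car (omap F x) ==>
   ap (amap G f) (ap (al x) t) = ap (al y) (ap (amap F f) t)"
proof -
 note d = assms[unfolded nat_trans_def]
 show F: "sF A B F" and G: "sF A B G" and "al \<in> extensional (OB A)" and a: "!!x. x \<in> OB A ==> al x \<in> HOM B (omap F x) (omap G x)" using d by simp_all
 fix f x y t assume f: "f \<in> HOM A x y" and t: "t \<in> car (omap F x)"
 note fd = HOM_D[OF f]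
 have "amap G f \<cdot>[B] al x = al y \<cdot>[B] amap F f" using d fd by auto
 then show "ap (amap G f) (ap (al x) t) = ap (al y) (ap (amap F f) t)" using Cmp_HOM(2)[OF a[OF fd(1)] functor_D(2)[OF G f] t]
   Cmp_HOM(2)[OF functor_D(2)[OF F f] a[OF fd(2)] t] by simp
qed

lemma nat_trans_I: assumes F: "sF A B F" and G: "sF A B G" and e: "al \<in> extensional (OB A)" and a: "!!x. x \<in> OB A ==> al x \<in> HOM B (omap F x) (omap G x)"
  and n: "!!f x y t. f \<in> HOM A x y ==> t \<in> car (omap F x) ==> ap (amap G f) (ap (al x) t) = ap (al y) (ap (amap F f) t)" shows "nat_trans (SO A) (SO B) F G al"
proof -
 have "amap G f \<cdot>[B] al (fst f) = al (snd (snd f)) \<cdot>[B] amap F f" if "f \<in> Arr (SO A)" for f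
 proof -
  have f: "f \<in> HOM A (fst f) (snd (snd f))" using that by (simp add: Arr_HOM)
  note fd = HOM_D[OF f]
  note 1 = Cmp_HOM[OF a[OF fd(1)] functor_D(2)[OF G f]] and 2 = Cmp_HOM[OF functor_D(2)[OF F f] a[OF fd(2)]]
  show ?thesis by (rule HOM_eqI[OF 1(1) 2(1)]) (simp add: 1(2) 2(2) n[OF f])
 qed
 then show ?thesis unfolding nat_trans_def using F G e a by simp
qed

lemma cartesian_nat_trans_iff: assumes n: "nat_trans (SO (A :: 'v set)) (SO (B :: 'v set)) F G al" shows "cartesian_nat_trans (SO A) (SO B) F G al <->
  (ALL x y f. f \<in> HOM A x y --> (ALL a:car (omap G x). ALL b:car (omap F y).
   ap (amap G f) a = ap (al y) b --> (EX! c. c \<in> car (omap F x) & ap (al x) c = a & ap (amap F f) c = b)))"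
proof -
 note d = nat_trans_D[OF n]
 have "is_pullback (SO B) (amap G f) (al y) (al x) (amap F f) <-> (ALL a:car (omap G x). ALL b:car (omap F y).
   ap (amap G f) a = ap (al y) b --> (EX! c. c \<in> car (omap F x) & ap (al x) c = a & ap (amap F f) c = b))" if f: "f \<in> HOM A x y" for f x y
  using pullback_iff[OF functor_D(2)[OF d(2) f] d(4)[OF HOM_D(2)[OF f]] d(4)[OF HOM_D(1)[OF f]]
   functor_D(2)[OF d(1) f]] d(5)[OF f] by simp
 moreover have "(ALL f:Arr (SO A). P f (fst f) (snd (snd f))) <-> (ALL x y f. f \<in> HOM A x y --> P f x y)" for P using Arr_HOM HOM_D(3-5) by metis
 note this[of "%f x y. is_pullback (SO B) (amap G f) (al y) (al x) (amap F f)"]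
 ultimately show ?thesis unfolding cartesian_nat_trans_def using n by simp
qed

lemma monad_D: assumes "monad_obj (A :: 'v set, T)" shows "small A" "cartesian_monad (SO A) T" "finitary A (mfun T)" "preserves_wide_pullbacks A (mfun T)"
  and "sF A A (mfun T)" and "!!x. x \<in> OB A ==> eta T x \<in> HOM A x (mO T x)" and "!!f x y z. f \<in> HOM A x y ==> z \<in> car x ==>
   mV T f (ap (eta T x) z) = ap (eta T y) (ap f z)" and "!!x. x \<in> OB A ==> mu T x \<in> HOM A (mO T (mO T x)) (mO T x)"
  and "!!f x y t. f \<in> HOM A x y ==> t \<in> mE T (mO T x) ==> mV T f (ap (mu T x) t) = ap (mu T y) (mV T (mA T f) t)" and "!!x t. x \<in> OB A ==> t \<in> mE T x ==>
   ap (mu T x) (mV T (eta T x) t) = t" and "!!x t. x \<in> OB A ==> t \<in> mE T x ==> ap (mu T x) (ap (eta T (mO T x)) t) = t"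
  and "!!x t. x \<in> OB A ==> t \<in> mE T (mO T (mO T x)) ==> ap (mu T x) (mV T (mu T x) t) = ap (mu T x) (ap (mu T (mO T x)) t)"
  and "!!f x y a b. f \<in> HOM A x y ==> a \<in> mE T x ==> b \<in> car y ==> mV T f a = ap (eta T y) b ==> EX! c. c \<in> car x & ap (eta T x) c = a & ap f c = b"
  and "!!f x y a b. f \<in> HOM A x y ==> a \<in> mE T x ==> b \<in> mE T (mO T y) ==> mV T f a = ap (mu T y) b ==> EX! c. c \<in> mE T (mO T x) & ap (mu T x) c = a &
    mV T (mA T f) c = b" and "eta T \<in> extensional (OB A)" "mu T \<in> extensional (OB A)"
proof -
 show s: "small A" "cartesian_monad (SO A) T" "finitary A (mfun T)" "preserves_wide_pullbacks A (mfun T)" using assms unfolding monad_obj_def by simp_all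
 note c = s(2)[unfolded cartesian_monad_def] and m = conjunct1[OF s(2)[unfolded cartesian_monad_def], unfolded is_monad_def]
 show F: "sF A A (mfun T)" using m by simp
 note o = functor_D(1)[OF F] and a = functor_D(2)[OF F]
 note cf = functor_comp[OF F F]
 have ne: "nat_trans (SO A) (SO A) (id_functor (SO A)) (mfun T) (eta T)" and nm: "nat_trans (SO A) (SO A) (cF (SO A) (mfun T) (mfun T)) (mfun T) (mu T)"
  using m by simp_all
 note e = nat_trans_D[OF ne] and u = nat_trans_D[OF nm]
 show eh: "!!x. x \<in> OB A ==> eta T x \<in> HOM A x (mO T x)" using e(4) by simp
 show mh: "!!x. x \<in> OB A ==> mu T x \<in> HOM A (mO T (mO T x)) (mO T x)" using u(4) cf(2) by simp
 show "eta T \<in> extensional (OB A)" "mu T \<in> extensional (OB A)" by (fact e(3)) (fact u(3))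
 { fix f x y z assume f: "f \<in> HOM A x y" and z: "z \<in> car x"
  show "mV T f (ap (eta T x) z) = ap (eta T y) (ap f z)" using e(5)[OF f] z HOM_D(1)[OF f] amap_id[OF f] by simp }
 { fix f x y t assume f: "f \<in> HOM A x y" and t: "t \<in> mE T (mO T x)"
  show "mV T f (ap (mu T x) t) = ap (mu T y) (mV T (mA T f) t)" using u(5)[OF f] t cf(2)[OF HOM_D(1)[OF f]] cf(3)[OF f] by simp }
 { fix x t assume x: "x \<in> OB A" and t: "t \<in> mE T x"
  show "ap (mu T x) (mV T (eta T x) t) = t" using m x t Cmp_HOM(2)[OF a[OF eh[OF x]] mh[OF x] t] Idn_HOM(2)[OF o[OF x] t] by simp
  show "ap (mu T x) (ap (eta T (mO T x)) t) = t" using m x t Cmp_HOM(2)[OF eh[OF o[OF x]] mh[OF x] t] Idn_HOM(2)[OF o[OF x] t] by simp }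
 { fix x t assume x: "x \<in> OB A" and t: "t \<in> mE T (mO T (mO T x))"
  show "ap (mu T x) (mV T (mu T x) t) = ap (mu T x) (ap (mu T (mO T x)) t)"
   using m x t Cmp_HOM(2)[OF a[OF mh[OF x]] mh[OF x] t] Cmp_HOM(2)[OF mh[OF o[OF x]] mh[OF x] t] by simp }
 { fix f x y a b assume f: "f \<in> HOM A x y" and h: "a \<in> mE T x" "b \<in> car y" "mV T f a = ap (eta T y) b"
  show "EX! c. c \<in> car x & ap (eta T x) c = a & ap f c = b"
   using cartesian_nat_trans_iff[OF ne, THEN iffD1, OF conjunct1[OF conjunct2[OF conjunct2[OF c]]], rule_format, OF f, of a b] h HOM_D(1,2)[OF f] amap_id[OF f] by simp }
 { fix f x y a b assume f: "f \<in> HOM A x y" and h: "a \<in> mE T x" "b \<in> mE T (mO T y)" "mV T f a = ap (mu T y) b"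
  show "EX! c. c \<in> mE T (mO T x) & ap (mu T x) c = a & mV T (mA T f) c = b"
   using cartesian_nat_trans_iff[OF nm, THEN iffD1, OF conjunct2[OF conjunct2[OF conjunct2[OF c]]], rule_format, OF f, of a b] h cf(2)[OF HOM_D(1)[OF f]] cf(2)[OF HOM_D(2)[OF f]] cf(3)[OF f]
   by simp }
qed

lemma cartesian_monad_I:
 fixes A :: "'v set" assumes F: "sF A A (mfun T)" and pp: "preserves_pullbacks (SO A) (SO A) (mfun T)" and eh: "!!x. x \<in> OB A ==> eta T x \<in> HOM A x (mO T x)"
  and en: "!!f x y z. f \<in> HOM A x y ==> z \<in> car x ==> mV T f (ap (eta T x) z) = ap (eta T y) (ap f z)"
  and mh: "!!x. x \<in> OB A ==> mu T x \<in> HOM A (mO T (mO T x)) (mO T x)" and mn: "!!f x y t. f \<in> HOM A x y ==> t \<in> mE T (mO T x) ==>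
   mV T f (ap (mu T x) t) = ap (mu T y) (mV T (mA T f) t)" and l1: "!!x t. x \<in> OB A ==> t \<in> mE T x ==> ap (mu T x) (mV T (eta T x) t) = t"
  and l2: "!!x t. x \<in> OB A ==> t \<in> mE T x ==> ap (mu T x) (ap (eta T (mO T x)) t) = t" and l3: "!!x t. x \<in> OB A ==> t \<in> mE T (mO T (mO T x)) ==>
   ap (mu T x) (mV T (mu T x) t) = ap (mu T x) (ap (mu T (mO T x)) t)" and ec: "!!f x y a b. f \<in> HOM A x y ==> a \<in> mE T x ==> b \<in> car y ==>
   mV T f a = ap (eta T y) b ==> EX! c. c \<in> car x & ap (eta T x) c = a & ap f c = b" and mc: "!!f x y a b. f \<in> HOM A x y ==> a \<in> mE T x ==>
   b \<in> mE T (mO T y) ==> mV T f a = ap (mu T y) b ==> EX! c. c \<in> mE T (mO T x) & ap (mu T x) c = a & mV T (mA T f) c = b"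
  and ext: "eta T \<in> extensional (OB A)" "mu T \<in> extensional (OB A)" shows "cartesian_monad (SO A) T"
proof -
 note o = functor_D(1)[OF F] and a = functor_D(2)[OF F]
 note cf = functor_comp[OF F F]
 have ne: "nat_trans (SO A) (SO A) (id_functor (SO A)) (mfun T) (eta T)"
 proof (rule nat_trans_I[OF functor_id F ext(1)])
  fix f x y t assume f: "f \<in> HOM A x y" and t: "t \<in> car (omap (id_functor (SO A)) x)"
  then show "mV T f (ap (eta T x) t) = ap (eta T y) (ap (amap (id_functor (SO A)) f) t)" using en[OF f] HOM_D(1)[OF f] amap_id[OF f] by simp
 qed (simp add: eh)
 have nm: "nat_trans (SO A) (SO A) (cF (SO A) (mfun T) (mfun T)) (mfun T) (mu T)"
 proof (rule nat_trans_I[OF cf(1) F ext(2)])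
  fix f x y t assume f: "f \<in> HOM A x y" and t: "t \<in> car (omap (cF (SO A) (mfun T) (mfun T)) x)"
  then show "mV T f (ap (mu T x) t) = ap (mu T y) (ap (amap (cF (SO A) (mfun T) (mfun T)) f) t)"
   using mn[OF f] HOM_D(1)[OF f] cf(2)[OF HOM_D(1)[OF f]] cf(3)[OF f] by simp
 qed (simp add: mh cf(2))
 have "cartesian_nat_trans (SO A) (SO A) (id_functor (SO A)) (mfun T) (eta T)" unfolding cartesian_nat_trans_iff[OF ne]
 proof (intro allI impI ballI)
  fix x y f a b assume f: "f \<in> HOM A x y" and h: "a \<in> mE T x" "b \<in> car (omap (id_functor (SO A)) y)" "mV T f a = ap (eta T y) b"
  show "EX! c. c \<in> car (omap (id_functor (SO A)) x) & ap (eta T x) c = a & ap (amap (id_functor (SO A)) f) c = b"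
   using ec[OF f] h HOM_D(1,2)[OF f] amap_id[OF f] by simp
 qed
 moreover have "cartesian_nat_trans (SO A) (SO A) (cF (SO A) (mfun T) (mfun T)) (mfun T) (mu T)" unfolding cartesian_nat_trans_iff[OF nm]
 proof (intro allI impI ballI)
  fix x y f a b assume f: "f \<in> HOM A x y" and h: "a \<in> mE T x" "b \<in> car (omap (cF (SO A) (mfun T) (mfun T)) y)" "mV T f a = ap (mu T y) b"
  show "EX! c. c \<in> car (omap (cF (SO A) (mfun T) (mfun T)) x) & ap (mu T x) c = a & ap (amap (cF (SO A) (mfun T) (mfun T)) f) c = b"
   using mc[OF f] h cf(2)[OF HOM_D(1)[OF f]] cf(2)[OF HOM_D(2)[OF f]] cf(3)[OF f] by simp
 qed
 moreover have "mu T x \<cdot>[A] mA T (eta T x) = iO A (mO T x)" "mu T x \<cdot>[A] eta T (mO T x) = iO A (mO T x)"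
  "mu T x \<cdot>[A] mA T (mu T x) = mu T x \<cdot>[A] mu T (mO T x)" if x: "x \<in> OB A" for x
 proof -
  note 1 = Cmp_HOM[OF a[OF eh[OF x]] mh[OF x]] and 2 = Cmp_HOM[OF eh[OF o[OF x]] mh[OF x]]
   and 3 = Cmp_HOM[OF a[OF mh[OF x]] mh[OF x]] and 4 = Cmp_HOM[OF mh[OF o[OF x]] mh[OF x]]
  show "mu T x \<cdot>[A] mA T (eta T x) = iO A (mO T x)" by (rule HOM_eqI[OF 1(1) Idn_HOM(1)[OF o[OF x]]]) (simp add: 1(2) l1[OF x] Idn_HOM(2)[OF o[OF x]])
  show "mu T x \<cdot>[A] eta T (mO T x) = iO A (mO T x)" by (rule HOM_eqI[OF 2(1) Idn_HOM(1)[OF o[OF x]]]) (simp add: 2(2) l2[OF x] Idn_HOM(2)[OF o[OF x]])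
  show "mu T x \<cdot>[A] mA T (mu T x) = mu T x \<cdot>[A] mu T (mO T x)" by (rule HOM_eqI[OF 3(1) 4(1)]) (simp add: 3(2) 4(2) l3[OF x])
 qed
 ultimately show ?thesis unfolding cartesian_monad_def is_monad_def using F pp ne nm by simp
qed

section \<open>Morphisms of monads\<close>

lemma mor_cong_fst: assumes "u \<in> Hom SetC A B" "f \<in> HOM A y (pb (u :: 'v fn) z)" "t \<in> car y" shows "ap f t = vpair (fn y t, vsnd (ap f t))"
 using pb_D(4,5)[OF assms(1) HOM_D(6)[OF assms(2,3)]] HOM_D(7)[OF assms(2,3)] by simp

lemma HOM_pb_eqI: assumes "u \<in> Hom SetC A B" "f \<in> HOM A y (pb (u :: 'v fn) z)" "g \<in> HOM A y (pb u z)" "!!t. t \<in> car y ==> vsnd (ap f t) = vsnd (ap g t)"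
 shows "f = g" by (rule HOM_eqI[OF assms(2,3)]) (metis mor_cong_fst[OF assms(1,2)] mor_cong_fst[OF assms(1,3)] assms(4))

text \<open>Only second components occur: the first component of an arrow into \<open>u\<^sup>* y\<close> is forced by its source.\<close>

definition emor :: "'v fn => 'v set => 'v set => ('v fn, 'v sarr) mnd => ('v fn, 'v sarr) mnd => ('v fn => 'v sarr) => bool" where
 "emor u A B L M f <-> f \<in> extensional (OB B) & (ALL x:OB B. f x \<in> HOM A (mO L (pb u x)) (pb u (mO M x))) &
  (ALL x y k t. k \<in> HOM B x y --> t \<in> mE L (pb u x) --> vsnd (ap (f y) (mV L (uA u k) t)) = mV M k (vsnd (ap (f x) t))) &
  (ALL x y k s t. k \<in> HOM B x y --> s \<in> mE M x --> t \<in> mE L (pb u y) --> mV M k s = vsnd (ap (f y) t) -->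
   (EX! t'. t' \<in> mE L (pb u x) & vsnd (ap (f x) t') = s & mV L (uA u k) t' = t)) &
  (ALL x:OB B. ALL z:car (pb u x). vsnd (ap (f x) (ap (eta L (pb u x)) z)) = ap (eta M x) (vsnd z)) & (ALL x:OB B. ALL w:mE L (mO L (pb u x)).
   vsnd (ap (f x) (ap (mu L (pb u x)) w)) = ap (mu M x) (vsnd (ap (f (mO M x)) (mV L (f x) w))))"

lemmas emor_D = iffD1[OF emor_def, THEN conjunct1, rule_format]
 iffD1[OF emor_def, THEN conjunct2, THEN conjunct1, rule_format]
 iffD1[OF emor_def, THEN conjunct2, THEN conjunct2, THEN conjunct1, rule_format]
 iffD1[OF emor_def, THEN conjunct2, THEN conjunct2, THEN conjunct2, THEN conjunct1, rule_format]
 iffD1[OF emor_def, THEN conjunct2, THEN conjunct2, THEN conjunct2, THEN conjunct2, THEN conjunct1, rule_format]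
 iffD1[OF emor_def, THEN conjunct2, THEN conjunct2, THEN conjunct2, THEN conjunct2, THEN conjunct2, rule_format]

text \<open>All the arrows involved end in objects of the form \<open>pb u y\<close>, where the
  first component of a value is the base point of the argument. Naturality, cartesianness and the
  two monad laws can therefore be tested on second components.\<close>

lemma mor_iff: assumes u: "u \<in> Hom SetC (A :: 'v set) B" and L: "monad_obj (A, L)" and M: "monad_obj (B, M)" shows "cartesian_monad_mor u L M f <-> emor u A B L M f"
proof -
 note Ld = monad_D[OF L] and Md = monad_D[OF M] and U = pb_functor[OF u]
 note c1 = functor_comp[OF U(1) Ld(5)] and c2 = functor_comp[OF Md(5) U(1)]
 note lo = functor_D(1)[OF Ld(5)] and la = functor_D(2)[OF Ld(5)] and mo = functor_D(1)[OF Md(5)] and ma = functor_D(2)[OF Md(5)] and uo = pb_obj_OB[OF u]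
 let ?H = "ALL x:OB B. f x \<in> HOM A (mO L (pb u x)) (pb u (mO M x))"
 let ?N = "ALL x y k t. k \<in> HOM B x y --> t \<in> mE L (pb u x) --> vsnd (ap (f y) (mV L (uA u k) t)) = mV M k (vsnd (ap (f x) t))"
 let ?C = "ALL x y k s t. k \<in> HOM B x y --> s \<in> mE M x --> t \<in> mE L (pb u y) --> mV M k s = vsnd (ap (f y) t) -->
   (EX! t'. t' \<in> mE L (pb u x) & vsnd (ap (f x) t') = s & mV L (uA u k) t' = t)"
 have sq: "ap (uA u (mA M k)) (ap (f x) t) = vpair (fn (mO L (pb u x)) t, mV M k (vsnd (ap (f x) t)))" "ap (f y) (mV L (uA u k) t) =
   vpair (fn (mO L (pb u x)) t, vsnd (ap (f y) (mV L (uA u k) t)))" if H: ?H and k: "k \<in> HOM B x y" and t: "t \<in> mE L (pb u x)" for k x y t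
 proof -
  note kd = HOM_D[OF k]
  have fx: "f x \<in> HOM A (mO L (pb u x)) (pb u (mO M x))" and fy: "f y \<in> HOM A (mO L (pb u y)) (pb u (mO M y))" using H kd by auto
  show "ap (uA u (mA M k)) (ap (f x) t) = vpair (fn (mO L (pb u x)) t, mV M k (vsnd (ap (f x) t)))"
   using U(3)[OF ma[OF k] HOM_D(6)[OF fx t]] mor_cong_fst[OF u fx t] by (metis vfst_vpair)
  show "ap (f y) (mV L (uA u k) t) = vpair (fn (mO L (pb u x)) t, vsnd (ap (f y) (mV L (uA u k) t)))"
   using mor_cong_fst[OF u fy HOM_D(6)[OF la[OF U(4)[OF k]] t]] HOM_D(7)[OF la[OF U(4)[OF k]] t] by simp
 qed
 have nat: "nat_trans (SO B) (SO A) (cF (SO B) (mfun L) (pb_functor u)) (cF (SO B) (pb_functor u) (mfun M)) f <-> f \<in> extensional (OB B) & ?H & ?N" (is "?L <-> _")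
 proof (intro iffI conjI)
  assume n: ?L
  note d = nat_trans_D[OF n]
  show "f \<in> extensional (OB B)" by (fact d(3))
  show H: ?H using d(4) c1(2) c2(2) U(2) mo by simp
  show ?N
  proof (intro allI impI)
   fix x y k t assume k: "k \<in> HOM B x y" and t: "t \<in> mE L (pb u x)"
   note kd = HOM_D[OF k]
   have "ap (uA u (mA M k)) (ap (f x) t) = ap (f y) (mV L (uA u k) t)" using d(5)[OF k] t c1(2)[OF kd(1)] c1(3)[OF k] c2(3)[OF k] U(2)[OF kd(1)] by simp
   then show "vsnd (ap (f y) (mV L (uA u k) t)) = mV M k (vsnd (ap (f x) t))" using sq(1)[OF H k t] by (metis vsnd_vpair)
  qed
 next
  assume h: "f \<in> extensional (OB B) & ?H & ?N"
  show ?L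
  proof (rule nat_trans_I[OF c1(1) c2(1)])
   fix x assume "x \<in> OB B" then show "f x \<in> HOM A (omap (cF (SO B) (mfun L) (pb_functor u)) x)
    (omap (cF (SO B) (pb_functor u) (mfun M)) x)" using h c1(2) c2(2) U(2) mo by simp
  next
   fix k x y t assume k: "k \<in> HOM B x y" and t: "t \<in> car (omap (cF (SO B) (mfun L) (pb_functor u)) x)"
   note kd = HOM_D[OF k]
   have t': "t \<in> mE L (pb u x)" using t c1(2)[OF kd(1)] U(2)[OF kd(1)] by simp
   have N: "vsnd (ap (f y) (mV L (uA u k) t)) = mV M k (vsnd (ap (f x) t))" using h k t' by blast
   have H: ?H using h by blast
   show "ap (amap (cF (SO B) (pb_functor u) (mfun M)) k) (ap (f x) t) = ap (f y) (ap (amap (cF (SO B) (mfun L) (pb_functor u)) k) t)"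
    using sq[OF H k t'] N c1(3)[OF k] c2(3)[OF k] by simp
  qed (use h in simp)
 qed
 have cart: "cartesian_nat_trans (SO B) (SO A) (cF (SO B) (mfun L) (pb_functor u)) (cF (SO B) (pb_functor u) (mfun M)) f <-> ?C" if n: ?L
 proof -
  have H: ?H and N: ?N using nat n by blast+
  have "(ALL a:car (pb u (mO M x)). ALL b:mE L (pb u y). ap (uA u (mA M k)) a = ap (f y) b --> (EX! c. c \<in> mE L (pb u x) & ap (f x) c = a & mV L (uA u k) c = b)) <->
   (ALL s t. s \<in> mE M x --> t \<in> mE L (pb u y) --> mV M k s = vsnd (ap (f y) t) --> (EX! t'. t' \<in> mE L (pb u x) & vsnd (ap (f x) t') = s &
     mV L (uA u k) t' = t))" (is "?l <-> ?r") if k: "k \<in> HOM B x y" for k x y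
  proof -
   note kd = HOM_D[OF k]
   have fx: "f x \<in> HOM A (mO L (pb u x)) (pb u (mO M x))" and fy: "f y \<in> HOM A (mO L (pb u y)) (pb u (mO M y))" using H kd by auto
   have ty: "fn (mO L (pb u x)) c = fn (mO L (pb u y)) b" if "c \<in> mE L (pb u x)" "mV L (uA u k) c = b" for b c
    using HOM_D(7)[OF la[OF U(4)[OF k]] that(1)] that(2) by simp
   \<comment> \<open>Arrows of the slice preserve base points: a candidate \<open>c\<close> lying
     over \<open>b\<close> has the base point of \<open>b\<close>, so fixing the second component of
     its value fixes the value.\<close>
   have e1: "ap (f x) c = vpair (fn (mO L (pb u y)) b, s) <-> vsnd (ap (f x) c) = s" if "c \<in> mE L (pb u x)" "mV L (uA u k) c = b" for b c s
    using mor_cong_fst[OF u fx that(1)] ty[OF that] by (metis vsnd_vpair)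
   show ?thesis
   proof
    assume l: ?l
    show ?r
    proof (intro allI impI)
     fix s t assume s: "s \<in> mE M x" and t: "t \<in> mE L (pb u y)" and e: "mV M k s = vsnd (ap (f y) t)"
     \<comment> \<open>The first component of a lift of \<open>s\<close> over \<open>t\<close> can
       only be the base point of \<open>t\<close>.\<close>
     let ?a = "vpair (fn (mO L (pb u y)) t, s)"
     note ft = mor_cong_fst[OF u fy t]
     have "ap (f y) t \<in> car (pb u (mO M y))" by (rule HOM_D(6)[OF fy t])
     then have "vpair (fn (mO L (pb u y)) t, vsnd (ap (f y) t)) \<in> car (pb u (mO M y))" using ft by simp
     then have a: "?a \<in> car (pb u (mO M x))" using s HOM_D(7)[OF ma[OF k] s] e by (simp add: vpair_car_pb[OF u])
     have "ap (uA u (mA M k)) ?a = ap (f y) t" using U(3)[OF ma[OF k] a] e ft by simp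
     then have "EX! c. c \<in> mE L (pb u x) & ap (f x) c = ?a & mV L (uA u k) c = t" using l a t by blast
     then show "EX! t'. t' \<in> mE L (pb u x) & vsnd (ap (f x) t') = s & mV L (uA u k) t' = t" using e1 by (smt (verit))
    qed
   next
    assume r: ?r
    show ?l
    proof (intro ballI impI)
     fix a b assume a: "a \<in> car (pb u (mO M x))" and b: "b \<in> mE L (pb u y)" and e: "ap (uA u (mA M k)) a = ap (f y) b"
     note ad = pb_D[OF u a]
     have e': "vpair (vfst a, mV M k (vsnd a)) = vpair (fn (mO L (pb u y)) b, vsnd (ap (f y) b))" using U(3)[OF ma[OF k] a] e mor_cong_fst[OF u fy b] by simp
     then have ae: "a = vpair (fn (mO L (pb u y)) b, vsnd a)" using ad(4) by (metis vpair_eq)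
     have "EX! t'. t' \<in> mE L (pb u x) & vsnd (ap (f x) t') = vsnd a & mV L (uA u k) t' = b" using r ad(2) b e' by simp
     then show "EX! c. c \<in> mE L (pb u x) & ap (f x) c = a & mV L (uA u k) c = b" using e1 ae by (smt (verit))
    qed
   qed
  qed
  note key = this
  show ?thesis unfolding cartesian_nat_trans_iff[OF n]
  proof (intro iffI allI impI)
   assume l: "ALL x y k. k \<in> HOM B x y --> (ALL a:car (omap (cF (SO B) (pb_functor u) (mfun M)) x). ALL b:car (omap (cF (SO B) (mfun L) (pb_functor u)) y).
     ap (amap (cF (SO B) (pb_functor u) (mfun M)) k) a = ap (f y) b --> (EX! c. c \<in> car (omap (cF (SO B) (mfun L) (pb_functor u)) x) & ap (f x) c = a &
       ap (amap (cF (SO B) (mfun L) (pb_functor u)) k) c = b))"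
   fix x y k s t assume k: "k \<in> HOM B x y" and h: "s \<in> mE M x" "t \<in> mE L (pb u y)" "mV M k s = vsnd (ap (f y) t)"
   note kd = HOM_D[OF k]
   show "EX! t'. t' \<in> mE L (pb u x) & vsnd (ap (f x) t') = s & mV L (uA u k) t' = t"
    using l[rule_format, OF k] key[OF k] c1(2)[OF kd(1)] c1(2)[OF kd(2)] c1(3)[OF k] c2(2)[OF kd(1)] c2(3)[OF k]
     U(2)[OF kd(1)] U(2)[OF kd(2)] U(2)[OF mo[OF kd(1)]] h by simp
  next
   assume r: ?C
   fix x y k assume k: "k \<in> HOM B x y"
   note kd = HOM_D[OF k]
   show "ALL a:car (omap (cF (SO B) (pb_functor u) (mfun M)) x). ALL b:car (omap (cF (SO B) (mfun L) (pb_functor u)) y).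
     ap (amap (cF (SO B) (pb_functor u) (mfun M)) k) a = ap (f y) b --> (EX! c. c \<in> car (omap (cF (SO B) (mfun L) (pb_functor u)) x) & ap (f x) c = a &
       ap (amap (cF (SO B) (mfun L) (pb_functor u)) k) c = b)" using r key[OF k] c1(2)[OF kd(1)] c1(2)[OF kd(2)] c1(3)[OF k] c2(2)[OF kd(1)] c2(3)[OF k]
     U(2)[OF kd(1)] U(2)[OF kd(2)] U(2)[OF mo[OF kd(1)]] k by simp
  qed
 qed
 have "f x \<cdot>[A] eta L (omap (pb_functor u) x) = uA u (eta M x) <-> (ALL z:car (pb u x). vsnd (ap (f x) (ap (eta L (pb u x)) z)) = ap (eta M x) (vsnd z))"
  "f x \<cdot>[A] mu L (omap (pb_functor u) x) = uA u (mu M x) \<cdot>[A] f (mO M x) \<cdot>[A] mA L (f x) <-> (ALL w:mE L (mO L (pb u x)).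
   vsnd (ap (f x) (ap (mu L (pb u x)) w)) = ap (mu M x) (vsnd (ap (f (mO M x)) (mV L (f x) w))))" if H: ?H and x: "x \<in> OB B" for x
 proof -
  have fx: "f x \<in> HOM A (mO L (pb u x)) (pb u (mO M x))" and fmx: "f (mO M x) \<in> HOM A (mO L (pb u (mO M x))) (pb u (mO M (mO M x)))" using H x mo by auto
  note l1 = Cmp_HOM[OF Ld(6)[OF uo[OF x]] fx] and r1 = U(4)[OF Md(6)[OF x]]
  note l2 = Cmp_HOM[OF Ld(8)[OF uo[OF x]] fx] and r2 = Cmp_HOM[OF la[OF fx] fmx]
  note r3 = Cmp_HOM[OF r2(1) U(4)[OF Md(8)[OF x]]]
  have "(f x \<cdot>[A] eta L (pb u x) = uA u (eta M x)) <-> (ALL z:car (pb u x). vsnd (ap (f x \<cdot>[A] eta L (pb u x)) z) = vsnd (ap (uA u (eta M x)) z))"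
   using HOM_pb_eqI[OF u l1(1) r1] by auto
  then show "f x \<cdot>[A] eta L (omap (pb_functor u) x) = uA u (eta M x) <-> (ALL z:car (pb u x). vsnd (ap (f x) (ap (eta L (pb u x)) z)) = ap (eta M x) (vsnd z))"
   using U(2)[OF x] l1(2) U(3)[OF Md(6)[OF x]] by simp
  let ?r = "uA u (mu M x) \<cdot>[A] f (mO M x) \<cdot>[A] mA L (f x)"
  have "(f x \<cdot>[A] mu L (pb u x) = ?r) <-> (ALL w:mE L (mO L (pb u x)). vsnd (ap (f x \<cdot>[A] mu L (pb u x)) w) = vsnd (ap ?r w))"
   using HOM_pb_eqI[OF u l2(1) r3(1)] by auto
  moreover have "vsnd (ap ?r w) = ap (mu M x) (vsnd (ap (f (mO M x)) (mV L (f x) w)))" if w: "w \<in> mE L (mO L (pb u x))" for w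
   using r3(2)[OF w] r2(2)[OF w] U(3)[OF Md(8)[OF x]] HOM_D(6)[OF fmx HOM_D(6)[OF la[OF fx] w]] by simp
  ultimately show "f x \<cdot>[A] mu L (omap (pb_functor u) x) = ?r <-> (ALL w:mE L (mO L (pb u x)). vsnd (ap (f x) (ap (mu L (pb u x)) w)) =
   ap (mu M x) (vsnd (ap (f (mO M x)) (mV L (f x) w))))" using U(2)[OF x] l2(2) by simp
 qed
 note um = this
 have AB: "fst u = A" "snd (snd u) = B" using u by (auto simp: Hom_iff)
 have "cartesian_nat_trans (SO B) (SO A) (cF (SO B) (mfun L) (pb_functor u)) (cF (SO B) (pb_functor u) (mfun M)) f <-> (f \<in> extensional (OB B) & ?H & ?N) & ?C"
  using nat cart cartesian_nat_trans_def by blast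
 note c = this
 let ?E1 = "%x. f x \<cdot>[A] eta L (omap (pb_functor u) x) = uA u (eta M x)"
 let ?E2 = "%x. f x \<cdot>[A] mu L (omap (pb_functor u) x) = uA u (mu M x) \<cdot>[A] f (mO M x) \<cdot>[A] mA L (f x)"
 let ?U1 = "%x. ALL z:car (pb u x). vsnd (ap (f x) (ap (eta L (pb u x)) z)) = ap (eta M x) (vsnd z)"
 let ?U2 = "%x. ALL w:mE L (mO L (pb u x)). vsnd (ap (f x) (ap (mu L (pb u x)) w)) = ap (mu M x) (vsnd (ap (f (mO M x)) (mV L (f x) w)))"
 have "(ALL x:OB B. ?E1 x & ?E2 x) <-> (ALL x:OB B. ?U1 x) & (ALL x:OB B. ?U2 x)" if H: ?H
 proof -
  have "(ALL x:OB B. ?E1 x & ?E2 x) <-> (ALL x:OB B. ?U1 x & ?U2 x)" by (rule ball_cong[OF refl]) (simp only: um[OF H])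
  then show ?thesis by (simp only: ball_conj_distrib)
 qed
 note e = this
 show ?thesis unfolding cartesian_monad_mor_def Let_def Src_SetC Tgt_SetC AB emor_def c
 proof (cases "?H", goal_cases)
  case 1
  show ?case unfolding e[OF 1] by (simp only: conj_assoc)
 next
  case 2
  then show ?case by (simp only: HOL.simp_thms)
 qed
qed

end

section \<open>The category of monads\<close>

context universe
begin

section \<open>Composition of monad morphisms\<close>

lemma pb_comp_iso: assumes u: "u \<in> Hom SetC (A :: 'v set) B" and v: "v \<in> Hom SetC B C" and x: "x \<in> OB C"
 defines "w \<equiv> v *[SetC] u" shows "w \<in> Hom SetC A C" "pb_comp_to v u x \<in> HOM A (pb w x) (pb u (pb v x))"
  "!!z. z \<in> car (pb w x) ==> ap (pb_comp_to v u x) z = vpair (vfst z, vpair (fn u (vfst z), vsnd z))" "pb_comp_from v u x \<in> HOM A (pb u (pb v x)) (pb w x)"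
  "!!z. z \<in> car (pb u (pb v x)) ==> ap (pb_comp_from v u x) z = vpair (vfst z, vsnd (vsnd z))"
  "!!z. z \<in> car (pb w x) ==> ap (pb_comp_from v u x) (ap (pb_comp_to v u x) z) = z"
  "!!z. z \<in> car (pb u (pb v x)) ==> ap (pb_comp_to v u x) (ap (pb_comp_from v u x) z) = z"
proof -
 show w: "w \<in> Hom SetC A C" unfolding w_def using category.Cmp_Hom[OF category_SetC u v] .
 note wm = fn_map_Cmp_SetC[OF u v, folded w_def]
 note ow = pb_obj_OB[OF w x] and ov = pb_obj_OB[OF v x] note ouv = pb_obj_OB[OF u ov]
 have fB: "fn u a \<in> B" if "a \<in> A" for a using u that by (auto simp: Hom_SetC)
 show t: "!!z. z \<in> car (pb w x) ==> ap (pb_comp_to v u x) z = vpair (vfst z, vpair (fn u (vfst z), vsnd z))"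
  and f: "!!z. z \<in> car (pb u (pb v x)) ==> ap (pb_comp_from v u x) z = vpair (vfst z, vsnd (vsnd z))" unfolding pb_comp_to_def pb_comp_from_def w_def by simp_all
 have 1: "vpair (vfst z, vpair (fn u (vfst z), vsnd z)) \<in> car (pb u (pb v x))" if z: "z \<in> car (pb w x)" for z
 proof -
  note d = pb_D[OF w z]
  have c: "vpair (fn u (vfst z), vsnd z) \<in> car (pb v x)" using d wm[OF d(1)] fB[OF d(1)] by (simp add: vpair_car_pb[OF v])
  then show ?thesis using d ty_pb[OF c] by (simp add: vpair_car_pb[OF u])
 qed
 have 2: "vpair (vfst z, vsnd (vsnd z)) \<in> car (pb w x)" "fn u (vfst z) = vfst (vsnd z)" if z: "z \<in> car (pb u (pb v x))" for z
 proof -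
  note d = pb_D[OF u z] note e = pb_D[OF v d(2)]
  show "fn u (vfst z) = vfst (vsnd z)" using d e by simp
  then show "vpair (vfst z, vsnd (vsnd z)) \<in> car (pb w x)" using d e wm[OF d(1)] by (simp add: vpair_car_pb[OF w])
 qed
 show "pb_comp_to v u x \<in> HOM A (pb w x) (pb u (pb v x))" unfolding pb_comp_to_def w_def[symmetric] by (rule slice_map_HOM[OF ow ouv]) (use 1 in "simp add: ty_pb")
 show "pb_comp_from v u x \<in> HOM A (pb u (pb v x)) (pb w x)" unfolding pb_comp_from_def w_def[symmetric]
  by (rule slice_map_HOM[OF ouv ow]) (use 2 in "simp add: ty_pb")
 show "!!z. z \<in> car (pb w x) ==> ap (pb_comp_from v u x) (ap (pb_comp_to v u x) z) = z" by (simp add: t f 1 pb_D[OF w])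
 show "ap (pb_comp_to v u x) (ap (pb_comp_from v u x) z) = z" if z: "z \<in> car (pb u (pb v x))" for z
  using pb_D[OF v pb_D(2)[OF u z]] pb_D[OF u z] 2[OF z] by (simp add: t f z)
qed

text \<open>On second components the outer \<open>pb_comp_from\<close> disappears and
  \<open>f\<close> followed by \<open>g\<close> remains. The last item is the full equation with
  that isomorphism moved to the left, which is the form that can be used underneath the functor of
  \<open>L\<close>.\<close>

lemma mon_comp_simp: assumes u: "u \<in> Hom SetC (A :: 'v set) B" and v: "v \<in> Hom SetC B C"
  and L: "monad_obj (A, L)" and M: "monad_obj (B, M)" and N: "monad_obj (C, N)" and f: "emor u A B L M f" and g: "emor v B C M N g"
 defines "w \<equiv> v *[SetC] u" shows "mon_comp v g u f L N \<in> extensional (OB C)"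
  "!!x. x \<in> OB C ==> mon_comp v g u f L N x \<in> HOM A (mO L (pb w x)) (pb w (mO N x))" "!!x t. x \<in> OB C ==> t \<in> mE L (pb w x) ==>
   vsnd (ap (mon_comp v g u f L N x) t) = vsnd (ap (g x) (vsnd (ap (f (pb v x)) (mV L (pb_comp_to v u x) t))))"
  "!!x. x \<in> OB C ==> pb_comp_to v u (mO N x) \<cdot>[A] mon_comp v g u f L N x = uA u (g x) \<cdot>[A] (f (pb v x) \<cdot>[A] mA L (pb_comp_to v u x))"
proof -
 have AC: "fst u = A" "snd (snd v) = C" using u v by (auto simp: Hom_iff)
 show "mon_comp v g u f L N \<in> extensional (OB C)" unfolding mon_comp_def Let_def by (simp add: AC)
 fix x assume x: "x \<in> OB C"
 note Nx = functor_D(1)[OF monad_D(5)[OF N] x]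
 note k = pb_comp_iso[OF u v x, folded w_def] and kN = pb_comp_iso[OF u v Nx, folded w_def]
 note fh = emor_D(2)[OF f pb_obj_OB[OF v x]] and gh = emor_D(2)[OF g x]
 note 1 = Cmp_HOM[OF functor_D(2)[OF monad_D(5)[OF L] k(2)] fh]
 note 2 = Cmp_HOM[OF 1(1) pb_functor(4)[OF u gh]]
 note 3 = Cmp_HOM[OF 2(1) kN(4)]
 have e: "mon_comp v g u f L N x = pb_comp_from v u (mO N x) \<cdot>[A] uA u (g x) \<cdot>[A] (f (pb v x) \<cdot>[A] mA L (pb_comp_to v u x))"
  unfolding mon_comp_def Let_def using x by (simp add: AC pb_functor(2)[OF v])
 show h: "mon_comp v g u f L N x \<in> HOM A (mO L (pb w x)) (pb w (mO N x))" unfolding e by (rule 3(1))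
 show "vsnd (ap (mon_comp v g u f L N x) t) = vsnd (ap (g x) (vsnd (ap (f (pb v x)) (mV L (pb_comp_to v u x) t))))" if t: "t \<in> mE L (pb w x)" for t
  unfolding e using 3(2)[OF t] 2(2)[OF t] 1(2)[OF t] kN(5)[OF HOM_D(6)[OF 2(1) t]]
   pb_functor(3)[OF u gh HOM_D(6)[OF 1(1) t]] by simp
 note 4 = Cmp_HOM[OF h kN(2)]
 show "pb_comp_to v u (mO N x) \<cdot>[A] mon_comp v g u f L N x = uA u (g x) \<cdot>[A] (f (pb v x) \<cdot>[A] mA L (pb_comp_to v u x))"
  by (rule HOM_eqI[OF 4(1) 2(1)]) (simp add: 4(2), simp add: e 3(2) kN(7) HOM_D(6)[OF 2(1)])
qed

text \<open>Naturality of the canonical isomorphism between pulling back along the composite and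
  pulling back twice.\<close>

lemma pb_obj_hom_eq: assumes u: "u \<in> Hom SetC (A :: 'v set) B" and v: "v \<in> Hom SetC B C" and k: "k \<in> HOM C x y"
 defines "w \<equiv> v *[SetC] u" shows "pb_comp_to v u y \<cdot>[A] uA w k = uA u (uA v k) \<cdot>[A] pb_comp_to v u x"
proof -
 note kd = HOM_D[OF k]
 note a = pb_comp_iso[OF u v kd(1), folded w_def] and b = pb_comp_iso[OF u v kd(2), folded w_def]
 note W = pb_functor[OF a(1)] and V = pb_functor[OF v] and U = pb_functor[OF u]
 note 1 = Cmp_HOM[OF W(4)[OF k] b(2)] and 2 = Cmp_HOM[OF a(2) U(4)[OF V(4)[OF k]]]
 show ?thesis
 proof (rule HOM_eqI[OF 1(1) 2(1)])
  fix z assume z: "z \<in> car (pb w x)"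
  show "ap (pb_comp_to v u y \<cdot>[A] uA w k) z = ap (uA u (uA v k) \<cdot>[A] pb_comp_to v u x) z"
   using 1(2)[OF z] 2(2)[OF z] HOM_D(6)[OF W(4)[OF k] z] W(3)[OF k z] b(3)[OF HOM_D(6)[OF W(4)[OF k] z]] a(3)[OF z]
    U(3)[OF V(4)[OF k] HOM_D(6)[OF a(2) z]] V(3)[OF k pb_D(2)[OF u HOM_D(6)[OF a(2) z]]] by simp
 qed
qed

text \<open>The laws of \<open>g\<close> and of \<open>f\<close> are applied one after the other.
  What has to be added is that the functor of \<open>L\<close> turns the canonical isomorphism into
  a bijection compatible with reindexing (\<open>Lk\<close>, \<open>LI\<close>,
  \<open>LI'\<close>).\<close>

lemma mon_comp_emor: assumes u: "u \<in> Hom SetC (A :: 'v set) B" and v: "v \<in> Hom SetC B C"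
  and L: "monad_obj (A, L)" and M: "monad_obj (B, M)" and N: "monad_obj (C, N)" and f: "emor u A B L M f" and g: "emor v B C M N g"
 defines "w \<equiv> v *[SetC] u" shows "emor w A C L N (mon_comp v g u f L N)"
proof -
 let ?c = "mon_comp v g u f L N"
 note c = mon_comp_simp[OF u v L M N f g, folded w_def]
 note Ld = monad_D[OF L] and Md = monad_D[OF M] and Nd = monad_D[OF N]
 note L1 = functor_D[OF Ld(5)] and M1 = functor_D[OF Md(5)] and N1 = functor_D[OF Nd(5)]
 note fd = emor_D[OF f] and gd = emor_D[OF g]
 note k = pb_comp_iso[OF u v, folded w_def]
 have w: "w \<in> Hom SetC A C" unfolding w_def using category.Cmp_Hom[OF category_SetC u v] .
 note U = pb_functor[OF u] and V = pb_functor[OF v] and W = pb_functor[OF w] and ov = pb_obj_OB[OF v] and ow = pb_obj_OB[OF w]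
 have Lk: "mV L (pb_comp_to v u y) (mV L (uA w h) t) = mV L (uA u (uA v h)) (mV L (pb_comp_to v u x) t)"
  if h: "h \<in> HOM C x y" and t: "t \<in> mE L (pb w x)" for h x y t
 proof -
  note hd = HOM_D[OF h]
  show ?thesis using L1(8)[OF W(4)[OF h] k(2)[OF hd(2)] t] L1(8)[OF k(2)[OF hd(1)] U(4)[OF V(4)[OF h]] t]
    pb_obj_hom_eq[OF u v h, folded w_def] by simp
 qed
 have kL: "mV L (pb_comp_to v u x) t \<in> mE L (pb u (pb v x))" if "x \<in> OB C" "t \<in> mE L (pb w x)" for x t using HOM_D(6)[OF L1(2)[OF k(2)]] that by blast
 have fv: "vsnd (ap (f y) t) \<in> mE M y" if "y \<in> OB B" "t \<in> mE L (pb u y)" for y t using pb_D(2)[OF u HOM_D(6)[OF fd(2)]] that by blast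
 show ?thesis unfolding emor_def
 proof (intro conjI ballI allI impI)
  fix x y h t assume h: "h \<in> HOM C x y" and t: "t \<in> mE L (pb w x)"
  note hd = HOM_D[OF h]
  show "vsnd (ap (?c y) (mV L (uA w h) t)) = mV N h (vsnd (ap (?c x) t))" using c(3)[OF hd(2) HOM_D(6)[OF L1(2)[OF W(4)[OF h]] t]] c(3)[OF hd(1) t] Lk[OF h t]
    fd(3)[OF V(4)[OF h] kL[OF hd(1) t]] gd(3)[OF h fv[OF ov[OF hd(1)] kL[OF hd(1) t]]] by simp
 next
  fix x y h s t assume h: "h \<in> HOM C x y" and s: "s \<in> mE N x" and t: "t \<in> mE L (pb w y)" and e: "mV N h s = vsnd (ap (?c y) t)"
  note hd = HOM_D[OF h]
  let ?t = "mV L (pb_comp_to v u y) t"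
  have t1: "?t \<in> mE L (pb u (pb v y))" by (rule kL[OF hd(2) t])
  note t2 = fv[OF ov[OF hd(2)] t1]
  have e1: "mV N h s = vsnd (ap (g y) (vsnd (ap (f (pb v y)) ?t)))" using e c(3)[OF hd(2) t] by simp
  \<comment> \<open>The lift is taken along \<open>g\<close> first and along \<open>f\<close>
    afterwards; uniqueness of the composite lift is checked in the same order.\<close>
  from gd(4)[OF h s t2 e1]
  obtain m where m: "m \<in> mE M (pb v x)" "vsnd (ap (g x) m) = s" "mV M (uA v h) m = vsnd (ap (f (pb v y)) ?t)"
   and mu: "!!m'. m' \<in> mE M (pb v x) ==> vsnd (ap (g x) m') = s ==> mV M (uA v h) m' = vsnd (ap (f (pb v y)) ?t) ==> m' = m" by blast
  from fd(4)[OF V(4)[OF h] m(1) t1 m(3)]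
  obtain l where l: "l \<in> mE L (pb u (pb v x))" "vsnd (ap (f (pb v x)) l) = m" "mV L (uA u (uA v h)) l = ?t"
   and lu: "!!l'. l' \<in> mE L (pb u (pb v x)) ==> vsnd (ap (f (pb v x)) l') = m ==> mV L (uA u (uA v h)) l' = ?t ==> l' = l" by blast
  \<comment> \<open>The lifts along \<open>f\<close> live over the iterated pullback; this bijection
    and its inverse \<open>LI'\<close> carry them back to the pullback along the composite.\<close>
  have LI: "mV L (pb_comp_from v u z) (mV L (pb_comp_to v u z) r) = r" if z: "z \<in> OB C" and r: "r \<in> mE L (pb w z)" for z r
  proof -
   note i = Cmp_HOM[OF k(2)[OF z] k(4)[OF z]]
   have "pb_comp_from v u z \<cdot>[A] pb_comp_to v u z = iO A (pb w z)"
    by (rule HOM_eqI[OF i(1) Idn_HOM(1)[OF ow[OF z]]]) (simp add: i(2) k(6)[OF z] Idn_HOM(2)[OF ow[OF z]])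
   then show ?thesis using L1(8)[OF k(2)[OF z] k(4)[OF z] r] L1(7)[OF ow[OF z] r] by simp
  qed
  have LI': "mV L (pb_comp_to v u z) (mV L (pb_comp_from v u z) r) = r" if z: "z \<in> OB C" and r: "r \<in> mE L (pb u (pb v z))" for z r
  proof -
   note i = Cmp_HOM[OF k(4)[OF z] k(2)[OF z]] and o = pb_obj_OB[OF u ov[OF z]]
   have "pb_comp_to v u z \<cdot>[A] pb_comp_from v u z = iO A (pb u (pb v z))" by (rule HOM_eqI[OF i(1) Idn_HOM(1)[OF o]]) (simp add: i(2) k(7)[OF z] Idn_HOM(2)[OF o])
   then show ?thesis using L1(8)[OF k(4)[OF z] k(2)[OF z] r] L1(7)[OF o r] by simp
  qed
  let ?r = "mV L (pb_comp_from v u x) l"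
  have r: "?r \<in> mE L (pb w x)" by (rule HOM_D(6)[OF L1(2)[OF k(4)[OF hd(1)]] l(1)])
  show "EX! t'. t' \<in> mE L (pb w x) & vsnd (ap (?c x) t') = s & mV L (uA w h) t' = t"
  proof (rule ex1I[of _ ?r], intro conjI)
   show "vsnd (ap (?c x) ?r) = s" using c(3)[OF hd(1) r] LI'[OF hd(1) l(1)] l(2) m(2) by simp
   have "mV L (pb_comp_to v u y) (mV L (uA w h) ?r) = ?t" using Lk[OF h r] LI'[OF hd(1) l(1)] l(3) by simp
   then show "mV L (uA w h) ?r = t" using LI[OF hd(2) t] LI[OF hd(2) HOM_D(6)[OF L1(2)[OF W(4)[OF h]] r]] by simp
   fix t' assume t': "t' \<in> mE L (pb w x) & vsnd (ap (?c x) t') = s & mV L (uA w h) t' = t"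
   then have t'c: "t' \<in> mE L (pb w x)" by simp
   let ?l = "mV L (pb_comp_to v u x) t'"
   note lc = kL[OF hd(1) t'c]
   have e2: "mV L (uA u (uA v h)) ?l = ?t" using Lk[OF h t'c] t' by simp
   have "vsnd (ap (f (pb v x)) ?l) = m" by (rule mu[OF fv[OF ov[OF hd(1)] lc]]) (use c(3)[OF hd(1) t'c] t' fd(3)[OF V(4)[OF h] lc] e2 in simp_all)
   then have "?l = l" using lu[OF lc] e2 by simp
   then show "t' = ?r" using LI[OF hd(1) t'c] by simp
  qed (rule r)
 next
  fix x z assume x: "x \<in> OB C" and z: "z \<in> car (pb w x)"
  have e: "mV L (pb_comp_to v u x) (ap (eta L (pb w x)) z) = ap (eta L (pb u (pb v x))) (ap (pb_comp_to v u x) z)" by (rule Ld(7)[OF k(2)[OF x] z])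
  have z1: "ap (pb_comp_to v u x) z \<in> car (pb u (pb v x))" by (rule HOM_D(6)[OF k(2)[OF x] z])
  show "vsnd (ap (?c x) (ap (eta L (pb w x)) z)) = ap (eta N x) (vsnd z)"
   using c(3)[OF x HOM_D(6)[OF Ld(6)[OF ow[OF x]] z]] e fd(5)[OF ov[OF x] z1] gd(5)[OF x pb_D(2)[OF u z1]]
    k(3)[OF x z] by simp
 next
  fix x t assume x: "x \<in> OB C" and t: "t \<in> mE L (mO L (pb w x))"
  note Nx = N1(1)[OF x] and vx = ov[OF x]
  let ?t = "mV L (mA L (pb_comp_to v u x)) t"
  have t1: "?t \<in> mE L (mO L (pb u (pb v x)))" by (rule HOM_D(6)[OF L1(2)[OF L1(2)[OF k(2)[OF x]]] t])
  note fvx = fd(2)[OF vx] and gx = gd(2)[OF x]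
  let ?s = "mV L (f (pb v x)) ?t"
  have s: "?s \<in> mE L (pb u (mO M (pb v x)))" by (rule HOM_D(6)[OF L1(2)[OF fvx] t1])
  let ?p = "vsnd (ap (f (mO M (pb v x))) ?s)"
  have p: "?p \<in> mE M (mO M (pb v x))" by (rule fv[OF M1(1)[OF vx] s])
  have "vsnd (ap (?c x) (ap (mu L (pb w x)) t)) = vsnd (ap (g x) (vsnd (ap (f (pb v x)) (ap (mu L (pb u (pb v x))) ?t))))"
   using c(3)[OF x HOM_D(6)[OF Ld(8)[OF ow[OF x]] t]] Ld(9)[OF k(2)[OF x] t] by simp
  also have "... = vsnd (ap (g x) (ap (mu M (pb v x)) ?p))" using fd(6)[OF vx t1] by simp
  also have "... = ap (mu N x) (vsnd (ap (g (mO N x)) (mV M (g x) ?p)))" using gd(6)[OF x p] .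
  \<comment> \<open>Naturality of \<open>f\<close> at the arrow \<open>g x\<close> is what links the
    multiplication law of \<open>g\<close> to that of \<open>f\<close>.\<close>
  also have "mV M (g x) ?p = vsnd (ap (f (pb v (mO N x))) (mV L (uA u (g x)) ?s))" using fd(3)[OF gx s] by simp
  also have "mV L (uA u (g x)) ?s = mV L (pb_comp_to v u (mO N x)) (mV L (?c x) t)"
  proof -
   note h1 = Cmp_HOM(1)[OF L1(2)[OF k(2)[OF x]] fvx]
   show ?thesis using L1(8)[OF c(2)[OF x] k(2)[OF Nx] t] c(4)[OF x] L1(8)[OF h1 U(4)[OF gx] t]
     L1(8)[OF L1(2)[OF k(2)[OF x]] fvx t] by simp
  qed
  also have "vsnd (ap (g (mO N x)) (vsnd (ap (f (pb v (mO N x))) (mV L (pb_comp_to v u (mO N x)) (mV L (?c x) t))))) = vsnd (ap (?c (mO N x)) (mV L (?c x) t))"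
   using c(3)[OF Nx HOM_D(6)[OF L1(2)[OF c(2)[OF x]] t]] by simp
  finally show "vsnd (ap (?c x) (ap (mu L (pb w x)) t)) = ap (mu N x) (vsnd (ap (?c (mO N x)) (mV L (?c x) t)))" .
 qed (use c in auto)
qed

text \<open>On second components both sides apply \<open>f\<close>, then \<open>g\<close>, then
  \<open>h\<close>. They differ in how the pullback along the triple composite is unfolded into
  three pullbacks, and \<open>key\<close> says that the two unfoldings agree.\<close>

lemma mon_comp_assoc: assumes u: "u \<in> Hom SetC (A :: 'v set) B" and v: "v \<in> Hom SetC B C" and w: "w \<in> Hom SetC C D"
  and K: "monad_obj (A, K)" and L: "monad_obj (B, L)" and M: "monad_obj (C, M)" and N: "monad_obj (D, N)"
  and f: "emor u A B K L f" and g: "emor v B C L M g" and h: "emor w C D M N h" shows "mon_comp (w *[SetC] v) (mon_comp w h v g L N) u f K N =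
  mon_comp w h (v *[SetC] u) (mon_comp v g u f K M) K N"
proof -
 have vu: "v *[SetC] u \<in> Hom SetC A C" and wv: "w *[SetC] v \<in> Hom SetC B D" using category.Cmp_Hom[OF category_SetC] u v w by blast+
 have ass: "(w *[SetC] v) *[SetC] u = w *[SetC] (v *[SetC] u)" by (rule category.Cmp_assoc[OF category_SetC u v w])
 note gf = mon_comp_emor[OF u v K L M f g] and hg = mon_comp_emor[OF v w L M N g h]
 note l = mon_comp_simp[OF u wv K L N f hg] and r = mon_comp_simp[OF vu w K M N gf h]
 note gf1 = mon_comp_simp[OF u v K L M f g] and hg1 = mon_comp_simp[OF v w L M N g h]
 note K1 = functor_D[OF monad_D(5)[OF K]]
 note fd = emor_D[OF f]
 show ?thesis
 proof (rule extensionalityI[OF l(1) r(1)])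
  fix x assume x: "x \<in> OB D"
  note wx = pb_obj_OB[OF w x]
  note k1 = pb_comp_iso[OF u wv x, unfolded ass] and k2 = pb_comp_iso[OF vu w x] and k3 = pb_comp_iso[OF u v wx] and k4 = pb_comp_iso[OF v w x]
  note c1 = Cmp_HOM[OF k1(2) pb_functor(4)[OF u k4(2)]] and c2 = Cmp_HOM[OF k2(2) k3(2)]
  have key: "uA u (pb_comp_to w v x) \<cdot>[A] pb_comp_to (w *[SetC] v) u x = pb_comp_to v u (pb w x) \<cdot>[A] pb_comp_to w (v *[SetC] u) x"
  proof (rule HOM_eqI[OF c1(1) c2(1)])
   fix z assume z: "z \<in> car (pb (w *[SetC] v *[SetC] u) x)"
   note z1 = HOM_D(6)[OF k1(2) z] and z2 = HOM_D(6)[OF k2(2) z]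
   have a: "vfst z \<in> A" using pb_D(1)[OF k2(1) z] .
   show "ap (uA u (pb_comp_to w v x) \<cdot>[A] pb_comp_to (w *[SetC] v) u x) z = ap (pb_comp_to v u (pb w x) \<cdot>[A] pb_comp_to w (v *[SetC] u) x) z"
    using c1(2)[OF z] c2(2)[OF z] pb_functor(3)[OF u k4(2) z1] k4(3)[OF pb_D(2)[OF u z1]] k3(3)[OF z2]
     k1(3)[OF z] k2(3)[OF z] fn_map_Cmp_SetC[OF u v a] by simp
  qed
  show "mon_comp (w *[SetC] v) (mon_comp w h v g L N) u f K N x = mon_comp w h (v *[SetC] u) (mon_comp v g u f K M) K N x"
  proof (rule HOM_pb_eqI[OF k2(1) l(2)[OF x, unfolded ass] r(2)[OF x]])
   fix t assume t: "t \<in> mE K (pb (w *[SetC] v *[SetC] u) x)"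
   let ?t1 = "mV K (pb_comp_to (w *[SetC] v) u x) t"
   let ?t2 = "mV K (pb_comp_to w (v *[SetC] u) x) t"
   have t1: "?t1 \<in> mE K (pb u (pb (w *[SetC] v) x))" by (rule HOM_D(6)[OF K1(2)[OF k1(2)] t])
   have t2: "?t2 \<in> mE K (pb (v *[SetC] u) (pb w x))" by (rule HOM_D(6)[OF K1(2)[OF k2(2)] t])
   let ?s = "vsnd (ap (f (pb (w *[SetC] v) x)) ?t1)"
   have s: "?s \<in> mE L (pb (w *[SetC] v) x)" by (rule pb_D(2)[OF u HOM_D(6)[OF fd(2)[OF pb_obj_OB[OF wv x]] t1]])
   have "mV L (pb_comp_to w v x) ?s = vsnd (ap (f (pb v (pb w x))) (mV K (uA u (pb_comp_to w v x)) ?t1))" using fd(3)[OF k4(2) t1] by simp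
   also have "mV K (uA u (pb_comp_to w v x)) ?t1 = mV K (pb_comp_to v u (pb w x)) ?t2"
    using K1(8)[OF k1(2) pb_functor(4)[OF u k4(2)] t] K1(8)[OF k2(2) k3(2) t] key by simp
   finally have e: "mV L (pb_comp_to w v x) ?s = vsnd (ap (f (pb v (pb w x))) (mV K (pb_comp_to v u (pb w x)) ?t2))" .
   show "vsnd (ap (mon_comp (w *[SetC] v) (mon_comp w h v g L N) u f K N x) t) = vsnd (ap (mon_comp w h (v *[SetC] u) (mon_comp v g u f K M) K N x) t)"
    using l(3)[OF x t[folded ass]] r(3)[OF x t] hg1(3)[OF x s] gf1(3)[OF wx t2] e by simp
  qed
 qed
qed

text \<open>Pulling back along an identity is only isomorphic to doing nothing, so a transformation
  between monads on one slice has to be conjugated with the canonical isomorphisms before it is a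
  morphism over the identity in \<open>MonC\<close>.\<close>

definition vert :: "'v set => ('v fn, 'v sarr) mnd => ('v fn, 'v sarr) mnd => ('v fn => 'v sarr) => 'v fn => 'v sarr" where
 "vert A T T' th = (\<lambda>x\<in>OB A. pb_id_to (mO T' x) \<cdot>[A] th x \<cdot>[A] mA T (pb_id_from x))"

text \<open>Isomorphism of monads on a fixed slice, on elements. Cartesianness comes for free: a
  naturality square with two bijective opposite sides is a pullback.\<close>

definition viso :: "'v set => ('v fn, 'v sarr) mnd => ('v fn, 'v sarr) mnd => ('v fn => 'v sarr) => bool" where "viso A T T' th <->
  (ALL x:OB A. th x \<in> HOM A (mO T x) (mO T' x)) & (ALL x:OB A. bij_betw (ap (th x)) (mE T x) (mE T' x)) & (ALL x y k t. k \<in> HOM A x y --> t \<in> mE T x -->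
   ap (th y) (mV T k t) = mV T' k (ap (th x) t)) & (ALL x:OB A. ALL z:car x. ap (th x) (ap (eta T x) z) = ap (eta T' x) z) &
  (ALL x:OB A. ALL w:mE T (mO T x). ap (th x) (ap (mu T x) w) = ap (mu T' x) (ap (th (mO T' x)) (mV T (th x) w)))"

lemmas viso_D = iffD1[OF viso_def, THEN conjunct1, rule_format]
 iffD1[OF viso_def, THEN conjunct2, THEN conjunct1, rule_format]
 iffD1[OF viso_def, THEN conjunct2, THEN conjunct2, THEN conjunct1, rule_format]
 iffD1[OF viso_def, THEN conjunct2, THEN conjunct2, THEN conjunct2, THEN conjunct1, rule_format]
 iffD1[OF viso_def, THEN conjunct2, THEN conjunct2, THEN conjunct2, THEN conjunct2, rule_format]

lemma pb_id_iso: assumes x: "x \<in> OB (A :: 'v set)" shows "Idn SetC A \<in> Hom SetC A A" "pb_id_to x \<in> HOM A x (pb (Idn SetC A) x)"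
  "!!z. z \<in> car x ==> ap (pb_id_to x) z = vpair (fn x z, z)" "pb_id_from x \<in> HOM A (pb (Idn SetC A) x) x"
  "!!z. z \<in> car (pb (Idn SetC A) x) ==> ap (pb_id_from x) z = vsnd z" "!!z. z \<in> car x ==> ap (pb_id_from x) (ap (pb_id_to x) z) = z"
  "!!z. z \<in> car (pb (Idn SetC A) x) ==> ap (pb_id_to x) (ap (pb_id_from x) z) = z"
proof -
 note xd = OB_D[OF x]
 show i: "Idn SetC A \<in> Hom SetC A A" using category.Idn_Hom[OF category_SetC] xd(3) by (simp add: Obj_SetC)
 have sx: "snd (snd x) = A" using xd(1) by (metis snd_conv)
 have im: "fn (Idn SetC A) a = a" if "a \<in> A" for a using that by (simp add: Idn_SetC)
 have 1: "vpair (fn x z, z) \<in> car (pb (Idn SetC A) x)" if "z \<in> car x" for z using that xd(5)[OF that] by (simp add: vpair_car_pb[OF i] im)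
 have 2: "vfst z = fn x (vsnd z)" if z: "z \<in> car (pb (Idn SetC A) x)" for z using pb_D[OF i z] im by simp
 show t: "!!z. z \<in> car x ==> ap (pb_id_to x) z = vpair (fn x z, z)" and f: "!!z. z \<in> car (pb (Idn SetC A) x) ==> ap (pb_id_from x) z = vsnd z"
  unfolding pb_id_to_def pb_id_from_def by (simp_all add: sx)
 show "pb_id_to x \<in> HOM A x (pb (Idn SetC A) x)" unfolding pb_id_to_def Tgt_SetC sx by (rule slice_map_HOM[OF x pb_obj_OB[OF i x]]) (simp add: 1 ty_pb)
 show "pb_id_from x \<in> HOM A (pb (Idn SetC A) x) x" unfolding pb_id_from_def Tgt_SetC sx by (rule slice_map_HOM[OF pb_obj_OB[OF i x] x]) (simp add: 2 ty_pb pb_D[OF i])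
 show "!!z. z \<in> car x ==> ap (pb_id_from x) (ap (pb_id_to x) z) = z" by (simp add: t f 1)
 show "ap (pb_id_to x) (ap (pb_id_from x) z) = z" if z: "z \<in> car (pb (Idn SetC A) x)" for z using pb_D(4)[OF i z] 2[OF z] by (simp add: t f z pb_D(2)[OF i z])
qed

lemma vert_simp: assumes T: "monad_obj (A :: 'v set, T)" and T': "monad_obj (A, T')" and v: "viso A T T' th" and x: "x \<in> OB A"
 shows "vert A T T' th x \<in> HOM A (mO T (pb (Idn SetC A) x)) (pb (Idn SetC A) (mO T' x))" "!!t. t \<in> mE T (pb (Idn SetC A) x) ==>
   vsnd (ap (vert A T T' th x) t) = ap (th x) (mV T (pb_id_from x) t)" "pb_id_from (mO T' x) \<cdot>[A] vert A T T' th x = th x \<cdot>[A] mA T (pb_id_from x)"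
  "bij_betw (%t. vsnd (ap (vert A T T' th x) t)) (mE T (pb (Idn SetC A) x)) (mE T' x)"
proof -
 note T1 = functor_D[OF monad_D(5)[OF T]] and T1' = functor_D[OF monad_D(5)[OF T']]
 note tx = T1'(1)[OF x] note i = pb_id_iso[OF x] and i' = pb_id_iso[OF tx] and vd = viso_D[OF v]
 note o = pb_obj_OB[OF i(1) x]
 note 1 = Cmp_HOM[OF T1(2)[OF i(4)] vd(1)[OF x]] note 2 = Cmp_HOM[OF 1(1) i'(2)]
 have e: "vert A T T' th x = pb_id_to (mO T' x) \<cdot>[A] th x \<cdot>[A] mA T (pb_id_from x)" unfolding vert_def using x by simp
 show h: "vert A T T' th x \<in> HOM A (mO T (pb (Idn SetC A) x)) (pb (Idn SetC A) (mO T' x))" unfolding e by (rule 2(1))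
 show s: "vsnd (ap (vert A T T' th x) t) = ap (th x) (mV T (pb_id_from x) t)" if t: "t \<in> mE T (pb (Idn SetC A) x)" for t
  unfolding e using 2(2)[OF t] 1(2)[OF t] i'(3)[OF HOM_D(6)[OF 1(1) t]] by simp
 note 3 = Cmp_HOM[OF h i'(4)]
 show "pb_id_from (mO T' x) \<cdot>[A] vert A T T' th x = th x \<cdot>[A] mA T (pb_id_from x)"
  by (rule HOM_eqI[OF 3(1) 1(1)]) (simp add: 3(2), simp add: e 2(2) i'(6) HOM_D(6)[OF 1(1)])
 have c1: "pb_id_from x \<cdot>[A] pb_id_to x = iO A x" by (rule HOM_eqI[OF Cmp_HOM(1)[OF i(2) i(4)] Idn_HOM(1)[OF x]])
   (simp add: Cmp_HOM(2)[OF i(2) i(4)] i(6) Idn_HOM(2)[OF x])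
 have c2: "pb_id_to x \<cdot>[A] pb_id_from x = iO A (pb (Idn SetC A) x)" by (rule HOM_eqI[OF Cmp_HOM(1)[OF i(4) i(2)] Idn_HOM(1)[OF o]])
   (simp add: Cmp_HOM(2)[OF i(4) i(2)] i(7) Idn_HOM(2)[OF o])
 have "bij_betw (mV T (pb_id_from x)) (mE T (pb (Idn SetC A) x)) (mE T x)" by (rule bij_betw_byWitness[where f' = "mV T (pb_id_to x)"])
   (use T1(8)[OF i(2) i(4)] T1(8)[OF i(4) i(2)] c1 c2 T1(7)[OF x] T1(7)[OF o] HOM_D(6)[OF T1(2)[OF i(2)]]
    HOM_D(6)[OF T1(2)[OF i(4)]] in auto)
 from bij_betw_trans[OF this vd(2)[OF x]]
 show "bij_betw (%t. vsnd (ap (vert A T T' th x) t)) (mE T (pb (Idn SetC A) x)) (mE T' x)" by (rule bij_betw_cong[THEN iffD1, rotated]) (simp add: s)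
qed

lemma vert_emor: assumes T: "monad_obj (A :: 'v set, T)" and T': "monad_obj (A, T')" and v: "viso A T T' th" shows "emor (Idn SetC A) A A T T' (vert A T T' th)"
proof -
 note T1 = functor_D[OF monad_D(5)[OF T]] and T1' = functor_D[OF monad_D(5)[OF T']]
 note vs = vert_simp[OF T T' v] and vd = viso_D[OF v] and Td = monad_D[OF T] and T'd = monad_D[OF T']
 let ?f = "vert A T T' th" and ?I = "Idn SetC A"
 have nat: "vsnd (ap (?f y) (mV T (amap (pb_functor ?I) k) t)) = mV T' k (vsnd (ap (?f x) t))" if k: "k \<in> HOM A x y" and t: "t \<in> mE T (pb ?I x)" for k x y t
 proof -
  note kd = HOM_D[OF k] note i = pb_id_iso[OF kd(1)] and i' = pb_id_iso[OF kd(2)] note U = pb_functor[OF i(1)]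
  note 1 = Cmp_HOM[OF U(4)[OF k] i'(4)] and 2 = Cmp_HOM[OF i(4) k]
  have e: "pb_id_from y \<cdot>[A] amap (pb_functor ?I) k = k \<cdot>[A] pb_id_from x"
  proof (rule HOM_eqI[OF 1(1) 2(1)])
   fix z assume z: "z \<in> car (pb ?I x)"
   show "ap (pb_id_from y \<cdot>[A] amap (pb_functor ?I) k) z = ap (k \<cdot>[A] pb_id_from x) z"
    using 1(2)[OF z] 2(2)[OF z] i(5)[OF z] U(3)[OF k z] i'(5)[OF HOM_D(6)[OF U(4)[OF k] z]] by simp
  qed
  show ?thesis using vs(2)[OF kd(2) HOM_D(6)[OF T1(2)[OF U(4)[OF k]] t]] vs(2)[OF kd(1) t] e
    T1(8)[OF U(4)[OF k] i'(4) t] T1(8)[OF i(4) k t] vd(3)[OF k HOM_D(6)[OF T1(2)[OF i(4)] t]] by simp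
 qed
 show ?thesis unfolding emor_def
 proof (intro conjI ballI allI impI)
  show "?f \<in> extensional (OB A)" unfolding vert_def by simp
  show "?f x \<in> HOM A (mO T (pb ?I x)) (pb ?I (mO T' x))" if "x \<in> OB A" for x by (rule vs(1)[OF that])
 next
  fix x y k s t assume k: "k \<in> HOM A x y" and s: "s \<in> mE T' x" and t: "t \<in> mE T (pb ?I y)" and e: "mV T' k s = vsnd (ap (?f y) t)"
  note kd = HOM_D[OF k] note U = pb_functor[OF pb_id_iso(1)[OF kd(1)]]
  note bx = vs(4)[OF kd(1)] and b_y = vs(4)[OF kd(2)]
  \<comment> \<open>Bijectivity at \<open>x\<close> provides the lift, and injectivity at
    \<open>y\<close> shows that it lies over \<open>t\<close>.\<close>
  obtain r where r: "r \<in> mE T (pb ?I x)" "vsnd (ap (?f x) r) = s"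
  proof -
   have "s \<in> (%t. vsnd (ap (?f x) t)) ` mE T (pb ?I x)" using bij_betw_imp_surj_on[OF bx] s by simp
   then show ?thesis using that by (elim imageE) simp
  qed
  have "vsnd (ap (?f y) (mV T (amap (pb_functor ?I) k) r)) = vsnd (ap (?f y) t)" using nat[OF k r(1)] r(2) e by simp
  then have "mV T (amap (pb_functor ?I) k) r = t" by (rule inj_onD[OF bij_betw_imp_inj_on[OF b_y]]) (rule HOM_D(6)[OF T1(2)[OF U(4)[OF k]] r(1)], rule t)
  then show "EX! t'. t' \<in> mE T (pb ?I x) & vsnd (ap (?f x) t') = s & mV T (amap (pb_functor ?I) k) t' = t"
  proof (intro ex1I[of _ r] conjI)
   fix t' assume t': "t' \<in> mE T (pb ?I x) & vsnd (ap (?f x) t') = s & mV T (amap (pb_functor ?I) k) t' = t"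
   then have "vsnd (ap (?f x) t') = vsnd (ap (?f x) r)" using r(2) by simp
   then show "t' = r" by (rule inj_onD[OF bij_betw_imp_inj_on[OF bx] _ conjunct1[OF t'] r(1)])
  qed (use r in auto)
 next
  fix x z assume x: "x \<in> OB A" and z: "z \<in> car (pb ?I x)"
  note i = pb_id_iso[OF x] note o = pb_obj_OB[OF i(1) x]
  show "vsnd (ap (?f x) (ap (eta T (pb ?I x)) z)) = ap (eta T' x) (vsnd z)"
   using vs(2)[OF x HOM_D(6)[OF Td(6)[OF o] z]] Td(7)[OF i(4) z] i(5)[OF z] vd(4)[OF x HOM_D(6)[OF i(4) z]] by simp
 next
  fix x w assume x: "x \<in> OB A" and w: "w \<in> mE T (mO T (pb ?I x))"
  note i = pb_id_iso[OF x] note o = pb_obj_OB[OF i(1) x] note tx = T1'(1)[OF x] note i' = pb_id_iso[OF tx]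
  have "vsnd (ap (?f x) (ap (mu T (pb ?I x)) w)) = ap (th x) (ap (mu T x) (mV T (mA T (pb_id_from x)) w))"
   using vs(2)[OF x HOM_D(6)[OF Td(8)[OF o] w]] Td(9)[OF i(4) w] by simp
  also have "... = ap (mu T' x) (ap (th (mO T' x)) (mV T (th x) (mV T (mA T (pb_id_from x)) w)))" using vd(5)[OF x HOM_D(6)[OF T1(2)[OF T1(2)[OF i(4)]] w]] .
  also have "mV T (th x) (mV T (mA T (pb_id_from x)) w) = mV T (pb_id_from (mO T' x)) (mV T (?f x) w)"
   using T1(8)[OF T1(2)[OF i(4)] vd(1)[OF x] w] T1(8)[OF vs(1)[OF x] i'(4) w] vs(3)[OF x] by simp
  also have "ap (th (mO T' x)) (mV T (pb_id_from (mO T' x)) (mV T (?f x) w)) = vsnd (ap (?f (mO T' x)) (mV T (?f x) w))"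
   using vs(2)[OF tx HOM_D(6)[OF T1(2)[OF vs(1)[OF x]] w]] by simp
  finally show "vsnd (ap (?f x) (ap (mu T (pb ?I x)) w)) = ap (mu T' x) (vsnd (ap (?f (mO T' x)) (mV T (?f x) w)))" .
 qed (rule nat)
qed

text \<open>The identity of \<open>MonC\<close> is exhibited as the \<open>vert\<close> of an
  identity transformation, so that its laws are instances of \<open>vert_emor\<close>.\<close>

lemma viso_id: assumes T: "monad_obj (A :: 'v set, T)" shows "viso A T T (%x. iO A (mO T x))" "mon_id (A, T) = vert A T T (%x. iO A (mO T x))"
proof -
 note T1 = functor_D[OF monad_D(5)[OF T]] and Td = monad_D[OF T]
 note i = Idn_HOM[OF T1(1)]
 show "viso A T T (%x. iO A (mO T x))" unfolding viso_def
 proof (intro conjI ballI allI impI)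
  fix x assume x: "x \<in> OB A"
  show "iO A (mO T x) \<in> HOM A (mO T x) (mO T x)" by (rule i(1)[OF x])
  show "bij_betw (ap (iO A (mO T x))) (mE T x) (mE T x)" by (rule bij_betw_byWitness[where f' = "%t. t"]) (use i(2)[OF x] in auto)
  fix z assume "z \<in> car x"
  then show "ap (iO A (mO T x)) (ap (eta T x) z) = ap (eta T x) z" using i(2)[OF x] HOM_D(6)[OF Td(6)[OF x]] by simp
 next
  fix x y k t assume k: "k \<in> HOM A x y" and t: "t \<in> mE T x"
  then show "ap (iO A (mO T y)) (mV T k t) = mV T k (ap (iO A (mO T x)) t)" using i(2)[OF HOM_D(1)[OF k] t] i(2)[OF HOM_D(2)[OF k] HOM_D(6)[OF T1(2)[OF k] t]] by simp
 next
  fix x w assume x: "x \<in> OB A" and w: "w \<in> mE T (mO T x)"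
  show "ap (iO A (mO T x)) (ap (mu T x) w) = ap (mu T x) (ap (iO A (mO T (mO T x))) (mV T (iO A (mO T x)) w))"
   using T1(7)[OF T1(1)[OF x] w] i(2)[OF T1(1)[OF x] w] i(2)[OF x HOM_D(6)[OF Td(8)[OF x] w]] by simp
 qed
 have "iO A (mO T x) \<cdot>[A] mA T (pb_id_from x) = mA T (pb_id_from x)"
  if "x \<in> OB A" for x using category.Idn_Cmp[OF category_SetOver T1(2)[OF pb_id_iso(4)[OF that]]] .
 then show "mon_id (A, T) = vert A T T (%x. iO A (mO T x))" unfolding mon_id_def vert_def by (auto simp: fun_eq_iff)
qed

lemma mon_id_emor: assumes T: "monad_obj (A :: 'v set, T)" shows "emor (Idn SetC A) A A T T (mon_id (A, T))" "!!x t. x \<in> OB A ==> t \<in> mE T (pb (Idn SetC A) x) ==>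
   vsnd (ap (mon_id (A, T) x) t) = mV T (pb_id_from x) t"
proof -
 note v = viso_id[OF T]
 show "emor (Idn SetC A) A A T T (mon_id (A, T))" using vert_emor[OF T T v(1)] v(2) by simp
 fix x t assume x: "x \<in> OB A" and t: "t \<in> mE T (pb (Idn SetC A) x)"
 show "vsnd (ap (mon_id (A, T) x) t) = mV T (pb_id_from x) t" using vert_simp(2)[OF T T v(1) x t] v(2) Idn_HOM(2)[OF functor_D(1)[OF monad_D(5)[OF T] x]
   HOM_D(6)[OF functor_D(2)[OF monad_D(5)[OF T] pb_id_iso(4)[OF x]] t]] by simp
qed

section \<open>The category laws for monads\<close>

lemma MonC_simps: "Obj MonC = {X :: 'v mobj. monad_obj X}" "Src MonC F = fst (F :: 'v marr)" "Tgt MonC F = snd (snd (snd F))"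
 "Idn MonC X = ((X :: 'v mobj), Idn SetC (fst X), mon_id X, X)" "Cmp MonC ((Y' :: 'v mobj), v, g, Z) (X, u, f, Y) = (X, v *[SetC] u, mon_comp v g u f (snd X) (snd Z), Z)"
 unfolding MonC_def by (auto split: prod.splits)

lemma Hom_MonC: "F \<in> Hom MonC (X :: 'v mobj) Y <-> monad_obj X & monad_obj Y &
  (EX u f. F = (X, u, f, Y) & u \<in> Hom SetC (fst X) (fst Y) & emor u (fst X) (fst Y) (snd X) (snd Y) f)" (is "?l <-> ?r")
proof -
 have "?l <-> monad_obj X & monad_obj Y & (EX u f. F = (X, u, f, Y) & u \<in> Hom SetC (fst X) (fst Y) & cartesian_monad_mor u (snd X) (snd Y) f)"
  by (cases X; cases Y; cases F) (auto simp: Hom_def[of MonC], auto simp: MonC_def)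
 also have "... <-> ?r" using mor_iff[of _ "fst X" "fst Y" "snd X" "snd Y"] by auto
 finally show ?thesis .
qed

lemma category_MonC: "category MO"
proof
 fix F assume "F \<in> Arr MO"
 then show "Src MonC F \<in> Obj MonC" "Tgt MonC F \<in> Obj MonC" by (auto simp: MonC_def)
next
 fix X assume "X \<in> Obj MO"
 then have X: "monad_obj X" by (simp add: MonC_simps)
 then have X': "monad_obj (fst X, snd X)" by simp
 have "Idn SetC (fst X) \<in> Hom SetC (fst X) (fst X)" using category.Idn_Hom[OF category_SetC] monad_D(1)[OF X'] by (simp add: Obj_SetC)
 then show "Idn MonC X \<in> Hom MonC X X" using mon_id_emor(1)[OF X'] X by (simp add: Hom_MonC MonC_simps)
next
 fix F X Y G Z assume F: "F \<in> Hom MO X Y" and G: "G \<in> Hom MonC Y Z"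
 obtain u f where f: "F = (X, u, f, Y)" "u \<in> Hom SetC (fst X) (fst Y)" "emor u (fst X) (fst Y) (snd X) (snd Y) f" using F by (auto simp: Hom_MonC)
 obtain v g where g: "G = (Y, v, g, Z)" "v \<in> Hom SetC (fst Y) (fst Z)" "emor v (fst Y) (fst Z) (snd Y) (snd Z) g" using G by (auto simp: Hom_MonC)
 have m: "monad_obj (fst X, snd X)" "monad_obj (fst Y, snd Y)" "monad_obj (fst Z, snd Z)" using F G by (auto simp: Hom_MonC)
 show "G *[MonC] F \<in> Hom MonC X Z" using mon_comp_emor[OF f(2) g(2) m f(3) g(3)] m category.Cmp_Hom[OF category_SetC f(2) g(2)]
  by (simp add: f(1) g(1) MonC_simps Hom_MonC)
next
 fix F X Y assume F: "F \<in> Hom MO X Y"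
 obtain u f where f: "F = (X, u, f, Y)" "u \<in> Hom SetC (fst X) (fst Y)" "emor u (fst X) (fst Y) (snd X) (snd Y) f" using F by (auto simp: Hom_MonC)
 have m: "monad_obj (fst X, snd X)" "monad_obj (fst Y, snd Y)" using F by (auto simp: Hom_MonC)
 note L1 = functor_D[OF monad_D(5)[OF m(1)]] and M1 = functor_D[OF monad_D(5)[OF m(2)]]
 have iX: "Idn SetC (fst X) \<in> Hom SetC (fst X) (fst X)" and iY: "Idn SetC (fst Y) \<in> Hom SetC (fst Y) (fst Y)"
  using category.Idn_Hom[OF category_SetC] monad_D(1)[OF m(1)] monad_D(1)[OF m(2)] by (simp_all add: Obj_SetC)
 have uX: "u *[SetC] Idn SetC (fst X) = u" and uY: "Idn SetC (fst Y) *[SetC] u = u"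
  using category.Cmp_Idn[OF category_SetC f(2)] category.Idn_Cmp[OF category_SetC f(2)] by auto
 note eX = mon_id_emor[OF m(1)] and eY = mon_id_emor[OF m(2)] and fd = emor_D[OF f(3)]
 note cX = mon_comp_simp[OF iX f(2) m(1) m(1) m(2) eX(1) f(3), unfolded uX]
 note cY = mon_comp_simp[OF f(2) iY m(1) m(2) m(2) f(3) eY(1), unfolded uY]
 have "mon_comp u f (Idn SetC (fst X)) (mon_id X) (snd X) (snd Y) = f"
 proof (rule extensionalityI[OF cX(1)[simplified] fd(1)])
  fix x assume x: "x \<in> OB (fst Y)"
  note o = pb_obj_OB[OF f(2) x] note i = pb_id_iso[OF o] note k = pb_comp_iso[OF iX f(2) x, unfolded uX]
  \<comment> \<open>The canonical isomorphism for the identity cancels the one for composing with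
    it; the other unit law below rests on the mirror image of this cancellation.\<close>
  have e: "pb_id_from (pb u x) \<cdot>[(fst X)] pb_comp_to u (Idn SetC (fst X)) x = iO (fst X) (pb u x)" by (rule HOM_eqI[OF Cmp_HOM(1)[OF k(2) i(4)] Idn_HOM(1)[OF o]])
    (use Cmp_HOM(2)[OF k(2) i(4)] Idn_HOM(2)[OF o] k(3) i(5)[OF HOM_D(6)[OF k(2)]] pb_D[OF f(2)] in "simp add: Idn_SetC")
  show "mon_comp u f (Idn SetC (fst X)) (mon_id X) (snd X) (snd Y) x = f x"
  proof (rule HOM_pb_eqI[OF f(2) cX(2)[OF x, simplified] fd(2)[OF x]])
   fix t assume t: "t \<in> mE (snd X) (pb u x)"
   show "vsnd (ap (mon_comp u f (Idn SetC (fst X)) (mon_id X) (snd X) (snd Y) x) t) = vsnd (ap (f x) t)"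
    using cX(3)[OF x t] eX(2)[OF o HOM_D(6)[OF L1(2)[OF k(2)] t]] L1(8)[OF k(2) i(4) t] e L1(7)[OF o t] by simp
  qed
 qed
 then show "F *[MonC] Idn MonC X = F" by (simp add: f(1) MonC_simps uX)
 have "mon_comp (Idn SetC (fst Y)) (mon_id Y) u f (snd X) (snd Y) = f"
 proof (rule extensionalityI[OF cY(1)[simplified] fd(1)])
  fix x assume x: "x \<in> OB (fst Y)"
  note i = pb_id_iso[OF x] note o = pb_obj_OB[OF f(2) x] and o' = pb_obj_OB[OF iY x]
  note k = pb_comp_iso[OF f(2) iY x, unfolded uY] and U = pb_functor[OF f(2)]
  have e: "uA u (pb_id_from x) \<cdot>[(fst X)] pb_comp_to (Idn SetC (fst Y)) u x = iO (fst X) (pb u x)"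
   by (rule HOM_eqI[OF Cmp_HOM(1)[OF k(2) U(4)[OF i(4)]] Idn_HOM(1)[OF o]]) (use Cmp_HOM(2)[OF k(2) U(4)[OF i(4)]] Idn_HOM(2)[OF o] k(3) U(3)[OF i(4) HOM_D(6)[OF k(2)]]
     i(5)[OF pb_D(2)[OF f(2) HOM_D(6)[OF k(2)]]] pb_D(4)[OF f(2)] in simp)
  show "mon_comp (Idn SetC (fst Y)) (mon_id Y) u f (snd X) (snd Y) x = f x"
  proof (rule HOM_pb_eqI[OF f(2) cY(2)[OF x, simplified] fd(2)[OF x]])
   fix t assume t: "t \<in> mE (snd X) (pb u x)"
   let ?t = "mV (snd X) (pb_comp_to (Idn SetC (fst Y)) u x) t"
   have t1: "?t \<in> mE (snd X) (pb u (pb (Idn SetC (fst Y)) x))" by (rule HOM_D(6)[OF L1(2)[OF k(2)] t])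
   have t2: "vsnd (ap (f (pb (Idn SetC (fst Y)) x)) ?t) \<in> mE (snd Y) (pb (Idn SetC (fst Y)) x)" by (rule pb_D(2)[OF f(2) HOM_D(6)[OF fd(2)[OF o'] t1]])
   show "vsnd (ap (mon_comp (Idn SetC (fst Y)) (mon_id Y) u f (snd X) (snd Y) x) t) = vsnd (ap (f x) t)"
    using cY(3)[OF x t] eY(2)[OF x t2] fd(3)[OF i(4) t1] L1(8)[OF k(2) U(4)[OF i(4)] t] e L1(7)[OF o t] by simp
  qed
 qed
 then show "Idn MonC Y *[MonC] F = F" by (simp add: f(1) MonC_simps uY)
next
 fix W X Y Z F G H
 assume F: "F \<in> Hom MO W X" and G: "G \<in> Hom MonC X Y" and H: "H \<in> Hom MonC Y Z"
 obtain u f where f: "F = (W, u, f, X)" "u \<in> Hom SetC (fst W) (fst X)" "emor u (fst W) (fst X) (snd W) (snd X) f" using F by (auto simp: Hom_MonC)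
 obtain v g where g: "G = (X, v, g, Y)" "v \<in> Hom SetC (fst X) (fst Y)" "emor v (fst X) (fst Y) (snd X) (snd Y) g" using G by (auto simp: Hom_MonC)
 obtain w h where h: "H = (Y, w, h, Z)" "w \<in> Hom SetC (fst Y) (fst Z)" "emor w (fst Y) (fst Z) (snd Y) (snd Z) h" using H by (auto simp: Hom_MonC)
 have m: "monad_obj (fst W, snd W)" "monad_obj (fst X, snd X)" "monad_obj (fst Y, snd Y)" "monad_obj (fst Z, snd Z)" using F G H by (auto simp: Hom_MonC)
 show "(H *[MonC] G) *[MonC] F = H *[MonC] G *[MonC] F" using mon_comp_assoc[OF f(2) g(2) h(2) m f(3) g(3) h(3)] category.Cmp_assoc[OF category_SetC f(2) g(2) h(2)]
  by (simp add: f(1) g(1) h(1) MonC_simps)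
qed

end

section \<open>Signatures acting on labelled operations\<close>

declare upt_Suc [simp del]

definition bdl :: "('a, 'o) sig => 'a => 'o list" where "bdl A a = map (bd A a) [1..<Suc (ar A a)]"

lemma length_bdl [simp]: "length (bdl A a) = ar A a" by (simp add: bdl_def)

lemma nth_bdl [simp]: "i < ar A a ==> bdl A a ! i = bd A a (Suc i)" by (simp add: bdl_def)

text \<open>Labellings without typing. Permuting labels and flattening make sense here for labels of
  any type, so most computations are carried out at this level and typing is added
  separately.\<close>

definition pelu :: "('a, 'o) sig => ('a * 'x list) set" where "pelu A = {(a, xs). a \<in> ops A & length xs = ar A a}"

text \<open>A pair \<open>(a, xs)\<close> is the operation \<open>a\<close> with its inputs labelled by \<open>xs\<close>.\<close>

definition pel :: "('a, 'o) sig => 'x set => ('x => 'o) => ('a * 'x list) set" where "pel A X t = {(a, xs). a \<in> ops A & set xs <= X & map t xs = bdl A a}"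

abbreviation "pE A x \<equiv> pel A (car x) (fn x)"

text \<open>Input \<open>j\<close> of the image operation receives the label of input
  \<open>perm ph a j\<close>. Inputs count from 1 and list positions from 0, hence the shift. With
  the order in which signature morphisms compose their permutations, this is a covariant action
  (\<open>premor_comp\<close>).\<close>

definition act :: "('a, 'b, 'o, 'q) sigmor => 'a * 'x list => 'b * 'x list" where
 "act ph = (%(a, xs). (fop ph a, map (%j. xs ! (perm ph a j - 1)) [1..<Suc (length xs)]))"

definition pmap :: "('x => 'y) => 'a * 'x list => 'a * 'y list" where "pmap h = (%(a, xs). (a, map h xs))"

text \<open>Identifies the elements of a composite of two polynomial functors with those of the
  polynomial functor of the tensor product; \<open>unflat\<close> is the inverse.\<close>

definition flat :: "'a * ('b * 'x list) list => ('a * 'b list) * 'x list" where "flat = (%(a, ys). ((a, map fst ys), concat (map snd ys)))"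

definition unflat :: "('b, 'o) sig => ('a * 'b list) * 'x list => 'a * ('b * 'x list) list" where "unflat B = (%((a, bs), zs). (a, zip bs (chunks (map (ar B) bs) zs)))"

definition mul :: "('a * 'b list, 'c, 'o, 'q) sigmor => 'a * ('b * 'x list) list => 'c * 'x list" where "mul m w = act m (flat w)"

abbreviation root :: "('a, 'o) sig => 'a * 'x list => 'o" where "root A v \<equiv> bd A (fst v) 0"

abbreviation "pel2 A \<equiv> pel A (pelu A) (root A)"

lemma pel_length: "(a, xs) \<in> pel A X t ==> length xs = ar A a" unfolding pel_def by (auto dest: arg_cong[where f = length])

lemma pel_pelu: "w \<in> pel A X t ==> w \<in> pelu A" using pel_length[of "fst w" "snd w" A X t] unfolding pelu_def by (auto simp: pel_def)

lemma pel_mono: "w \<in> pel A X t ==> X <= Y ==> w \<in> pel A Y t" unfolding pel_def by auto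

lemma pmap_pel: assumes "w \<in> pel A X t" "!!x. x \<in> X ==> h x \<in> Y & s (h x) = t x" shows "pmap h w \<in> pel A Y s"
proof -
 obtain a xs where w: "w = (a, xs)" by (cases w)
 have "map (s o h) xs = map t xs" by (rule map_cong[OF refl]) (use assms in "auto simp: w pel_def")
 then have "map s (map h xs) = map t xs" by (simp only: map_map)
 then show ?thesis using assms unfolding w pel_def pmap_def prod.case mem_Collect_eq by (simp only:) auto
qed

lemma fst_pmap [simp]: "fst (pmap h w) = fst w" and snd_pmap [simp]: "snd (pmap h w) = map h (snd w)" unfolding pmap_def by (auto split: prod.splits)

lemma pmap_comp: "pmap g (pmap h w) = pmap (g o h) w" unfolding pmap_def by (auto split: prod.splits)

lemma pmap_cong: "(!!x. x \<in> set (snd w) ==> g x = h x) ==> pmap g w = pmap h w" unfolding pmap_def by (auto split: prod.splits)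

lemma pmap_ident: "(!!x. x \<in> set (snd w) ==> h x = x) ==> pmap h w = w" unfolding pmap_def by (auto split: prod.splits simp: map_idI)

lemma pel_D: assumes "w \<in> pel A X t" shows "fst w \<in> ops A" "set (snd w) <= X" "map t (snd w) = bdl A (fst w)" "length (snd w) = ar A (fst w)"
 using assms pel_length[of "fst w" "snd w" A X t] unfolding pel_def by auto

lemma pelu_D: assumes "w \<in> pelu A" shows "fst w \<in> ops A" "length (snd w) = ar A (fst w)" using assms unfolding pelu_def by auto

text \<open>The part of being a morphism that concerns permutations only; it is all one needs to let \<open>ph\<close> act.\<close>

definition premor :: "('a, 'o) sig => ('a, 'b, 'o, 'q) sigmor => bool" where "premor A ph <-> fop ph \<in> extensional (ops A) & perm ph \<in> extensional (ops A) &
  (ALL a:ops A. (ALL j:{1..ar A a}. perm ph a j \<in> {1..ar A a}) & (ALL j. j \<notin> {1..ar A a} --> perm ph a j = j))"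

lemma sig_mor_D: assumes "sig_mor R A Q B ph" shows "premor A ph" "!!a. a \<in> ops A ==> fop ph a \<in> ops B" "!!a. a \<in> ops A ==> ar B (fop ph a) = ar A a"
  "!!a. a \<in> ops A ==> perm ph a permutes {1..ar A a}" "!!a i. a \<in> ops A ==> i <= ar A a ==> fob ph (bd A a (perm ph a i)) = bd B (fop ph a) i"
  "!!a. a \<in> ops A ==> bd B (fop ph a) 0 = fob ph (bd A a 0)"
proof -
 note d = assms[unfolded sig_mor_def]
 show p: "!!a. a \<in> ops A ==> perm ph a permutes {1..ar A a}" using d by blast
 show f: "!!a i. a \<in> ops A ==> i <= ar A a ==> fob ph (bd A a (perm ph a i)) = bd B (fop ph a) i" using d by auto
 show "!!a. a \<in> ops A ==> fop ph a \<in> ops B" "!!a. a \<in> ops A ==> ar B (fop ph a) = ar A a" using d by auto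
 show "premor A ph" unfolding premor_def
 proof (intro conjI ballI allI impI)
  show "fop ph \<in> extensional (ops A)" "perm ph \<in> extensional (ops A)" using d by (simp_all add: PiE_iff)
  show "perm ph a j \<in> {1..ar A a}" if "a \<in> ops A" "j \<in> {1..ar A a}" for a j using p[OF that(1)] that(2) by (simp only: permutes_in_image)
  show "perm ph a j = j" if "a \<in> ops A" "j \<notin> {1..ar A a}" for a j using p[OF that(1)] that(2) by (meson permutes_not_in)
 qed
 \<comment> \<open>Position 0 is the output, and a permutation of \<open>{1..n}\<close> fixes
   it.\<close>
 show "bd B (fop ph a) 0 = fob ph (bd A a 0)" if a: "a \<in> ops A" for a using f[OF a, of 0] permutes_not_in[OF p[OF a], of 0] by simp
qed

lemma premor_D: assumes "premor A ph" "a \<in> ops A" shows "!!j. 1 <= j ==> j <= ar A a ==> 1 <= perm ph a j & perm ph a j <= ar A a"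
  "!!j. j \<notin> {1..ar A a} ==> perm ph a j = j" "!!j. 1 <= j ==> j <= ar A a ==> perm ph a j - 1 < ar A a"
  "!!j. 1 <= j ==> j <= ar A a ==> Suc (perm ph a j - 1) = perm ph a j"
proof -
 show 1: "!!j. 1 <= j ==> j <= ar A a ==> 1 <= perm ph a j & perm ph a j <= ar A a"
  "!!j. j \<notin> {1..ar A a} ==> perm ph a j = j" using assms unfolding premor_def by auto
 show "perm ph a j - 1 < ar A a" "Suc (perm ph a j - 1) = perm ph a j" if "1 <= j" "j <= ar A a" for j using 1(1)[OF that] by linarith+
qed

lemma fst_act [simp]: "fst (act ph w) = fop ph (fst w)" and length_act [simp]: "length (snd (act ph w)) = length (snd w)" unfolding act_def by (auto split: prod.splits)

lemma act_pmap: assumes "premor A ph" "w \<in> pelu A" shows "act ph (pmap h w) = pmap h (act ph w)"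
proof -
 obtain a xs where w: "w = (a, xs)" "a \<in> ops A" "length xs = ar A a" using assms(2) unfolding pelu_def by auto
 have "perm ph a j - 1 < length xs" if "j \<in> set [1..<Suc (length xs)]" for j using premor_D(3)[OF assms(1) w(2), of j] that w(3) by auto
 then show ?thesis unfolding act_def pmap_def w(1) by simp
qed

lemma set_act: assumes "premor A ph" "w \<in> pelu A" shows "set (snd (act ph w)) <= set (snd w)"
proof -
 obtain a xs where w: "w = (a, xs)" "a \<in> ops A" "length xs = ar A a" using assms(2) unfolding pelu_def by auto
 have "perm ph a j - 1 < length xs" if "j \<in> set [1..<Suc (length xs)]" for j using premor_D(3)[OF assms(1) w(2), of j] that w(3) by auto
 then show ?thesis unfolding act_def w(1) by auto
qed

lemma act_pelu: assumes "sig_mor R A Q B ph" "w \<in> pelu A" shows "act ph w \<in> pelu B" using assms sig_mor_D(2,3)[OF assms(1)] unfolding pelu_def act_def by auto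

lemma act_pel: assumes m: "sig_mor R A Q B ph" and w: "w \<in> pel A X t" shows "act ph w \<in> pel B X (fob ph o t)"
proof -
 obtain a xs where e: "w = (a, xs)" by (cases w)
 note d = pel_D[OF w, unfolded e fst_conv snd_conv] and md = sig_mor_D[OF m]
 have "fob ph (t (xs ! (perm ph a j - 1))) = bd B (fop ph a) j" if j: "1 <= j" "j <= ar A a" for j
 proof -
  note p = premor_D(3,4)[OF md(1) d(1) j]
  have "t (xs ! (perm ph a j - 1)) = map t xs ! (perm ph a j - 1)" using p d(4) by simp
  also have "... = bd A a (perm ph a j)" unfolding d(3) using nth_bdl[OF p(1)] p(2) by simp
  finally show ?thesis using md(5)[OF d(1) j(2)] by simp
 qed
 then show ?thesis using set_act[OF md(1) pel_pelu[OF w]] d md(2,3)[OF d(1)] unfolding e pel_def act_def by (auto simp: bdl_def)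
qed

lemma premor_comp: assumes "premor A ph" "premor B ps" "ALL a:ops A. fop ph a \<in> ops B & ar B (fop ph a) = ar A a" shows "premor A (sig_comp R A ps ph)"
  and "!!w. w \<in> pelu A ==> act (sig_comp R A ps ph) w = act ps (act ph w)"
proof -
 have r: "1 <= perm ps (fop ph a) j & perm ps (fop ph a) j <= ar A a" if "a \<in> ops A" "1 <= j" "j <= ar A a" for a j
  using premor_D(1)[OF assms(2), of "fop ph a" j] assms(3)[rule_format, OF that(1)] that by auto
 show "premor A (sig_comp R A ps ph)" unfolding premor_def
 proof (intro conjI ballI allI impI)
  fix a j assume a: "a \<in> ops A"
  show "perm (sig_comp R A ps ph) a j \<in> {1..ar A a}" if "j \<in> {1..ar A a}"
   using premor_D(1)[OF assms(1) a, of "perm ps (fop ph a) j"] r[OF a, of j] that a by (simp add: sig_comp_def)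
  show "perm (sig_comp R A ps ph) a j = j" if "j \<notin> {1..ar A a}"
   using premor_D(2)[OF assms(1) a that] premor_D(2)[OF assms(2), of "fop ph a" j] assms(3)[rule_format, OF a] that a by (simp add: sig_comp_def)
 qed (auto simp: sig_comp_def)
 fix w :: "'a * 'x list" assume "w \<in> pelu A"
 then obtain a xs where w: "w = (a, xs)" "a \<in> ops A" "length xs = ar A a" unfolding pelu_def by auto
 have "map (%j. xs ! (perm ph a j - 1)) [1..<Suc (length xs)] ! (perm ps (fop ph a) j - 1)
   = xs ! (perm ph a (perm ps (fop ph a) j) - 1)" if "1 <= j" "j <= length xs" for j
 proof -
  have "perm ps (fop ph a) j - 1 < length xs" "Suc (perm ps (fop ph a) j - 1) = perm ps (fop ph a) j" using r[OF w(2), of j] that w(3) by linarith+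
  then show ?thesis by simp
 qed
 then show "act (sig_comp R A ps ph) w = act ps (act ph w)" unfolding w(1) act_def using w(2) by (simp add: sig_comp_def compose_def)
qed

lemma sig_over_D: "sig_over R A ==> a \<in> ops A ==> i <= ar A a ==> bd A a i \<in> R" unfolding sig_over_def by (auto simp: PiE_iff)

lemma sig_comp_mor: assumes o: "sig_over R A" and p: "sig_mor R A Q B ph" and q: "sig_mor Q B S C ps"
 shows "sig_mor R A S C (sig_comp R A ps ph)" "!!w. w \<in> pelu A ==> act (sig_comp R A ps ph) w = act ps (act ph w)"
  "fob (sig_comp R A ps ph) = compose R (fob ps) (fob ph)"
proof -
 note pd = sig_mor_D[OF p] and qd = sig_mor_D[OF q] and p' = p[unfolded sig_mor_def] and q' = q[unfolded sig_mor_def]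
 show "!!w. w \<in> pelu A ==> act (sig_comp R A ps ph) w = act ps (act ph w)" by (rule premor_comp(2)[OF pd(1) qd(1)]) (use pd(2,3) in auto)
 show "fob (sig_comp R A ps ph) = compose R (fob ps) (fob ph)" by (simp add: sig_comp_def)
 show "sig_mor R A S C (sig_comp R A ps ph)" unfolding sig_mor_def
 proof (intro conjI ballI)
  show "fob (sig_comp R A ps ph) \<in> R ->E S" "fop (sig_comp R A ps ph) \<in> ops A ->E ops C" using p' q' by (auto simp: sig_comp_def compose_def PiE_iff)
  show "perm (sig_comp R A ps ph) \<in> extensional (ops A)" by (simp add: sig_comp_def)
  fix a assume a: "a \<in> ops A"
  note b = pd(2)[OF a] and r = pd(3)[OF a]
  show "perm (sig_comp R A ps ph) a permutes {1..ar A a}" using permutes_compose[OF qd(4)[OF b, unfolded r] pd(4)[OF a]] a by (simp add: sig_comp_def)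
  show "ar C (fop (sig_comp R A ps ph) a) = ar A a" using qd(3)[OF b] r a by (simp add: sig_comp_def compose_def)
  fix i assume i: "i \<in> {0..ar A a}"
  have q0: "perm ps (fop ph a) i <= ar A a" using premor_D[OF qd(1) b, of i] r i by (cases "i = 0") auto
  have "perm ph a (perm ps (fop ph a) i) <= ar A a" using premor_D[OF pd(1) a, of "perm ps (fop ph a) i"] q0 by (cases "perm ps (fop ph a) i = 0") auto
  \<comment> \<open>The \<open>fob\<close> of a composite is restricted to \<open>R\<close>, so the
    boundary value has to be located there before it can be evaluated.\<close>
  then have "bd A a (perm ph a (perm ps (fop ph a) i)) \<in> R" by (rule sig_over_D[OF o a])
  then show "fob (sig_comp R A ps ph) (bd A a (perm (sig_comp R A ps ph) a i)) = bd C (fop (sig_comp R A ps ph) a) i"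
   using pd(5)[OF a q0] qd(5)[OF b, of i] r i a by (simp add: sig_comp_def compose_def)
 qed
qed

text \<open>From distinct labels the permutation can be read off. This is the bridge from equations
  between signature morphisms to equations between labelled operations; the label type can be chosen
  afresh at each use.\<close>

lemma sigmor_eqI:
 fixes ph ps :: "('a, 'b, 'o, 'q) sigmor" assumes "premor A ph" "premor A ps" "fob ph = fob ps"
  and h: "!!a. a \<in> ops A ==> EX zs :: 'x list. distinct zs & length zs = ar A a & act ph (a, zs) = act ps (a, zs)" shows "ph = ps"
proof -
 have *: "fop ph a = fop ps a" "perm ph a = perm ps a" if a: "a \<in> ops A" for a
 proof -
  obtain zs :: "'x list" where zs: "distinct zs" "length zs = ar A a" "act ph (a, zs) = act ps (a, zs)" using h[OF a] by blast
  then show "fop ph a = fop ps a" by (simp add: act_def)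
  show "perm ph a = perm ps a"
  proof
   fix j show "perm ph a j = perm ps a j"
   proof (cases "j \<in> {1..ar A a}")
    case True
    have "map (%j. zs ! (perm ph a j - 1)) [1..<Suc (length zs)] ! (j - 1) = map (%j. zs ! (perm ps a j - 1)) [1..<Suc (length zs)] ! (j - 1)"
     using zs(3) unfolding act_def prod.case prod.inject by (simp only:)
    then have "zs ! (perm ph a j - 1) = zs ! (perm ps a j - 1)"
    proof -
     have "j - 1 < Suc (length zs) - 1" "1 + (j - 1) = j" using True zs(2) by auto
     then show ?thesis using \<open>map _ _ ! _ = _\<close> by (simp only: nth_map_upt)
    qed
    moreover have "1 <= perm ph a j & perm ph a j <= ar A a" "1 <= perm ps a j & perm ps a j <= ar A a"
     using premor_D(1)[OF assms(1) a] premor_D(1)[OF assms(2) a] True by auto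
    ultimately have "perm ph a j - 1 = perm ps a j - 1" using nth_eq_iff_index_eq[OF zs(1)] zs(2) by auto
    then show ?thesis using \<open>1 <= perm ph a j & _\<close> \<open>1 <= perm ps a j & _\<close> by linarith
   next
    case False
    then show ?thesis using premor_D(2)[OF assms(1) a] premor_D(2)[OF assms(2) a] by simp
   qed
  qed
 qed
 have "fop ph = fop ps" by (rule extensionalityI[of _ "ops A"]) (use assms * in "auto simp: premor_def")
 moreover have "perm ph = perm ps" by (rule extensionalityI[of _ "ops A"]) (use assms * in "auto simp: premor_def")
 ultimately show ?thesis using assms(3) by (cases ph; cases ps) simp
qed

lemma sig_id_pre: "premor A (sig_id R A)" "w \<in> pelu A ==> act (sig_id R A) w = w"
proof -
 show "premor A (sig_id R A)" unfolding premor_def sig_id_def by auto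
 assume "w \<in> pelu A"
 then obtain a xs where w: "w = (a, xs)" "a \<in> ops A" unfolding pelu_def by auto
 have "map (%j. xs ! (j - 1)) [1..<Suc (length xs)] = xs" by (rule nth_equalityI) simp_all
 then show "act (sig_id R A) w = w" unfolding w act_def sig_id_def using w(2) by (simp)
qed

section \<open>The tensor product\<close>

lemma chunks_concat: "chunks (map length zss) (concat zss) = zss" by (induction zss) auto

lemma length_chunks [simp]: "length (chunks ns zs) = length ns" by (induction ns arbitrary: zs) auto

lemma concat_chunks: "sum_list ns = length zs ==> concat (chunks ns zs) = zs" by (induction ns arbitrary: zs) auto

lemma map_length_chunks: "sum_list ns = length zs ==> map length (chunks ns zs) = ns" by (induction ns arbitrary: zs) auto

lemma nth_concat_offset: "i < length zss ==> k < length (zss ! i) ==> concat zss ! (sum_list (take i (map length zss)) + k) = zss ! i ! k"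
 by (induction zss arbitrary: i) (auto simp: nth_append nth_Cons less_Suc_eq_0_disj split: nat.splits)

lemma offset_bound: "i < length ns ==> k <= ns ! i ==> sum_list (take i ns) + k <= sum_list (ns :: nat list)"
proof (induction ns arbitrary: i)
 case (Cons n ns)
 then show ?case using Cons.IH[of "i - 1"] by (cases i) auto
qed simp

text \<open>Makes the lemmas on typed labellings available for the operations of a tensor product
  themselves: operations of \<open>B\<close> serve as labels, and their outputs as types.\<close>

lemma ops_tensor: "ops (tensor A B) = pel A (ops B) (%b. bd B b 0)"
proof -
 have "(length bs = ar A a & (ALL i:{1..ar A a}. bs ! (i - 1) \<in> ops B & bd A a i = bd B (bs ! (i - 1)) 0)) <->
  set bs <= ops B & map (%b. bd B b 0) bs = bdl A a" (is "?l <-> ?r") for a bs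
 proof
  assume l: ?l
  have "bs ! i \<in> ops B & bd B (bs ! i) 0 = bd A a (Suc i)" if "i < ar A a" for i using l that by (auto dest!: bspec[of _ _ "Suc i"])
  then show ?r using l by (auto simp: in_set_conv_nth list_eq_iff_nth_eq)
 next
  assume r: ?r
  then have n: "length bs = ar A a" by (metis length_map length_bdl)
  have "bs ! (i - 1) \<in> ops B & bd A a i = bd B (bs ! (i - 1)) 0" if "i \<in> {1..ar A a}" for i
  proof -
   have i: "i - 1 < ar A a" "Suc (i - 1) = i" using that by auto
   have "map (%b. bd B b 0) bs ! (i - 1) = bdl A a ! (i - 1)" using r by simp
   then have "bd B (bs ! (i - 1)) 0 = bd A a i" using n i nth_bdl[OF i(1)] by (simp only: nth_map)
   moreover have "bs ! (i - 1) \<in> ops B" using r n i nth_mem[of "i - 1" bs] by auto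
   ultimately show ?thesis by simp
  qed
  then show ?l using n by blast
 qed
 then show ?thesis unfolding tensor_def Let_def pel_def by auto
qed

lemma tensor_simps: assumes "(a, bs) \<in> ops (tensor A B)" shows "ar (tensor A B) (a, bs) = sum_list (map (ar B) bs)" "bd (tensor A B) (a, bs) 0 = bd A a 0"
  "bdl (tensor A B) (a, bs) = concat (map (bdl B) bs)"
proof -
 have T: "(a, bs) \<in> {(a, bs). a \<in> ops A & length bs = ar A a & (ALL i:{1..ar A a}. bs ! (i - 1) \<in> ops B & bd A a i = bd B (bs ! (i - 1)) 0)}"
  using assms unfolding tensor_def Let_def by simp
 show r: "ar (tensor A B) (a, bs) = sum_list (map (ar B) bs)" using T unfolding tensor_def Let_def by simp
 show "bd (tensor A B) (a, bs) 0 = bd A a 0" using T unfolding tensor_def Let_def by simp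
 have b: "bd (tensor A B) (a, bs) i = concat (map (bdl B) bs) ! (i - 1)" if "1 <= i" "i <= sum_list (map (ar B) bs)" for i
  using T that unfolding tensor_def Let_def by (simp add: bdl_def[abs_def])
 have l: "length (concat (map (bdl B) bs)) = sum_list (map (ar B) bs)" by (simp add: length_concat comp_def)
 show "bdl (tensor A B) (a, bs) = concat (map (bdl B) bs)" by (rule nth_equalityI) (simp_all add: r l b)
qed

lemma flat_pelu: assumes "w \<in> pel A (pelu B) (root B)" shows "flat w \<in> pelu (tensor A B)" "unflat B (flat w) = w"
proof -
 obtain a ys where w: "w = (a, ys)" by (cases w)
 note d = pel_D[OF assms, unfolded w fst_conv snd_conv]
 have y: "fst y \<in> ops B" "length (snd y) = ar B (fst y)" if "y \<in> set ys" for y using d(2) that pelu_D by blast+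
 have m: "map (length o snd) ys = map (ar B o fst) ys" using y by simp
 have o: "(a, map fst ys) \<in> ops (tensor A B)" unfolding ops_tensor pel_def using d y by (auto simp: comp_def)
 show "flat w \<in> pelu (tensor A B)" using o m unfolding w flat_def pelu_def by (simp add: tensor_simps(1)[OF o] length_concat comp_def cong: map_cong)
 have "map (ar B) (map fst ys) = map length (map snd ys)" using m by simp
 then show "unflat B (flat w) = w" unfolding w flat_def unflat_def by (simp only: prod.case chunks_concat zip_map_fst_snd)
qed

lemma flat_pel: assumes "w \<in> pel A (pel B X t) (root B)" shows "flat w \<in> pel (tensor A B) X t"
proof -
 obtain a ys where w: "w = (a, ys)" by (cases w)
 have wu: "w \<in> pel A (pelu B) (root B)" by (rule pel_mono[OF assms]) (use pel_pelu in blast)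
 note f = flat_pelu(1)[OF wu]
 have o: "(a, map fst ys) \<in> ops (tensor A B)" using f unfolding w flat_def pelu_def by simp
 have s: "set ys <= pel B X t" using pel_D(2)[OF assms] w by simp
 then have "map (map t o snd) ys = map (bdl B o fst) ys" using pel_D(3)[where A = B and X = X and t = t] by auto
 then have "map t (concat (map snd ys)) = concat (map (bdl B) (map fst ys))" by (simp only: map_concat map_map)
 moreover have "set (concat (map snd ys)) <= X" using s pel_D(2)[where A = B and X = X and t = t] by fastforce
 ultimately show ?thesis using o unfolding w flat_def pel_def prod.case mem_Collect_eq by (simp only: tensor_simps(3)[OF o])
qed

lemma unflat_pelu: assumes "v \<in> pelu (tensor A B)" shows "unflat B v \<in> pel A (pelu B) (root B)" "flat (unflat B v) = v"
proof -
 obtain a bs zs where v: "v = ((a, bs), zs)" and o: "(a, bs) \<in> ops (tensor A B)" and l: "length zs = ar (tensor A B) (a, bs)" using assms unfolding pelu_def by auto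
 note l = l[unfolded tensor_simps(1)[OF o]]
 have ml: "map length (chunks (map (ar B) bs) zs) = map (ar B) bs" by (rule map_length_chunks) (simp add: l)
 have "map (length o snd) (zip bs (chunks (map (ar B) bs) zs)) = map (ar B o fst) (zip bs (chunks (map (ar B) bs) zs))" using ml by (simp flip: map_map)
 then have ys: "length (snd y) = ar B (fst y)" if "y \<in> set (zip bs (chunks (map (ar B) bs) zs))" for y using that by auto
 have "fst y \<in> ops B" if "y \<in> set (zip bs (chunks (map (ar B) bs) zs))" for y
  using set_zip_leftD[of "fst y" "snd y"] that pel_D(2)[OF o[unfolded ops_tensor]] by auto
 moreover have "map (root B) (zip bs (chunks (map (ar B) bs) zs)) = map (%b. bd B b 0) (map fst (zip bs (chunks (map (ar B) bs) zs)))" by (simp only: map_map comp_def)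
 ultimately show "unflat B v \<in> pel A (pelu B) (root B)" using ys o[unfolded ops_tensor] unfolding v unflat_def pel_def by (auto simp: pelu_def)
 show "flat (unflat B v) = v" unfolding v flat_def unflat_def by (simp add: concat_chunks l)
qed

lemma unflat_pel: assumes "v \<in> pel (tensor A B) X t" shows "unflat B v \<in> pel A (pel B X t) (root B)"
proof -
 note u = unflat_pelu[OF pel_pelu[OF assms]] and d = pel_D[OF assms]
 obtain a ys where w: "unflat B v = (a, ys)" by (cases "unflat B v")
 have v: "v = ((a, map fst ys), concat (map snd ys))" using u(2) unfolding w flat_def by simp
 have y: "y \<in> pelu B" if "y \<in> set ys" for y using pel_D(2)[OF u(1)] that w by auto
 have "map t (concat (map snd ys)) = concat (map (bdl B) (map fst ys))" using d(1,3) unfolding v by (simp add: tensor_simps(3))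
 then have "concat (map (map t o snd) ys) = concat (map (bdl B o fst) ys)" by (simp add: map_concat)
 moreover have "\<forall>(p, q)\<in>set (zip (map (map t o snd) ys) (map (bdl B o fst) ys)). length p = length q"
  using pelu_D(2)[OF y[OF nth_mem]] by (auto simp: set_zip)
 \<comment> \<open>Corresponding blocks have equal lengths, so an equality of concatenations splits
   into equalities of blocks.\<close>
 ultimately have "map (map t o snd) ys = map (bdl B o fst) ys" by (subst (asm) concat_eq_concat_iff) auto
 then have "y \<in> pel B X t" if yy: "y \<in> set ys" for y
 proof -
  have "set (snd y) <= X" using d(2) yy unfolding v by auto
  moreover have "map t (snd y) = bdl B (fst y)" using \<open>map (map t o snd) ys = _\<close> yy by simp
  ultimately show ?thesis using y[OF yy] unfolding pel_def pelu_def by (cases y) simp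
 qed
 then show ?thesis using u(1) unfolding w pel_def by auto
qed

text \<open>Permuting the blocks keeps the total length, so the list describing a block permutation
  has as many entries as the tensor operation has inputs.\<close>

lemma perm_sum_list: assumes p: "p permutes {1..length ns}" shows "sum_list (map (%j. ns ! (p j - 1)) [1..<Suc (length ns)]) = sum_list (ns :: nat list)"
proof -
 have "sum_list (map (%j. ns ! (p j - 1)) [1..<Suc (length ns)]) = (\<Sum>j\<in>{1..length ns}. ns ! (p j - 1))"
  by (subst sum_list_distinct_conv_sum_set) (simp_all add: atLeastLessThanSuc_atLeastAtMost)
 also have "... = (\<Sum>j\<in>{1..length ns}. ns ! (j - 1))" using sum.permute[OF p, of "%j. ns ! (j - 1)"] by (simp add: comp_def)
 also have "... = (\<Sum>j\<in>{0..<length ns}. ns ! j)" by (rule sum.reindex_bij_witness[where i = Suc and j = "%j. j - 1"]) auto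
 finally show ?thesis by (simp add: sum_list_sum_nth)
qed

text \<open>The one place where block permutations are computed. On labels such a permutation
  rearranges the blocks by \<open>ph\<close> and the labels within each block by \<open>ps\<close>;
  through \<open>flat\<close>, tensoring morphisms thus amounts to acting on two levels.\<close>

lemma tensor_mor_act:
 fixes A :: "('a, 'o) sig" and B :: "('b, 'o) sig" assumes f: "sig_mor R A Q C ph" and g: "premor B ps" shows "premor (tensor A B) (tensor_mor A B ph ps)"
  and "!!w. w \<in> pel A (pelu B) (root B) ==> act (tensor_mor A B ph ps) (flat w) = flat (act ph (pmap (act ps) w))"
proof -
 note fd = sig_mor_D[OF f]
 \<comment> \<open>\<open>L a bs\<close> lists the values of the block permutation;
   \<open>LP\<close> bounds its length and its entries.\<close>
 define L where "L a bs = concat (map (%j. map (%k. sum_list (take (perm ph a j - 1) (map (ar B) bs)) +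
  perm ps (bs ! (perm ph a j - 1)) k) [1..<Suc (map (ar B) bs ! (perm ph a j - 1))]) [1..<Suc (length (map (ar B) bs))])" for a bs
 have P: "perm (tensor_mor A B ph ps) (a, bs) = (%p. if p \<in> {1..length (L a bs)} then L a bs ! (p - 1) else p)" if "(a, bs) \<in> ops (tensor A B)" for a bs
  using that unfolding tensor_mor_def block_perm_def Let_def L_def by simp
 have LP: "length (L a bs) = sum_list (map (ar B) bs)" "set (L a bs) <= {1..sum_list (map (ar B) bs)}" if o: "(a, bs) \<in> ops (tensor A B)" for a bs
 proof -
  note d = pel_D[OF o[unfolded ops_tensor], unfolded fst_conv snd_conv]
  have "length (L a bs) = sum_list (map (%j. map (ar B) bs ! (perm ph a j - 1)) [1..<Suc (length (map (ar B) bs))])" unfolding L_def by (simp add: length_concat comp_def)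
  then show "length (L a bs) = sum_list (map (ar B) bs)" using perm_sum_list[of "perm ph a" "map (ar B) bs"] fd(4)[OF d(1)] d(4) by simp
  show "set (L a bs) <= {1..sum_list (map (ar B) bs)}"
  proof
   fix p assume "p \<in> set (L a bs)"
   then obtain j k where j: "1 <= j" "j <= length bs" and k: "1 <= k" "k <= map (ar B) bs ! (perm ph a j - 1)"
    and p: "p = sum_list (take (perm ph a j - 1) (map (ar B) bs)) + perm ps (bs ! (perm ph a j - 1)) k" unfolding L_def by auto
   have pj: "perm ph a j - 1 < length bs" using premor_D(1)[OF fd(1) d(1), of j] j d(4) by auto
   then have b: "bs ! (perm ph a j - 1) \<in> ops B" using d(2) by auto
   have "1 <= perm ps (bs ! (perm ph a j - 1)) k & perm ps (bs ! (perm ph a j - 1)) k <= ar B (bs ! (perm ph a j - 1))" using premor_D(1)[OF g b, of k] k pj by auto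
   then show "p \<in> {1..sum_list (map (ar B) bs)}" using offset_bound[of "perm ph a j - 1" "map (ar B) bs" "perm ps (bs ! (perm ph a j - 1)) k"] pj unfolding p by auto
  qed
 qed
 show "premor (tensor A B) (tensor_mor A B ph ps)" unfolding premor_def
 proof (intro conjI ballI allI impI)
  show "fop (tensor_mor A B ph ps) \<in> extensional (ops (tensor A B))" "perm (tensor_mor A B ph ps) \<in> extensional (ops (tensor A B))"
   unfolding tensor_mor_def by simp_all
  fix s assume s: "s \<in> ops (tensor A B)"
  obtain a bs where e: "s = (a, bs)" by (cases s)
  note o = s[unfolded e]
  show "perm (tensor_mor A B ph ps) s j \<in> {1..ar (tensor A B) s}" if "j \<in> {1..ar (tensor A B) s}" for j
  proof -
   have "L a bs ! (j - 1) \<in> set (L a bs)" using that unfolding e tensor_simps(1)[OF o] LP(1)[OF o, symmetric] by auto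
   then show ?thesis using that LP[OF o] unfolding e tensor_simps(1)[OF o] P[OF o] by auto
  qed
  show "perm (tensor_mor A B ph ps) s j = j" if "j \<notin> {1..ar (tensor A B) s}" for j using that LP(1)[OF o] unfolding e tensor_simps(1)[OF o] P[OF o] by auto
 qed
 fix w :: "'a * ('b * 'x list) list" assume w: "w \<in> pel A (pelu B) (root B)"
 obtain a ys where e: "w = (a, ys)" by (cases w)
 let ?bs = "map fst ys" and ?ns = "map (ar B) (map fst ys)" and ?zss = "map snd ys"
 have o: "(a, ?bs) \<in> ops (tensor A B)" using flat_pelu(1)[OF w] unfolding e flat_def pelu_def by simp
 note d = pel_D[OF w, unfolded e fst_conv snd_conv]
 have y: "fst y \<in> ops B" "length (snd y) = ar B (fst y)" if "y \<in> set ys" for y using d(2) that pelu_D by blast+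
 have ns: "?ns = map length ?zss" using y by auto
 have len: "length (concat ?zss) = length (L a ?bs)" using LP(1)[OF o] by (simp only: ns length_concat)
 have "map (%p. concat ?zss ! (perm (tensor_mor A B ph ps) (a, ?bs) p - 1)) [1..<Suc (length (concat ?zss))] = map (%q. concat ?zss ! (q - 1)) (L a ?bs)"
  unfolding P[OF o] len by (rule nth_equalityI) simp_all
 also have "... = concat (map (%j. map (%k. concat ?zss ! (sum_list (take (perm ph a j - 1) ?ns) +
   perm ps (?bs ! (perm ph a j - 1)) k - 1)) [1..<Suc (?ns ! (perm ph a j - 1))]) [1..<Suc (length ys)])" unfolding L_def map_concat by (simp add: comp_def)
 also have "... = concat (map (%j. snd (act ps (ys ! (perm ph a j - 1)))) [1..<Suc (length ys)])"
 proof (rule arg_cong[where f = concat], rule map_cong[OF refl])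
  fix j assume "j \<in> set [1..<Suc (length ys)]"
  then have j: "1 <= j" "j <= ar A a" using d(4) by auto
  let ?i = "perm ph a j - 1"
  have i: "?i < length ys" using premor_D(1)[OF fd(1) d(1) j] d(4) by linarith
  have b: "fst (ys ! ?i) \<in> ops B" "length (snd (ys ! ?i)) = ar B (fst (ys ! ?i))" using y i by auto
  have "concat ?zss ! (sum_list (take ?i ?ns) + perm ps (?bs ! ?i) k - 1) = snd (ys ! ?i) ! (perm ps (fst (ys ! ?i)) k - 1)"
   if k: "1 <= k" "k <= ar B (fst (ys ! ?i))" for k
  proof -
   note q = premor_D(1)[OF g b(1) k]
   have "concat ?zss ! (sum_list (take ?i (map length ?zss)) + (perm ps (fst (ys ! ?i)) k - 1)) = ?zss ! ?i ! (perm ps (fst (ys ! ?i)) k - 1)"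
    by (rule nth_concat_offset) (use i q b(2) in auto)
   then show ?thesis using i q unfolding ns by simp
  qed
  then show "map (%k. concat ?zss ! (sum_list (take ?i ?ns) + perm ps (?bs ! ?i) k - 1)) [1..<Suc (?ns ! ?i)] = snd (act ps (ys ! ?i))"
   using i b(2) unfolding act_def by (auto split: prod.splits)
 qed
 finally have snds: "map (%p. concat ?zss ! (perm (tensor_mor A B ph ps) (a, ?bs) p - 1)) [1..<Suc (length (concat ?zss))] =
   concat (map (%j. snd (act ps (ys ! (perm ph a j - 1)))) [1..<Suc (length ys)])" .
 have i: "perm ph a j - 1 < length ys" if "1 <= j" "j <= length ys" for j using premor_D(1)[OF fd(1) d(1), of j] that d(4) by linarith
 have fsts: "fop (tensor_mor A B ph ps) (a, ?bs) = (fop ph a, map (%j. fop ps (fst (ys ! (perm ph a j - 1)))) [1..<Suc (length ys)])"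
  using o i d(4) unfolding tensor_mor_def by auto
 have r: "act ph (pmap (act ps) w) = (fop ph a, map (%j. act ps (ys ! (perm ph a j - 1))) [1..<Suc (length ys)])" using i unfolding e act_def[of ph] pmap_def by auto
 have "act (tensor_mor A B ph ps) (flat w) = (fop (tensor_mor A B ph ps) (a, ?bs),
   map (%p. concat ?zss ! (perm (tensor_mor A B ph ps) (a, ?bs) p - 1)) [1..<Suc (length (concat ?zss))])" unfolding e flat_def by (simp only: prod.case act_def)
 also have "... = flat (act ph (pmap (act ps) w))" unfolding snds fsts r flat_def by (simp add: comp_def)
 finally show "act (tensor_mor A B ph ps) (flat w) = flat (act ph (pmap (act ps) w))" .
qed

section \<open>Multicategories elementwise\<close>

lemma pel_cong: "(!!x. x \<in> X ==> t x = s x) ==> pel A X t = pel A X s"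
proof -
 assume a: "!!x. x \<in> X ==> t x = s x"
 have "w \<in> pel A X t'" if "w \<in> pel A X s'" "!!x. x \<in> X ==> t' x = s' x" for s' t' w
  using pmap_pel[OF that(1), of "%x. x" X t'] that(2) pmap_ident[of w "%x. x"] by simp
 then show ?thesis using a by (metis subsetI subset_antisym)
qed

text \<open>An infinite type has enough distinct labels, and distinctness makes the prescribed types
  a function of the label.\<close>

lemma generic_labels: assumes "infinite (UNIV :: 'x set)" obtains zs :: "'x list" and t where "distinct zs" "length zs = length bs" "map t zs = bs"
proof -
 obtain X :: "'x set" where X: "finite X" "card X = length bs" using infinite_arbitrarily_large[OF assms] by blast
 obtain zs where zs: "set zs = X" "distinct zs" using finite_distinct_list[OF X(1)] by blast
 have l: "length zs = length bs" using zs X(2) distinct_card by metis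
 have "map (the o map_of (zip zs bs)) zs = bs" by (rule nth_equalityI) (use l zs(2) in "auto simp: map_of_zip_nth")
 then show ?thesis using that zs(2) l by blast
qed

lemma flat_pmap:
 fixes h :: "'x => 'y" and w :: "'a * ('b * 'x list) list" shows "flat (pmap (pmap h) w) = pmap h (flat w)"
proof -
 have "concat (map (snd o pmap h) ys) = map h (concat (map snd ys))" for ys :: "('b * 'x list) list" by (induction ys) (auto simp: pmap_def)
 then show ?thesis unfolding flat_def by (cases w) (simp add: pmap_def[of "pmap h"], simp add: pmap_def split: prod.splits)
qed

lemma act_inj:
 fixes v v' :: "'a * 'x list" assumes m: "sig_mor R A Q B ph" and v: "v \<in> pelu A" "v' \<in> pelu A" "fst v = fst v'" "act ph v = act ph v'" shows "v = v'"
proof -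
 obtain a xs where 1: "v = (a, xs)" "a \<in> ops A" "length xs = ar A a" using v(1) unfolding pelu_def by auto
 obtain ys where 2: "v' = (a, ys)" "length ys = ar A a" using v(2,3) 1 unfolding pelu_def by auto
 note p = sig_mor_D(4)[OF m 1(2)]
 have "xs ! i = ys ! i" if i: "i < ar A a" for i
 proof -
  define j where "j = inv (perm ph a) (Suc i)"
  have j: "perm ph a j = Suc i" unfolding j_def using permutes_inverses(1)[OF p] by simp
  have "j \<in> {1..ar A a}" unfolding j_def using permutes_in_image[OF permutes_inv[OF p]] i by simp
  then have "j - 1 < Suc (ar A a) - 1" "1 + (j - 1) = j" by auto
  then have N: "map (%j. zs ! (perm ph a j - 1)) [1..<Suc (ar A a)] ! (j - 1) = zs ! i" for zs :: "'x list" using j by (simp only: nth_map_upt) simp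
  have E: "map (%j. xs ! (perm ph a j - 1)) [1..<Suc (ar A a)] = map (%j. ys ! (perm ph a j - 1)) [1..<Suc (ar A a)]"
   using v(4) unfolding 1(1) 2(1) act_def prod.case prod.inject 1(3) 2(2) by blast
  have "xs ! i = map (%j. xs ! (perm ph a j - 1)) [1..<Suc (ar A a)] ! (j - 1)" by (rule N[symmetric])
  also have "... = ys ! i" unfolding E by (rule N)
  finally show ?thesis .
 qed
 then show ?thesis using 1 2 by (auto intro: nth_equalityI)
qed

lemma act_surj: assumes m: "sig_mor R A Q B ph" and a: "a \<in> ops A" "length xs = ar A a"
 obtains zs where "(a, zs) \<in> pelu A" "act ph (a, zs) = (fop ph a, xs)" "set zs <= set xs"
proof -
 note p = sig_mor_D(4)[OF m a(1)]
 let ?q = "inv (perm ph a)"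
 let ?zs = "map (%i. xs ! (?q i - 1)) [1..<Suc (length xs)]"
 have q: "?q i - 1 < length xs" "Suc (?q i - 1) = ?q i" if "1 <= i" "i <= length xs" for i using permutes_in_image[OF permutes_inv[OF p], of i] that a(2) by auto
 have "map (%j. ?zs ! (perm ph a j - 1)) [1..<Suc (length xs)] = xs"
 proof (rule nth_equalityI)
  fix i assume "i < length (map (%j. ?zs ! (perm ph a j - 1)) [1..<Suc (length xs)])"
  then have i: "1 <= Suc i" "Suc i <= length xs" "Suc i <= ar A a" using a(2) by auto
  note pd = premor_D(3,4)[OF sig_mor_D(1)[OF m] a(1) i(1) i(3)]
  have "?zs ! (perm ph a (Suc i) - 1) = xs ! (?q (perm ph a (Suc i)) - 1)" using pd a(2) by simp
  then show "map (%j. ?zs ! (perm ph a j - 1)) [1..<Suc (length xs)] ! i = xs ! i" using i permutes_inverses(2)[OF p] by simp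
 qed simp
 moreover have "set ?zs <= set xs" using q by auto
 moreover have "(a, ?zs) \<in> pelu A" using a by (simp add: pelu_def)
 ultimately show ?thesis using that[of ?zs] by (simp add: act_def)
qed

text \<open>For a fixed operation the action merely permutes the labels, which is invertible. Hence
  a labelling \<open>s\<close> of the image operation that \<open>k\<close> turns into
  \<open>act ph v\<close> lifts uniquely; this is cartesianness of the transformation given by
  \<open>ph\<close>.\<close>

lemma act_cartesian: assumes m: "sig_mor R A Q B ph" and v: "v \<in> pelu A" and s: "pmap k s = act ph v"
 obtains v' where "v' \<in> pelu A" "act ph v' = s" "pmap k v' = v" "set (snd v') <= set (snd s)"
  "!!v''. v'' \<in> pelu A ==> act ph v'' = s ==> pmap k v'' = v ==> v'' = v'"
proof -
 note d = pelu_D[OF v] and md = sig_mor_D[OF m]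
 have l: "length (snd s) = ar A (fst v)" using arg_cong[OF s, of "%z. length (snd z)"] d(2) by simp
 have f: "fst s = fop ph (fst v)" using arg_cong[OF s, of fst] by simp
 obtain zs where zs: "(fst v, zs) \<in> pelu A" "act ph (fst v, zs) = (fop ph (fst v), snd s)" "set zs <= set (snd s)" using act_surj[OF m d(1) l] by blast
 have s': "act ph (fst v, zs) = s" using zs(2) f by (metis prod.collapse)
 have "act ph (pmap k (fst v, zs)) = act ph v" using act_pmap[OF md(1) zs(1), of k] s s' by simp
 then have "pmap k (fst v, zs) = v" by (rule act_inj[OF m _ v, rotated -1]) (use zs(1) in "auto simp: pelu_def pmap_def")
 moreover have "v'' = (fst v, zs)" if "v'' \<in> pelu A" "act ph v'' = s" "pmap k v'' = v" for v''
 proof -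
  have "fst v'' = fst v" using that(3) by auto
  then show ?thesis using act_inj[OF m that(1) zs(1)] that(2) s' by simp
 qed
 moreover have "set (snd (fst v, zs)) <= set (snd s)" using zs(3) by simp
 ultimately show ?thesis by (intro that[of "(fst v, zs)"] zs(1) s')
qed

lemma mul_pmap: assumes "premor (tensor A B) m" "w \<in> pel A (pelu B) (root B)" shows "mul m (pmap (pmap h) w) = pmap h (mul m w)"
 unfolding mul_def flat_pmap using act_pmap[OF assms(1) flat_pelu(1)[OF assms(2)]] .

lemma pmap_pelu: "v \<in> pelu A ==> pmap h v \<in> pelu A" unfolding pelu_def pmap_def by auto

lemma pmap_pmap_pel: "w \<in> pel A (pelu B) (root B) ==> pmap (pmap h) w \<in> pel A (pelu B) (root B)" by (erule pmap_pel) (simp add: pmap_pelu)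

lemma pel_pel_pelu: "w \<in> pel A (pel B X t) (root B) ==> w \<in> pel A (pelu B) (root B)" by (erule pel_mono) (use pel_pelu in blast)

text \<open>Carries \<open>act_cartesian\<close> along the bijection \<open>flat\<close>. The labels
  of the lift are among those of \<open>s\<close>, which is what later recovers their types.\<close>

lemma mul_cartesian: assumes m: "sig_mor R (tensor A B) Q C m" and w: "w \<in> pel A (pelu B) (root B)" and s: "pmap k s = mul m w"
 obtains w' where "w' \<in> pel A (pelu B) (root B)" "mul m w' = s" "pmap (pmap k) w' = w" "!!y. y \<in> set (snd w') ==> set (snd y) <= set (snd s)"
  "!!w''. w'' \<in> pel A (pelu B) (root B) ==> mul m w'' = s ==> pmap (pmap k) w'' = w ==> w'' = w'"
proof -
 obtain v where v: "v \<in> pelu (tensor A B)" "act m v = s" "pmap k v = flat w" "set (snd v) <= set (snd s)"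
  and un: "!!v''. v'' \<in> pelu (tensor A B) ==> act m v'' = s ==> pmap k v'' = flat w ==> v'' = v"
  by (rule act_cartesian[OF m flat_pelu(1)[OF w] s[unfolded mul_def]]) (rule that; assumption)
 note u = unflat_pelu[OF v(1)]
 have "pmap (pmap k) (unflat B v) = unflat B (flat (pmap (pmap k) (unflat B v)))" by (rule flat_pelu(2)[OF pmap_pmap_pel[OF u(1)], symmetric])
 also have "... = w" by (simp only: flat_pmap u(2) v(3) flat_pelu(2)[OF w])
 finally have e: "pmap (pmap k) (unflat B v) = w" .
 have "set (snd y) <= set (snd s)" if y: "y \<in> set (snd (unflat B v))" for y
 proof -
  have "snd (flat (unflat B v)) = concat (map snd (snd (unflat B v)))" by (simp add: flat_def case_prod_unfold)
  then have "set (snd y) <= set (snd (flat (unflat B v)))" using y by auto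
  then show ?thesis unfolding u(2) using v(4) by blast
 qed
 moreover have "w'' = unflat B v" if "w'' \<in> pel A (pelu B) (root B)" "mul m w'' = s" "pmap (pmap k) w'' = w" for w''
 proof -
  have "pmap k (flat w'') = flat w" by (simp only: flat_pmap[symmetric] that(3))
  then have "flat w'' = v" using un[OF flat_pelu(1)[OF that(1)]] that(2) unfolding mul_def by blast
  then show ?thesis using flat_pelu(2)[OF that(1)] by metis
 qed
 moreover have "mul m (unflat B v) = s" unfolding mul_def u(2) by (rule v(2))
 ultimately show ?thesis by (intro that[of "unflat B v"] u(1) e)
qed

lemma mul_pel: assumes m: "sig_mor R (tensor A A) R A m" "fob m = (\<lambda>x\<in>R. x)" and w: "w \<in> pel A (pel A X t) (root A)"
  and t: "!!x. x \<in> X ==> t x \<in> R" shows "mul m w \<in> pel A X t"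
proof -
 have "pel A X (fob m o t) = pel A X t" by (rule pel_cong) (simp add: m(2) t)
 then show ?thesis using act_pel[OF m(1) flat_pel[OF w]] unfolding mul_def by simp
qed

lemma root_mul: assumes m: "sig_mor R (tensor A A) R A m" "fob m = (\<lambda>x\<in>R. x)" and o: "sig_over R A" and w: "w \<in> pel2 A"
 shows "root A (mul m w) = root A w"
proof -
 note f = flat_pelu(1)[OF w]
 have o': "fst (flat w) \<in> ops (tensor A A)" using f by (simp add: pelu_D)
 have "root A (mul m w) = fob m (bd (tensor A A) (fst (flat w)) 0)" using sig_mor_D(6)[OF m(1) o'] by (simp add: mul_def)
 also have "bd (tensor A A) (fst (flat w)) 0 = root A w" using tensor_simps(2)[of "fst w" "map fst (snd w)" A A] o' by (simp add: flat_def case_prod_unfold)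
 finally show ?thesis using m(2) sig_over_D[OF o pel_D(1)[OF w]] by simp
qed

lemma tensor_mor_ops:
 fixes A :: "('a, 'o) sig" and B :: "('b, 'o) sig" assumes f: "sig_mor R A Q C ph" and g: "sig_mor R B Q D ps" and e: "fob ph = fob ps"
 shows "ALL s:ops (tensor A B). fop (tensor_mor A B ph ps) s \<in> ops (tensor C D) & ar (tensor C D) (fop (tensor_mor A B ph ps) s) = ar (tensor A B) s"
proof
 fix s assume s: "s \<in> ops (tensor A B)"
 \<comment> \<open>Labelling every input by \<open>()\<close> turns a claim about operations and
   arities into one about labelled operations, where \<open>tensor_mor_act\<close> applies.\<close>
 let ?v = "(s, replicate (ar (tensor A B) s) ())"
 have v: "?v \<in> pelu (tensor A B)" using s by (simp add: pelu_def)
 note u = unflat_pelu[OF v]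
 let ?w = "unflat B ?v"
 have 1: "act (tensor_mor A B ph ps) ?v = flat (pmap (act ps) (act ph ?w))"
  using tensor_mor_act(2)[OF f sig_mor_D(1)[OF g] u(1)] u(2) act_pmap[OF sig_mor_D(1)[OF f] pel_pelu[OF u(1)], of "act ps"] by simp
 have "act ph ?w \<in> pel C (pelu B) (fob ph o root B)" by (rule act_pel[OF f u(1)])
 then have "pmap (act ps) (act ph ?w) \<in> pel C (pelu D) (root D)"
 proof (rule pmap_pel)
  fix y :: "'b \<times> unit list" assume y: "y \<in> pelu B"
  show "act ps y \<in> pelu D & root D (act ps y) = (fob ph o root B) y" using act_pelu[OF g y] sig_mor_D(6)[OF g pelu_D(1)[OF y]] e by simp
 qed
 then have "act (tensor_mor A B ph ps) ?v \<in> pelu (tensor C D)" unfolding 1 by (rule flat_pelu(1))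
 then show "fop (tensor_mor A B ph ps) s \<in> ops (tensor C D) & ar (tensor C D) (fop (tensor_mor A B ph ps) s) = ar (tensor A B) s"
  using pelu_D[of "act (tensor_mor A B ph ps) ?v" "tensor C D"] by simp
qed

lemma unit_sig_simps [simp]: "ops (unit_sig R) = R" "x \<in> R ==> ar (unit_sig R) x = 1"
 "x \<in> R ==> i <= 1 ==> bd (unit_sig R) x i = x" "x \<in> R ==> bdl (unit_sig R) x = [x]" unfolding unit_sig_def bdl_def by (auto simp: upt_rec)

lemma act_unit: assumes e: "premor (unit_sig R) e" and x: "x \<in> R" shows "act e (x, [z]) = (fop e x, [z])"
proof -
 have "perm e x 1 = 1" using premor_D(1)[OF e, of x 1] x by simp
 then show ?thesis by (simp add: act_def upt_rec)
qed

abbreviation units :: "('o, 'a, 'o, 'o) sigmor => ('a, 'o) sig => 'a * 'x list => 'a * ('a * 'x list) list" where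
 "units e A v \<equiv> (fst v, map (%(x, z). (fop e x, [z])) (zip (bdl A (fst v)) (snd v)))"

text \<open>Presents \<open>v\<close> as an element of the tensor product with the unit on the left,
  so that the left unit law can be evaluated at it; \<open>runit_elem\<close> does the same on the
  right.\<close>

lemma lunit_elem: assumes "sig_over R A" "v \<in> pelu A"
 shows "(root A v, [v]) \<in> pel (unit_sig R) (pelu A) (root A)" "flat (root A v, [v]) = ((root A v, [fst v]), snd v)"
 using assms sig_over_D[OF assms(1) pelu_D(1)[OF assms(2)], of 0] unfolding pel_def flat_def by auto

lemma runit_elem:
 fixes A :: "('a, 'o) sig" and v :: "'a * 'x list" assumes "sig_over R A" "v \<in> pelu A"
 defines "w \<equiv> (fst v, map (%(x, z). (x, [z])) (zip (bdl A (fst v)) (snd v)))"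
 shows "w \<in> pel A (pelu (unit_sig R)) (root (unit_sig R))" "flat w = ((fst v, bdl A (fst v)), snd v)"
proof -
 note d = pelu_D[OF assms(2)]
 have R: "set (bdl A (fst v)) <= R" using sig_over_D[OF assms(1) d(1)] by (auto simp: bdl_def)
 have "map (root (unit_sig R) o (%(x, z). (x, [z]))) (zip (bdl A (fst v)) (snd v)) = map fst (zip (bdl A (fst v)) (snd v))" using R by (auto dest!: set_zip_leftD)
 then show "w \<in> pel A (pelu (unit_sig R)) (root (unit_sig R))" using d R unfolding w_def pel_def pelu_def by (auto dest!: set_zip_leftD)
 let ?ps = "zip (bdl A (fst v)) (snd v)"
 have "concat (map (snd o (%(x, z). (x, [z]))) ps) = map snd ps" for ps :: "('o * 'x) list" by (induction ps) auto
 note this[of ?ps]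
 moreover have "map (fst o (%(x, z). (x, [z]))) ps = map fst ps" for ps :: "('o * 'x) list" by auto
 note this[of ?ps]
 ultimately show "flat w = ((fst v, bdl A (fst v)), snd v)" unfolding w_def flat_def prod.case map_map using d by simp
qed

lemma root_flat: assumes "y \<in> pel2 A" shows "root (tensor A A) (flat y) = root A y"
 using tensor_simps(2)[of "fst y" "map fst (snd y)" A A] pelu_D(1)[OF flat_pelu(1)[OF assms]] by (simp add: flat_def case_prod_unfold)

text \<open>A triple nesting can be flattened from the outside or from the inside. The associativity
  isomorphism has identity permutations, so it rebrackets the operations and leaves the list of
  labels alone.\<close>

lemma assoc_elem:
 fixes A :: "('a, 'o) sig" and w :: "'a * ('a * ('a * 'x list) list) list" assumes w: "w \<in> pel A (pel2 A) (root A)"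
 shows "flat w \<in> pel (tensor A A) (pelu A) (root A)" "pmap flat w \<in> pel A (pelu (tensor A A)) (root (tensor A A))"
  "act (assoc_mor R A A A) (flat (flat w)) = flat (pmap flat w)"
proof -
 show f: "flat w \<in> pel (tensor A A) (pelu A) (root A)" by (rule flat_pel[OF w])

 show "pmap flat w \<in> pel A (pelu (tensor A A)) (root (tensor A A))" by (rule pmap_pel[OF w]) (simp add: flat_pelu(1) root_flat)
 obtain a vs where e: "w = (a, vs)" by (cases w)
 have v: "v \<in> pel2 A" if "v \<in> set vs" for v using pel_D(2)[OF w] that e by auto
 have o: "((a, map fst vs), map fst (concat (map snd vs))) \<in> ops (tensor (tensor A A) A)" using pelu_D(1)[OF flat_pelu(1)[OF f]] unfolding e flat_def by simp
 have ml: "map (ar A) (map fst vs) = map length (map (map fst o snd) vs)" using pel_D(4)[OF v] by simp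
 have mc: "map fst (concat (map snd vs)) = concat (map (map fst o snd) vs)" by (simp add: map_concat)
 have c: "chunks (map (ar A) (map fst vs)) (map fst (concat (map snd vs))) = map (map fst o snd) vs" unfolding ml mc by (rule chunks_concat)
 have z: "zip (map fst vs) (map (map fst o snd) vs) = map (fst o flat) vs" by (simp add: zip_map_map zip_same_conv_map flat_def case_prod_unfold comp_def)
 have s: "concat (map snd (concat (map snd vs))) = concat (map (snd o flat) vs)" by (induction vs) (auto simp: flat_def)
 have i: "map (%j. xs ! (j - 1)) [1..<Suc (length xs)] = xs" for xs :: "'x list" by (rule nth_equalityI) simp_all
 have F: "flat (flat w) = (((a, map fst vs), map fst (concat (map snd vs))), concat (map (snd o flat) vs))" unfolding e flat_def prod.case s[unfolded flat_def] ..
 have A: "fop (assoc_mor R A A A) ((a, map fst vs), map fst (concat (map snd vs))) = (a, map (fst o flat) vs)"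
 proof -
  have "zip (map fst vs) (chunks (map (ar A) (map fst vs)) (map fst (concat (map snd vs)))) = map (fst o flat) vs" by (simp only: c z)
  then show ?thesis using o unfolding assoc_mor_def by (simp del: map_map)
 qed
 have "act (assoc_mor R A A A) (flat (flat w)) = ((a, map (fst o flat) vs), concat (map (snd o flat) vs))"
  unfolding F act_def prod.case A using o i by (simp add: assoc_mor_def)
 then show "act (assoc_mor R A A A) (flat (flat w)) = flat (pmap flat w)" unfolding e pmap_def flat_def by (simp add: comp_def)
qed

lemma premor_id_perm: "fop ph \<in> extensional (ops A) ==> perm ph = (\<lambda>_\<in>ops A. id) ==> premor A ph" unfolding premor_def by auto

text \<open>The data of a monoid without its laws. The laws can be evaluated on elements in this
  setting, both to use them and to establish them.\<close>

locale mcat_data =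
 fixes R :: "'o set" and A :: "('a, 'o) sig" and m :: "('a * 'a list, 'a, 'o, 'o) sigmor" and e :: "('o, 'a, 'o, 'o) sigmor" assumes so: "sig_over R A"
  and m: "sig_mor R (tensor A A) R A m" and fm: "fob m = (\<lambda>x\<in>R. x)" and e: "sig_mor R (unit_sig R) R A e" and fe: "fob e = (\<lambda>x\<in>R. x)"
begin

lemma sid: "sig_mor R A R A (sig_id R A)" "fob (sig_id R A) = (\<lambda>x\<in>R. x)"
 using so unfolding sig_mor_def sig_over_def sig_id_def by (auto simp: permutes_id PiE_iff)

text \<open>Evaluated at a flattened triple nesting, the two composites of signature morphisms
  become the two usual ways of multiplying it out.\<close>

lemma assoc_sides:
 defines "l \<equiv> sig_comp R (tensor (tensor A A) A) m (tensor_mor (tensor A A) A m (sig_id R A))" and "r \<equiv> sig_comp R (tensor (tensor A A) A)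
      (sig_comp R (tensor A (tensor A A)) m (tensor_mor A (tensor A A) (sig_id R A) m)) (assoc_mor R A A A)"
 shows "premor (tensor (tensor A A) A) l" "premor (tensor (tensor A A) A) r" "fob l = fob r"
  "!!w. w \<in> pel A (pel2 A) (root A) ==> act l (flat (flat w)) = mul m (mul m w)"
  "!!w. w \<in> pel A (pel2 A) (root A) ==> act r (flat (flat w)) = mul m (pmap (mul m) w)"
proof -
 note tl = tensor_mor_act[OF m sig_mor_D(1)[OF sid(1)]] and tr = tensor_mor_act[OF sid(1) sig_mor_D(1)[OF m]]
 note ol = tensor_mor_ops[OF m sid(1), unfolded fm sid(2), OF refl] and or = tensor_mor_ops[OF sid(1) m, unfolded fm sid(2), OF refl]
 note cl = premor_comp[OF tl(1) sig_mor_D(1)[OF m] ol, where R = R] and cr = premor_comp[OF tr(1) sig_mor_D(1)[OF m] or, where R = R]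
 have pa: "premor (tensor (tensor A A) A) (assoc_mor R A A A)" by (rule premor_id_perm) (simp_all add: assoc_mor_def)
 have oa: "ALL s:ops (tensor (tensor A A) A). fop (assoc_mor R A A A) s \<in> ops (tensor A (tensor A A)) &
  ar (tensor A (tensor A A)) (fop (assoc_mor R A A A) s) = ar (tensor (tensor A A) A) s"
 proof
  fix s assume s: "s \<in> ops (tensor (tensor A A) A)"
  let ?v = "(s, replicate (ar (tensor (tensor A A) A) s) ())"
  have v: "?v \<in> pelu (tensor (tensor A A) A)" using s by (simp add: pelu_def)
  let ?w = "unflat A (unflat A ?v)"
  have w: "?w \<in> pel A (pel2 A) (root A)" "flat (flat ?w) = ?v"
   using unflat_pel[OF unflat_pelu(1)[OF v]] unflat_pelu(2)[OF v] unflat_pelu(2)[OF pel_pelu[OF unflat_pelu(1)[OF v]]] by simp_all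
  have "act (assoc_mor R A A A) ?v \<in> pelu (tensor A (tensor A A))" using assoc_elem(3)[OF w(1), of R] flat_pelu(1)[OF assoc_elem(2)[OF w(1)]] w(2) by simp
  then show "fop (assoc_mor R A A A) s \<in> ops (tensor A (tensor A A)) & ar (tensor A (tensor A A)) (fop (assoc_mor R A A A) s) = ar (tensor (tensor A A) A) s"
   using pelu_D[of "act (assoc_mor R A A A) ?v" "tensor A (tensor A A)"] by simp
 qed
 note ca = premor_comp[OF pa cr(1) oa, where R = R]
 show "premor (tensor (tensor A A) A) l" "premor (tensor (tensor A A) A) r" unfolding l_def r_def using cl(1) ca(1) by auto
 show "fob l = fob r" unfolding l_def r_def sig_comp_def tensor_mor_def assoc_mor_def using fm by (auto simp: compose_def sid(2) fun_eq_iff sig_id_def)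
 fix w :: "'a * ('a * ('a * 'x list) list) list" assume w: "w \<in> pel A (pel2 A) (root A)"
 note a = assoc_elem[OF w]
 have i: "pmap (act (sig_id R A)) (flat w) = flat w" by (rule pmap_ident) (use sig_id_pre(2) pel_D(2)[OF a(1)] in blast)
 show "act l (flat (flat w)) = mul m (mul m w)" unfolding l_def cl(2)[OF flat_pelu(1)[OF a(1)]] tl(2)[OF a(1)] i mul_def ..
 have i2: "act (sig_id R A) (pmap (act m) (pmap flat w)) = pmap (mul m) w"
 proof -
  have "pmap (act m) (pmap flat w) = pmap (mul m) w" unfolding pmap_comp by (rule pmap_cong) (simp add: mul_def)
  then show ?thesis using sig_id_pre(2)[OF pmap_pelu[OF pel_pelu[OF w]], of R "mul m"] by simp
 qed
 show "act r (flat (flat w)) = mul m (pmap (mul m) w)" unfolding r_def ca(2)[OF flat_pelu(1)[OF a(1)]] a(3) cr(2)[OF flat_pelu(1)[OF a(2)]] tr(2)[OF a(2)] i2 mul_def ..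
qed

lemma lunit_sides:
 defines "l \<equiv> sig_comp R (tensor (unit_sig R) A) m (tensor_mor (unit_sig R) A e (sig_id R A))"
 shows "premor (tensor (unit_sig R) A) l" "premor (tensor (unit_sig R) A) (lunit_mor R A)" "fob l = fob (lunit_mor R A)"
  "!!v. v \<in> pelu A ==> act l (flat (root A v, [v])) = mul m (fop e (root A v), [v])" "!!v. v \<in> pelu A ==> act (lunit_mor R A) (flat (root A v, [v])) = v"
proof -
 note tl = tensor_mor_act[OF e sig_mor_D(1)[OF sid(1)]]
 note ol = tensor_mor_ops[OF e sid(1), unfolded fe sid(2), OF refl]
 note cl = premor_comp[OF tl(1) sig_mor_D(1)[OF m] ol, where R = R]
 show "premor (tensor (unit_sig R) A) l" unfolding l_def by (rule cl(1))
 show "premor (tensor (unit_sig R) A) (lunit_mor R A)" by (rule premor_id_perm) (simp_all add: lunit_mor_def)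
 show "fob l = fob (lunit_mor R A)" unfolding l_def sig_comp_def tensor_mor_def lunit_mor_def using fm fe by (auto simp: compose_def fun_eq_iff)
 fix v :: "'a * 'x list" assume v: "v \<in> pelu A"
 note a = lunit_elem[OF so v]
 have x: "root A v \<in> R" using sig_over_D[OF so pelu_D(1)[OF v]] by simp
 have i: "pmap (act (sig_id R A)) (root A v, [v]) = (root A v, [v])" using sig_id_pre(2)[OF v] by (simp add: pmap_def)
 show "act l (flat (root A v, [v])) = mul m (fop e (root A v), [v])"
  unfolding l_def cl(2)[OF flat_pelu(1)[OF a(1)]] tl(2)[OF a(1)] i act_unit[OF sig_mor_D(1)[OF e] x] mul_def ..
 have "map (%j. xs ! (j - 1)) [1..<Suc (length xs)] = xs" for xs :: "'x list" by (rule nth_equalityI) simp_all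
 then show "act (lunit_mor R A) (flat (root A v, [v])) = v" using pelu_D(1)[OF flat_pelu(1)[OF a(1)]] unfolding a(2) act_def lunit_mor_def by simp
qed

lemma runit_sides:
 defines "l \<equiv> sig_comp R (tensor A (unit_sig R)) m (tensor_mor A (unit_sig R) (sig_id R A) e)"
 shows "premor (tensor A (unit_sig R)) l" "premor (tensor A (unit_sig R)) (runit_mor R A)" "fob l = fob (runit_mor R A)"
  "!!v. v \<in> pelu A ==> act l ((fst v, bdl A (fst v)), snd v) = mul m (units e A v)" "!!v. v \<in> pelu A ==> act (runit_mor R A) ((fst v, bdl A (fst v)), snd v) = v"
proof -
 note tl = tensor_mor_act[OF sid(1) sig_mor_D(1)[OF e]]
 note ol = tensor_mor_ops[OF sid(1) e, unfolded fe sid(2), OF refl]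
 note cl = premor_comp[OF tl(1) sig_mor_D(1)[OF m] ol, where R = R]
 show "premor (tensor A (unit_sig R)) l" unfolding l_def by (rule cl(1))
 show "premor (tensor A (unit_sig R)) (runit_mor R A)" by (rule premor_id_perm) (simp_all add: runit_mor_def)
 show "fob l = fob (runit_mor R A)" unfolding l_def sig_comp_def tensor_mor_def runit_mor_def using fm sid(2) by (auto simp: compose_def fun_eq_iff)
 fix v :: "'a * 'x list" assume v: "v \<in> pelu A"
 define w where "w = (fst v, map (%(x, z). (x, [z])) (zip (bdl A (fst v)) (snd v)))"
 note a = runit_elem[OF so v, folded w_def]
 have R: "set (bdl A (fst v)) <= R" using sig_over_D[OF so pelu_D(1)[OF v]] by (auto simp: bdl_def)
 have "pmap (act e) w = units e A v" unfolding w_def pmap_def using R by (auto dest!: set_zip_leftD intro!: act_unit[OF sig_mor_D(1)[OF e]])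
 moreover have "act (sig_id R A) (pmap (act e) w) = pmap (act e) w" by (rule sig_id_pre(2)[OF pmap_pelu[OF pel_pelu[OF a(1)]]])
 ultimately have i: "act (sig_id R A) (pmap (act e) w) = units e A v" by simp
 show "act l ((fst v, bdl A (fst v)), snd v) = mul m (units e A v)" unfolding a(2)[symmetric] l_def cl(2)[OF flat_pelu(1)[OF a(1)]] tl(2)[OF a(1)] i mul_def ..
 have "map (%j. xs ! (j - 1)) [1..<Suc (length xs)] = xs" for xs :: "'x list" by (rule nth_equalityI) simp_all
 then show "act (runit_mor R A) ((fst v, bdl A (fst v)), snd v) = v" using pelu_D(1)[OF flat_pelu(1)[OF a(1)]] unfolding a(2) act_def runit_mor_def by simp
qed

end

text \<open>Equations between signature morphisms do not mention labels, so the elementwise laws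
  hold for labels of any type \<open>'x\<close>.\<close>

lemma multicategory_D:
 fixes M :: "'v mcat" assumes "multicategory M"
 defines "R \<equiv> base M" and "A \<equiv> msig M" and "m \<equiv> mmul M" and "e \<equiv> munit M" shows "mcat_data R A m e" "small R" "small (ops A)"
  "!!w :: 'v * ('v * ('v * 'x list) list) list. w \<in> pel A (pel2 A) (root A) ==> mul m (mul m w) = mul m (pmap (mul m) w)"
  "!!v :: 'v * 'x list. v \<in> pelu A ==> mul m (fop e (root A v), [v]) = v" "!!v :: 'v * 'x list. v \<in> pelu A ==> mul m (units e A v) = v"
proof -
 note d = assms(1)[unfolded multicategory_def Let_def, folded R_def A_def m_def e_def]
 show md: "mcat_data R A m e" using d unfolding mcat_data_def by simp
 show "small R" "small (ops A)" using d by simp_all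
 interpret mcat_data R A m e by (rule md)
 show "!!w :: 'v * ('v * ('v * 'x list) list) list. w \<in> pel A (pel2 A) (root A) ==> mul m (mul m w) = mul m (pmap (mul m) w)" using assoc_sides(4,5) d by metis
 show "!!v :: 'v * 'x list. v \<in> pelu A ==> mul m (fop e (root A v), [v]) = v" using lunit_sides(4,5) d by metis
 show "!!v :: 'v * 'x list. v \<in> pelu A ==> mul m (units e A v) = v" using runit_sides(4,5) d by metis
qed

text \<open>A law concerns one operation at a time, and for that operation finitely many distinct
  labels suffice. It may thus be checked on finite sets of typed labels from a single infinite type;
  such sets will be objects of a slice.\<close>

lemma multicategory_I:
 fixes M :: "'v mcat"
 defines "R \<equiv> base M" and "A \<equiv> msig M" and "m \<equiv> mmul M" and "e \<equiv> munit M"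
 assumes md: "mcat_data R A m e" and s: "small R" "small (ops A)" and inf: "infinite (UNIV :: 'x set)"
  and 1: "!!X t (w :: 'v * ('v * ('v * 'x list) list) list). finite X ==> t ` X <= R ==>
    w \<in> pel A (pel A (pel A X t) (root A)) (root A) ==> mul m (mul m w) = mul m (pmap (mul m) w)"
  and 2: "!!X t (v :: 'v * 'x list). finite X ==> t ` X <= R ==> v \<in> pel A X t ==> mul m (fop e (root A v), [v]) = v"
  and 3: "!!X t (v :: 'v * 'x list). finite X ==> t ` X <= R ==> v \<in> pel A X t ==> mul m (units e A v) = v" shows "multicategory M"
proof -
 interpret mcat_data R A m e by (rule md)
 have gen: "\<exists>(zs :: 'x list) t. distinct zs & length zs = ar B b & (b, zs) \<in> pel B (set zs) t & finite (set zs) & t ` set zs <= set (bdl B b)"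
  if "b \<in> ops B" for b and B :: "('b, 'v) sig"
 proof -
  obtain zs :: "'x list" and t where "distinct zs" "length zs = length (bdl B b)" "map t zs = bdl B b" by (rule generic_labels[OF inf])
  then have "distinct zs & length zs = ar B b & (b, zs) \<in> pel B (set zs) t & finite (set zs) & t ` set zs <= set (bdl B b)"
   using that by (simp add: pel_def flip: set_map)
  then show ?thesis by (intro exI)
 qed
 have R: "set (bdl A a) <= R" if "a \<in> ops A" for a using sig_over_D[OF so that] by (auto simp: bdl_def)
 have Rt: "set (bdl (tensor B A) s) <= R" if s: "s \<in> ops (tensor B A)" for s and B :: "('b, 'v) sig"
 proof -
  obtain b as where e: "s = (b, as)" by (cases s)
  have "set as <= ops A" using pel_D(2)[OF s[unfolded ops_tensor]] e by simp
  then show ?thesis using R unfolding e tensor_simps(3)[OF s[unfolded e]] by fastforce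
 qed
 have "sig_comp R (tensor (tensor A A) A) m (tensor_mor (tensor A A) A m (sig_id R A)) = sig_comp R (tensor (tensor A A) A)
      (sig_comp R (tensor A (tensor A A)) m (tensor_mor A (tensor A A) (sig_id R A) m)) (assoc_mor R A A A)"
 proof (rule sigmor_eqI[OF assoc_sides(1-3)])
  fix s assume s: "s \<in> ops (tensor (tensor A A) A)"
  obtain zs :: "'x list" and t where zs: "distinct zs" "length zs = ar (tensor (tensor A A) A) s"
   "(s, zs) \<in> pel (tensor (tensor A A) A) (set zs) t" "t ` set zs <= R" using gen[OF s] Rt[OF s] by blast
  define w where "w = unflat A (unflat A (s, zs))"
  have w: "w \<in> pel A (pel A (pel A (set zs) t) (root A)) (root A)" unfolding w_def by (intro unflat_pel zs)
  have wu: "w \<in> pel A (pel2 A) (root A)" by (rule pel_mono[OF w]) (use pel_pel_pelu in blast)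
  have f: "flat (flat w) = (s, zs)" using unflat_pelu(2)[OF pel_pelu[OF zs(3)]] unflat_pelu(2)[OF pel_pelu[OF unflat_pel[OF zs(3)]]] unfolding w_def by simp
  show "EX zs :: 'x list. distinct zs & length zs = ar (tensor (tensor A A) A) s &
    act (sig_comp R (tensor (tensor A A) A) m (tensor_mor (tensor A A) A m (sig_id R A))) (s, zs) = act (sig_comp R (tensor (tensor A A) A)
      (sig_comp R (tensor A (tensor A A)) m (tensor_mor A (tensor A A) (sig_id R A) m)) (assoc_mor R A A A)) (s, zs)"
   using assoc_sides(4,5)[OF wu] 1[OF _ zs(4) w] zs(1,2) f by auto
 qed
 moreover have "sig_comp R (tensor (unit_sig R) A) m (tensor_mor (unit_sig R) A e (sig_id R A)) = lunit_mor R A"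
 proof (rule sigmor_eqI[OF lunit_sides(1-3)])
  fix s assume s: "s \<in> ops (tensor (unit_sig R) A)"
  obtain x as where e1: "s = (x, as)" by (cases s)
  have "x \<in> R" using pel_D(1)[OF s[unfolded ops_tensor]] e1 by simp
  then have as: "set as <= ops A" "map (%b. bd A b 0) as = [x]" using pel_D(2,3)[OF s[unfolded ops_tensor]] e1 by simp_all
  then obtain a where a: "as = [a]" "a \<in> ops A" "bd A a 0 = x" by (cases as) auto
  obtain zs :: "'x list" and t where zs: "distinct zs" "length zs = ar A a" "(a, zs) \<in> pel A (set zs) t" "t ` set zs <= R" using gen[OF a(2)] R[OF a(2)] by blast
  note v = pel_pelu[OF zs(3)]
  have f: "flat (root A (a, zs), [(a, zs)]) = (s, zs)" using e1 a by (simp add: flat_def)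
  show "EX zs :: 'x list. distinct zs & length zs = ar (tensor (unit_sig R) A) s &
   act (sig_comp R (tensor (unit_sig R) A) m (tensor_mor (unit_sig R) A e (sig_id R A))) (s, zs) = act (lunit_mor R A) (s, zs)"
   using lunit_sides(4,5)[OF v] 2[OF _ zs(4,3)] zs(1,2) f tensor_simps(1)[OF s[unfolded e1]] e1 a by auto
 qed
 moreover have "sig_comp R (tensor A (unit_sig R)) m (tensor_mor A (unit_sig R) (sig_id R A) e) = runit_mor R A"
 proof (rule sigmor_eqI[OF runit_sides(1-3)])
  fix s assume s: "s \<in> ops (tensor A (unit_sig R))"
  obtain a xs where e1: "s = (a, xs)" by (cases s)
  note d = pel_D[OF s[unfolded ops_tensor], unfolded e1 fst_conv snd_conv]
  have xs: "xs = bdl A a" "sum_list (map (ar (unit_sig R)) xs) = length xs"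
  proof -
   have "map (%b. bd (unit_sig R) b 0) xs = xs" by (rule map_idI) (use d(2) in auto)
   then show "xs = bdl A a" using d(3) by simp
   show "sum_list (map (ar (unit_sig R)) xs) = length xs" using d(2) by (induction xs) auto
  qed
  obtain zs :: "'x list" and t where zs: "distinct zs" "length zs = ar A a" "(a, zs) \<in> pel A (set zs) t" "t ` set zs <= R" using gen[OF d(1)] R[OF d(1)] by blast
  note v = pel_pelu[OF zs(3)]
  show "EX zs :: 'x list. distinct zs & length zs = ar (tensor A (unit_sig R)) s &
   act (sig_comp R (tensor A (unit_sig R)) m (tensor_mor A (unit_sig R) (sig_id R A) e)) (s, zs) = act (runit_mor R A) (s, zs)"
   using runit_sides(4,5)[OF v] 3[OF _ zs(4,3)] zs(1,2) xs tensor_simps(1)[OF s[unfolded e1]] d(4) e1 by (intro exI[of _ zs]) simp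
 qed
 ultimately show ?thesis unfolding multicategory_def Let_def R_def[symmetric] A_def[symmetric] m_def[symmetric] e_def[symmetric] using s so m fm e fe by blast
qed

text \<open>The same reduction for morphisms: the multiplication law is used for arbitrary labels
  and established by testing on finite sets of typed ones. The unit law is a plain equation of
  operations, since a single input cannot be permuted.\<close>

lemma multicat_mor_iff:
 fixes M N :: "'v mcat"
 defines "R \<equiv> base M" and "A \<equiv> msig M" and "B \<equiv> msig N"
 assumes M: "mcat_data R A (mmul M) (munit M)" and N: "mcat_data (base N) B (mmul N) (munit N)"
 shows "!!w :: 'v * ('v * 'x list) list. multicat_mor M N ph ==> w \<in> pel2 A ==> act ph (mul (mmul M) w) = mul (mmul N) (act ph (pmap (act ph) w))"
  "!!x. multicat_mor M N ph ==> x \<in> R ==> fop ph (fop (munit M) x) = fop (munit N) (fob ph x)" "multicat_mor M N ph ==> sig_mor R A (base N) B ph"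
  "infinite (UNIV :: 'y set) ==> sig_mor R A (base N) B ph ==> (!!X t (w :: 'v * ('v * 'y list) list). finite X ==> t ` X <= R ==> w \<in> pel A (pel A X t) (root A) ==>
    act ph (mul (mmul M) w) = mul (mmul N) (act ph (pmap (act ph) w))) ==>
   (!!x. x \<in> R ==> fop ph (fop (munit M) x) = fop (munit N) (fob ph x)) ==> multicat_mor M N ph"
proof -
 interpret M: mcat_data R A "mmul M" "munit M" by (rule M)
 interpret N: mcat_data "base N" B "mmul N" "munit N" by (rule N)
 let ?l = "sig_comp R (tensor A A) ph (mmul M)" and ?r = "sig_comp R (tensor A A) (mmul N) (tensor_mor A A ph ph)"
 let ?l1 = "sig_comp R (unit_sig R) ph (munit M)" and ?r1 = "sig_comp R (unit_sig R) (munit N) (unit_mor R (fob ph))"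
 have d: "multicat_mor M N ph <-> sig_mor R A (base N) B ph & ?l = ?r & ?l1 = ?r1" unfolding multicat_mor_def Let_def R_def A_def B_def ..
 have 1: "premor (tensor A A) ?l & premor (tensor A A) ?r & fob ?l = fob ?r & premor (unit_sig R) ?l1 & premor (unit_sig R) ?r1 & fob ?l1 = fob ?r1 &
  (ALL x:R. fop ?l1 x = fop ph (fop (munit M) x) & fop ?r1 x = fop (munit N) (fob ph x))" if p: "sig_mor R A (base N) B ph"
 proof -
  note pd = sig_mor_D[OF p]
  have m0: "ALL a:ops (tensor A A). fop (mmul M) a \<in> ops A & ar A (fop (mmul M) a) = ar (tensor A A) a"
   and e0: "ALL a:ops (unit_sig R). fop (munit M) a \<in> ops A & ar A (fop (munit M) a) = ar (unit_sig R) a" using sig_mor_D(2,3)[OF M.m] sig_mor_D(2,3)[OF M.e] by auto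
  note cl = premor_comp[OF sig_mor_D(1)[OF M.m] pd(1) m0, where R = R]
  note t = tensor_mor_act[OF p pd(1)]
  note cr = premor_comp[OF t(1) sig_mor_D(1)[OF N.m] tensor_mor_ops[OF p p refl], where R = R]
  have u: "fob ph x \<in> base N" if "x \<in> R" for x using p that unfolding sig_mor_def by auto
  note cl1 = premor_comp[OF sig_mor_D(1)[OF M.e] pd(1) e0, where R = R]
  have pu: "premor (unit_sig R) (unit_mor R (fob ph))" by (rule premor_id_perm) (simp_all add: unit_mor_def)
  have u0: "ALL a:ops (unit_sig R). fop (unit_mor R (fob ph)) a \<in> ops (unit_sig (base N)) & ar (unit_sig (base N)) (fop (unit_mor R (fob ph)) a) = ar (unit_sig R) a"
   using u by (simp add: unit_mor_def)
  note cr1 = premor_comp[OF pu sig_mor_D(1)[OF N.e] u0, where R = R]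
  have "fop ?l1 x = fop ph (fop (munit M) x) & fop ?r1 x = fop (munit N) (fob ph x)" if x: "x \<in> R" for x using x by (simp add: sig_comp_def compose_def unit_mor_def)
  moreover have "fob ?l = fob ?r" using M.fm N.fm u p unfolding sig_mor_def by (auto simp: sig_comp_def tensor_mor_def compose_def fun_eq_iff)
  moreover have "fob ?l1 = fob ?r1" using M.fe N.fe u p unfolding sig_mor_def by (auto simp: sig_comp_def unit_mor_def compose_def fun_eq_iff)
  ultimately show ?thesis using cl(1) cr(1) cl1(1) cr1(1) by blast
 qed
 have 2: "act ?l (flat w) = act ph (mul (mmul M) w) & act ?r (flat w) = mul (mmul N) (act ph (pmap (act ph) w))"
  if p: "sig_mor R A (base N) B ph" and w: "w \<in> pel2 A" for w :: "'v * ('v * 'z list) list"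
 proof -
  note pd = sig_mor_D[OF p]
  have m0: "ALL a:ops (tensor A A). fop (mmul M) a \<in> ops A & ar A (fop (mmul M) a) = ar (tensor A A) a" using sig_mor_D(2,3)[OF M.m] by auto
  note cl = premor_comp[OF sig_mor_D(1)[OF M.m] pd(1) m0, where R = R]
  note t = tensor_mor_act[OF p pd(1)]
  note cr = premor_comp[OF t(1) sig_mor_D(1)[OF N.m] tensor_mor_ops[OF p p refl], where R = R]
  show ?thesis using cl(2)[OF flat_pelu(1)[OF w]] cr(2)[OF flat_pelu(1)[OF w]] t(2)[OF w] by (simp add: mul_def)
 qed
 show 3: "multicat_mor M N ph ==> sig_mor R A (base N) B ph" using d by blast
 show "!!w :: 'v * ('v * 'x list) list. multicat_mor M N ph ==> w \<in> pel2 A ==> act ph (mul (mmul M) w) = mul (mmul N) (act ph (pmap (act ph) w))" using 2 d by metis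
 show "!!x. multicat_mor M N ph ==> x \<in> R ==> fop ph (fop (munit M) x) = fop (munit N) (fob ph x)" using 1 d by metis
 assume inf: "infinite (UNIV :: 'y set)" and p: "sig_mor R A (base N) B ph"
  and h: "!!X t (w :: 'v * ('v * 'y list) list). finite X ==> t ` X <= R ==> w \<in> pel A (pel A X t) (root A) ==>
    act ph (mul (mmul M) w) = mul (mmul N) (act ph (pmap (act ph) w))" and h1: "!!x. x \<in> R ==> fop ph (fop (munit M) x) = fop (munit N) (fob ph x)"
 note p1 = 1[OF p]
 have "?l1 = ?r1"
 proof (rule sigmor_eqI)
  fix x assume "x \<in> ops (unit_sig R)"
  then have x: "x \<in> R" by simp
  have "premor (unit_sig R) ?l1" "premor (unit_sig R) ?r1" "fop ?l1 x = fop ?r1 x" using p1 x h1 by simp_all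
  \<comment> \<open>Unit operations have one input, so a single label is a list of distinct labels
    and the type \<open>unit\<close> is large enough.\<close>
  then show "EX zs :: unit list. distinct zs & length zs = ar (unit_sig R) x & act ?l1 (x, zs) = act ?r1 (x, zs)" using x by (intro exI[of _ "[()]"]) (simp add: act_unit)
 qed (use p1 in blast)+
 moreover have "?l = ?r"
 proof (rule sigmor_eqI)
  fix s assume s: "s \<in> ops (tensor A A)"
  obtain zs :: "'y list" and t where zs: "distinct zs" "length zs = length (bdl (tensor A A) s)" "map t zs = bdl (tensor A A) s" by (rule generic_labels[OF inf])
  then have z: "(s, zs) \<in> pel (tensor A A) (set zs) t" using s by (simp add: pel_def)
  obtain a as where e: "s = (a, as)" by (cases s)
  have as: "set as <= ops A" using pel_D(2)[OF s[unfolded ops_tensor]] e by simp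
  have "set (bdl A a) <= R" if "a \<in> ops A" for a using sig_over_D[OF M.so that] by (auto simp: bdl_def)
  then have "set (bdl (tensor A A) s) <= R" using as unfolding e tensor_simps(3)[OF s[unfolded e]] by fastforce
  then have t: "t ` set zs <= R" using zs(3) by (simp flip: set_map)
  have w: "unflat A (s, zs) \<in> pel A (pel A (set zs) t) (root A)" by (rule unflat_pel[OF z])
  show "EX zs :: 'y list. distinct zs & length zs = ar (tensor A A) s & act ?l (s, zs) = act ?r (s, zs)"
   using 2[OF p pel_pel_pelu[OF w]] h[OF _ t w] zs(1,2) unflat_pelu(2)[OF pel_pelu[OF z]] by (intro exI[of _ zs]) simp
 qed (use p1 in blast)+
 ultimately show "multicat_mor M N ph" using d p by blast
qed

section \<open>The category of multicategories\<close>

lemma MultC_simps: "Obj MultC = {M :: 'v mcat. multicategory M}" "Src MultC F = fst (F :: 'v mcarr)" "Tgt MultC F = snd (snd F)"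
 "Idn MultC M = ((M :: 'v mcat), sig_id (base M) (msig M), M)" "Cmp MultC ((N' :: 'v mcat), ps, P) (M, ph, N) = (M, sig_comp (base M) (msig M) ps ph, P)"
 unfolding MultC_def by (auto split: prod.splits)

lemma Hom_MultC: "F \<in> Hom MultC (M :: 'v mcat) N <-> multicategory M & multicategory N & (EX ph. F = (M, ph, N) & multicat_mor M N ph)"
 unfolding Hom_def by (cases F) (auto simp: MultC_def)

context universe
begin

lemma multicat_mor_comp:
 fixes M N P :: "'v mcat" assumes M: "multicategory M" and N: "multicategory N" and P: "multicategory P" and p: "multicat_mor M N ph" and q: "multicat_mor N P ps"
 shows "multicat_mor M P (sig_comp (base M) (msig M) ps ph)"
proof -
 note Md = multicategory_D[OF M] and Nd = multicategory_D[OF N] and Pd = multicategory_D[OF P]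
 interpret M: mcat_data "base M" "msig M" "mmul M" "munit M" by (rule Md(1))
 note pd = multicat_mor_iff(1-3)[OF Md(1) Nd(1)] and qd = multicat_mor_iff(1-3)[OF Nd(1) Pd(1)]
 note ps = pd(3)[OF p] and qs = qd(3)[OF q]
 note c = sig_comp_mor[OF M.so ps qs]
 show ?thesis
 proof (rule multicat_mor_iff(4)[OF Md(1) Pd(1) infinite_UNIV c(1)])
  fix X :: "'v set" and t w assume w0: "w \<in> pel (msig M) (pel (msig M) X t) (root (msig M))"
  note w = pel_pel_pelu[OF w0]
  have "mul (mmul M) w \<in> pelu (msig M)" unfolding mul_def by (rule act_pelu[OF M.m flat_pelu(1)[OF w]])
  then have "act (sig_comp (base M) (msig M) ps ph) (mul (mmul M) w) = act ps (mul (mmul N) (act ph (pmap (act ph) w)))"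
   using c(2)[of "mul (mmul M) w"] pd(1)[OF p w] by simp
  also have "... = mul (mmul P) (act ps (pmap (act ps) (act ph (pmap (act ph) w))))"
  proof (rule qd(1)[OF q])

   have "act ph w \<in> pel (msig N) (pelu (msig M)) (fob ph o root (msig M))" by (rule act_pel[OF ps w])
   then have "pmap (act ph) (act ph w) \<in> pel (msig N) (pelu (msig N)) (root (msig N))"
   proof (rule pmap_pel)
    fix y :: "'v * 'v list" assume y: "y \<in> pelu (msig M)"
    show "act ph y \<in> pelu (msig N) & root (msig N) (act ph y) = (fob ph o root (msig M)) y" using act_pelu[OF ps y] sig_mor_D(6)[OF ps pelu_D(1)[OF y]] by simp
   qed
   then show "act ph (pmap (act ph) w) \<in> pel (msig N) (pelu (msig N)) (root (msig N))" using act_pmap[OF sig_mor_D(1)[OF ps] pel_pelu[OF w], of "act ph"] by simp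
  qed
  also have "pmap (act ps) (act ph (pmap (act ph) w)) = act ph (pmap (act (sig_comp (base M) (msig M) ps ph)) w)"
  proof -
   have "pmap (act ps) (act ph (pmap (act ph) w)) = act ph (pmap (act ps o act ph) w)"
    using act_pmap[OF sig_mor_D(1)[OF ps] pmap_pelu[OF pel_pelu[OF w]], of "act ps" "act ph"] by (simp add: pmap_comp)
   also have "pmap (act ps o act ph) w = pmap (act (sig_comp (base M) (msig M) ps ph)) w" by (rule pmap_cong) (simp add: c(2) subsetD[OF pel_D(2)[OF w]])
   finally show ?thesis .
  qed
  also have "act ps (act ph (pmap (act (sig_comp (base M) (msig M) ps ph)) w)) = act (sig_comp (base M) (msig M) ps ph) (pmap (act (sig_comp (base M) (msig M) ps ph)) w)"
   by (rule c(2)[OF pmap_pelu[OF pel_pelu[OF w]], symmetric])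
  finally show "act (sig_comp (base M) (msig M) ps ph) (mul (mmul M) w) =
   mul (mmul P) (act (sig_comp (base M) (msig M) ps ph) (pmap (act (sig_comp (base M) (msig M) ps ph)) w))" .
 next
  fix x assume x: "x \<in> base M"
  have "fop (munit M) x \<in> ops (msig M)" using sig_mor_D(2)[OF M.e] x by simp
  moreover have "fob ph x \<in> base N" using ps x unfolding sig_mor_def by auto
  ultimately show "fop (sig_comp (base M) (msig M) ps ph) (fop (munit M) x) = fop (munit P) (fob (sig_comp (base M) (msig M) ps ph) x)"
   using pd(2)[OF p x] qd(2)[OF q] x by (simp add: sig_comp_def compose_def)
 qed
qed

lemma multicat_mor_id:
 fixes M :: "'v mcat" assumes M: "multicategory M" shows "multicat_mor M M (sig_id (base M) (msig M))"
proof -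
 note Md = multicategory_D[OF M]
 interpret M: mcat_data "base M" "msig M" "mmul M" "munit M" by (rule Md(1))
 show ?thesis
 proof (rule multicat_mor_iff(4)[OF Md(1) Md(1) infinite_UNIV M.sid(1)])
  fix X :: "'v set" and t w assume "w \<in> pel (msig M) (pel (msig M) X t) (root (msig M))"
  note w = pel_pel_pelu[OF this]
  have "mul (mmul M) w \<in> pelu (msig M)" unfolding mul_def by (rule act_pelu[OF M.m flat_pelu(1)[OF w]])
  moreover have "pmap (act (sig_id (base M) (msig M))) w = w" by (rule pmap_ident) (use sig_id_pre(2) pel_D(2)[OF w] in blast)
  ultimately show "act (sig_id (base M) (msig M)) (mul (mmul M) w) = mul (mmul M) (act (sig_id (base M) (msig M)) (pmap (act (sig_id (base M) (msig M))) w))"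
   using sig_id_pre(2)[of "mul (mmul M) w"] sig_id_pre(2)[OF pel_pelu[OF w]] by simp
 next
  fix x assume x: "x \<in> base M"
  then show "fop (sig_id (base M) (msig M)) (fop (munit M) x) = fop (munit M) (fob (sig_id (base M) (msig M)) x)"
   using sig_mor_D(2)[OF M.e, of x] by (simp add: sig_id_def)
 qed
qed

lemma category_MultC: "category MU"
proof
 fix F assume "F \<in> Arr MU"
 then show "Src MultC F \<in> Obj MultC" "Tgt MultC F \<in> Obj MultC" by (auto simp: MultC_def)
next
 fix M assume "M \<in> Obj MU"
 then show "Idn MultC M \<in> Hom MultC M M" using multicat_mor_id by (simp add: Hom_MultC MultC_simps)
next
 fix F M N G P assume "F \<in> Hom MU M N" "G \<in> Hom MultC N P"
 then show "G *[MultC] F \<in> Hom MultC M P" using multicat_mor_comp by (auto simp: Hom_MultC MultC_simps)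
next
 fix F M N assume "F \<in> Hom MU M N"
 then obtain ph where f: "F = (M, ph, N)" "multicategory M" "multicategory N" "multicat_mor M N ph" by (auto simp: Hom_MultC)
 note s = multicat_mor_iff(3)[OF multicategory_D(1)[OF f(2)] multicategory_D(1)[OF f(3)] f(4)]
 note d = sig_mor_D[OF s] and s' = s[unfolded sig_mor_def]
 have "sig_comp (base M) (msig M) ph (sig_id (base M) (msig M)) = ph"
  using s' by (cases ph) (auto simp: sig_comp_def sig_id_def compose_def fun_eq_iff PiE_iff extensional_def)
 moreover have "sig_comp (base M) (msig M) (sig_id (base N) (msig N)) ph = ph"
  using s' d(2) by (cases ph) (auto simp: sig_comp_def sig_id_def compose_def fun_eq_iff PiE_iff extensional_def)
 ultimately show "F *[MultC] Idn MultC M = F" "Idn MultC N *[MultC] F = F" by (simp_all add: f(1) MultC_simps)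
next
 fix M N P Q F G H assume a: "F \<in> Hom MU M N" "G \<in> Hom MultC N P" "H \<in> Hom MultC P Q"
 obtain ph where f: "F = (M, ph, N)" "multicategory M" "multicategory N" "multicat_mor M N ph" using a by (auto simp: Hom_MultC)
 obtain ps where g: "G = (N, ps, P)" using a by (auto simp: Hom_MultC)
 obtain ch where h: "H = (P, ch, Q)" using a by (auto simp: Hom_MultC)
 have s: "sig_mor (base M) (msig M) (base N) (msig N) ph" by (rule multicat_mor_iff(3)[OF multicategory_D(1)[OF f(2)] multicategory_D(1)[OF f(3)] f(4)])
 have "sig_comp (base M) (msig M) (sig_comp (base N) (msig N) ch ps) ph = sig_comp (base M) (msig M) ch (sig_comp (base M) (msig M) ps ph)"
  using s unfolding sig_mor_def by (auto simp: sig_comp_def compose_def fun_eq_iff PiE_iff)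
 then show "(H *[MultC] G) *[MultC] F = H *[MultC] G *[MultC] F" by (simp add: f(1) g h MultC_simps)
qed

end

section \<open>The polynomial monad of a multicategory\<close>

text \<open>Lets limits of a polynomial functor be computed separately in each label
  position.\<close>

lemma list_lift: assumes "!!k. k < n ==> EX! c. c \<in> W & Q k c" shows "EX! zs. length zs = n & set zs <= W & (ALL k<n. Q k (zs ! k))"
proof -
 define c where "c k = (THE c. c \<in> W & Q k c)" for k
 have c: "c k \<in> W" "Q k (c k)" if "k < n" for k using theI'[OF assms[OF that]] unfolding c_def by auto
 show ?thesis
 proof (rule ex1I[of _ "map c [0..<n]"])
  show "length (map c [0..<n]) = n & set (map c [0..<n]) <= W & (ALL k<n. Q k (map c [0..<n] ! k))" using c by auto
  fix zs assume z: "length zs = n & set zs <= W & (ALL k<n. Q k (zs ! k))"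
  have "zs ! k = c k" if "k < n" for k
  proof -
   have "zs ! k \<in> W & Q k (zs ! k)" using z that nth_mem[of k zs] by auto
   then show ?thesis using assms[OF that] c[OF that] by blast
  qed
  then show "zs = map c [0..<n]" using z by (intro nth_equalityI) auto
 qed
qed

text \<open>The boundary is pushed forward along \<open>u\<close>. On polynomial functors this is
  the functor of \<open>A\<close> sandwiched between \<open>u^*\<close> and its left adjoint:
  labelling \<open>A\<close> in a pullback amounts to labelling \<open>relab u A\<close> in the
  original object (\<open>pel_relab\<close>, \<open>lift_pel\<close>).\<close>

definition relab :: "('o => 'q) => ('a, 'o) sig => ('a, 'q) sig" where "relab u A = \<lparr>ops = ops A, ar = ar A, bd = (%a i. u (bd A a i))\<rparr>"

lemma relab_simps [simp]: "ops (relab u A) = ops A" "ar (relab u A) = ar A" "bd (relab u A) a i = u (bd A a i)"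
 "bdl (relab u A) a = map u (bdl A a)" "pelu (relab u A) = pelu A" unfolding relab_def bdl_def pelu_def by auto

definition pob :: "'v set => ('v, 'v) sig => 'v fn => 'v fn" where "pob R A x = (let P = enc ` pE A x in (P, \<lambda>z\<in>P. root A (dec z), R))"

abbreviation "pobM M \<equiv> pob (base M) (msig M)"

definition pfun :: "'v set => ('v, 'v) sig => ('v fn, 'v sarr, 'v fn, 'v sarr) fctr" where "pfun R A = mk_functor R (pob R A) (%f z. enc (pmap (ap f) (dec z)))"

abbreviation "pO R A \<equiv> omap (pfun R A)"
abbreviation "pA R A \<equiv> amap (pfun R A)"
abbreviation "pV R A f \<equiv> ap (pA R A f)"

definition pmnd :: "'v mcat => ('v fn, 'v sarr) mnd" where "pmnd M = (let R = base M; A = msig M in \<lparr>mfun = pfun R A,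
  eta = (\<lambda>x\<in>OB R. slice_map x (%z. enc (fop (munit M) (fn x z), [z])) (pob R A x)),
  mu = (\<lambda>x\<in>OB R. slice_map (pob R A (pob R A x)) (%w. enc (mul (mmul M) (pmap dec (dec w)))) (pob R A x))\<rparr>)"

text \<open>Inverse to forgetting the first components of labels in a pullback: for a typed
  labelling these components are the boundary of the operation.\<close>

definition lift :: "('a, 'v) sig => 'a * 'v list => 'a * 'v list" where "lift A v = (fst v, map vpair (zip (bdl A (fst v)) (snd v)))"

text \<open>The first components of the labels are dropped, as the boundary determines them, and
  \<open>ph\<close> acts on the rest. The first component of the value has to be the output of the
  operation in \<open>M\<close>.\<close>

definition fmor :: "'v mcat => 'v mcat => ('v, 'v, 'v, 'v) sigmor => 'v fn => 'v sarr" where "fmor M N ph = (let u = (base M, fob ph, base N) in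
  (\<lambda>x\<in>OB (base N). slice_map (pobM M (pb u x)) (%z. vpair (root (msig M) (dec z), enc (act ph (pmap vsnd (dec z))))) (pb u (pobM N x))))"

locale vsig = universe V for V :: "'v itself" +
 fixes R :: "'v set" and A :: "('v, 'v) sig" assumes sR: "small R" and sA: "small (ops A)" and so: "sig_over R A"
begin

lemma car_pob: "z \<in> car (pob R A x) <-> (EX v:pE A x. z = enc v)" unfolding pob_def Let_def by auto

lemma enc_car_pob [simp]: "enc v \<in> car (pob R A x) <-> v \<in> pE A x" by (auto simp: car_pob)

lemma dec_pob: "z \<in> car (pob R A x) ==> dec z \<in> pE A x" "z \<in> car (pob R A x) ==> enc (dec z) = z" by (auto simp: car_pob)

lemma ty_pob: "z \<in> car (pob R A x) ==> fn (pob R A x) z = root A (dec z)" unfolding pob_def Let_def by auto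

lemma pob_OB: "x \<in> OB R ==> pob R A x \<in> OB R"
proof -
 assume x: "x \<in> OB R"
 have "pE A x <= ops A \<times> lists (car x)" unfolding pel_def by auto
 then have "enc ` pE A x <= enc ` (ops A \<times> lists (car x))" by blast
 then have "small (enc ` pE A x)" using small_mono[OF small_enc[OF sA OB_D(2)[OF x]]] by blast
 then show ?thesis unfolding pob_def Let_def by (rule OB_I[OF _ sR]) (auto simp: sig_over_D[OF so] pel_def)
qed

lemma pmap_pob: assumes "f \<in> HOM R x y" "v \<in> pE A x" shows "pmap (ap f) v \<in> pE A y" by (rule pmap_pel[OF assms(2)]) (use HOM_D(6,7)[OF assms(1)] in auto)

lemma pfun_functor: "sF R R (pfun R A)" unfolding pfun_def
proof (rule mk_functor_is_functor)
 fix f x y t assume f: "f \<in> HOM R x y" and t: "t \<in> car (pob R A x)"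
 note p = pmap_pob[OF f dec_pob(1)[OF t]]
 then show "enc (pmap (ap f) (dec t)) \<in> car (pob R A y) & fn (pob R A y) (enc (pmap (ap f) (dec t))) = fn (pob R A x) t"
  using ty_pob[of "enc (pmap (ap f) (dec t))" y] ty_pob[OF t] by simp
next
 fix x t assume x: "x \<in> OB R" and t: "t \<in> car (pob R A x)"
 have "pmap (ap (iO R x)) (dec t) = dec t" by (rule pmap_ident) (use Idn_HOM(2)[OF x] pel_D(2)[OF dec_pob(1)[OF t]] in auto)
 then show "enc (pmap (ap (iO R x)) (dec t)) = t" using dec_pob(2)[OF t] by simp
next
 fix f g x y z t assume f: "f \<in> HOM R x y" and g: "g \<in> HOM R y z" and t: "t \<in> car (pob R A x)"
 have "pmap (ap (g \<cdot>[R] f)) (dec t) = pmap (ap g o ap f) (dec t)" by (rule pmap_cong) (use Cmp_HOM(2)[OF f g] pel_D(2)[OF dec_pob(1)[OF t]] in auto)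
 then show "enc (pmap (ap (g \<cdot>[R] f)) (dec t)) = enc (pmap (ap g) (dec (enc (pmap (ap f) (dec t)))))" by (simp add: pmap_comp)
qed (rule pob_OB)

lemma omap_pfun [simp]: "x \<in> OB R ==> pO R A x = pob R A x" unfolding pfun_def by simp

lemma ap_pfun: "f \<in> HOM R x y ==> t \<in> car (pob R A x) ==> pV R A f t = enc (pmap (ap f) (dec t))" unfolding pfun_def by (rule ap_amap_mk)

lemma ap_pfun_enc: "f \<in> HOM R x y ==> v \<in> pE A x ==> pV R A f (enc v) = enc (pmap (ap f) v)" using ap_pfun[of f x y "enc v"] by simp

lemma amap_pfun: "f \<in> HOM R x y ==> pA R A f \<in> HOM R (pob R A x) (pob R A y)" using functor_D(2)[OF pfun_functor] omap_pfun HOM_D(1,2) by metis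

text \<open>Arrows of the slice preserve types, so a labelling in the carrier of \<open>x\<close> is
  well typed as soon as its image is.\<close>

lemma pel_from_typed: assumes f: "f \<in> HOM R x y" and zs: "length zs = ar A a" "set zs <= car x" and v: "(a, map (ap f) zs) \<in> pE A y" shows "(a, zs) \<in> pE A x"
proof -
 have "map (fn x) zs = map (fn y) (map (ap f) zs)" using HOM_D(7)[OF f] zs(2) by auto
 also have "... = bdl A a" using pel_D(3)[OF v] by (simp only: fst_conv snd_conv)
 finally show ?thesis using v zs by (simp add: pel_def)
qed

text \<open>Relabelling keeps the operation, so along a cone only the labels vary, and the limit is
  formed in each input position separately.\<close>

lemma pfun_wide_pullbacks: assumes "is_wide_pullback I (SO R) f y p d" shows "is_wide_pullback I (SO R) (%i. pA R A (f i)) (pO R A y) (%i. pA R A (p i)) (pA R A d)"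
proof -
 define w where "w = fst d"
 define x where "x i = fst (f i)" for i
 note wp = assms[unfolded is_wide_pullback_def, simplified]
 have d: "d \<in> HOM R w y" using wp by (simp add: Hom_iff w_def)
 have f0: "ALL i:I. f i \<in> HOM R (x i) y" and p0: "ALL i:I. p i \<in> HOM R w (x i)" using wp by (simp_all add: Hom_iff[of "f _"] w_def x_def)
 note f = f0[rule_format] and p = p0[rule_format]
 note y = HOM_D(2)[OF d] and ww = HOM_D(1)[OF d]
 note E = assms[unfolded wide_pullback_iff[OF y d f0 p0]]
 have Px: "ALL i:I. pA R A (f i) \<in> HOM R (pob R A (x i)) (pob R A y)" "ALL i:I. pA R A (p i) \<in> HOM R (pob R A w) (pob R A (x i))" using amap_pfun f p by blast+
 show ?thesis unfolding omap_pfun[OF y] wide_pullback_iff[OF pob_OB[OF y] amap_pfun[OF d] Px]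
 proof (intro conjI ballI allI impI)
  fix i c assume i: "i \<in> I" and c: "c \<in> car (pob R A w)"
  note v = dec_pob(1)[OF c]
  have "pmap (ap (f i) o ap (p i)) (dec c) = pmap (ap d) (dec c)" by (rule pmap_cong) (use E i pel_D(2)[OF v] in auto)
  then show "ap (pA R A (f i)) (ap (pA R A (p i)) c) = pV R A d c"
   using ap_pfun[OF p[OF i] c] ap_pfun[OF d c] ap_pfun_enc[OF f[OF i] pmap_pob[OF p[OF i] v]] by (simp add: pmap_comp)
 next
  fix b a assume b: "b \<in> car (pob R A y)" and a: "ALL i:I. a i \<in> car (pob R A (x i)) & ap (pA R A (f i)) (a i) = b"
  obtain ob bs where bv: "dec b = (ob, bs)" by (cases "dec b")
  note bp = dec_pob[OF b, unfolded bv] and bd = pel_D[OF dec_pob(1)[OF b], unfolded bv fst_conv snd_conv]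
  have ai: "dec (a i) \<in> pE A (x i)" "fst (dec (a i)) = ob" "map (ap (f i)) (snd (dec (a i))) = bs" "length (snd (dec (a i))) = ar A ob" if i: "i \<in> I" for i
  proof -
   have c: "a i \<in> car (pob R A (x i))" "ap (pA R A (f i)) (a i) = b" using a i by auto
   show "dec (a i) \<in> pE A (x i)" by (rule dec_pob(1)[OF c(1)])
   have "enc (pmap (ap (f i)) (dec (a i))) = enc (ob, bs)" using ap_pfun[OF f[OF i] c(1)] c(2) bp by simp
   then have e: "pmap (ap (f i)) (dec (a i)) = (ob, bs)" by (simp only: enc_eq)
   show "fst (dec (a i)) = ob" "map (ap (f i)) (snd (dec (a i))) = bs" using arg_cong[OF e, of fst] arg_cong[OF e, of snd] by simp_all
   then show "length (snd (dec (a i))) = ar A ob" using bd(4) by (metis length_map)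
  qed
  \<comment> \<open>All the \<open>a i\<close> share the operation \<open>ob\<close> of
    \<open>b\<close>; in every position their labels form a compatible family, which the given wide
    pullback solves uniquely.\<close>
  have "EX! zs. length zs = ar A ob & set zs <= car w & (ALL k<ar A ob. ap d (zs ! k) = bs ! k & (ALL i:I. ap (p i) (zs ! k) = snd (dec (a i)) ! k))"
  proof (rule list_lift)
   fix k assume k: "k < ar A ob"
   have "bs ! k \<in> car y" using bd(2,4) k by auto
   moreover have "snd (dec (a i)) ! k \<in> car (x i) & ap (f i) (snd (dec (a i)) ! k) = bs ! k" if i: "i \<in> I" for i
    using ai[OF i] pel_D(2)[OF ai(1)[OF i]] k nth_map[of k "snd (dec (a i))" "ap (f i)"] by auto
   ultimately show "EX! c. c \<in> car w & ap d c = bs ! k & (ALL i:I. ap (p i) c = snd (dec (a i)) ! k)"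
    using conjunct2[OF E, rule_format, of "bs ! k" "%i. snd (dec (a i)) ! k"] by simp
  qed
  then obtain zs where zs: "length zs = ar A ob" "set zs <= car w"
    "!!k. k < ar A ob ==> ap d (zs ! k) = bs ! k" "!!k i. k < ar A ob ==> i \<in> I ==> ap (p i) (zs ! k) = snd (dec (a i)) ! k"
   and un: "!!zs'. length zs' = ar A ob ==> set zs' <= car w ==>
    ALL k<ar A ob. ap d (zs' ! k) = bs ! k & (ALL i:I. ap (p i) (zs' ! k) = snd (dec (a i)) ! k) ==> zs' = zs" by (elim ex1E) blast
  have mb: "map (ap d) zs = bs" by (rule nth_equalityI) (use zs bd(4) in auto)
  have ma: "map (ap (p i)) zs = snd (dec (a i))" if "i \<in> I" for i by (rule nth_equalityI) (use zs ai(4)[OF that] that in auto)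
  have zp: "(ob, zs) \<in> pE A w" by (rule pel_from_typed[OF d zs(1,2)]) (use bp mb in simp)
  show "EX! c. c \<in> car (pob R A w) & pV R A d c = b & (ALL i:I. ap (pA R A (p i)) c = a i)"
  proof (rule ex1I[of _ "enc (ob, zs)"], intro conjI ballI)
   show "enc (ob, zs) \<in> car (pob R A w)" using zp by simp
   show "pV R A d (enc (ob, zs)) = b" using ap_pfun_enc[OF d zp] mb bp(2) by (simp add: pmap_def)
   fix i assume i: "i \<in> I"
   have "pmap (ap (p i)) (ob, zs) = dec (a i)" using ma[OF i] ai(2)[OF i] by (simp add: pmap_def) (metis prod.collapse)
   then show "ap (pA R A (p i)) (enc (ob, zs)) = a i" using ap_pfun_enc[OF p[OF i] zp] a i dec_pob(2)[of "a i" "x i"] by auto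
  next
   fix c assume c: "c \<in> car (pob R A w) & pV R A d c = b & (ALL i:I. ap (pA R A (p i)) c = a i)"
   then have cc: "c \<in> car (pob R A w)" by simp
   obtain oc cs where cv: "dec c = (oc, cs)" by (cases "dec c")
   note cd = pel_D[OF dec_pob(1)[OF cc], unfolded cv fst_conv snd_conv]
   have "enc (pmap (ap d) (dec c)) = enc (ob, bs)" using c ap_pfun[OF d cc] bp(2) by simp
   then have 1: "oc = ob" "map (ap d) cs = bs" unfolding cv by (simp_all add: pmap_def)
   have 2: "map (ap (p i)) cs = snd (dec (a i))" if i: "i \<in> I" for i using c ap_pfun[OF p[OF i] cc] i by (metis cv dec_enc snd_conv snd_pmap)
   have "cs = zs"
   proof (rule un)
    show "ALL k<ar A ob. ap d (cs ! k) = bs ! k & (ALL i:I. ap (p i) (cs ! k) = snd (dec (a i)) ! k)" using 1 2 cd(4) by (metis nth_map)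
   qed (use cd 1 in auto)
   then show "c = enc (ob, zs)" using dec_pob(2)[OF cc] cv 1 by simp
  qed
 qed
qed

text \<open>A pullback is a wide pullback over the booleans, and the index type of
  \<open>pfun_wide_pullbacks\<close> is arbitrary.\<close>

lemma pfun_pullbacks: "preserves_pullbacks (SO R) (SO R) (pfun R A)" unfolding preserves_pullbacks_def
proof (intro allI impI)
 fix f g p q assume pb: "is_pullback (SO R) f g p q"
 then have h: "f \<in> HOM R (fst f) (snd (snd f))" "g \<in> HOM R (fst g) (snd (snd f))" "p \<in> HOM R (fst p) (fst f)" "q \<in> HOM R (fst p) (fst g)"
  unfolding is_pullback_def by (simp_all add: Hom_iff)
 note P = functor_D(2)[OF pfun_functor] and c = functor_D(4)[OF pfun_functor]
 note w = pb[unfolded pullback_wide[OF category_SetOver h]]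
 have "(%i. pA R A (if i then f else g)) = (%i. if i then pA R A f else pA R A g)" "(%i. pA R A (if i then p else q)) = (%i. if i then pA R A p else pA R A q)" by auto
 with pfun_wide_pullbacks[OF conjunct2[OF w]] arg_cong[OF conjunct1[OF w], of "pA R A"]
 show "is_pullback (SO R) (pA R A f) (pA R A g) (pA R A p) (pA R A q)"
  unfolding pullback_wide[OF category_SetOver P[OF h(1)] P[OF h(2)] P[OF h(3)] P[OF h(4)]] c[OF h(3,1)] c[OF h(4,2)] by simp
qed

lemma is_functor_into_comp: assumes D: "is_functor J (SO R) D" and F: "sF R R F" shows "is_functor J (SO R) (cF J F D)"
  "!!j. j \<in> Obj J ==> omap (cF J F D) j = omap F (omap D j)" "!!f i j. f \<in> Hom J i j ==> amap (cF J F D) f = amap F (amap D f)"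
proof -
 note d = D[unfolded is_functor_def] and f = F[unfolded is_functor_def]
 interpret category J using d by simp
 have c: "g *[J] h \<in> Arr J" if "h \<in> Arr J" "g \<in> Arr J" "Tgt J h = Src J g" for g h
  using Cmp_Hom[of h "Src J h" "Src J g" g "Tgt J g"] that by (simp add: Hom_iff)
 have i: "Idn J x \<in> Arr J" if "x \<in> Obj J" for x using Idn_Hom[OF that] by (simp add: Hom_iff)
 show "is_functor J (SO R) (cF J F D)" unfolding is_functor_def comp_functor_def using d f c i by (simp add: PiE_iff Src_Obj Tgt_Obj del: Src_slice Tgt_slice)
 show "!!j. j \<in> Obj J ==> omap (cF J F D) j = omap F (omap D j)" "!!f i j. f \<in> Hom J i j ==> amap (cF J F D) f = amap F (amap D f)"
  unfolding comp_functor_def by (simp_all add: Hom_iff)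
qed

text \<open>Arities are finite: finitely many labels come from one common stage, and finitely many
  identifications take place at one common stage.\<close>

lemma pfun_filtered:
 fixes J :: "('j, 'k) cat" assumes J: "filtered J" shows "preserves_colimits_of_shape J (SO R) (SO R) (pfun R A)" unfolding preserves_colimits_of_shape_def
proof (intro allI impI)
 fix D c l assume col: "is_colimit J (SO R) D c l"
 then have co: "is_cocone J (SO R) D c l" unfolding is_colimit_def by simp
 note D = cocone_D(1)[OF co] and c = cocone_D(2)[OF co] and l = cocone_D(3)[OF co] and ln = cocone_D(4)[OF co]
 note Do = functor_into_D(1)[OF D] and Da = functor_into_D(2)[OF D] and Dc = functor_into_D(3)[OF D] and Di = functor_into_D(4)[OF D]
 note E = filtered_colimit_iff[OF J co, THEN iffD1, OF col]
 note C = is_functor_into_comp[OF D pfun_functor]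
 interpret category J by (rule filtered_D(1)[OF J])
 let ?P = "pfun R A" and ?D = "cF J (pfun R A) D"
 have co': "is_cocone J (SO R) ?D (omap ?P c) (%j. amap ?P (l j))"
 proof (rule cocone_I[OF C(1)])
  show "omap ?P c \<in> OB R" using pob_OB[OF c] c by simp
  show "amap ?P (l j) \<in> HOM R (omap ?D j) (omap ?P c)" if "j \<in> Obj J" for j using amap_pfun[OF l[OF that]] C(2)[OF that] Do[OF that] c by simp
  fix f i j a assume f: "f \<in> Hom J i j" and ij: "i \<in> Obj J" "j \<in> Obj J" and a: "a \<in> car (omap ?D i)"
  then have a: "a \<in> car (pob R A (omap D i))" using C(2) Do by simp
  note v = dec_pob(1)[OF a]
  have "pmap (ap (l j) o ap (amap D f)) (dec a) = pmap (ap (l i)) (dec a)" by (rule pmap_cong) (use ln[OF f ij] pel_D(2)[OF v] in auto)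
  then show "ap (amap ?P (l j)) (ap (amap ?D f) a) = ap (amap ?P (l i)) a"
   using C(3)[OF f] ap_pfun[OF Da[OF f] a] ap_pfun[OF l[OF ij(1)] a] ap_pfun_enc[OF l[OF ij(2)] pmap_pob[OF Da[OF f] v]] by (simp add: pmap_comp)
 qed
 \<comment> \<open>Induction on the list: the stage of the new label and the stage of the remaining
   ones are merged.\<close>
 have surj: "EX j:Obj J. EX ys. set ys <= car (omap D j) & map (ap (l j)) ys = zs" if "set zs <= car c" for zs using that
 proof (induction zs)
  case Nil
  obtain j where "j \<in> Obj J" using filtered_D(2)[OF J] by blast
  then show ?case by (intro bexI[of _ j] exI[of _ "[]"]) auto
 next
  case (Cons z zs)
  obtain i y where i: "i \<in> Obj J" "y \<in> car (omap D i)" "ap (l i) y = z" using E Cons.prems by force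
  obtain j ys where j: "j \<in> Obj J" "set ys <= car (omap D j)" "map (ap (l j)) ys = zs" using Cons by auto
  obtain k f g where k: "k \<in> Obj J" "f \<in> Hom J i k" "g \<in> Hom J j k" using filtered_D(3)[OF J i(1) j(1)] by blast
  have "set (ap (amap D f) y # map (ap (amap D g)) ys) <= car (omap D k)" using HOM_D(6)[OF Da[OF k(2)] i(2)] HOM_D(6)[OF Da[OF k(3)]] j(2) by auto
  moreover have "map (ap (l k) o ap (amap D g)) ys = map (ap (l j)) ys" using ln[OF k(3) j(1) k(1)] j(2) by auto
  ultimately show ?case using k(1) ln[OF k(2) i(1) k(1) i(2)] i(3) j(3) by (intro bexI[of _ k] exI[of _ "ap (amap D f) y # map (ap (amap D g)) ys"]) simp_all
 qed
 \<comment> \<open>Induction on the list: after the tails have been identified at \<open>k\<close>,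
   one more arrow identifies the heads and keeps the tails equal.\<close>
 have inj: "EX k:Obj J. EX f:Hom J j k. map (ap (amap D f)) xs = map (ap (amap D f)) ys"
  if "j \<in> Obj J" "set xs <= car (omap D j)" "set ys <= car (omap D j)" "map (ap (l j)) xs = map (ap (l j)) ys" for j xs ys using that(2-)
 proof (induction xs arbitrary: ys)
  case Nil
  then show ?case using that(1) Idn_Hom by (intro bexI[of _ j] bexI[of _ "Idn J j"]) auto
 next
  case (Cons x xs)
  obtain y ys' where ys: "ys = y # ys'" using Cons.prems by (cases ys) auto
  obtain k f where k: "k \<in> Obj J" "f \<in> Hom J j k" "map (ap (amap D f)) xs = map (ap (amap D f)) ys'" using Cons.IH[of ys'] Cons.prems ys by auto
  have xy: "x \<in> car (omap D j)" "y \<in> car (omap D j)" "ap (l j) x = ap (l j) y" using Cons.prems ys by auto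
  have "ap (l k) (ap (amap D f) x) = ap (l k) (ap (amap D f) y)" using ln[OF k(2) that(1) k(1)] xy by simp
  then obtain m g where m: "m \<in> Obj J" "g \<in> Hom J k m" "ap (amap D g) (ap (amap D f) x) = ap (amap D g) (ap (amap D f) y)"
   using E k(1) HOM_D(6)[OF Da[OF k(2)]] xy by blast
  have gf: "ap (amap D (g *[J] f)) z = ap (amap D g) (ap (amap D f) z)" if "z \<in> car (omap D j)" for z by (rule Dc[OF k(2) m(2) that])
  have "map (ap (amap D (g *[J] f))) xs = map (ap (amap D g)) (map (ap (amap D f)) xs)" "map (ap (amap D (g *[J] f))) ys' = map (ap (amap D g)) (map (ap (amap D f)) ys')"
   using gf Cons.prems ys by auto
  then have "map (ap (amap D (g *[J] f))) (x # xs) = map (ap (amap D (g *[J] f))) (y # ys')" using k(3) m(3) gf xy by simp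
  then show ?case unfolding ys using m(1) Cmp_Hom[OF k(2) m(2)] by blast
 qed
 show "is_colimit J (SO R) ?D (omap ?P c) (%j. amap ?P (l j))" unfolding filtered_colimit_iff[OF J co']
 proof (intro conjI ballI impI)
  fix z assume "z \<in> car (omap ?P c)"
  then have z: "z \<in> car (pob R A c)" using c by simp
  obtain a zs where v: "dec z = (a, zs)" by (cases "dec z")
  note p = dec_pob[OF z, unfolded v] note d = pel_D[OF p(1), unfolded fst_conv snd_conv]
  obtain j ys where j: "j \<in> Obj J" "set ys <= car (omap D j)" "map (ap (l j)) ys = zs" using surj[OF d(2)] by blast
  have "length ys = ar A a" using d(4) j(3) by (metis length_map)
  then have y: "(a, ys) \<in> pE A (omap D j)" using pel_from_typed[OF l[OF j(1)] _ j(2)] p(1) j(3) by simp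
  then show "EX j:Obj J. EX b:car (omap ?D j). ap (amap ?P (l j)) b = z" using j C(2)[OF j(1)] Do[OF j(1)] ap_pfun_enc[OF l[OF j(1)] y] p(2)
   by (intro bexI[of _ j] bexI[of _ "enc (a, ys)"]) (simp_all add: pmap_def)
 next
  fix j s t assume j: "j \<in> Obj J" and s: "s \<in> car (omap ?D j)" and t: "t \<in> car (omap ?D j)" and e: "ap (amap ?P (l j)) s = ap (amap ?P (l j)) t"
  then have s: "s \<in> car (pob R A (omap D j))" and t: "t \<in> car (pob R A (omap D j))" using C(2) Do by simp_all
  obtain a xs where sv: "dec s = (a, xs)" by (cases "dec s")
  obtain b ys where tv: "dec t = (b, ys)" by (cases "dec t")
  note sd = pel_D[OF dec_pob(1)[OF s], unfolded sv fst_conv snd_conv] and td = pel_D[OF dec_pob(1)[OF t], unfolded tv fst_conv snd_conv]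
  have e': "a = b" "map (ap (l j)) xs = map (ap (l j)) ys" using e unfolding ap_pfun[OF l[OF j] s] ap_pfun[OF l[OF j] t] sv tv by (simp_all add: pmap_def)
  obtain k f where k: "k \<in> Obj J" "f \<in> Hom J j k" "map (ap (amap D f)) xs = map (ap (amap D f)) ys" using inj[OF j sd(2) td(2) e'(2)] by blast
  then show "EX k:Obj J. EX f:Hom J j k. ap (amap ?D f) s = ap (amap ?D f) t" using C(3)[OF k(2)] ap_pfun[OF Da[OF k(2)] s] ap_pfun[OF Da[OF k(2)] t] e'(1) sv tv
   by (intro bexI[of _ k] bexI[of _ f]) (simp_all add: pmap_def)
 qed
qed

text \<open>Removes the inner layer of codes, so that the multiplication can be applied to a plain
  nested labelling; \<open>pel_pob'\<close> restores it.\<close>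

lemma pel_pob: "w \<in> pE A (pob R A x) ==> pmap dec w \<in> pel A (pE A x) (root A)" by (erule pmap_pel) (simp add: dec_pob ty_pob)

lemma pel_pob': "w \<in> pel A (pE A x) (root A) ==> pmap enc w \<in> pE A (pob R A x)" by (erule pmap_pel) (simp add: ty_pob)

end

lemma pel_restrict: "w \<in> pel A X t ==> set (snd w) <= Y ==> w \<in> pel A Y t" by (auto simp: pel_def)

context universe
begin

section \<open>Unit, multiplication and laws of the monad of a multicategory\<close>

lemma multicategory_vsig: "multicategory (M :: 'v mcat) ==> vsig V (base M) (msig M)"
 using multicategory_D[of M] universe_axioms unfolding vsig_def vsig_axioms_def mcat_data_def by blast

lemma pmnd_simps: "mfun (pmnd M) = pfun (base M) (msig (M :: 'v mcat))"
 "!!x. x \<in> OB (base M) ==> eta (pmnd M) x = slice_map x (%z. enc (fop (munit M) (fn x z), [z])) (pobM M x)"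
 "!!x. x \<in> OB (base M) ==> mu (pmnd M) x = slice_map (pobM M (pobM M x)) (%w. enc (mul (mmul M) (pmap dec (dec w)))) (pobM M x)"
 "eta (pmnd M) \<in> extensional (OB (base M))" "mu (pmnd M) \<in> extensional (OB (base M))" unfolding pmnd_def Let_def by simp_all

lemma pmnd_eta_mu: assumes M: "multicategory (M :: 'v mcat)" and x: "x \<in> OB (base M)" shows "eta (pmnd M) x \<in> HOM (base M) x (pobM M x)"
  "!!z. z \<in> car x ==> ap (eta (pmnd M) x) z = enc (fop (munit M) (fn x z), [z])" "!!z. z \<in> car x ==> (fop (munit M) (fn x z), [z]) \<in> pE (msig M) x"
  "!!z. z \<in> car x ==> bd (msig M) (fop (munit M) (fn x z)) 0 = fn x z" "mu (pmnd M) x \<in> HOM (base M) (pobM M (pobM M x)) (pobM M x)"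
  "!!w. w \<in> pel (msig M) (pE (msig M) x) (root (msig M)) ==> mul (mmul M) w \<in> pE (msig M) x" "!!w. w \<in> car (pobM M (pobM M x)) ==>
   ap (mu (pmnd M) x) w = enc (mul (mmul M) (pmap dec (dec w)))"
proof -
 note Md = multicategory_D[OF M]
 interpret vsig V "base M" "msig M" by (rule multicategory_vsig[OF M])
 interpret M: mcat_data "base M" "msig M" "mmul M" "munit M" by (rule Md(1))
 let ?R = "base M" and ?A = "msig M"
 have t: "fn x z \<in> ?R" if "z \<in> car x" for z using OB_D(5)[OF x that] .
 show el: "(fop (munit M) (fn x z), [z]) \<in> pE ?A x" if z: "z \<in> car x" for z
 proof -
  have "(fn x z, [z]) \<in> pE (unit_sig ?R) x" using z t[OF z] by (simp add: pel_def)
  note a = act_pel[OF M.e this]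
  have "pel ?A (car x) (fob (munit M) o fn x) = pE ?A x" by (rule pel_cong) (simp add: M.fe t)
  then show ?thesis using a act_unit[OF sig_mor_D(1)[OF M.e] t[OF z], of z] by simp
 qed
 show rt: "bd ?A (fop (munit M) (fn x z)) 0 = fn x z" if z: "z \<in> car x" for z using sig_mor_D(6)[OF M.e, of "fn x z"] t[OF z] by (simp add: M.fe)
 show "eta (pmnd M) x \<in> HOM ?R x (pob ?R ?A x)" unfolding pmnd_simps(2)[OF x] by (rule slice_map_HOM[OF x pob_OB[OF x]]) (simp add: el ty_pob rt)
 show "!!z. z \<in> car x ==> ap (eta (pmnd M) x) z = enc (fop (munit M) (fn x z), [z])" by (simp add: pmnd_simps(2)[OF x])
 show ml: "mul (mmul M) w \<in> pE ?A x" if "w \<in> pel ?A (pE ?A x) (root ?A)" for w by (rule mul_pel[OF M.m M.fm that]) (rule t)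
 show "mu (pmnd M) x \<in> HOM ?R (pob ?R ?A (pob ?R ?A x)) (pob ?R ?A x)" unfolding pmnd_simps(3)[OF x]
 proof (rule slice_map_HOM[OF pob_OB[OF pob_OB[OF x]] pob_OB[OF x]])
  fix w assume w: "w \<in> car (pob ?R ?A (pob ?R ?A x))"
  note p = pel_pob[OF dec_pob(1)[OF w]]
  show "enc (mul (mmul M) (pmap dec (dec w))) \<in> car (pob ?R ?A x) & fn (pob ?R ?A x) (enc (mul (mmul M) (pmap dec (dec w)))) = fn (pob ?R ?A (pob ?R ?A x)) w"
   using ml[OF p] root_mul[OF M.m M.fm M.so pel_pel_pelu[OF p]] by (simp add: ty_pob w)
 qed
 show "!!w. w \<in> car (pob ?R ?A (pob ?R ?A x)) ==> ap (mu (pmnd M) x) w = enc (mul (mmul M) (pmap dec (dec w)))" by (simp add: pmnd_simps(3)[OF x])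
qed

text \<open>After decoding, the monad laws are the elementwise laws of the multicategory. The unit
  is cartesian because a unit operation has exactly one label; for the multiplication,
  \<open>mul_cartesian\<close> supplies the unique lifts.\<close>

lemma pmnd_obj: assumes M: "multicategory (M :: 'v mcat)" shows "monad_obj (base M, pmnd M)"
proof -
 note Md = multicategory_D[OF M]
 interpret vsig V "base M" "msig M" by (rule multicategory_vsig[OF M])
 interpret M: mcat_data "base M" "msig M" "mmul M" "munit M" by (rule Md(1))
 let ?R = "base M" and ?A = "msig M" and ?P = "pobM M"
 note em = pmnd_eta_mu[OF M]
 have muv: "ap (mu (pmnd M) x) (enc w) = enc (mul (mmul M) (pmap dec w))" if "x \<in> OB ?R" "w \<in> pE ?A (?P x)" for x w
  using em(7)[OF that(1), of "enc w"] that(2) by simp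
 have "cartesian_monad (SO ?R) (pmnd M)"
 proof (rule cartesian_monad_I; (unfold pmnd_simps(1))?)
  show "sF ?R ?R (pfun ?R ?A)" by (rule pfun_functor)
  show "preserves_pullbacks (SO ?R) (SO ?R) (pfun ?R ?A)" by (rule pfun_pullbacks)
  show "eta (pmnd M) \<in> extensional (OB ?R)" "mu (pmnd M) \<in> extensional (OB ?R)" by (rule pmnd_simps)+
 next
  fix x assume x: "x \<in> OB ?R"
  show "eta (pmnd M) x \<in> HOM ?R x (pO ?R ?A x)" using em(1)[OF x] x by simp
  show "mu (pmnd M) x \<in> HOM ?R (pO ?R ?A (pO ?R ?A x)) (pO ?R ?A x)" using em(5)[OF x] x pob_OB[OF x] by simp
 next
  fix f x y z assume f: "f \<in> HOM ?R x y" and z: "z \<in> car x"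
  note fd = HOM_D[OF f]
  show "pV ?R ?A f (ap (eta (pmnd M) x) z) = ap (eta (pmnd M) y) (ap f z)"
   using em(2)[OF fd(1) z] ap_pfun_enc[OF f em(3)[OF fd(1) z]] em(2)[OF fd(2) fd(6)[OF z]] fd(7)[OF z] by (simp add: pmap_def)
 next
  fix f x y t assume f: "f \<in> HOM ?R x y" and t0: "t \<in> car (pO ?R ?A (pO ?R ?A x))"
  note fd = HOM_D[OF f]
  have t: "t \<in> car (?P (?P x))" using t0 fd(1) pob_OB[OF fd(1)] by simp
  note p = pel_pob[OF dec_pob(1)[OF t]] note F = amap_pfun[OF f]
  have "pmap dec (pmap (pV ?R ?A f) (dec t)) = pmap (pmap (ap f)) (pmap dec (dec t))"
   unfolding pmap_comp by (rule pmap_cong) (use ap_pfun[OF f] pel_D(2)[OF dec_pob(1)[OF t]] in auto)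
  then show "pV ?R ?A f (ap (mu (pmnd M) x) t) = ap (mu (pmnd M) y) (ap (pA ?R ?A (pA ?R ?A f)) t)"
   using em(7)[OF fd(1) t] ap_pfun_enc[OF f em(6)[OF fd(1) p]] ap_pfun[OF F t]
    muv[OF fd(2) pmap_pob[OF F dec_pob(1)[OF t]]] mul_pmap[OF sig_mor_D(1)[OF M.m] pel_pel_pelu[OF p], of "ap f"] by simp
 next
  fix x t assume x: "x \<in> OB ?R" and "t \<in> car (pO ?R ?A x)"
  then have t: "t \<in> car (?P x)" by simp
  note v = dec_pob[OF t]
  note e = em(1)[OF x]
  \<comment> \<open>Each label is replaced by the unit at its own type; \<open>units\<close> takes
    these types from the boundary, which is the same thing for a typed labelling.\<close>
  have "pmap dec (pmap (ap (eta (pmnd M) x)) (dec t)) = units (munit M) ?A (dec t)"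
  proof -
   have m: "bdl ?A (fst (dec t)) = map (fn x) (snd (dec t))" using pel_D(3)[OF v(1)] by simp
   have "pmap dec (pmap (ap (eta (pmnd M) x)) (dec t)) = pmap (%z. (fop (munit M) (fn x z), [z])) (dec t)"
    unfolding pmap_comp by (rule pmap_cong) (use em(2)[OF x] pel_D(2)[OF v(1)] in auto)
   also have "... = units (munit M) ?A (dec t)" unfolding m pmap_def by (simp add: case_prod_unfold zip_map1 zip_same_conv_map)
   finally show ?thesis .
  qed
  then show "ap (mu (pmnd M) x) (ap (pA ?R ?A (eta (pmnd M) x)) t) = t" using ap_pfun[OF e t] muv[OF x pmap_pob[OF e v(1)]] Md(6)[OF pel_pelu[OF v(1)]] v(2) by simp
  note xx = pob_OB[OF x]
  show "ap (mu (pmnd M) x) (ap (eta (pmnd M) (pO ?R ?A x)) t) = t"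
   using em(2)[OF xx t] muv[OF x em(3)[OF xx t]] Md(5)[OF pel_pelu[OF v(1)]] v(2) x by (simp add: ty_pob[OF t] pmap_def)
 next
  fix x t assume x: "x \<in> OB ?R" and "t \<in> car (pO ?R ?A (pO ?R ?A (pO ?R ?A x)))"
  note xx = pob_OB[OF x]
  have t: "t \<in> car (?P (?P (?P x)))" using \<open>t \<in> _\<close> x xx pob_OB[OF xx] by simp
  note v = dec_pob(1)[OF t] note q = pel_pob[OF v] note m = em(5)[OF x]
  let ?w = "pmap (pmap dec) (pmap dec (dec t))"
  have w: "?w \<in> pel ?A (pel ?A (pE ?A x) (root ?A)) (root ?A)" by (rule pmap_pel[OF q]) (simp add: pel_pob)
  have wu: "?w \<in> pel ?A (pel2 ?A) (root ?A)" by (rule pel_mono[OF w]) (use pel_pel_pelu in blast)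
  have "pmap dec (pmap (ap (mu (pmnd M) x)) (dec t)) = pmap (mul (mmul M)) ?w" unfolding pmap_comp by (rule pmap_cong) (use em(7)[OF x] pel_D(2)[OF v] in auto)
  then have "ap (mu (pmnd M) x) (ap (pA ?R ?A (mu (pmnd M) x)) t) = enc (mul (mmul M) (pmap (mul (mmul M)) ?w))" using ap_pfun[OF m t] muv[OF x pmap_pob[OF m v]] by simp
  moreover have "ap (mu (pmnd M) x) (ap (mu (pmnd M) (?P x)) t) = enc (mul (mmul M) (mul (mmul M) ?w))"
   using em(7)[OF xx t] muv[OF x em(6)[OF xx q]] mul_pmap[OF sig_mor_D(1)[OF M.m] pel_pel_pelu[OF q], of dec] by simp
  ultimately show "ap (mu (pmnd M) x) (ap (pA ?R ?A (mu (pmnd M) x)) t) = ap (mu (pmnd M) x) (ap (mu (pmnd M) (pO ?R ?A x)) t)" using Md(4)[OF wu] x by simp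
 next
  fix f x y a b assume f: "f \<in> HOM ?R x y" and a0: "a \<in> car (pO ?R ?A x)" and b: "b \<in> car y" and e: "pV ?R ?A f a = ap (eta (pmnd M) y) b"
  note fd = HOM_D[OF f]
  have a: "a \<in> car (?P x)" using a0 fd(1) by simp
  obtain c xs where v: "dec a = (c, xs)" by (cases "dec a")
  note va = dec_pob[OF a, unfolded v]
  have "enc (c, map (ap f) xs) = enc (fop (munit M) (fn y b), [b])" using e ap_pfun[OF f a] em(2)[OF fd(2) b] v by (simp add: pmap_def)
  then have e': "c = fop (munit M) (fn y b)" "map (ap f) xs = [b]" by simp_all
  then obtain z where z: "xs = [z]" "ap f z = b" by auto
  have zc: "z \<in> car x" using pel_D(2)[OF va(1)] z by simp
  show "EX! c. c \<in> car x & ap (eta (pmnd M) x) c = a & ap f c = b"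
  proof (rule ex1I[of _ z])
   show "z \<in> car x & ap (eta (pmnd M) x) z = a & ap f z = b" using zc em(2)[OF fd(1) zc] fd(7)[OF zc] z e'(1) va(2) by simp
   fix z' assume "z' \<in> car x & ap (eta (pmnd M) x) z' = a & ap f z' = b"
   then show "z' = z" using em(2)[OF fd(1), of z'] va(2) z(1) by auto
  qed
 next
  fix f x y a b assume f: "f \<in> HOM ?R x y" and a0: "a \<in> car (pO ?R ?A x)" and b0: "b \<in> car (pO ?R ?A (pO ?R ?A y))"
   and e: "pV ?R ?A f a = ap (mu (pmnd M) y) b"
  note fd = HOM_D[OF f]
  have a: "a \<in> car (?P x)" and b: "b \<in> car (?P (?P y))" using a0 b0 fd(1,2) pob_OB by simp_all
  note va = dec_pob[OF a] and vb = dec_pob[OF b] note q = pel_pob[OF vb(1)] note F = amap_pfun[OF f]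
  have me: "pmap (ap f) (dec a) = mul (mmul M) (pmap dec (dec b))" using e ap_pfun[OF f a] em(7)[OF fd(2) b] by simp
  obtain w where w: "w \<in> pel2 ?A" "mul (mmul M) w = dec a" "pmap (pmap (ap f)) w = pmap dec (dec b)" "!!y. y \<in> set (snd w) ==> set (snd y) <= set (snd (dec a))"
   and un: "!!w'. w' \<in> pel2 ?A ==> mul (mmul M) w' = dec a ==> pmap (pmap (ap f)) w' = pmap dec (dec b) ==> w' = w"
   by (rule mul_cartesian[OF M.m pel_pel_pelu[OF q] me]) (rule that; assumption)
  \<comment> \<open>The lift was found without types. Its labels lie in the carrier of
    \<open>x\<close> because they occur in \<open>a\<close>, and they are well typed because their
    images along \<open>f\<close> are.\<close>
  have "v \<in> pE ?A x" if s: "v \<in> set (snd w)" for v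
  proof -
   have "v \<in> pelu ?A" using pel_D(2)[OF w(1)] s by auto
   moreover have "set (snd v) <= car x" using w(4)[OF s] pel_D(2)[OF va(1)] by blast
   moreover have "pmap (ap f) v \<in> pE ?A y"
   proof -
    have "pmap (ap f) v \<in> set (snd (pmap (pmap (ap f)) w))" using s by simp
    then show ?thesis unfolding w(3) using pel_D(2)[OF q] by blast
   qed
   ultimately show ?thesis using pel_from_typed[OF f, of "snd v" "fst v"] pelu_D(2)[of v ?A] by (simp add: pmap_def case_prod_unfold)
  qed
  then have wt: "w \<in> pel ?A (pE ?A x) (root ?A)" by (intro pel_restrict[OF w(1)] subsetI)
  note wp = pel_pob'[OF wt]
  have dw: "pmap dec (pmap enc w) = w" unfolding pmap_comp by (rule pmap_ident) simp
  show "EX! c. c \<in> car (pO ?R ?A (pO ?R ?A x)) & ap (mu (pmnd M) x) c = a & ap (pA ?R ?A (pA ?R ?A f)) c = b"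
  proof (rule ex1I[of _ "enc (pmap enc w)"], intro conjI)
   show "enc (pmap enc w) \<in> car (pO ?R ?A (pO ?R ?A x))" using wp fd(1) pob_OB[OF fd(1)] by simp
   show "ap (mu (pmnd M) x) (enc (pmap enc w)) = a" using muv[OF fd(1) wp] dw w(2) va(2) by simp
   have "pmap (pV ?R ?A f) (pmap enc w) = pmap enc (pmap (pmap (ap f)) w)" unfolding pmap_comp by (rule pmap_cong) (use ap_pfun_enc[OF f] pel_D(2)[OF wt] in auto)
   also have "... = dec b" unfolding w(3) pmap_comp by (rule pmap_ident) (use pel_D(2)[OF vb(1)] dec_pob(2)[of _ y] in auto)
   finally show "ap (pA ?R ?A (pA ?R ?A f)) (enc (pmap enc w)) = b" using ap_pfun_enc[OF F wp] vb(2) by simp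
  next
   fix c assume c: "c \<in> car (pO ?R ?A (pO ?R ?A x)) & ap (mu (pmnd M) x) c = a & ap (pA ?R ?A (pA ?R ?A f)) c = b"
   then have cc: "c \<in> car (?P (?P x))" using fd(1) pob_OB[OF fd(1)] by simp
   note vc = dec_pob[OF cc]
   have "pmap (pmap (ap f)) (pmap dec (dec c)) = pmap dec (pmap (pV ?R ?A f) (dec c))"
    unfolding pmap_comp by (rule pmap_cong) (use ap_pfun[OF f] pel_D(2)[OF vc(1)] in auto)
   also have "pmap (pV ?R ?A f) (dec c) = dec b" using c ap_pfun[OF F cc] by (metis dec_enc)
   finally have "pmap (pmap (ap f)) (pmap dec (dec c)) = pmap dec (dec b)" .
   moreover have "mul (mmul M) (pmap dec (dec c)) = dec a" using c em(7)[OF fd(1) cc] by (metis dec_enc)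
   ultimately have "pmap dec (dec c) = w" by (intro un pel_pel_pelu[OF pel_pob[OF vc(1)]])
   then have "w = pmap dec (dec c)" ..
   then have "pmap enc w = pmap (enc o dec) (dec c)" by (simp only: pmap_comp)
   also have "... = dec c" by (rule pmap_ident) (simp add: dec_pob(2)[of _ x] subsetD[OF pel_D(2)[OF vc(1)]])
   finally have "pmap enc w = dec c" .
   then show "c = enc (pmap enc w)" using vc(2) by simp
  qed
 qed
 moreover have "finitary ?R (mfun (pmnd M))" unfolding finitary_def pmnd_simps using pfun_filtered by blast
 moreover have "preserves_wide_pullbacks ?R (mfun (pmnd M))"
  unfolding preserves_wide_pullbacks_def preserves_wide_pullbacks_of_shape_def pmnd_simps using pfun_wide_pullbacks by blast
 ultimately show ?thesis unfolding monad_obj_def using Md(2) by simp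
qed

lemma act_single: assumes "premor A ph" "a \<in> ops A" "ar A a = 1" shows "act ph (a, [z]) = (fop ph a, [z])"
proof -
 have "perm ph a 1 = 1" using premor_D(1)[OF assms(1,2), of 1] assms(3) by simp
 then show ?thesis by (simp add: act_def upt_rec)
qed

lemma pel_relab: assumes u: "u \<in> Hom SetC R Q" and v: "v \<in> pel A (car (pb (u :: 'v fn) x)) (fn (pb u x))"
 shows "pmap vsnd v \<in> pel (relab (fn u) A) (car x) (fn x)" "lift A (pmap vsnd v) = v"
proof -
 obtain a zs where e: "v = (a, zs)" by (cases v)
 note d = pel_D[OF v, unfolded e fst_conv snd_conv]
 have z: "vsnd z \<in> car x" "fn x (vsnd z) = fn u (fn (pb u x) z)" "vpair (fn (pb u x) z, vsnd z) = z" if "z \<in> set zs" for z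
 proof -
  have zc: "z \<in> car (pb u x)" using d(2) that by blast
  note p = pb_D[OF u zc]
  show "vsnd z \<in> car x" "fn x (vsnd z) = fn u (fn (pb u x) z)" "vpair (fn (pb u x) z, vsnd z) = z" using p by simp_all
 qed
 have "map (fn x) (map vsnd zs) = map (fn u) (map (fn (pb u x)) zs)" using z(2) by auto
 then have "map (fn x) (map vsnd zs) = bdl (relab (fn u) A) a" by (simp only: relab_simps d(3))
 then show "pmap vsnd v \<in> pel (relab (fn u) A) (car x) (fn x)" using d(1) z(1) by (auto simp: e pmap_def pel_def simp del: relab_simps(4))
 have "map vpair (zip (bdl A a) (map vsnd zs)) = zs" unfolding d(3)[symmetric] by (rule nth_equalityI) (use z(3) in auto)
 then show "lift A (pmap vsnd v) = v" by (simp add: lift_def e pmap_def)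
qed

lemma lift_pel: assumes u: "u \<in> Hom SetC R Q" and so: "sig_over R A" and v: "v \<in> pel (relab (fn u) A) (car x) (fn x)"
 shows "lift A v \<in> pel A (car (pb (u :: 'v fn) x)) (fn (pb u x))" "pmap vsnd (lift A v) = v"
proof -
 obtain a zs where e: "v = (a, zs)" by (cases v)
 note d = pel_D[OF v, unfolded e fst_conv snd_conv relab_simps]
 have z: "bdl A a ! i \<in> R" "zs ! i \<in> car x" "fn u (bdl A a ! i) = fn x (zs ! i)" if i: "i < ar A a" for i
 proof -
  show "bdl A a ! i \<in> R" using i sig_over_D[OF so d(1), of "Suc i"] by simp
  show "zs ! i \<in> car x" using d(2,4) i by auto
  show "fn u (bdl A a ! i) = fn x (zs ! i)" using arg_cong[OF d(3), of "%l. l ! i"] i d(4) by simp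
 qed
 have c: "vpair (bdl A a ! i, zs ! i) \<in> car (pb u x)" if "i < ar A a" for i using z[OF that] by (simp add: vpair_car_pb[OF u])
 have "set (map vpair (zip (bdl A a) zs)) <= car (pb u x)" using c d(4) by (auto simp: set_zip)
 moreover have "map (fn (pb u x)) (map vpair (zip (bdl A a) zs)) = bdl A a" by (rule nth_equalityI) (use c d(4) in "auto simp: ty_pb")
 ultimately show "lift A v \<in> pE A (pb u x)" using d(1) by (simp add: lift_def e pel_def)
 have "map vsnd (map vpair (zip (bdl A a) zs)) = zs" by (rule nth_equalityI) (use d(4) in auto)
 then show "pmap vsnd (lift A v) = v" by (simp add: lift_def e pmap_def)
qed

lemma relab_act: assumes p: "sig_mor R A Q B ph" and v: "v \<in> pel (relab (fob ph) A) X t" shows "act ph v \<in> pel B X t" "root B (act ph v) = fob ph (root A v)"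
proof -
 obtain a xs where e: "v = (a, xs)" by (cases v)
 note d = pel_D[OF v, unfolded e fst_conv snd_conv relab_simps] and md = sig_mor_D[OF p]
 have "t (xs ! (perm ph a j - 1)) = bd B (fop ph a) j" if j: "1 <= j" "j <= ar A a" for j
 proof -
  note q = premor_D(3,4)[OF md(1) d(1) j]
  have "t (xs ! (perm ph a j - 1)) = map t xs ! (perm ph a j - 1)" using q d(4) by simp
  also have "... = fob ph (bd A a (perm ph a j))" unfolding d(3) using q by (simp add: nth_bdl[OF q(1)])
  finally show ?thesis using md(5)[OF d(1) j(2)] by simp
 qed
 moreover have "v \<in> pelu A" using pel_pelu[OF v] by simp
 ultimately show "act ph v \<in> pel B X t" using set_act[OF md(1), of v] d md(2,3)[OF d(1)] unfolding e pel_def act_def by (auto simp: bdl_def)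
 show "root B (act ph v) = fob ph (root A v)" using md(6)[OF d(1)] by (simp add: e)
qed

section \<open>Morphisms of multicategories as morphisms of monads\<close>

lemma multicat_mor_hom: assumes M: "multicategory (M :: 'v mcat)" and N: "multicategory N" and p: "multicat_mor M N ph"
 shows "(base M, fob ph, base N) \<in> Hom SetC (base M) (base N)"
 using multicategory_D(2)[OF M] multicategory_D(2)[OF N] multicat_mor_iff(3)[OF multicategory_D(1)[OF M] multicategory_D(1)[OF N] p] by (auto simp: Hom_SetC sig_mor_def)

lemma fmor_simp: assumes M: "multicategory (M :: 'v mcat)" and N: "multicategory N" and p: "multicat_mor M N ph" and x: "x \<in> OB (base N)"
 defines "u \<equiv> (base M, fob ph, base N)" shows "fmor M N ph x \<in> HOM (base M) (pobM M (pb u x)) (pb u (pobM N x))" "!!v. v \<in> pE (msig M) (pb u x) ==>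
   act ph (pmap vsnd v) \<in> pE (msig N) x" "!!t. t \<in> car (pobM M (pb u x)) ==>
   ap (fmor M N ph x) t = vpair (root (msig M) (dec t), enc (act ph (pmap vsnd (dec t))))"
proof -
 interpret M: vsig V "base M" "msig M" by (rule multicategory_vsig[OF M])
 interpret N: vsig V "base N" "msig N" by (rule multicategory_vsig[OF N])
 note u = multicat_mor_hom[OF M N p, folded u_def]
 note s = multicat_mor_iff(3)[OF multicategory_D(1)[OF M] multicategory_D(1)[OF N] p]
 have e: "fmor M N ph x = slice_map (pobM M (pb u x)) (%z. vpair (root (msig M) (dec z), enc (act ph (pmap vsnd (dec z))))) (pb u (pobM N x))"
  unfolding fmor_def Let_def u_def using x by simp
 have fu: "fn u = fob ph" by (simp add: u_def)
 show a: "act ph (pmap vsnd v) \<in> pE (msig N) x" if "v \<in> pE (msig M) (pb u x)" for v using relab_act(1)[OF s] pel_relab(1)[OF u that] fu by simp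
 show "fmor M N ph x \<in> HOM (base M) (pobM M (pb u x)) (pb u (pobM N x))" unfolding e
 proof (rule slice_map_HOM[OF M.pob_OB[OF pb_obj_OB[OF u x]] pb_obj_OB[OF u N.pob_OB[OF x]]])
  fix t assume t: "t \<in> car (pobM M (pb u x))"
  note v = M.dec_pob(1)[OF t]
  have r: "root (msig M) (dec t) \<in> base M" using sig_over_D[OF M.so pel_D(1)[OF v]] by simp
  have "root (msig N) (act ph (pmap vsnd (dec t))) = fob ph (root (msig M) (dec t))" using relab_act(2)[OF s, of "pmap vsnd (dec t)"] pel_relab(1)[OF u v] fu by simp
  then have "vpair (root (msig M) (dec t), enc (act ph (pmap vsnd (dec t)))) \<in> car (pb u (pobM N x))" using r a[OF v] fu by (simp add: vpair_car_pb[OF u] N.ty_pob)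
  then show "vpair (root (msig M) (dec t), enc (act ph (pmap vsnd (dec t)))) \<in> car (pb u (pobM N x)) &
   fn (pb u (pobM N x)) (vpair (root (msig M) (dec t), enc (act ph (pmap vsnd (dec t))))) = fn (pobM M (pb u x)) t" by (simp add: ty_pb M.ty_pob[OF t])
 qed
 show "!!t. t \<in> car (pobM M (pb u x)) ==> ap (fmor M N ph x) t = vpair (root (msig M) (dec t), enc (act ph (pmap vsnd (dec t))))" unfolding e by simp
qed

text \<open>On second components \<open>fmor M N ph\<close> is the action of \<open>ph\<close> after
  dropping first components of labels, and each law is the corresponding law of \<open>ph\<close>.
  In the cartesian lift the dropped components are restored by \<open>lift\<close>.\<close>

lemma fmor_emor: assumes M: "multicategory (M :: 'v mcat)" and N: "multicategory N" and p: "multicat_mor M N ph"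
 defines "u \<equiv> (base M, fob ph, base N)" shows "emor u (base M) (base N) (pmnd M) (pmnd N) (fmor M N ph)"
proof -
 interpret M: vsig V "base M" "msig M" by (rule multicategory_vsig[OF M])
 interpret N: vsig V "base N" "msig N" by (rule multicategory_vsig[OF N])
 note Md = multicategory_D[OF M] and Nd = multicategory_D[OF N]
 interpret MM: mcat_data "base M" "msig M" "mmul M" "munit M" by (rule Md(1))
 interpret NN: mcat_data "base N" "msig N" "mmul N" "munit N" by (rule Nd(1))
 note u = multicat_mor_hom[OF M N p, folded u_def] note U = pb_functor[OF u]
 note pi = multicat_mor_iff(1-3)[OF Md(1) Nd(1)] note s = pi(3)[OF p]
 note fs = fmor_simp[OF M N p, folded u_def] note pre = sig_mor_D(1)[OF s]
 let ?A = "msig M" and ?B = "msig N" and ?R = "base M" and ?Q = "base N"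
 have fu: "fn u = fob ph" by (simp add: u_def)
 show ?thesis unfolding emor_def pmnd_simps(1)
 proof (intro conjI ballI allI impI)
  show "fmor M N ph \<in> extensional (OB ?Q)" unfolding fmor_def Let_def by simp
  show "fmor M N ph x \<in> HOM ?R (pO ?R ?A (pb u x)) (pb u (pO ?Q ?B x))" if "x \<in> OB ?Q" for x using fs(1)[OF that] that pb_obj_OB[OF u that] by simp
 next
  fix x y k t assume k: "k \<in> HOM ?Q x y" and t0: "t \<in> car (pO ?R ?A (pb u x))"
  note kd = HOM_D[OF k] note ox = pb_obj_OB[OF u kd(1)]
  have t: "t \<in> car (pob ?R ?A (pb u x))" using t0 ox by simp
  note v = M.dec_pob(1)[OF t]
  have "pmap vsnd (pmap (ap (uA u k)) (dec t)) = pmap (ap k) (pmap vsnd (dec t))" unfolding pmap_comp by (rule pmap_cong) (use U(3)[OF k] pel_D(2)[OF v] in auto)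
  moreover have "pmap vsnd (dec t) \<in> pelu ?A" using pmap_pelu[OF pel_pelu[OF v]] .
  ultimately show "vsnd (ap (fmor M N ph y) (ap (pA ?R ?A (uA u k)) t)) = pV ?Q ?B k (vsnd (ap (fmor M N ph x) t))"
   using fs(3)[OF kd(1) t] M.ap_pfun[OF U(4)[OF k] t] fs(3)[OF kd(2), of "enc (pmap (ap (uA u k)) (dec t))"]
    M.pmap_pob[OF U(4)[OF k] v] N.ap_pfun_enc[OF k fs(2)[OF kd(1) v]] act_pmap[OF pre, of "pmap vsnd (dec t)" "ap k"] by simp
 next
  fix x y k s' t assume k: "k \<in> HOM ?Q x y" and s0: "s' \<in> car (pO ?Q ?B x)"
   and t0: "t \<in> car (pO ?R ?A (pb u y))" and e: "pV ?Q ?B k s' = vsnd (ap (fmor M N ph y) t)"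
  note kd = HOM_D[OF k] note ox = pb_obj_OB[OF u kd(1)] and oy = pb_obj_OB[OF u kd(2)]
  have t: "t \<in> car (pob ?R ?A (pb u y))" and sc: "s' \<in> car (pob ?Q ?B x)" using s0 t0 oy kd by simp_all
  note v = M.dec_pob[OF t] and w = N.dec_pob[OF sc]
  note vr = pel_relab[OF u v(1)]
  have vu: "pmap vsnd (dec t) \<in> pelu ?A" using pmap_pelu[OF pel_pelu[OF v(1)]] .
  have ae: "pmap (ap k) (dec s') = act ph (pmap vsnd (dec t))" using e N.ap_pfun[OF k sc] fs(3)[OF kd(2) t] by simp
  obtain v' where v': "v' \<in> pelu ?A" "act ph v' = dec s'" "pmap (ap k) v' = pmap vsnd (dec t)" "set (snd v') <= set (snd (dec s'))"
   and un: "!!v''. v'' \<in> pelu ?A ==> act ph v'' = dec s' ==> pmap (ap k) v'' = pmap vsnd (dec t) ==> v'' = v'"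
   by (rule act_cartesian[OF s vu ae]) (rule that; assumption)
  \<comment> \<open>The lift found by \<open>act_cartesian\<close> is untyped; its types are read
    off from its image along \<open>k\<close>, which is the typed labelling coming from
    \<open>t\<close>.\<close>
  have r: "v' \<in> pel (relab (fn u) ?A) (car x) (fn x)"
  proof -
   have c: "set (snd v') <= car x" using v'(4) pel_D(2)[OF w(1)] by blast
   have "map (fn x) (snd v') = map (fn y) (map (ap k) (snd v'))" using HOM_D(7)[OF k] c by auto
   also have "map (ap k) (snd v') = snd (pmap vsnd (dec t))" using v'(3) by (metis snd_pmap)
   also have "map (fn y) ... = bdl (relab (fn u) ?A) (fst v')" using pel_D(3)[OF vr(1)] v'(3) by (metis fst_pmap)
   finally show ?thesis using c pelu_D(1)[OF v'(1)] by (cases v') (simp add: pel_def)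
  qed
  note l = lift_pel[OF u M.so r]
  have lk: "pmap (ap (uA u k)) (lift ?A v') = dec t"
  proof -
   have "snd (pmap (ap (uA u k)) (lift ?A v')) = snd (lift ?A (pmap (ap k) v'))"
   proof (rule nth_equalityI)
    show "length (snd (pmap (ap (uA u k)) (lift ?A v'))) = length (snd (lift ?A (pmap (ap k) v')))" by (simp add: lift_def)
    fix i assume "i < length (snd (pmap (ap (uA u k)) (lift ?A v')))"
    then have i: "i < length (snd v')" "i < ar ?A (fst v')" using pelu_D[OF v'(1)] by (simp_all add: lift_def)
    have "snd (lift ?A v') ! i \<in> car (pb u x)" by (rule subsetD[OF pel_D(2)[OF l(1)] nth_mem]) (use i in "simp add: lift_def")
    moreover have "snd (lift ?A v') ! i = vpair (bdl ?A (fst v') ! i, snd v' ! i)" using i by (simp add: lift_def del: nth_bdl)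
    ultimately show "snd (pmap (ap (uA u k)) (lift ?A v')) ! i = snd (lift ?A (pmap (ap k) v')) ! i" using U(3)[OF k] i by (simp add: lift_def)
   qed
   then have "pmap (ap (uA u k)) (lift ?A v') = lift ?A (pmap (ap k) v')" by (simp add: prod_eq_iff) (simp add: lift_def)
   then show ?thesis using v'(3) vr(2) by simp
  qed
  show "EX! t'. t' \<in> car (pO ?R ?A (pb u x)) & vsnd (ap (fmor M N ph x) t') = s' & ap (pA ?R ?A (uA u k)) t' = t"
  proof (rule ex1I[of _ "enc (lift ?A v')"], intro conjI)
   show "enc (lift ?A v') \<in> car (pO ?R ?A (pb u x))" using l(1) ox by simp
   show "vsnd (ap (fmor M N ph x) (enc (lift ?A v'))) = s'" using fs(3)[OF kd(1), of "enc (lift ?A v')"] l v'(2) w(2) by simp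
   show "ap (pA ?R ?A (uA u k)) (enc (lift ?A v')) = t" using M.ap_pfun_enc[OF U(4)[OF k] l(1)] lk v(2) by simp
  next
   fix t' assume t'0: "t' \<in> car (pO ?R ?A (pb u x)) & vsnd (ap (fmor M N ph x) t') = s' & ap (pA ?R ?A (uA u k)) t' = t"
   then have t': "t' \<in> car (pob ?R ?A (pb u x))" using ox by simp
   note q = M.dec_pob[OF t']
   have d: "pmap (ap (uA u k)) (dec t') = dec t" using t'0 M.ap_pfun[OF U(4)[OF k] t'] by (metis dec_enc)
   have "pmap vsnd (dec t') = v'"
   proof (rule un)
    show "pmap vsnd (dec t') \<in> pelu ?A" using pmap_pelu[OF pel_pelu[OF q(1)]] .
    show "act ph (pmap vsnd (dec t')) = dec s'" using t'0 fs(3)[OF kd(1) t'] by (metis dec_enc vsnd_vpair)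
    have "pmap (ap k) (pmap vsnd (dec t')) = pmap vsnd (pmap (ap (uA u k)) (dec t'))" unfolding pmap_comp by (rule pmap_cong) (use U(3)[OF k] pel_D(2)[OF q(1)] in auto)
    then show "pmap (ap k) (pmap vsnd (dec t')) = pmap vsnd (dec t)" using d by simp
   qed
   then show "t' = enc (lift ?A v')" using pel_relab(2)[OF u q(1)] q(2) by simp
  qed
 next
  fix x z assume x: "x \<in> OB ?Q" and z: "z \<in> car (pb u x)"
  note ox = pb_obj_OB[OF u x] note zd = pb_D[OF u z]
  note em = pmnd_eta_mu[OF M ox] and en = pmnd_eta_mu[OF N x]
  have o: "fop (munit M) (fn (pb u x) z) \<in> ops ?A" "ar ?A (fop (munit M) (fn (pb u x) z)) = 1" using sig_mor_D(2,3)[OF MM.e] zd by simp_all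
  have "act ph (fop (munit M) (fn (pb u x) z), [vsnd z]) = (fop (munit N) (fn x (vsnd z)), [vsnd z])" unfolding act_single[OF pre o] using pi(2)[OF p zd(1)] zd fu by simp
  then show "vsnd (ap (fmor M N ph x) (ap (eta (pmnd M) (pb u x)) z)) = ap (eta (pmnd N) x) (vsnd z)"
   using em(2)[OF z] en(2)[OF zd(2)] fs(3)[OF x, of "enc (fop (munit M) (fn (pb u x) z), [z])"] em(3)[OF z] by (simp add: pmap_def)
 next
  fix x w assume x: "x \<in> OB ?Q" and w0: "w \<in> car (pO ?R ?A (pO ?R ?A (pb u x)))"
  note ox = pb_obj_OB[OF u x] note Nx = N.pob_OB[OF x]
  note em = pmnd_eta_mu[OF M ox] and en = pmnd_eta_mu[OF N x]
  have w: "w \<in> car (pob ?R ?A (pob ?R ?A (pb u x)))" using w0 ox M.pob_OB[OF ox] by simp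
  note v = M.dec_pob(1)[OF w] note q = M.pel_pob[OF v] note f = fs(1)[OF x]
  let ?w1 = "pmap dec (dec w)"
  have w2: "pmap (pmap vsnd) ?w1 \<in> pel2 ?A" using pmap_pmap_pel[OF pel_pel_pelu[OF q]] .
  have "vsnd (ap (fmor M N ph x) (ap (mu (pmnd M) (pb u x)) w)) = enc (act ph (pmap vsnd (mul (mmul M) ?w1)))"
   using em(7)[OF w] fs(3)[OF x, of "enc (mul (mmul M) ?w1)"] em(6)[OF q] by simp
  also have "pmap vsnd (mul (mmul M) ?w1) = mul (mmul M) (pmap (pmap vsnd) ?w1)" by (rule mul_pmap[OF sig_mor_D(1)[OF MM.m] pel_pel_pelu[OF q], symmetric])
  also have "act ph ... = mul (mmul N) (act ph (pmap (act ph) (pmap (pmap vsnd) ?w1)))" by (rule pi(1)[OF p w2])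
  finally have L: "vsnd (ap (fmor M N ph x) (ap (mu (pmnd M) (pb u x)) w)) = enc (mul (mmul N) (act ph (pmap (act ph) (pmap (pmap vsnd) ?w1))))" .
  have fw: "ap (pA ?R ?A (fmor M N ph x)) w = enc (pmap (ap (fmor M N ph x)) (dec w))" by (rule M.ap_pfun[OF f w])
  note fwp = M.pmap_pob[OF f v]
  have e1: "pmap vsnd (pmap (ap (fmor M N ph x)) (dec w)) = pmap (enc o act ph o pmap vsnd o dec) (dec w)"
   unfolding pmap_comp by (rule pmap_cong) (use fs(3)[OF x] pel_D(2)[OF v] in auto)
  have ff: "vsnd (ap (fmor M N ph (pob ?Q ?B x)) (enc (pmap (ap (fmor M N ph x)) (dec w)))) = enc (act ph (pmap vsnd (pmap (ap (fmor M N ph x)) (dec w))))"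
   using fs(3)[OF Nx, of "enc (pmap (ap (fmor M N ph x)) (dec w))"] fwp by simp
  have "pmap dec (act ph (pmap (enc o act ph o pmap vsnd o dec) (dec w))) = act ph (pmap dec (pmap (enc o act ph o pmap vsnd o dec) (dec w)))"
   by (rule act_pmap[OF pre pmap_pelu[OF pel_pelu[OF v]], symmetric])
  also have "pmap dec (pmap (enc o act ph o pmap vsnd o dec) (dec w)) = pmap (act ph) (pmap (pmap vsnd) ?w1)" unfolding pmap_comp by (rule pmap_cong) simp
  finally have e2: "pmap dec (act ph (pmap (enc o act ph o pmap vsnd o dec) (dec w))) = act ph (pmap (act ph) (pmap (pmap vsnd) ?w1))" .
  have "act ph (pmap vsnd (pmap (ap (fmor M N ph x)) (dec w))) \<in> pE ?B (pob ?Q ?B x)" by (rule fs(2)[OF Nx fwp])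
  then show "vsnd (ap (fmor M N ph x) (ap (mu (pmnd M) (pb u x)) w)) = ap (mu (pmnd N) x) (vsnd (ap (fmor M N ph (pO ?Q ?B x)) (ap (pA ?R ?A (fmor M N ph x)) w)))"
   using L en(7)[of "enc (act ph (pmap vsnd (pmap (ap (fmor M N ph x)) (dec w))))"] ff fw e1 e2 x by simp
 qed
qed

end

section \<open>Cartesian transformations between polynomial functors\<close>

lemma perm_of_lists: assumes "distinct zs" "distinct ys" "set ys = set zs"
 obtains sg where "sg permutes {1..length zs}" "ys = map (%j. zs ! (sg j - 1)) [1..<Suc (length zs)]"
proof -
 let ?n = "length zs" and ?z = "%i. zs ! (i - 1)" and ?y = "%i. ys ! (i - 1)"
 have n: "length ys = ?n" using assms by (metis distinct_card)
 have b: "bij_betw (%i. xs ! (i - 1)) {1..length xs} (set xs)" if "distinct xs" for xs :: "'a list"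
 proof (rule bij_betw_imageI)
  show "inj_on (%i. xs ! (i - 1)) {1..length xs}"
  proof (rule inj_onI)
   fix i j assume *: "i \<in> {1..length xs}" "j \<in> {1..length xs}" "xs ! (i - 1) = xs ! (j - 1)"
   then have "i - 1 < length xs" "j - 1 < length xs" by auto
   then have "i - 1 = j - 1" using that * nth_eq_iff_index_eq by blast
   then show "i = j" using * by auto
  qed
  show "(%i. xs ! (i - 1)) ` {1..length xs} = set xs"
  proof
   show "(%i. xs ! (i - 1)) ` {1..length xs} <= set xs" by auto
   show "set xs <= (%i. xs ! (i - 1)) ` {1..length xs}"
   proof
    fix x assume "x \<in> set xs"
    then obtain i where "i < length xs" "xs ! i = x" by (auto simp: in_set_conv_nth)
    then show "x \<in> (%i. xs ! (i - 1)) ` {1..length xs}" by (intro image_eqI[of _ _ "Suc i"]) auto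
   qed
  qed
 qed
 note bz = b[OF assms(1)] and by' = b[OF assms(2), unfolded n assms(3)]
 define sg where "sg j = (if j \<in> {1..?n} then inv_into {1..?n} ?z (?y j) else j)" for j
 have "bij_betw (inv_into {1..?n} ?z o ?y) {1..?n} {1..?n}" by (rule bij_betw_trans[OF by' bij_betw_inv_into[OF bz]])
 then have "bij_betw sg {1..?n} {1..?n}" by (rule bij_betw_cong[THEN iffD1, rotated]) (simp add: sg_def)
 then have p: "sg permutes {1..?n}" by (rule bij_imp_permutes) (auto simp: sg_def)
 have "ys = map (%j. zs ! (sg j - 1)) [1..<Suc ?n]"
 proof (rule nth_equalityI)
  fix i assume "i < length ys"
  then have i: "i < ?n" "Suc i \<in> {1..?n}" using n by auto
  have "?y (Suc i) \<in> set zs" using bij_betwE[OF by'] i(2) by blast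
  then have "?z (sg (Suc i)) = ?y (Suc i)" using bij_betw_inv_into_right[OF bz] i(2) by (simp add: sg_def)
  then show "ys ! i = map (%j. zs ! (sg j - 1)) [1..<Suc ?n] ! i" using i by simp
 qed (use n in simp)
 then show ?thesis using that p by blast
qed

context universe
begin

text \<open>The universal labelling of \<open>a\<close>: the carrier consists of distinct names for
  the inputs, and every other typed labelling of \<open>a\<close> is its image along an
  arrow.\<close>

lemma generic_obj:
 fixes A :: "('a, 'v) sig" assumes so: "!!i. i <= ar A a ==> bd A a i \<in> Q" and Q: "small (Q :: 'v set)" and a: "a \<in> ops A"
 obtains zs x where "distinct zs" "length zs = ar A a" "x \<in> OB Q" "car x = set zs" "(a, zs) \<in> pE A x"
  "!!y xs. y \<in> OB Q ==> (a, xs) \<in> pE A y ==> EX k:HOM Q x y. map (ap k) zs = xs"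
proof -
 obtain zs :: "'v list" and t where zs: "distinct zs" "length zs = length (bdl A a)" "map t zs = bdl A a" by (rule generic_labels[OF infinite_UNIV])
 let ?x = "(set zs, restrict t (set zs), Q)"
 have "t z \<in> Q" if "z \<in> set zs" for z
 proof -
  have "t z \<in> set (bdl A a)" using that by (simp flip: zs(3))
  then show ?thesis using so by (auto simp: bdl_def)
 qed
 then have x: "?x \<in> OB Q" using small_finite[of "set zs"] Q by (intro OB_I) auto
 have p: "(a, zs) \<in> pE A ?x" using zs(3) a by (simp add: pel_def cong: map_cong)
 have k: "EX k:HOM Q ?x y. map (ap k) zs = xs" if y: "y \<in> OB Q" and v: "(a, xs) \<in> pE A y" for y xs
 proof -
  note d = pel_D[OF v, unfolded fst_conv snd_conv]
  let ?h = "the o map_of (zip zs xs)"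
  have h: "?h (zs ! i) = xs ! i" if "i < length zs" for i using that zs(1,2) d(4) by (simp add: map_of_zip_nth)
  have "slice_map ?x ?h y \<in> HOM Q ?x y"
  proof (rule slice_map_HOM[OF x y])
   fix z assume "z \<in> car ?x"
   then obtain i where i: "i < length zs" "z = zs ! i" by (auto simp: in_set_conv_nth)
   have "fn y (xs ! i) = bdl A a ! i" using arg_cong[OF d(3), of "%l. l ! i"] i zs(2) d(4) by simp
   also have "... = t (zs ! i)" using arg_cong[OF zs(3), of "%l. l ! i"] i zs(2) by simp
   finally show "?h z \<in> car y & fn y (?h z) = fn ?x z" using h[OF i(1)] i d(2,4) zs(2) by auto
  qed
  moreover have "map (ap (slice_map ?x ?h y)) zs = xs" by (rule nth_equalityI) (use h zs(2) d(4) in auto)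
  ultimately show ?thesis by blast
 qed
 show ?thesis by (rule that[OF zs(1) _ x _ p k]) (use zs(2) in simp_all)
qed

text \<open>
 A transformation is determined by its values on generic elements, and cartesianness makes the labels of
 such a value a permutation of the generic ones: they are compared with a second generic element,
 that of the operation in the target.
\<close>

lemma cartesian_transformation_act:
 fixes A :: "('a, 'v) sig" and B :: "('b, 'v) sig" and ta :: "'v fn => 'a * 'v list => 'b * 'v list"
 assumes soA: "!!a i. a \<in> ops A ==> i <= ar A a ==> bd A a i \<in> Q"
  and soB: "!!b i. b \<in> ops B ==> i <= ar B b ==> bd B b i \<in> Q" and Q: "small (Q :: 'v set)"
  and ty: "!!x v. x \<in> OB Q ==> v \<in> pE A x ==> ta x v \<in> pE B x & root B (ta x v) = root A v"
  and nat: "!!x y k v. k \<in> HOM Q x y ==> v \<in> pE A x ==> ta y (pmap (ap k) v) = pmap (ap k) (ta x v)"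
  and cart: "!!x y k s v. k \<in> HOM Q x y ==> s \<in> pE B x ==> v \<in> pE A y ==> pmap (ap k) s = ta y v ==> EX v':pE A x. ta x v' = s & pmap (ap k) v' = v"
 obtains ph where "sig_mor Q A Q B ph" "fob ph = (\<lambda>x\<in>Q. x)" "!!x v. x \<in> OB Q ==> v \<in> pE A x ==> ta x v = act ph v"
proof -
 have key: "EX b sg. b \<in> ops B & ar B b = ar A a & sg permutes {1..ar A a} & (ALL i:{0..ar A a}. bd A a (sg i) = bd B b i) &
   (ALL x xs. x \<in> OB Q --> (a, xs) \<in> pE A x --> ta x (a, xs) = (b, map (%j. xs ! (sg j - 1)) [1..<Suc (length xs)]))" if a: "a \<in> ops A" for a
 proof -
  obtain zs x where zs: "distinct zs" "length zs = ar A a" "x \<in> OB Q" "car x = set zs" "(a, zs) \<in> pE A x"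
   and gz: "!!y xs. y \<in> OB Q ==> (a, xs) \<in> pE A y ==> EX k:HOM Q x y. map (ap k) zs = xs" by (rule generic_obj[of A a Q]) (rule soA[OF a] Q a that; assumption)+
  obtain b ys where bys: "ta x (a, zs) = (b, ys)" by (cases "ta x (a, zs)")
  note t = ty[OF zs(3,5), unfolded bys fst_conv]
  have b: "b \<in> ops B" using t pel_D(1) by fastforce
  note yd = pel_D[OF conjunct1[OF t], unfolded fst_conv snd_conv]
  obtain ws y where ws: "distinct ws" "length ws = ar B b" "y \<in> OB Q" "car y = set ws" "(b, ws) \<in> pE B y"
   and gw: "!!z xs. z \<in> OB Q ==> (b, xs) \<in> pE B z ==> EX k:HOM Q y z. map (ap k) ws = xs" by (rule generic_obj[of B b Q]) (rule soB[OF b] Q b that; assumption)+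
  obtain g where g: "g \<in> HOM Q y x" "map (ap g) ws = ys" using gw[OF zs(3)] t by blast
  \<comment> \<open>Cartesianness lifts the generic labelling of \<open>b\<close> back through
    \<open>ta\<close>. The arrows \<open>g\<close> and \<open>h\<close> between the two generic
    objects then give both halves of the claim: \<open>h\<close> sends \<open>ys\<close> to the
    distinct list \<open>ws\<close>, and every entry of \<open>zs\<close> is in the image of
    \<open>ws\<close> under \<open>g\<close>, that is, in \<open>ys\<close>.\<close>
  obtain v' where v': "v' \<in> pE A y" "ta y v' = (b, ws)" "pmap (ap g) v' = (a, zs)" using cart[OF g(1) ws(5) zs(5)] bys g(2) by (auto simp: pmap_def)
  have "fst v' = a" using v'(3) by (metis fst_conv fst_pmap)
  then obtain xs where v'e: "v' = (a, xs)" by (cases v') simp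
  note gxs = v'(3)[unfolded v'e]
  obtain h where h: "h \<in> HOM Q x y" "map (ap h) zs = xs" using gz[OF ws(3)] v'(1) v'e by blast
  have hys: "map (ap h) ys = ws" using nat[OF h(1) zs(5)] bys v'(2) v'e h(2) by (simp add: pmap_def)
  have gh: "map (ap g) xs = zs" using gxs by (simp add: pmap_def)
  have "distinct ys" using ws(1) hys by (metis distinct_map)
  moreover have "set ys = set zs"
  proof
   show "set ys <= set zs" using yd(2) zs(4) by simp
   have "set xs <= set ws" using pel_D(2)[OF v'(1)] v'e ws(4) by simp
   then have "set (map (ap g) xs) <= set (map (ap g) ws)" by auto
   then show "set zs <= set ys" unfolding gh g(2) .
  qed
  ultimately obtain sg where s: "sg permutes {1..ar A a}" "ys = map (%j. zs ! (sg j - 1)) [1..<Suc (ar A a)]" using perm_of_lists[OF zs(1)] zs(2) by metis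
  have ar: "ar B b = ar A a" using yd(4) s(2) by simp
  have sr: "sg i - 1 < ar A a" "Suc (sg i - 1) = sg i" if "1 <= i" "i <= ar A a" for i using permutes_in_image[OF s(1), of i] that by auto
  have "bd A a (sg i) = bd B b i" if i: "i \<in> {0..ar A a}" for i
  proof (cases "i = 0")
   case True
   then show ?thesis using t permutes_not_in[OF s(1), of 0] by simp
  next
   case False
   then have i1: "1 <= i" "i <= ar A a" "i - 1 < ar A a" "Suc (i - 1) = i" using i by auto
   note r = sr[OF i1(1,2)]
   have "bdl B b ! (i - 1) = bd B b (Suc (i - 1))" by (rule nth_bdl) (use i1 ar in simp)
   then have "bd B b i = bdl B b ! (i - 1)" using i1(4) by simp
   also have "... = fn x (ys ! (i - 1))" using yd(3,4) i1 ar by (metis nth_map)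
   also have "ys ! (i - 1) = zs ! (sg i - 1)" unfolding s(2) using i1 by simp
   also have "fn x (zs ! (sg i - 1)) = bdl A a ! (sg i - 1)" using pel_D(3)[OF zs(5)] r(1) zs(2) by (metis nth_map fst_conv snd_conv)
   also have "... = bd A a (sg i)" using r by simp
   finally show ?thesis by simp
  qed
  \<comment> \<open>Naturality carries the formula from the generic labelling to all others.\<close>
  moreover have "ta z (a, us) = (b, map (%j. us ! (sg j - 1)) [1..<Suc (length us)])" if z: "z \<in> OB Q" and us: "(a, us) \<in> pE A z" for z us
  proof -
   obtain k where k: "k \<in> HOM Q x z" "map (ap k) zs = us" using gz[OF z us] by blast
   have "ta z (a, us) = (b, map (ap k) ys)" using nat[OF k(1) zs(5)] bys k(2) by (simp add: pmap_def)
   moreover have "map (ap k) ys = map (%j. us ! (sg j - 1)) [1..<Suc (length us)]" unfolding s(2) k(2)[symmetric] using sr zs(2) by (auto simp: comp_def)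
   ultimately show ?thesis by simp
  qed
  ultimately show ?thesis using b ar s(1) by blast
 qed
 then obtain f sg where fs: "!!a. a \<in> ops A ==> f a \<in> ops B & ar B (f a) = ar A a & sg a permutes {1..ar A a} &
   (ALL i:{0..ar A a}. bd A a (sg a i) = bd B (f a) i) & (ALL x xs. x \<in> OB Q --> (a, xs) \<in> pE A x -->
    ta x (a, xs) = (f a, map (%j. xs ! (sg a j - 1)) [1..<Suc (length xs)]))" by metis
 define ph where "ph = \<lparr>fop = restrict f (ops A), perm = restrict sg (ops A), fob = (\<lambda>x\<in>Q. x)\<rparr>"
 have "fob ph (bd A a (perm ph a i)) = bd B (fop ph a) i" if a: "a \<in> ops A" and i: "i \<in> {0..ar A a}" for a i
 proof -
  have e: "bd A a (sg a i) = bd B (f a) i" using fs[OF a] i by blast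
  moreover have "bd B (f a) i \<in> Q" using fs[OF a] i by (intro soB) auto
  ultimately show ?thesis using a by (simp add: ph_def)
 qed
 then have "sig_mor Q A Q B ph" unfolding sig_mor_def using fs by (simp add: ph_def)
 moreover have "ta x v = act ph v" if "x \<in> OB Q" "v \<in> pE A x" for x v
  using fs[OF pel_D(1)[OF that(2)]] that pel_D(1)[OF that(2)] by (cases v) (simp add: act_def ph_def)
 ultimately show ?thesis using that[of ph] by (simp add: ph_def)
qed

section \<open>The functor from multicategories to monads\<close>

definition mfunctor :: "('v mcat, 'v mcarr, 'v mobj, 'v marr) fctr" where "mfunctor = \<lparr>omap = (\<lambda>M\<in>Obj MultC. (base M, pmnd M)),
  amap = (\<lambda>(M, ph, N)\<in>Arr MultC. ((base M, pmnd M), (base M, fob ph, base N), fmor M N ph, (base N, pmnd N)))\<rparr>"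

lemma fmor_id: assumes M: "multicategory (M :: 'v mcat)" shows "fmor M M (sig_id (base M) (msig M)) = mon_id (base M, pmnd M)"
proof -
 interpret M: vsig V "base M" "msig M" by (rule multicategory_vsig[OF M])
 note p = multicat_mor_id[OF M]
 have u: "(base M, fob (sig_id (base M) (msig M)), base M) = Idn SetC (base M)" by (simp add: sig_id_def Idn_SetC)
 note fs = fmor_simp[OF M M p, unfolded u]
 note i = mon_id_emor[OF pmnd_obj[OF M], unfolded pmnd_simps(1)] note id = emor_D[OF i(1), unfolded pmnd_simps(1)]
 show ?thesis
 proof (rule extensionalityI)
  show "fmor M M (sig_id (base M) (msig M)) \<in> extensional (OB (base M))" unfolding fmor_def Let_def by simp
  show "mon_id (base M, pmnd M) \<in> extensional (OB (base M))" by (rule id(1))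
  fix x assume x: "x \<in> OB (base M)"
  note k = pb_id_iso[OF x] note o = pb_obj_OB[OF k(1) x]
  show "fmor M M (sig_id (base M) (msig M)) x = mon_id (base M, pmnd M) x"
  proof (rule HOM_pb_eqI[OF k(1) fs(1)[OF x]])
   show "mon_id (base M, pmnd M) x \<in> HOM (base M) (pobM M (pb (Idn SetC (base M)) x)) (pb (Idn SetC (base M)) (pobM M x))" using id(2)[OF x] x o by simp
   fix t assume t: "t \<in> car (pobM M (pb (Idn SetC (base M)) x))"
   note v = M.dec_pob(1)[OF t]
   have "pmap vsnd (dec t) = pmap (ap (pb_id_from x)) (dec t)" by (rule pmap_cong) (use k(5) pel_D(2)[OF v] in auto)
   moreover have "act (sig_id (base M) (msig M)) (pmap vsnd (dec t)) = pmap vsnd (dec t)" by (rule sig_id_pre(2)[OF pmap_pelu[OF pel_pelu[OF v]]])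
   ultimately show "vsnd (ap (fmor M M (sig_id (base M) (msig M)) x) t) = vsnd (ap (mon_id (base M, pmnd M) x) t)"
    using fs(3)[OF x t] i(2)[OF x, of t] M.ap_pfun[OF k(4) t] t o by simp
  qed
 qed
qed

text \<open>Once first components are dropped, both sides act by \<open>ph\<close> and then by
  \<open>ps\<close>; the canonical isomorphism in the composite affects first components
  alone.\<close>

lemma fmor_comp: assumes M: "multicategory (M :: 'v mcat)" and N: "multicategory N" and P: "multicategory P" and p: "multicat_mor M N ph" and q: "multicat_mor N P ps"
 shows "fmor M P (sig_comp (base M) (msig M) ps ph) = mon_comp (base N, fob ps, base P) (fmor N P ps) (base M, fob ph, base N) (fmor M N ph) (pmnd M) (pmnd P)"
proof -
 interpret M: vsig V "base M" "msig M" by (rule multicategory_vsig[OF M])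
 interpret N: vsig V "base N" "msig N" by (rule multicategory_vsig[OF N])
 interpret P: vsig V "base P" "msig P" by (rule multicategory_vsig[OF P])
 let ?u = "(base M, fob ph, base N)" and ?v = "(base N, fob ps, base P)" and ?c = "sig_comp (base M) (msig M) ps ph"
 note u = multicat_mor_hom[OF M N p] and v = multicat_mor_hom[OF N P q]
 note sp = multicat_mor_iff(3)[OF multicategory_D(1)[OF M] multicategory_D(1)[OF N] p]
  and sq = multicat_mor_iff(3)[OF multicategory_D(1)[OF N] multicategory_D(1)[OF P] q]
 note cc = sig_comp_mor[OF M.so sp sq]
 have w: "(base M, fob ?c, base P) = ?v *[SetC] ?u" by (simp add: Cmp_SetC cc(3))
 note pc = multicat_mor_comp[OF M N P p q]
 note fc = fmor_simp[OF M P pc, unfolded w] and fp = fmor_simp[OF M N p] and fq = fmor_simp[OF N P q]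
 note mc = mon_comp_simp[OF u v pmnd_obj[OF M] pmnd_obj[OF N] pmnd_obj[OF P] fmor_emor[OF M N p] fmor_emor[OF N P q], unfolded pmnd_simps(1)]
 show ?thesis
 proof (rule extensionalityI[OF _ mc(1)])
  show "fmor M P ?c \<in> extensional (OB (base P))" unfolding fmor_def Let_def by simp
  fix x assume x: "x \<in> OB (base P)"
  note k = pb_comp_iso[OF u v x] note ov = pb_obj_OB[OF v x] note ow = pb_obj_OB[OF k(1) x]
  show "fmor M P ?c x = mon_comp ?v (fmor N P ps) ?u (fmor M N ph) (pmnd M) (pmnd P) x"
  proof (rule HOM_pb_eqI[OF k(1) fc(1)[OF x]])
   show "mon_comp ?v (fmor N P ps) ?u (fmor M N ph) (pmnd M) (pmnd P) x \<in> HOM (base M) (pobM M (pb (?v *[SetC] ?u) x)) (pb (?v *[SetC] ?u) (pobM P x))"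
    using mc(2)[OF x] x ow by simp
   fix t assume t: "t \<in> car (pobM M (pb (?v *[SetC] ?u) x))"
   note d = M.dec_pob(1)[OF t]
   let ?d = "pmap (ap (pb_comp_to ?v ?u x)) (dec t)"
   note d1 = M.pmap_pob[OF k(2) d]
   note d2 = fp(2)[OF ov d1]
   have "pmap vsnd (act ph (pmap vsnd ?d)) = act ph (pmap vsnd (pmap vsnd ?d))" by (rule act_pmap[OF sig_mor_D(1)[OF sp] pmap_pelu[OF pel_pelu[OF d1]], symmetric])
   also have "pmap vsnd (pmap vsnd ?d) = pmap vsnd (dec t)" unfolding pmap_comp by (rule pmap_cong) (use k(3) pel_D(2)[OF d] in auto)
   finally have e: "pmap vsnd (act ph (pmap vsnd ?d)) = act ph (pmap vsnd (dec t))" .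
   show "vsnd (ap (fmor M P ?c x) t) = vsnd (ap (mon_comp ?v (fmor N P ps) ?u (fmor M N ph) (pmnd M) (pmnd P) x) t)"
    using fc(3)[OF x t] mc(3)[OF x, of t] t ow M.ap_pfun[OF k(2) t] fp(3)[OF ov, of "enc ?d"] d1
     fq(3)[OF x, of "enc (act ph (pmap vsnd ?d))"] d2 e cc(2)[OF pmap_pelu[OF pel_pelu[OF d]], of vsnd] by simp
  qed
 qed
qed

lemma mfunctor: "is_functor MU MonC mfunctor"
proof -
 have arr: "EX M ph N. f = (M, ph, N) & multicategory M & multicategory N & multicat_mor M N ph" if "f \<in> Arr MU" for f using that by (auto simp: MultC_def)
 have am: "amap mfunctor (M, ph, N) = ((base M, pmnd M), (base M, fob ph, base N), fmor M N ph, (base N, pmnd N))"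
  if "multicategory M" "multicategory N" "multicat_mor M N ph" for M N :: "'v mcat" and ph using that unfolding mfunctor_def by (simp add: MultC_def)
 have om: "omap mfunctor M = (base M, pmnd M)" if "multicategory (M :: 'v mcat)" for M using that unfolding mfunctor_def by (simp add: MultC_simps)
 have ah: "amap mfunctor (M, ph, N) \<in> Hom MonC (base M, pmnd M) (base N, pmnd N)"
  if "multicategory M" "multicategory N" "multicat_mor M N ph" for M N :: "'v mcat" and ph
  using fmor_emor[OF that] multicat_mor_hom[OF that] pmnd_obj that by (simp add: am Hom_MonC)
 show ?thesis unfolding is_functor_def
 proof (intro conjI ballI impI)
  show "category MU" "category MO" by (rule category_MultC category_MonC)+
  show "omap mfunctor \<in> Obj MU ->E Obj MonC" using pmnd_obj by (auto simp: PiE_iff om MultC_simps MonC_simps) (simp add: mfunctor_def MultC_simps)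
  show "amap mfunctor \<in> Arr MU ->E Arr MonC"
  proof (rule PiE_I)
   fix f assume "f \<in> Arr MU"
   then obtain M ph N where "f = (M, ph, N)" "multicategory M" "multicategory N" "multicat_mor M N ph" using arr by blast
   then show "amap mfunctor f \<in> Arr MonC" using ah[of M N ph] by (simp add: Hom_def)
  next
   fix f assume "f \<notin> Arr MU"
   then show "amap mfunctor f = undefined" by (simp add: mfunctor_def)
  qed
 next
  fix f assume "f \<in> Arr MU"
  then obtain M ph N where f: "f = (M, ph, N)" "multicategory M" "multicategory N" "multicat_mor M N ph" using arr by blast
  show "Src MonC (amap mfunctor f) = omap mfunctor (Src MultC f)" "Tgt MonC (amap mfunctor f) = omap mfunctor (Tgt MultC f)"
   using f by (simp_all add: am om MultC_simps MonC_simps)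
 next
  fix M assume "M \<in> Obj MU"
  then have M: "multicategory M" by (simp add: MultC_simps)
  show "amap mfunctor (Idn MultC M) = Idn MonC (omap mfunctor M)"
   using fmor_id[OF M] by (simp add: MultC_simps MonC_simps om M am multicat_mor_id) (simp add: sig_id_def Idn_SetC)
 next
  fix f g assume fa: "f \<in> Arr MU" and ga: "g \<in> Arr MU" and t: "Tgt MultC f = Src MultC g"
  obtain M ph N where f: "f = (M, ph, N)" "multicategory M" "multicategory N" "multicat_mor M N ph" using arr[OF fa] by blast
  obtain N' ps P where g': "g = (N', ps, P)" "multicategory P" "multicat_mor N' P ps" using arr[OF ga] by blast
  have "N' = N" using t f g' by (simp add: MultC_simps)
  note g = g'[unfolded this]
  have "(base M, fob (sig_comp (base M) (msig M) ps ph), base P) = (base N, fob ps, base P) *[SetC] (base M, fob ph, base N)" by (simp add: Cmp_SetC sig_comp_def)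
  then show "amap mfunctor (g *[MultC] f) = amap mfunctor g *[MonC] amap mfunctor f"
   using fmor_comp[OF f(2,3) g(2) f(4) g(3)] multicat_mor_comp[OF f(2,3) g(2) f(4) g(3)] f g by (simp add: MultC_simps MonC_simps am)
 qed
qed

text \<open>Evaluated at a labelling with distinct labels, the transformation returns the action of
  the morphism on it, and \<open>sigmor_eqI\<close> applies.\<close>

lemma fmor_faithful: assumes M: "multicategory (M :: 'v mcat)" and N: "multicategory N" and p: "multicat_mor M N ph" and q: "multicat_mor M N ps"
  and e: "fob ph = fob ps" "fmor M N ph = fmor M N ps" shows "ph = ps"
proof -
 interpret M: vsig V "base M" "msig M" by (rule multicategory_vsig[OF M])
 interpret N: vsig V "base N" "msig N" by (rule multicategory_vsig[OF N])
 note sp = multicat_mor_iff(3)[OF multicategory_D(1)[OF M] multicategory_D(1)[OF N] p]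
  and sq = multicat_mor_iff(3)[OF multicategory_D(1)[OF M] multicategory_D(1)[OF N] q]
 let ?u = "(base M, fob ph, base N)"
 note u = multicat_mor_hom[OF M N p]
 note fp = fmor_simp[OF M N p] and fq = fmor_simp[OF M N q, folded e(1)]
 show ?thesis
 proof (rule sigmor_eqI[OF sig_mor_D(1)[OF sp] sig_mor_D(1)[OF sq] e(1)])
  fix a assume a: "a \<in> ops (msig M)"
  have "!!b i. b \<in> ops (msig M) ==> i <= ar (msig M) b ==> fob ph (bd (msig M) b i) \<in> base N" using sig_over_D[OF M.so] sp unfolding sig_mor_def by blast
  moreover have "fn ?u = fob ph" by simp
  \<comment> \<open>Labels are generic for the boundary pushed forward along \<open>fob ph\<close>,
    because the transformations are evaluated at objects over the base of \<open>N\<close>.\<close>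
  ultimately obtain zs :: "'v list" and t where zs: "distinct zs" "length zs = ar (msig M) a" "map t zs = bdl (relab (fob ph) (msig M)) a" "t ` set zs <= base N"
  proof -
   assume h: "!!b i. b \<in> ops (msig M) ==> i <= ar (msig M) b ==> fob ph (bd (msig M) b i) \<in> base N"
   obtain zs :: "'v list" and t where zs: "distinct zs" "length zs = length (bdl (relab (fob ph) (msig M)) a)" "map t zs = bdl (relab (fob ph) (msig M)) a"
    by (rule generic_labels[OF infinite_UNIV])
   have "t ` set zs = set (bdl (relab (fob ph) (msig M)) a)" using zs(3) by (metis set_map)
   also have "... <= base N" using h[OF a] by (auto simp: bdl_def)
   finally show ?thesis using zs by (intro that[of zs t]) simp_all
  qed
  let ?x = "(set zs, restrict t (set zs), base N)"
  have x: "?x \<in> OB (base N)" using small_finite[of "set zs"] N.sR zs(4) by (intro OB_I) auto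
  have v: "(a, zs) \<in> pel (relab (fn ?u) (msig M)) (car ?x) (fn ?x)" using zs(3) a by (simp add: pel_def cong: map_cong)
  note l = lift_pel[OF u M.so v]
  have "act ph (a, zs) = act ps (a, zs)" using fp(3)[OF x, of "enc (lift (msig M) (a, zs))"] fq(3)[OF x, of "enc (lift (msig M) (a, zs))"] l e(2) by simp
  then show "EX zs :: 'v list. distinct zs & length zs = ar (msig M) a & act ph (a, zs) = act ps (a, zs)" using zs by blast
 qed
qed

text \<open>Transposing along \<open>u\<close> turns \<open>f\<close> into a transformation
  \<open>ta\<close> over the base of \<open>N\<close>, from the polynomial functor of
  \<open>relab (fn u) A\<close> to that of \<open>B\<close>. It inherits cartesianness, so it is the
  action of some \<open>ps\<close>. The laws for multiplication and unit are then read off from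
  those of \<open>f\<close> at suitable finite objects.\<close>

lemma fmor_full: assumes M: "multicategory (M :: 'v mcat)" and N: "multicategory N" and u: "u \<in> Hom SetC (base M) (base N)"
  and f: "emor u (base M) (base N) (pmnd M) (pmnd N) f" obtains ph where "multicat_mor M N ph" "u = (base M, fob ph, base N)" "fmor M N ph = f"
proof -
 interpret M: vsig V "base M" "msig M" by (rule multicategory_vsig[OF M])
 interpret N: vsig V "base N" "msig N" by (rule multicategory_vsig[OF N])
 note Md = multicategory_D[OF M] and Nd = multicategory_D[OF N]
 interpret MM: mcat_data "base M" "msig M" "mmul M" "munit M" by (rule Md(1))
 interpret NN: mcat_data "base N" "msig N" "mmul N" "munit N" by (rule Nd(1))
 let ?A = "msig M" and ?B = "msig N" and ?R = "base M" and ?Q = "base N"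
 note fd = emor_D[OF f, unfolded pmnd_simps(1)] note U = pb_functor[OF u]
 have ue: "u = (?R, fn u, ?Q)" "fn u \<in> ?R ->E ?Q" using u by (auto simp: Hom_SetC)
 have fh: "f x \<in> HOM ?R (pob ?R ?A (pb u x)) (pb u (pob ?Q ?B x))" if "x \<in> OB ?Q" for x using fd(2)[OF that] that pb_obj_OB[OF u that] by simp
 let ?A' = "relab (fn u) ?A"
 define ta where "ta x v = dec (vsnd (ap (f x) (enc (lift ?A v))))" for x v
 have lc: "enc (lift ?A v) \<in> car (pob ?R ?A (pb u x))" if "v \<in> pE ?A' x" for x v using lift_pel(1)[OF u M.so that] by simp
 have tau: "ta x v \<in> pE ?B x" "root ?B (ta x v) = root ?A' v" "ap (f x) (enc (lift ?A v)) = vpair (root ?A v, enc (ta x v))"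
  if x: "x \<in> OB ?Q" and v: "v \<in> pE ?A' x" for x v
 proof -
  note y = HOM_D(6)[OF fh[OF x] lc[OF v]] note p = pb_D[OF u y]
  show t: "ta x v \<in> pE ?B x" unfolding ta_def by (rule N.dec_pob(1)[OF p(2)])
  have r: "vfst (ap (f x) (enc (lift ?A v))) = root ?A v" using HOM_D(7)[OF fh[OF x] lc[OF v]] p(5) M.ty_pob[OF lc[OF v]] by (simp add: lift_def)
  show "root ?B (ta x v) = root ?A' v" using p(3) N.ty_pob[OF p(2)] r by (simp add: ta_def)
  show "ap (f x) (enc (lift ?A v)) = vpair (root ?A v, enc (ta x v))" using p(4) r N.dec_pob(2)[OF p(2)] by (simp add: ta_def)
 qed
 have lk: "pmap (ap (uA u k)) (lift ?A v) = lift ?A (pmap (ap k) v)" if k: "k \<in> HOM ?Q x y" and v: "v \<in> pE ?A' x" for k x y v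
 proof -
  note l = lift_pel[OF u M.so v]
  have "pmap vsnd (pmap (ap (uA u k)) (lift ?A v)) = pmap (ap k) (pmap vsnd (lift ?A v))"
   unfolding pmap_comp by (rule pmap_cong) (use U(3)[OF k] pel_D(2)[OF l(1)] in auto)
  then show ?thesis using pel_relab(2)[OF u M.pmap_pob[OF U(4)[OF k] l(1)]] l(2) by simp
 qed
 obtain ps where psi: "sig_mor ?Q ?A' ?Q ?B ps" "fob ps = (\<lambda>x\<in>?Q. x)" "!!x v. x \<in> OB ?Q ==> v \<in> pE ?A' x ==> ta x v = act ps v"
 proof (rule cartesian_transformation_act[of ?A' ?Q ?B ta])
  show "bd ?A' a i \<in> ?Q" if "a \<in> ops ?A'" "i <= ar ?A' a" for a i using sig_over_D[OF M.so] ue(2) that by auto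
  show "bd ?B b i \<in> ?Q" if "b \<in> ops ?B" "i <= ar ?B b" for b i using sig_over_D[OF N.so that] .
  show "small ?Q" by (rule N.sR)
  show "ta x v \<in> pE ?B x & root ?B (ta x v) = root ?A' v" if "x \<in> OB ?Q" "v \<in> pE ?A' x" for x v using tau[OF that] by simp
 next
  fix x y k v assume k: "k \<in> HOM ?Q x y" and v: "v \<in> pE ?A' x"
  note kd = HOM_D[OF k] note ox = pb_obj_OB[OF u kd(1)]
  have v': "pmap (ap k) v \<in> pE ?A' y" by (rule pmap_pel[OF v]) (use kd(6,7) in auto)
  show "ta y (pmap (ap k) v) = pmap (ap k) (ta x v)" using fd(3)[OF k, of "enc (lift ?A v)"] lc[OF v] ox M.ap_pfun_enc[OF U(4)[OF k] lift_pel(1)[OF u M.so v]] lk[OF k v]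
    tau(3)[OF kd(1) v] tau(3)[OF kd(2) v'] N.ap_pfun_enc[OF k tau(1)[OF kd(1) v]] by simp
 next
  fix x y k s v assume k: "k \<in> HOM ?Q x y" and s: "s \<in> pE ?B x" and v: "v \<in> pE ?A' y" and e: "pmap (ap k) s = ta y v"
  note kd = HOM_D[OF k] note ox = pb_obj_OB[OF u kd(1)] and oy = pb_obj_OB[OF u kd(2)]
  have "EX! t'. t' \<in> car (pO ?R ?A (pb u x)) & vsnd (ap (f x) t') = enc s & ap (pA ?R ?A (uA u k)) t' = enc (lift ?A v)"
   by (rule fd(4)[OF k]) (use s kd lc[OF v] oy N.ap_pfun_enc[OF k s] e tau(3)[OF kd(2) v] in simp_all)
  then obtain t' where t': "t' \<in> car (pob ?R ?A (pb u x))" "vsnd (ap (f x) t') = enc s" "ap (pA ?R ?A (uA u k)) t' = enc (lift ?A v)" using ox by (elim ex1E) auto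
  note d = M.dec_pob[OF t'(1)] note r = pel_relab[OF u d(1)]
  have "pmap (ap (uA u k)) (dec t') = lift ?A v" using t'(3) M.ap_pfun[OF U(4)[OF k] t'(1)] by simp
  then have "pmap (ap k) (pmap vsnd (dec t')) = pmap vsnd (lift ?A v)"
   using lk[OF k r(1)] r(2) lift_pel(2)[OF u M.so] pmap_pel[OF r(1), of "ap k" "car y" "fn y"] kd(6,7) by metis
  then have "pmap (ap k) (pmap vsnd (dec t')) = v" using lift_pel(2)[OF u M.so v] by simp
  moreover have "ta x (pmap vsnd (dec t')) = s" unfolding ta_def r(2) using d(2) t'(2) by simp
  ultimately show "EX v':pE ?A' x. ta x v' = s & pmap (ap k) v' = v" using r(1) by blast
 next
  fix ph assume "sig_mor ?Q ?A' ?Q ?B ph" "fob ph = (\<lambda>x\<in>?Q. x)" "!!x v. x \<in> OB ?Q ==> v \<in> pE ?A' x ==> ta x v = act ph v"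
  then show thesis by (rule that)
 qed
 \<comment> \<open>\<open>ps\<close> starts from the relabelled signature and lies over the
   identity; with the same operations and permutations, \<open>ph\<close> starts from the original
   one and lies over \<open>u\<close>.\<close>
 define ph where "ph = \<lparr>fop = fop ps, perm = perm ps, fob = fn u\<rparr>"
 have act: "act ph v = act ps v" for v :: "'v * 'v list" by (simp add: act_def ph_def)
 note pd = sig_mor_D[OF psi(1)] and p' = psi(1)[unfolded sig_mor_def]
 have s: "sig_mor ?R ?A ?Q ?B ph" unfolding sig_mor_def
 proof (intro conjI ballI)
  fix a i assume a: "a \<in> ops ?A" and i: "i \<in> {0..ar ?A a}"
  have "perm ps a i <= ar ?A a" using premor_D[OF pd(1), of a i] a i by (cases "i = 0") auto
  then have "fn u (bd ?A a (perm ps a i)) \<in> ?Q" using sig_over_D[OF M.so a] ue(2) by auto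
  then show "fob ph (bd ?A a (perm ph a i)) = bd ?B (fop ph a) i" using pd(5)[of a i] a i psi(2) by (simp add: ph_def)
 qed (use p' ue(2) in "auto simp: ph_def")
 have F: "ap (f x) t = vpair (root ?A (dec t), enc (act ph (pmap vsnd (dec t))))" if x: "x \<in> OB ?Q" and t: "t \<in> car (pob ?R ?A (pb u x))" for x t
 proof -
  note d = M.dec_pob[OF t] note r = pel_relab[OF u d(1)]
  show ?thesis using tau(3)[OF x r(1)] psi(3)[OF x r(1)] r(2) d(2) by (simp add: act)
 qed
 have m: "multicat_mor M N ph"
 proof (rule multicat_mor_iff(4)[OF Md(1) Nd(1) infinite_UNIV s])
  fix X :: "'v set" and t w assume X: "finite X" "t ` X <= ?R" and w: "w \<in> pel ?A (pel ?A X t) (root ?A)"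
  let ?x = "(X, restrict (fn u o t) X, ?Q)"
  have x: "?x \<in> OB ?Q" using small_finite[OF X(1)] N.sR X(2) ue(2) by (intro OB_I) auto
  note ox = pb_obj_OB[OF u x] note Nx = N.pob_OB[OF x]
  \<comment> \<open>Pairing a label with its type in the base of \<open>M\<close> embeds
    \<open>X\<close> in the pullback along \<open>u\<close>, where \<open>f\<close> can be
    evaluated.\<close>
  let ?j = "%z. vpair (t z, z)"
  have j: "?j z \<in> car (pb u ?x)" "fn (pb u ?x) (?j z) = t z" if "z \<in> X" for z using that X(2) by (auto simp: vpair_car_pb[OF u] ty_pb)
  let ?w = "pmap (pmap ?j) w"
  have w': "?w \<in> pel ?A (pE ?A (pb u ?x)) (root ?A)" by (rule pmap_pel[OF w]) (simp add: pmap_pel j)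
  have vw: "pmap (pmap vsnd) ?w = w" unfolding pmap_comp by (rule pmap_ident) (auto simp: pmap_comp intro!: pmap_ident)
  let ?W = "pmap enc ?w"
  note W = M.pel_pob'[OF w']
  have dW: "pmap dec ?W = ?w" unfolding pmap_comp by (rule pmap_cong) simp
  note em = pmnd_eta_mu[OF M ox] and en = pmnd_eta_mu[OF N x]
  have mw: "mul (mmul M) ?w \<in> pE ?A (pb u ?x)" by (rule em(6)[OF w'])
  have "pmap vsnd (mul (mmul M) ?w) = mul (mmul M) w" using mul_pmap[OF sig_mor_D(1)[OF MM.m] pel_pel_pelu[OF w'], of vsnd] vw by simp
  then have L: "vsnd (ap (f ?x) (ap (mu (pmnd M) (pb u ?x)) (enc ?W))) = enc (act ph (mul (mmul M) w))"
   using em(7)[of "enc ?W"] W dW F[OF x, of "enc (mul (mmul M) ?w)"] mw by simp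
  have fW: "ap (pA ?R ?A (f ?x)) (enc ?W) = enc (pmap (ap (f ?x)) ?W)" by (rule M.ap_pfun_enc[OF fh[OF x] W])
  note fwp = M.pmap_pob[OF fh[OF x] W]
  have e1: "pmap vsnd (pmap (ap (f ?x)) ?W) = pmap (enc o act ph) w"
  proof -
   have "pmap vsnd (pmap (ap (f ?x)) ?W) = pmap (enc o act ph) (pmap (pmap vsnd) ?w)"
    unfolding pmap_comp by (rule pmap_cong) (use F[OF x] pmap_pel[of _ ?A X t ?j] j pel_D(2)[OF w] in auto)
   then show ?thesis unfolding vw .
  qed
  have ff: "vsnd (ap (f (pob ?Q ?B ?x)) (enc (pmap (ap (f ?x)) ?W))) = enc (act ph (pmap (enc o act ph) w))" using F[OF Nx, of "enc (pmap (ap (f ?x)) ?W)"] fwp e1 by simp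
  have "act ph (pmap (enc o act ph) w) \<in> pE ?B (pob ?Q ?B ?x)"
   using relab_act(1)[OF s, of "pmap vsnd (pmap (ap (f ?x)) ?W)"] pel_relab(1)[OF u fwp] e1 by (simp add: ph_def)
  moreover have "pmap dec (act ph (pmap (enc o act ph) w)) = act ph (pmap (act ph) w)"
   using act_pmap[OF sig_mor_D(1)[OF s] pmap_pelu[OF pel_pelu[OF w]], of dec "enc o act ph"] by (simp add: pmap_comp comp_def)
  ultimately have R: "ap (mu (pmnd N) ?x) (vsnd (ap (f (pob ?Q ?B ?x)) (ap (pA ?R ?A (f ?x)) (enc ?W)))) = enc (mul (mmul N) (act ph (pmap (act ph) w)))"
   using en(7)[of "enc (act ph (pmap (enc o act ph) w))"] ff fW by simp
  have "enc ?W \<in> car (pO ?R ?A (pO ?R ?A (pb u ?x)))" using W ox M.pob_OB[OF ox] by simp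
  note fd(6)[OF x this]
  then have "enc (act ph (mul (mmul M) w)) = enc (mul (mmul N) (act ph (pmap (act ph) w)))" unfolding L N.omap_pfun[OF x] R .
  then show "act ph (mul (mmul M) w) = mul (mmul N) (act ph (pmap (act ph) w))" by simp
 next
  fix r assume r: "r \<in> ?R"
  \<comment> \<open>One label of type \<open>fn u r\<close>: at this object the unit law of
    \<open>f\<close> compares the unit operation at \<open>r\<close> with the one at
    \<open>fn u r\<close>.\<close>
  let ?x = "({r}, \<lambda>z\<in>{r}. fn u r, ?Q)"
  have x: "?x \<in> OB ?Q" using small_finite[of "{r}"] N.sR r ue(2) by (intro OB_I) auto
  note ox = pb_obj_OB[OF u x]
  have z: "vpair (r, r) \<in> car (pb u ?x)" using r by (simp add: vpair_car_pb[OF u])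
  note em = pmnd_eta_mu[OF M ox] and en = pmnd_eta_mu[OF N x]
  have tz: "fn (pb u ?x) (vpair (r, r)) = r" using z by (simp add: ty_pb)
  have o: "fop (munit M) r \<in> ops ?A" "ar ?A (fop (munit M) r) = 1" using sig_mor_D(2,3)[OF MM.e] r by simp_all
  have "enc (act ph (fop (munit M) r, [r])) = enc (fop (munit N) (fn u r), [r])"
   using fd(5)[OF x z] em(2)[OF z] en(2)[of r] em(3)[OF z] F[OF x, of "enc (fop (munit M) r, [vpair (r, r)])"] by (simp add: tz pmap_def)
  then show "fop ph (fop (munit M) r) = fop (munit N) (fob ph r)" using act_single[OF sig_mor_D(1)[OF s] o, of r] by (simp add: ph_def)
 qed
 have ueq: "u = (?R, fob ph, ?Q)" using ue(1) by (simp add: ph_def)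
 have "fmor M N ph = f"
 proof (rule extensionalityI[OF _ fd(1)])
  show "fmor M N ph \<in> extensional (OB ?Q)" unfolding fmor_def Let_def by simp
  fix x assume x: "x \<in> OB ?Q"
  note fs = fmor_simp[OF M N m x, folded ueq]
  show "fmor M N ph x = f x" by (rule HOM_eqI[OF fs(1) fh[OF x]]) (simp add: fs(3) F[OF x])
 qed
 then show ?thesis using that m ueq by blast
qed

end

section \<open>Finitary functors preserving wide pullbacks are polynomial\<close>

definition sub :: "'v fn => 'v set => 'v fn" where "sub x S = (S, restrict (fn x) S, snd (snd x))"

definition inc :: "'v fn => 'v set => 'v sarr" where "inc x S = slice_map (sub x S) (%z. z) x"

text \<open>The terminal object of the slice, with \<open>bang\<close> the unique arrow to it. The
  value of the functor here will be the set of operations.\<close>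

definition one :: "'v set => 'v fn" where "one A = (A, \<lambda>a\<in>A. a, A)"

definition bang :: "'v set => 'v fn => 'v sarr" where "bang A x = slice_map x (fn x) (one A)"

context universe
begin

lemma car_sub [simp]: "car (sub x S) = S" and ty_sub [simp]: "z \<in> S ==> fn (sub x S) z = fn x z" unfolding sub_def by auto

lemma sub_OB: assumes "x \<in> OB (A :: 'v set)" "S <= car x" shows "sub x S \<in> OB A" "inc x S \<in> HOM A (sub x S) x"
proof -
 have "snd (snd x) = A" using OB_D(1)[OF assms(1)] by (metis snd_conv)
 then show s: "sub x S \<in> OB A" unfolding sub_def using OB_D[OF assms(1)] small_mono[OF _ assms(2)] assms(2) by (auto intro!: OB_I)
 show "inc x S \<in> HOM A (sub x S) x" unfolding inc_def by (rule slice_map_HOM[OF s assms(1)]) (use assms in auto)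
qed

lemma ap_inc [simp]: "z \<in> S ==> ap (inc x S) z = z" unfolding inc_def by simp

lemma sub_full: assumes "x \<in> OB (A :: 'v set)" shows "sub x (car x) = x" "inc x (car x) = iO A x"
proof -
 note d = OB_D[OF assms]
 have "snd (snd x) = A" using d(1) by (metis snd_conv)
 moreover have "restrict (fn x) (car x) = fn x" using d(4) by (auto simp: PiE_iff extensional_restrict)
 ultimately show e: "sub x (car x) = x" unfolding sub_def using d(1) by metis
 show "inc x (car x) = iO A x" by (rule HOM_eqI[OF sub_OB(2)[OF assms subset_refl, unfolded e] Idn_HOM(1)[OF assms]]) (simp add: Idn_HOM(2)[OF assms])
qed

lemma one_OB: "small (A :: 'v set) ==> one A \<in> OB A" and car_one [simp]: "car (one A) = A" and ty_one [simp]: "a \<in> A ==> fn (one A) a = a"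
 unfolding one_def by (auto intro: OB_I)

lemma bang_HOM: assumes "x \<in> OB (A :: 'v set)" shows "bang A x \<in> HOM A x (one A)" "!!z. z \<in> car x ==> ap (bang A x) z = fn x z"
  "!!f. f \<in> HOM A x (one A) ==> f = bang A x"
proof -
 note d = OB_D[OF assms]
 show b: "bang A x \<in> HOM A x (one A)" unfolding bang_def by (rule slice_map_HOM[OF assms one_OB[OF d(3)]]) (simp add: d(5))
 show a: "!!z. z \<in> car x ==> ap (bang A x) z = fn x z" unfolding bang_def by simp
 fix f assume f: "f \<in> HOM A x (one A)"
 show "f = bang A x"
 proof (rule HOM_eqI[OF f b])
  fix z assume z: "z \<in> car x"
  show "ap f z = ap (bang A x) z" using HOM_D(6,7)[OF f z] a[OF z] by simp
 qed
qed

lemma bang_comp: assumes "f \<in> HOM (A :: 'v set) x y" shows "bang A y \<cdot>[A] f = bang A x"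
 by (rule bang_HOM(3)[OF HOM_D(1)[OF assms] Cmp_HOM(1)[OF assms bang_HOM(1)[OF HOM_D(2)[OF assms]]]])

text \<open>Finite subsets of the carrier, ordered by inclusion. They are presented by lists, so
  that objects and arrows are elements of \<open>'v\<close> as smallness of shapes demands; the
  order is thereby only a preorder. The component \<open>undefined\<close> is padding, because
  \<open>enc\<close> codes pairs.\<close>

definition finsub_cat :: "'v fn => ('v, 'v) cat" where "finsub_cat x = \<lparr>Obj = enc ` ({undefined} \<times> lists (car x)),
  Arr = vpair ` {(i, j). i \<in> enc ` ({undefined} \<times> lists (car x)) & j \<in> enc ` ({undefined} \<times> lists (car x)) &
   set (snd (dec i)) <= set (snd (dec j))}, Src = vfst, Tgt = vsnd, Idn = (%i. vpair (i, i)), Cmp = (%g f. vpair (vfst f, vsnd g))\<rparr>"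

lemma finsub_Obj: "j \<in> Obj (finsub_cat x) <-> (EX l. set l <= car x & j = enc (undefined, l))" unfolding finsub_cat_def by (auto simp: image_iff)

lemma finsub_Hom: "f \<in> Hom (finsub_cat x) i j <-> i \<in> Obj (finsub_cat x) & j \<in> Obj (finsub_cat x) & set (snd (dec i)) <= set (snd (dec j)) & f = vpair (i, j)"
 unfolding Hom_def finsub_cat_def by auto

lemma finsub_filtered: assumes x: "x \<in> OB (A :: 'v set)" shows "filtered (finsub_cat x)" "small (Obj (finsub_cat x))" "small (Arr (finsub_cat x))"
proof -
 let ?J = "finsub_cat x"
 have cat: "category ?J"
 proof
  fix f assume "f \<in> Arr ?J" then show "Src ?J f \<in> Obj ?J" "Tgt ?J f \<in> Obj ?J" unfolding finsub_cat_def by auto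
 qed (auto simp: finsub_Hom, auto simp: finsub_cat_def)
 show "filtered ?J" unfolding filtered_def
 proof (intro conjI ballI)
  show "category ?J" by (rule cat)
  have "enc (undefined, []) \<in> Obj ?J" unfolding finsub_Obj by (intro exI[of _ "[]"]) simp
  then show "Obj ?J ~= {}" by blast
 next
  fix i j assume "i \<in> Obj ?J" "j \<in> Obj ?J"
  then obtain k l where l: "set k <= car x" "i = enc (undefined, k)" "set l <= car x" "j = enc (undefined, l)" unfolding finsub_Obj by blast
  let ?m = "enc (undefined, k @ l)"
  have m: "?m \<in> Obj ?J" unfolding finsub_Obj using l by auto
  then have "vpair (i, ?m) \<in> Hom ?J i ?m" "vpair (j, ?m) \<in> Hom ?J j ?m"
   using \<open>i \<in> Obj ?J\<close> \<open>j \<in> Obj ?J\<close> l by (simp_all add: finsub_Hom)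
  then show "EX k:Obj ?J. Hom ?J i k ~= {} & Hom ?J j k ~= {}" using m by blast
 next
  fix i j f g assume "i \<in> Obj ?J" "j \<in> Obj ?J" "f \<in> Hom ?J i j" "g \<in> Hom ?J i j"
  then have "f = g" "Idn ?J j \<in> Hom ?J j j" using category.Idn_Hom[OF cat] by (simp_all add: finsub_Hom)
  then show "EX k:Obj ?J. EX h:Hom ?J j k. h *[?J] f = h *[?J] g" using \<open>j \<in> Obj ?J\<close> by blast
 qed
 have s: "small (enc ` ({undefined} \<times> lists (car x)))" by (rule small_enc[OF small_finite OB_D(2)[OF x]]) simp
 then show "small (Obj ?J)" unfolding finsub_cat_def by simp
 show "small (Arr ?J)" by (rule small_mono[OF small_times[OF s s]]) (auto simp: finsub_cat_def)
qed

definition finsub_diag :: "'v fn => ('v, 'v, 'v fn, 'v sarr) fctr" where "finsub_diag x = \<lparr>omap = (\<lambda>j\<in>Obj (finsub_cat x). sub x (set (snd (dec j)))),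
  amap = (\<lambda>f\<in>Arr (finsub_cat x). slice_map (sub x (set (snd (dec (vfst f))))) (%z. z) (sub x (set (snd (dec (vsnd f))))))\<rparr>"

text \<open>A set is the directed union of its finite subsets. Applied to a finitary functor, this
  is the source of finite supports.\<close>

lemma finsub_colimit: assumes x: "x \<in> OB (A :: 'v set)" shows "is_colimit (finsub_cat x) (SO A) (finsub_diag x) x (%j. inc x (set (snd (dec j))))"
proof -
 let ?J = "finsub_cat x" and ?S = "%j. set (snd (dec j))"
 note fil = finsub_filtered[OF x]
 interpret category ?J by (rule filtered_D(1)[OF fil(1)])
 have S: "?S j <= car x" if "j \<in> Obj ?J" for j using that unfolding finsub_Obj by auto
 have o: "omap (finsub_diag x) j = sub x (?S j)" if "j \<in> Obj ?J" for j using that by (simp add: finsub_diag_def)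
 have a: "amap (finsub_diag x) f = slice_map (sub x (?S i)) (%z. z) (sub x (?S j))" if f: "f \<in> Hom ?J i j" for f i j
 proof -
  have "f \<in> Arr ?J" "f = vpair (i, j)" using f unfolding finsub_Hom using f by (simp_all add: Hom_iff)
  then show ?thesis by (simp add: finsub_diag_def)
 qed
 have ah: "amap (finsub_diag x) f \<in> HOM A (sub x (?S i)) (sub x (?S j))" if f: "f \<in> Hom ?J i j" for f i j
  unfolding a[OF f] by (rule slice_map_HOM; (intro sub_OB(1)[OF x] S)?) (use f in "auto simp: finsub_Hom")
 have av: "ap (amap (finsub_diag x) f) z = z" if f: "f \<in> Hom ?J i j" and "z \<in> ?S i" for f i j z unfolding a[OF f] using that by simp
 have D: "is_functor ?J (SO A) (finsub_diag x)" unfolding is_functor_def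
 proof (intro conjI ballI impI)
  show "category ?J" "category (SO A)" by (rule filtered_D(1)[OF fil(1)] category_SetOver)+
  show "omap (finsub_diag x) \<in> Obj ?J ->E OB A"
  proof (rule PiE_I)
   fix j assume j: "j \<in> Obj ?J" show "omap (finsub_diag x) j \<in> OB A" unfolding o[OF j] by (rule sub_OB(1)[OF x S[OF j]])
  qed (simp add: finsub_diag_def)
  show "amap (finsub_diag x) \<in> Arr ?J ->E Arr (SO A)"
  proof (rule PiE_I)
   fix f assume "f \<in> Arr ?J" then show "amap (finsub_diag x) f \<in> Arr (SO A)" by (intro HOM_D(3)[OF ah]) (simp add: Hom_iff)
  qed (simp add: finsub_diag_def)
 next
  fix f assume "f \<in> Arr ?J"
  then have f: "f \<in> Hom ?J (Src ?J f) (Tgt ?J f)" by (simp add: Arr_Hom[symmetric])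
  then have ij: "Src ?J f \<in> Obj ?J" "Tgt ?J f \<in> Obj ?J" unfolding finsub_Hom by simp_all
  show "Src (SO A) (amap (finsub_diag x) f) = omap (finsub_diag x) (Src ?J f)" "Tgt (SO A) (amap (finsub_diag x) f) = omap (finsub_diag x) (Tgt ?J f)"
   using HOM_D(4,5)[OF ah[OF f]] o ij by simp_all
 next
  fix j assume j: "j \<in> Obj ?J"
  note i = Idn_Hom[OF j] and s = sub_OB(1)[OF x S[OF j]]
  show "amap (finsub_diag x) (Idn ?J j) = iO A (omap (finsub_diag x) j)"
   unfolding o[OF j] by (rule HOM_eqI[OF ah[OF i] Idn_HOM(1)[OF s]]) (simp add: av[OF i] Idn_HOM(2)[OF s])
 next
  fix f g assume "f \<in> Arr ?J" "g \<in> Arr ?J" "Tgt ?J f = Src ?J g"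
  then have f: "f \<in> Hom ?J (Src ?J f) (Src ?J g)" and g: "g \<in> Hom ?J (Src ?J g) (Tgt ?J g)" by (simp_all add: Hom_iff)
  note gf = Cmp_Hom[OF f g] and c = Cmp_HOM[OF ah[OF f] ah[OF g]]
  have "?S (Src ?J f) <= ?S (Src ?J g)" using f unfolding finsub_Hom by simp
  then show "amap (finsub_diag x) (g *[?J] f) = amap (finsub_diag x) g \<cdot>[A] amap (finsub_diag x) f"
   by (intro HOM_eqI[OF ah[OF gf] c(1)]) (auto simp add: c(2) av[OF f] av[OF g] av[OF gf])
 qed
 have co: "is_cocone ?J (SO A) (finsub_diag x) x (%j. inc x (?S j))"
 proof (rule cocone_I[OF D x])
  show "inc x (?S j) \<in> HOM A (omap (finsub_diag x) j) x" if "j \<in> Obj ?J" for j using sub_OB(2)[OF x S[OF that]] o[OF that] by simp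
  fix f i j z assume f: "f \<in> Hom ?J i j" "i \<in> Obj ?J" "j \<in> Obj ?J" "z \<in> car (omap (finsub_diag x) i)"
  then have z: "z \<in> ?S i" using o by simp
  moreover have "z \<in> ?S j" using f(1) z unfolding finsub_Hom by blast
  ultimately show "ap (inc x (?S j)) (ap (amap (finsub_diag x) f) z) = ap (inc x (?S i)) z" using av[OF f(1)] by simp
 qed
 show ?thesis unfolding filtered_colimit_iff[OF fil(1) co]
 proof (intro conjI ballI impI)
  fix z assume z: "z \<in> car x"
  have j: "enc (undefined, [z]) \<in> Obj ?J" unfolding finsub_Obj using z by (intro exI[of _ "[z]"]) simp
  then show "EX j:Obj ?J. EX a:car (omap (finsub_diag x) j). ap (inc x (?S j)) a = z" by (intro bexI[OF _ j] bexI[of _ z]) (simp_all add: o)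
 next
  fix j a b assume j: "j \<in> Obj ?J" and ab: "a \<in> car (omap (finsub_diag x) j)" "b \<in> car (omap (finsub_diag x) j)" "ap (inc x (?S j)) a = ap (inc x (?S j)) b"
  then have "a = b" using o by simp
  then show "EX k:Obj ?J. EX f:Hom ?J j k. ap (amap (finsub_diag x) f) a = ap (amap (finsub_diag x) f) b" using j Idn_Hom by blast
 qed
qed

end

section \<open>Supports, preimages and generic elements\<close>

locale fmonad = universe V for V :: "'v itself" +
 fixes A :: "'v set" and T :: "('v fn, 'v sarr) mnd" assumes T: "monad_obj (A, T)"
begin

abbreviation "Fo \<equiv> mO T"
abbreviation "Fa f \<equiv> mV T f"

lemmas Td = monad_D[OF T]
lemmas F = functor_D[OF Td(5)]

lemma Fa_car: "f \<in> HOM A x y ==> t \<in> car (Fo x) ==> Fa f t \<in> car (Fo y)" by (rule HOM_D(6)[OF F(2)])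

text \<open>The colimit of \<open>finsub_colimit\<close> is preserved, and every element of a
  filtered colimit comes from some stage.\<close>

lemma support: assumes x: "x \<in> OB A" and t: "t \<in> car (Fo x)" obtains S s where "finite S" "S <= car x" "s \<in> car (Fo (sub x S))" "Fa (inc x S) s = t"
proof -
 let ?J = "finsub_cat x" and ?D = "finsub_diag x"
 note fil = finsub_filtered[OF x] and col = finsub_colimit[OF x]
 have "is_colimit ?J (SO A) (cF ?J (mfun T) ?D) (Fo x) (%j. mA T (inc x (set (snd (dec j)))))"
  using Td(3) fil col unfolding finitary_def preserves_colimits_of_shape_def by blast
 then have "ALL z:car (Fo x). EX j:Obj ?J. EX a:car (omap (cF ?J (mfun T) ?D) j). Fa (inc x (set (snd (dec j)))) a = z"
  using filtered_colimit_iff[OF fil(1)] unfolding is_colimit_def by blast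
 then obtain j a where j: "j \<in> Obj ?J" "a \<in> car (omap (cF ?J (mfun T) ?D) j)" "Fa (inc x (set (snd (dec j)))) a = t" using t by blast
 have "omap (cF ?J (mfun T) ?D) j = Fo (sub x (set (snd (dec j))))" using j(1) by (simp add: comp_functor_def finsub_diag_def)
 then show ?thesis using that[of "set (snd (dec j))" a] j by (auto simp: finsub_Obj)
qed

lemma F_pullback: assumes pb: "is_pullback (SO A) f g p q" and f: "f \<in> HOM A x z" and g: "g \<in> HOM A y z" and p: "p \<in> HOM A w x" and q: "q \<in> HOM A w y"
  and a: "a \<in> car (Fo x)" and b: "b \<in> car (Fo y)" and e: "Fa f a = Fa g b" shows "EX! c. c \<in> car (Fo w) & Fa p c = a & Fa q c = b"
proof -
 have "is_pullback (SO A) (mA T f) (mA T g) (mA T p) (mA T q)" using Td(2) pb unfolding cartesian_monad_def preserves_pullbacks_def by blast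
 then show ?thesis using a b e unfolding pullback_iff[OF F(2)[OF f] F(2)[OF g] F(2)[OF p] F(2)[OF q]] by blast
qed

text \<open>For injective \<open>k\<close> the square formed by \<open>S\<close>, \<open>w\<close>,
  \<open>y\<close> and \<open>z\<close> is a pullback, which the functor preserves. An element whose
  image factors through \<open>k\<close> is therefore supported on the preimage.\<close>

lemma preimage: assumes p: "p \<in> HOM A w z" and k: "k \<in> HOM A y z" and inj: "inj_on (ap k) (car y)"
  and a: "a \<in> car (Fo w)" and b: "b \<in> car (Fo y)" and e: "Fa p a = Fa k b"
 defines "S \<equiv> {c \<in> car w. ap p c \<in> ap k ` car y}"
 obtains c g where "c \<in> car (Fo (sub w S))" "Fa (inc w S) c = a" "g \<in> HOM A (sub w S) y" "Fa g c = b"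
proof -
 note pd = HOM_D[OF p] and kd = HOM_D[OF k]
 have Sw: "S <= car w" unfolding S_def by blast
 note i = sub_OB(2)[OF pd(1) Sw] and s = sub_OB(1)[OF pd(1) Sw]
 let ?g = "slice_map (sub w S) (%c. inv_into (car y) (ap k) (ap p c)) y"
 have gv: "inv_into (car y) (ap k) (ap p c) \<in> car y" "ap k (inv_into (car y) (ap k) (ap p c)) = ap p c" if "c \<in> S" for c
  using that unfolding S_def by (auto intro: inv_into_into f_inv_into_f)
 have g: "?g \<in> HOM A (sub w S) y" by (rule slice_map_HOM[OF s kd(1)]) (use gv kd(7) pd(7) Sw in "auto, metis subsetD")
 have "is_pullback (SO A) p k (inc w S) ?g" unfolding pullback_iff[OF p k i g]
 proof (intro conjI ballI impI)
  fix c assume "c \<in> car (sub w S)"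
  then show "ap p (ap (inc w S) c) = ap k (ap ?g c)" using gv by simp
 next
  fix c d assume c: "c \<in> car w" and d: "d \<in> car y" and e: "ap p c = ap k d"
  have cS: "c \<in> S" unfolding S_def using c d e by blast
  then have "ap ?g c = d" using gv[OF cS] e inj d by (simp add: inj_on_eq_iff)
  then show "EX! b. b \<in> car (sub w S) & ap (inc w S) b = c & ap ?g b = d" using cS by (intro ex1I[of _ c]) auto
 qed
 then show ?thesis using F_pullback[OF _ p k i g a b e] that g by blast
qed

text \<open>Preservation of pullbacks is made to yield a statement about equalisers: the equaliser
  of two arrows is the preimage of one graph under the other, inside the product of \<open>w\<close>
  and \<open>y\<close>, and this product is a pullback over the terminal object.\<close>

lemma F_equal: assumes w: "w \<in> OB A" and y: "y \<in> OB A" and k: "k \<in> HOM A w y" and k': "k' \<in> HOM A w y"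
  and q: "q \<in> car (Fo w)" and e: "Fa k q = Fa k' q"
 defines "S \<equiv> {c \<in> car w. ap k c = ap k' c}" obtains c where "c \<in> car (Fo (sub w S))" "Fa (inc w S) c = q"
proof -
 let ?C = "vpair ` {(a, b). a \<in> car w & b \<in> car y & fn w a = fn y b}"
 let ?z = "(?C, \<lambda>c\<in>?C. fn w (vfst c), A)"
 have "?C <= vpair ` (car w \<times> car y)" by auto
 then have "small ?C" using small_mono[OF small_times[OF OB_D(2)[OF w] OB_D(2)[OF y]]] by blast
 then have z: "?z \<in> OB A"
 proof (rule OB_I[OF _ Td(1)])
  fix c assume "c \<in> ?C"
  then obtain a b where "c = vpair (a, b)" "a \<in> car w" by blast
  then show "fn w (vfst c) \<in> A" using OB_D(5)[OF w] by simp
 qed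
 let ?p = "slice_map ?z vfst w" and ?q = "slice_map ?z vsnd y"
 have p: "?p \<in> HOM A ?z w" by (rule slice_map_HOM[OF z w]) auto
 have q': "?q \<in> HOM A ?z y" by (rule slice_map_HOM[OF z y]) auto
 have gr: "slice_map w (%c. vpair (c, ap h c)) ?z \<in> HOM A w ?z" if h: "h \<in> HOM A w y" for h by (rule slice_map_HOM[OF w z]) (use HOM_D(6,7)[OF h] in auto)
 let ?g = "%h. slice_map w (%c. vpair (c, ap h c)) ?z"
 have pg: "?p \<cdot>[A] ?g h = iO A w" and qg: "?q \<cdot>[A] ?g h = h" if h: "h \<in> HOM A w y" for h
 proof -
  have c: "vpair (c, ap h c) \<in> ?C" if "c \<in> car w" for c using HOM_D(6,7)[OF h] that by auto
  show "?p \<cdot>[A] ?g h = iO A w" by (rule HOM_eqI[OF Cmp_HOM(1)[OF gr[OF h] p] Idn_HOM(1)[OF w]])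
    (simp add: Cmp_HOM(2)[OF gr[OF h] p] Idn_HOM(2)[OF w] c ap_slice_map[of _ ?z])
  show "?q \<cdot>[A] ?g h = h" by (rule HOM_eqI[OF Cmp_HOM(1)[OF gr[OF h] q'] h]) (simp add: Cmp_HOM(2)[OF gr[OF h] q'] c ap_slice_map[of _ ?z])
 qed
 have "is_pullback (SO A) (bang A w) (bang A y) ?p ?q" unfolding pullback_iff[OF bang_HOM(1)[OF w] bang_HOM(1)[OF y] p q']
 proof (intro conjI ballI impI)
  fix c assume "c \<in> car ?z"
  then show "ap (bang A w) (ap ?p c) = ap (bang A y) (ap ?q c)" using bang_HOM(2)[OF w] bang_HOM(2)[OF y] by (auto simp: ap_slice_map[of _ ?z])
 next
  fix a b assume ab: "a \<in> car w" "b \<in> car y" "ap (bang A w) a = ap (bang A y) b"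
  then have "vpair (a, b) \<in> ?C" using bang_HOM(2)[OF w] bang_HOM(2)[OF y] by auto
  then show "EX! c. c \<in> car ?z & ap ?p c = a & ap ?q c = b" by (intro ex1I[of _ "vpair (a, b)"]) (auto simp: ap_slice_map[of _ ?z])
 qed
 note pb = F_pullback[OF this bang_HOM(1)[OF w] bang_HOM(1)[OF y] p q']
 have g1: "Fa ?p (Fa (?g h) q) = q" "Fa ?q (Fa (?g h) q) = Fa h q" if h: "h \<in> HOM A w y" for h
  using F(8)[OF gr[OF h] p q] F(8)[OF gr[OF h] q' q] pg[OF h] qg[OF h] F(7)[OF w q] by simp_all
 have eb: "Fa (bang A w) q = Fa (bang A y) (Fa k q)" using F(8)[OF k bang_HOM(1)[OF y] q] bang_comp[OF k] by simp
 \<comment> \<open>An element of the functor at the product is determined by its two projections,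
   since that pullback is preserved; for the two graphs both projections agree.\<close>
 have "Fa (?g k) q = Fa (?g k') q" using pb[OF q Fa_car[OF k q] eb] g1[OF k] g1[OF k'] e Fa_car[OF gr[OF k] q] Fa_car[OF gr[OF k'] q] by auto
 moreover have "inj_on (ap (?g k')) (car w)" by (rule inj_onI) simp
 ultimately obtain c g where c: "c \<in> car (Fo (sub w {c \<in> car w. ap (?g k) c \<in> ap (?g k') ` car w}))"
   "Fa (inc w {c \<in> car w. ap (?g k) c \<in> ap (?g k') ` car w}) c = q" using preimage[OF gr[OF k] gr[OF k'] _ q q] by blast
 have "{c \<in> car w. ap (?g k) c \<in> ap (?g k') ` car w} = S" unfolding S_def by auto
 then show ?thesis using that c by simp
qed

text \<open>
 The generic element is found in a large power: the exponent runs over all elements over \<open>t\<close> of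
 \<open>F N\<close>, where every finite object embeds into \<open>N\<close>, and the tautological element of \<open>F\<close> of the power
 is restricted to a finite support of least cardinality. Minimality makes factorisations unique.
\<close>

lemma generic_exists: assumes t: "t \<in> car (Fo (one A))" obtains w q where "w \<in> OB A" "finite (car w)" "q \<in> car (Fo w)" "Fa (bang A w) q = t"
  "!!y s. y \<in> OB A ==> s \<in> car (Fo y) ==> Fa (bang A y) s = t ==> EX k:HOM A w y. Fa k q = s"
  "!!y k k'. k \<in> HOM A w y ==> k' \<in> HOM A w y ==> Fa k q = Fa k' q ==> k = k'"
proof -
 note sA = Td(1) note o1 = one_OB[OF sA]
 obtain Z :: "'v set" where Z: "infinite Z" "small Z" by (rule infinite_small)
 let ?N = "(vpair ` (A \<times> Z), restrict vfst (vpair ` (A \<times> Z)), A)"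
 have N: "?N \<in> OB A" by (rule OB_I[OF small_times[OF sA Z(2)] sA]) auto
 define I where "I = {r \<in> car (Fo ?N). Fa (bang A ?N) r = t}"
 have sI: "small I" by (rule small_mono[OF OB_D(2)[OF F(1)[OF N]]]) (auto simp: I_def)
 let ?E = "I ->E car ?N"
 obtain ka :: "('v => 'v) => 'v" where ka: "inj_on ka ?E" "small (ka ` ?E)" by (rule small_funcs[OF sI OB_D(2)[OF N]]) (rule that; assumption)
 \<comment> \<open>\<open>?P\<close> is the power of \<open>?N\<close> with exponent
   \<open>I\<close> in the slice: families whose members lie over one base point, coded by
   \<open>ka\<close>. The base point is stored too, so that an empty \<open>I\<close> gives the
   terminal object up to isomorphism.\<close>
 let ?C = "vpair ` {(a, c). a \<in> A & (EX h:?E. c = ka h & (ALL i:I. fn ?N (h i) = a))}"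
 let ?P = "(?C, restrict vfst ?C, A)"
 have "?C <= vpair ` (A \<times> ka ` ?E)" by auto
 then have "small ?C" using small_mono[OF small_times[OF sA ka(2)]] by blast
 then have P: "?P \<in> OB A" by (rule OB_I[OF _ sA]) auto
 define dc where "dc z = inv_into ?E ka (vsnd z)" for z
 have dc: "dc (vpair (a, ka h)) = h" if "h \<in> ?E" for a h unfolding dc_def using ka(1) that by simp
 define pj where "pj i = slice_map ?P (%z. dc z i) ?N" for i
 have pj: "pj i \<in> HOM A ?P ?N" if i: "i \<in> I" for i unfolding pj_def
 proof (rule slice_map_HOM[OF P N])
  fix z assume z: "z \<in> car ?P"
  then have "z \<in> ?C" by simp
  then obtain a h where ah: "z = vpair (a, ka h)" "h \<in> ?E" "ALL i:I. fn ?N (h i) = a" by blast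
  have "fn ?P z = vfst z" using z by simp
  moreover have "dc z i = h i" using dc[OF ah(2), of a] ah(1) by simp
  ultimately show "dc z i \<in> car ?N & fn ?N (dc z i) = fn ?P z" by (simp only: bspec[OF ah(3) i] ah(1) vfst_vpair PiE_mem[OF ah(2) i] simp_thms)
 qed
 have pjv: "ap (pj i) (vpair (a, ka h)) = h i" if "vpair (a, ka h) \<in> ?C" "h \<in> ?E" for a h i
  unfolding pj_def using that dc[OF that(2)] by (subst ap_slice_map) simp_all
 have "is_wide_pullback I (SO A) (%i. bang A ?N) (one A) pj (bang A ?P)"
 proof (rule iffD2[OF wide_pullback_iff[OF o1 bang_HOM(1)[OF P], where x = "%i. ?N"]], goal_cases)
  case 3
  show ?case
  proof (intro conjI ballI allI impI)
   fix i c assume i: "i \<in> I" and c: "c \<in> car ?P"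
   show "ap (bang A ?N) (ap (pj i) c) = ap (bang A ?P) c" using bang_HOM(2)[OF N HOM_D(6)[OF pj[OF i] c]] bang_HOM(2)[OF P c] HOM_D(7)[OF pj[OF i] c] by simp
  next
   fix b a assume b: "b \<in> car (one A)" and a: "ALL i:I. a i \<in> car ?N & ap (bang A ?N) (a i) = b"
   then have b: "b \<in> A" and a: "!!i. i \<in> I ==> a i \<in> car ?N & fn ?N (a i) = b" using bang_HOM(2)[OF N] by auto
   have aE: "restrict a I \<in> ?E" using a by auto
   have "ALL i:I. fn ?N (restrict a I i) = b"
   proof
    fix i assume i: "i \<in> I" show "fn ?N (restrict a I i) = b" unfolding restrict_apply'[OF i] using a[OF i] ..
   qed
   then have cC: "vpair (b, ka (restrict a I)) \<in> ?C" using b aE by blast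
   show "EX! c. c \<in> car ?P & ap (bang A ?P) c = b & (ALL i:I. ap (pj i) c = a i)"
   proof (rule ex1I[of _ "vpair (b, ka (restrict a I))"], intro conjI ballI)
    show c: "vpair (b, ka (restrict a I)) \<in> car ?P" using cC by simp
    show "ap (bang A ?P) (vpair (b, ka (restrict a I))) = b" using bang_HOM(2)[OF P c] cC by simp
    show "ap (pj i) (vpair (b, ka (restrict a I))) = a i" if "i \<in> I" for i using pjv[OF cC aE, of i] that by simp
    fix c assume c: "c \<in> car ?P & ap (bang A ?P) c = b & (ALL i:I. ap (pj i) c = a i)"
    then have "c \<in> ?C" by simp
    then obtain a' h where h: "c = vpair (a', ka h)" "h \<in> ?E" by blast
    have "fn ?P c = vfst c" using \<open>c \<in> ?C\<close> by simp
    then have "a' = b" using c bang_HOM(2)[OF P, of c] h by simp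
    moreover have "h = restrict a I" by (rule PiE_ext[OF h(2) aE]) (use pjv[of a' h] \<open>c \<in> ?C\<close> h c in auto)
    ultimately show "c = vpair (b, ka (restrict a I))" using h by simp
   qed
  qed
 qed (use bang_HOM(1)[OF N] pj in auto)
 then have wp: "is_wide_pullback I (SO A) (%i. mA T (bang A ?N)) (Fo (one A)) (%i. mA T (pj i)) (mA T (bang A ?P))"
  using Td(4) sI unfolding preserves_wide_pullbacks_def preserves_wide_pullbacks_of_shape_def by blast
 have "ALL b:car (Fo (one A)). ALL a. (ALL i:I. a i \<in> car (Fo ?N) & Fa (bang A ?N) (a i) = b) -->
   (EX! c. c \<in> car (Fo ?P) & Fa (bang A ?P) c = b & (ALL i:I. Fa (pj i) c = a i))"
  using wide_pullback_iff[OF F(1)[OF o1] F(2)[OF bang_HOM(1)[OF P]], where x = "%i. Fo ?N" and I = I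
   and f = "%i. mA T (bang A ?N)" and p = "%i. mA T (pj i)"] F(2)[OF bang_HOM(1)[OF N]] F(2)[OF pj] wp by blast
 from this[rule_format, OF t, of "%i. i"]
 have "EX! c. c \<in> car (Fo ?P) & Fa (bang A ?P) c = t & (ALL i:I. Fa (pj i) c = i)" by (simp add: I_def)
 then obtain sg where sg: "sg \<in> car (Fo ?P)" "Fa (bang A ?P) sg = t" "!!i. i \<in> I ==> Fa (pj i) sg = i" by blast
 \<comment> \<open>Candidates are finite objects with an arrow \<open>io\<close> along which some
   \<open>q\<close> becomes the tautological element \<open>sg\<close>; finite support provides one,
   and one of least cardinality is chosen.\<close>
 let ?G = "%n. EX w q io. w \<in> OB A & finite (car w) & card (car w) = n & q \<in> car (Fo w) & io \<in> HOM A w ?P & Fa io q = sg"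
 obtain S s where S: "finite S" "S <= car ?P" "s \<in> car (Fo (sub ?P S))" "Fa (inc ?P S) s = sg" by (rule support[OF P sg(1)])
 have "?G (card S)" by (intro exI[of _ "sub ?P S"] exI[of _ s] exI[of _ "inc ?P S"]) (use S sub_OB[OF P S(2)] in simp)
 then have "?G (LEAST n. ?G n)" by (rule LeastI)
 then obtain w q io where w: "w \<in> OB A" "finite (car w)" "card (car w) = (LEAST n. ?G n)" and q: "q \<in> car (Fo w)"
  and io: "io \<in> HOM A w ?P" "Fa io q = sg" by blast
 \<comment> \<open>A smaller support of \<open>q\<close> would again be a candidate, so
   \<open>q\<close> is supported on no proper subset of the carrier.\<close>
 have tight: "S' = car w" if S': "S' <= car w" "q' \<in> car (Fo (sub w S'))" "Fa (inc w S') q' = q" for S' q'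
 proof -
  note i = sub_OB[OF w(1) S'(1)]
  have "?G (card S')" by (intro exI[of _ "sub w S'"] exI[of _ q'] exI[of _ "io \<cdot>[A] inc w S'"])
    (use i S' finite_subset[OF S'(1) w(2)] Cmp_HOM(1)[OF i(2) io(1)] F(8)[OF i(2) io(1) S'(2)] io(2) in simp)
  then have "card (car w) <= card S'" unfolding w(3) by (rule Least_le)
  then show ?thesis using card_seteq[OF w(2) S'(1)] by simp
 qed
 show ?thesis
 proof (rule that[OF w(1,2) q])
  show "Fa (bang A w) q = t" using F(8)[OF io(1) bang_HOM(1)[OF P] q] bang_comp[OF io(1)] io(2) sg(2) by simp
 next
  fix y s assume y: "y \<in> OB A" and s: "s \<in> car (Fo y)" "Fa (bang A y) s = t"
  obtain S' s' where S': "finite S'" "S' <= car y" "s' \<in> car (Fo (sub y S'))" "Fa (inc y S') s' = s" by (rule support[OF y s(1)])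
  note i = sub_OB[OF y S'(2)]
  obtain \<epsilon> :: "'v => 'v" where \<epsilon>: "inj_on \<epsilon> S'" "\<epsilon> ` S' <= Z"
   using finite_lepoll_infinite[OF Z(1) S'(1)] unfolding lepoll_def by blast
  let ?j = "slice_map (sub y S') (%z. vpair (fn y z, \<epsilon> z)) ?N"
  have j: "?j \<in> HOM A (sub y S') ?N"
  proof (rule slice_map_HOM[OF i(1) N])
   fix z assume "z \<in> car (sub y S')"
   then have z: "z \<in> S'" by simp
   then have "vpair (fn y z, \<epsilon> z) \<in> vpair ` (A \<times> Z)" using \<epsilon>(2) S'(2) OB_D(5)[OF y, of z] by auto
   then show "vpair (fn y z, \<epsilon> z) \<in> car ?N & fn ?N (vpair (fn y z, \<epsilon> z)) = fn (sub y S') z" using z by simp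
  qed
  have jinj: "inj_on (ap ?j) (car (sub y S'))"
  proof (rule inj_onI)
   fix z z' assume "z \<in> car (sub y S')" "z' \<in> car (sub y S')" "ap ?j z = ap ?j z'"
   then show "z = z'" using \<epsilon>(1) by (simp add: inj_on_eq_iff)
  qed
  \<comment> \<open>\<open>?r\<close> is one of the exponents, and the projection at
    \<open>?r\<close> sends \<open>sg\<close> to \<open>?r\<close>. So \<open>q\<close> is carried
    to an element that factors through the injective \<open>?j\<close>; by \<open>preimage\<close>
    and \<open>tight\<close> the factorisation is defined on all of \<open>w\<close>.\<close>
  let ?r = "Fa ?j s'"
  have "Fa (bang A ?N) ?r = Fa (bang A (sub y S')) s'" using F(8)[OF j bang_HOM(1)[OF N] S'(3)] bang_comp[OF j] by simp
  also have "... = t" using F(8)[OF i(2) bang_HOM(1)[OF y] S'(3)] bang_comp[OF i(2)] S'(4) s(2) by simp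
  finally have r: "?r \<in> I" unfolding I_def using Fa_car[OF j S'(3)] by simp
  note pi = Cmp_HOM(1)[OF io(1) pj[OF r]]
  have "Fa (pj ?r \<cdot>[A] io) q = Fa ?j s'" using F(8)[OF io(1) pj[OF r] q] io(2) sg(3)[OF r] by simp
  then obtain c g where c: "c \<in> car (Fo (sub w {c \<in> car w. ap (pj ?r \<cdot>[A] io) c \<in> ap ?j ` car (sub y S')}))"
    "Fa (inc w {c \<in> car w. ap (pj ?r \<cdot>[A] io) c \<in> ap ?j ` car (sub y S')}) c = q"
    "g \<in> HOM A (sub w {c \<in> car w. ap (pj ?r \<cdot>[A] io) c \<in> ap ?j ` car (sub y S')}) (sub y S')" "Fa g c = s'" by (rule preimage[OF pi j jinj q S'(3)])
  have full: "{c \<in> car w. ap (pj ?r \<cdot>[A] io) c \<in> ap ?j ` car (sub y S')} = car w" by (rule tight[OF _ c(1,2)]) blast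
  note c' = c[unfolded full sub_full(1)[OF w(1)] sub_full(2)[OF w(1)]]
  have "c = q" using c'(2) F(7)[OF w(1) c'(1)] by simp
  then have "Fa (inc y S' \<cdot>[A] g) q = s" using F(8)[OF c'(3) i(2) c'(1)] c'(4) S'(4) by simp
  then show "EX k:HOM A w y. Fa k q = s" using Cmp_HOM(1)[OF c'(3) i(2)] by blast
 next
  fix y k k' assume k: "k \<in> HOM A w y" and k': "k' \<in> HOM A w y" and e: "Fa k q = Fa k' q"
  \<comment> \<open>The equaliser of \<open>k\<close> and \<open>k'\<close> supports
    \<open>q\<close>, hence by \<open>tight\<close> it is everything.\<close>
  obtain c where c: "c \<in> car (Fo (sub w {c \<in> car w. ap k c = ap k' c}))" "Fa (inc w {c \<in> car w. ap k c = ap k' c}) c = q"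
   by (rule F_equal[OF w(1) HOM_D(2)[OF k] k k' q e])
  have "{c \<in> car w. ap k c = ap k' c} = car w" by (rule tight[OF _ c]) blast
  then show "k = k'" by (intro HOM_eqI[OF k k']) blast
 qed
qed

text \<open>The operations are the elements \<open>t\<close> of the functor at the terminal object,
  and the inputs of \<open>t\<close> are the points of its generic object in a chosen order
  \<open>ws t\<close>. A typed labelling is an arrow \<open>hh\<close> out of that object, and
  \<open>th\<close> applies it to the generic element: existence of factorisations gives
  surjectivity, uniqueness gives injectivity.\<close>

lemma polynomial: obtains B :: "('v, 'v) sig" and th where "sig_over A B" "small (ops B)" "!!x. x \<in> OB A ==> bij_betw (th x) (pE B x) (car (Fo x))"
  "!!x v. x \<in> OB A ==> v \<in> pE B x ==> fn (Fo x) (th x v) = root B v" "!!x y f v. f \<in> HOM A x y ==> v \<in> pE B x ==> th y (pmap (ap f) v) = Fa f (th x v)"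
proof -
 note sA = Td(1) note o1 = one_OB[OF sA]
 define P where "P t w q ws <-> w \<in> OB A & distinct ws & set ws = car w & q \<in> car (Fo w) & Fa (bang A w) q = t &
  (ALL y s. y \<in> OB A --> s \<in> car (Fo y) --> Fa (bang A y) s = t --> (EX k:HOM A w y. Fa k q = s)) &
  (ALL y k k'. k \<in> HOM A w y --> k' \<in> HOM A w y --> Fa k q = Fa k' q --> k = k')" for t w q and ws :: "'v list"
 have "ALL t:car (Fo (one A)). EX p. P t (fst p) (fst (snd p)) (snd (snd p))"
 proof
  fix t assume t: "t \<in> car (Fo (one A))"
  obtain w q where w: "w \<in> OB A" "finite (car w)" "q \<in> car (Fo w)" "Fa (bang A w) q = t"
   "!!y s. y \<in> OB A ==> s \<in> car (Fo y) ==> Fa (bang A y) s = t ==> EX k:HOM A w y. Fa k q = s"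
   "!!y k k'. k \<in> HOM A w y ==> k' \<in> HOM A w y ==> Fa k q = Fa k' q ==> k = k'" by (rule generic_exists[OF t]) (rule that; assumption)
  obtain ws where "set ws = car w" "distinct ws" using finite_distinct_list[OF w(2)] by blast
  then have "P t w q ws" unfolding P_def using w by (intro conjI allI impI) assumption+
  then show "EX p. P t (fst p) (fst (snd p)) (snd (snd p))" by (intro exI[of _ "(w, q, ws)"]) simp
 qed
 from bchoice[OF this] obtain p where "ALL t:car (Fo (one A)). P t (fst (p t)) (fst (snd (p t))) (snd (snd (p t)))" ..
 then obtain w q ws where "ALL t:car (Fo (one A)). P t (w t) (q t) (ws t)" by (rule that)
 note G = bspec[OF this, unfolded P_def]
 let ?O = "car (Fo (one A))"
 define B :: "('v, 'v) sig" where "B = \<lparr>ops = ?O, ar = (\<lambda>t\<in>?O. length (ws t)),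
  bd = (\<lambda>t\<in>?O. \<lambda>i\<in>{0..length (ws t)}. if i = 0 then fn (Fo (one A)) t else fn (w t) (ws t ! (i - 1)))\<rparr>"
 have Bs: "ops B = ?O" "!!t. t \<in> ?O ==> ar B t = length (ws t)" "!!t. t \<in> ?O ==> bd B t 0 = fn (Fo (one A)) t"
  "!!t. t \<in> ?O ==> bdl B t = map (fn (w t)) (ws t)" unfolding B_def bdl_def by (auto intro!: nth_equalityI)
 have soB: "sig_over A B"
 proof -
  have "fn (w t) (ws t ! (i - 1)) \<in> A" if "t \<in> ?O" "i \<in> {0..length (ws t)}" "i ~= 0" for t i
   using OB_D(5)[of "w t" A "ws t ! (i - 1)"] G[OF that(1)] that nth_mem[of "i - 1" "ws t"] by auto
  then show ?thesis unfolding sig_over_def B_def using OB_D(5)[OF F(1)[OF o1]] by auto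
 qed
 define hh where "hh x v = slice_map (w (fst v)) (the o map_of (zip (ws (fst v)) (snd v))) x" for x :: "'v fn" and v :: "'v * 'v list"
 have hh: "hh x v \<in> HOM A (w (fst v)) x" "map (ap (hh x v)) (ws (fst v)) = snd v" if x: "x \<in> OB A" and v: "v \<in> pE B x" for x v
 proof -
  note d = pel_D[OF v, unfolded Bs(1)] note g = G[OF d(1)] and l = d(4)[unfolded Bs(2)[OF d(1)]]
  have h: "(the o map_of (zip (ws (fst v)) (snd v))) (ws (fst v) ! i) = snd v ! i" if "i < length (ws (fst v))" for i using that l g by (simp add: map_of_zip_nth)
  show "hh x v \<in> HOM A (w (fst v)) x" unfolding hh_def
  proof (rule slice_map_HOM[OF _ x])
   show "w (fst v) \<in> OB A" using g by blast
   fix z assume "z \<in> car (w (fst v))"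
   then obtain i where i: "i < length (ws (fst v))" "z = ws (fst v) ! i" using g by (metis in_set_conv_nth)
   have "fn x (snd v ! i) = fn (w (fst v)) (ws (fst v) ! i)" using arg_cong[OF d(3)[unfolded Bs(4)[OF d(1)]], of "%l. l ! i"] i l by simp
   then show "(the o map_of (zip (ws (fst v)) (snd v))) z \<in> car x & fn x ((the o map_of (zip (ws (fst v)) (snd v))) z) = fn (w (fst v)) z"
    using h[OF i(1)] i d(2) l by auto
  qed
  show "map (ap (hh x v)) (ws (fst v)) = snd v"
  proof (rule nth_equalityI)
   fix i assume "i < length (map (ap (hh x v)) (ws (fst v)))"
   then have i: "i < length (ws (fst v))" by simp
   then have "ws (fst v) ! i \<in> car (w (fst v))" using g nth_mem by blast
   then show "map (ap (hh x v)) (ws (fst v)) ! i = snd v ! i" using h[OF i] i by (simp add: hh_def)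
  qed (use l in simp)
 qed
 define th where "th x v = Fa (hh x v) (q (fst v))" for x v
 have th: "th x v \<in> car (Fo x)" "Fa (bang A x) (th x v) = fst v" "fst v \<in> ?O" if x: "x \<in> OB A" and v: "v \<in> pE B x" for x v
 proof -
  show o: "fst v \<in> ?O" using pel_D(1)[OF v] Bs(1) by simp
  note g = G[OF o] note h = hh(1)[OF x v]
  show "th x v \<in> car (Fo x)" unfolding th_def using Fa_car[OF h] g by blast
  show "Fa (bang A x) (th x v) = fst v" unfolding th_def using F(8)[OF h bang_HOM(1)[OF x]] bang_comp[OF h] g by auto
 qed
 show ?thesis
 proof (rule that[OF soB])
  show "small (ops B)" unfolding Bs(1) by (rule OB_D(2)[OF F(1)[OF o1]])
 next
  fix x assume x: "x \<in> OB A"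
  show "bij_betw (th x) (pE B x) (car (Fo x))"
  proof (rule bij_betw_imageI)
   show "inj_on (th x) (pE B x)"
   proof (rule inj_onI)
    fix v v' assume v: "v \<in> pE B x" and v': "v' \<in> pE B x" and e: "th x v = th x v'"
    have f: "fst v = fst v'" using th(2)[OF x v] th(2)[OF x v'] e by simp
    have "hh x v = hh x v'" using G[OF th(3)[OF x v]] hh(1)[OF x v] hh(1)[OF x v'] e f unfolding th_def by metis
    then have "snd v = snd v'" using hh(2)[OF x v] hh(2)[OF x v'] f by simp
    then show "v = v'" using f by (simp add: prod_eq_iff)
   qed
   show "th x ` pE B x = car (Fo x)"
   proof
    show "th x ` pE B x <= car (Fo x)" using th(1)[OF x] by blast
    show "car (Fo x) <= th x ` pE B x"
    proof
     fix s assume s: "s \<in> car (Fo x)"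
     define t where "t = Fa (bang A x) s"
     have t: "t \<in> ?O" unfolding t_def by (rule Fa_car[OF bang_HOM(1)[OF x] s])
     note g = G[OF t]
     obtain k where k: "k \<in> HOM A (w t) x" "Fa k (q t) = s" using g x s t_def by blast
     let ?v = "(t, map (ap k) (ws t))"
     have "map (fn x) (map (ap k) (ws t)) = map (fn (w t)) (ws t)" using HOM_D(7)[OF k(1)] g by auto
     moreover have "set (map (ap k) (ws t)) <= car x" using HOM_D(6)[OF k(1)] g by auto
     ultimately have v: "?v \<in> pE B x" using t by (simp add: pel_def Bs(1) Bs(4)[OF t] del: map_map)
     have "hh x ?v = k"
     proof (rule HOM_eqI[OF hh(1)[OF x v, unfolded fst_conv] k(1)])
      fix z assume "z \<in> car (w t)"
      then have "z \<in> set (ws t)" using g by blast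
      then show "ap (hh x ?v) z = ap k z" using hh(2)[OF x v] by simp
     qed
     then have "th x ?v = s" unfolding th_def using k(2) by simp
     then show "s \<in> th x ` pE B x" using v by (metis image_eqI)
    qed
   qed
  qed
  fix v assume v: "v \<in> pE B x"
  show "fn (Fo x) (th x v) = root B v" using HOM_D(7)[OF F(2)[OF bang_HOM(1)[OF x]] th(1)[OF x v]] th(2,3)[OF x v] Bs(3) by simp
 next
  fix x y f v assume f: "f \<in> HOM A x y" and v: "v \<in> pE B x"
  note fd = HOM_D[OF f]
  have v': "pmap (ap f) v \<in> pE B y" by (rule pmap_pel[OF v]) (use fd(6,7) in auto)
  note h = hh[OF fd(1) v] and h' = hh[OF fd(2) v', unfolded fst_pmap snd_pmap] and g = G[OF th(3)[OF fd(1) v]]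
  note c = Cmp_HOM[OF h(1) f]
  have "hh y (pmap (ap f) v) = f \<cdot>[A] hh x v"
  proof (rule HOM_eqI[OF h'(1) c(1)])
   fix z assume z: "z \<in> car (w (fst v))"
   then obtain i where i: "i < length (ws (fst v))" "z = ws (fst v) ! i" using g by (metis in_set_conv_nth)
   have "ap (hh x v) z = snd v ! i" using arg_cong[OF h(2), of "%l. l ! i"] i by simp
   moreover have "ap (hh y (pmap (ap f) v)) z = map (ap f) (snd v) ! i" using arg_cong[OF h'(2), of "%l. l ! i"] i by simp
   moreover have "length (snd v) = length (ws (fst v))" using h(2) by (metis length_map)
   ultimately show "ap (hh y (pmap (ap f) v)) z = ap (f \<cdot>[A] hh x v) z" using c(2)[OF z] i by simp
  qed
  then show "th y (pmap (ap f) v) = Fa f (th x v)" unfolding th_def using F(8)[OF h(1) f] g by simp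
 qed
qed

end

section \<open>Every object of the fibration of monads comes from a multicategory\<close>

lemma tensor_bd_in: assumes o: "!!a i. a \<in> ops A ==> i <= ar A a ==> bd A a i \<in> R" and s: "s \<in> ops (tensor A A)" and i: "i <= ar (tensor A A) s"
 shows "bd (tensor A A) s i \<in> R"
proof -
 obtain a bs where ab: "s = (a, bs)" "a \<in> ops A" "set bs <= ops A" using s pel_D[OF s[unfolded ops_tensor]] by (cases s) auto
 note t = tensor_simps[OF s[unfolded ab(1)]]
 show ?thesis
 proof (cases i)
  case 0 then show ?thesis using t(2) o[OF ab(2), of 0] ab(1) by simp
 next
  case (Suc k)
  then have "bd (tensor A A) s i = bdl (tensor A A) s ! k" "k < ar (tensor A A) s" using i by simp_all
  moreover have "set (bdl (tensor A A) s) <= R" unfolding ab(1) t(3) using ab(3) o by (fastforce simp: bdl_def)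
  ultimately show ?thesis using nth_mem[of k "bdl (tensor A A) s"] by auto
 qed
qed

locale poly = fmonad V A T for V :: "'v itself" and A T +
 fixes B :: "('v, 'v) sig" and th :: "'v fn => 'v * 'v list => 'v" assumes so: "sig_over A B" and sB: "small (ops B)"
  and bij: "x \<in> OB A ==> bij_betw (th x) (pE B x) (car (Fo x))" and rt: "x \<in> OB A ==> v \<in> pE B x ==> fn (Fo x) (th x v) = root B v"
  and nat: "f \<in> HOM A x y ==> v \<in> pE B x ==> th y (pmap (ap f) v) = Fa f (th x v)"
begin

abbreviation "E x \<equiv> pE B x"
abbreviation "E2 x \<equiv> pel B (E x) (root B)"

definition io where "io x = inv_into (E x) (th x)"
text \<open>The bijection induced by \<open>th\<close> between nested labellings and the twofold
  application of the functor; \<open>th2\<close> proves it to be one.\<close>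

definition Th2 :: "'v fn => 'v * ('v * 'v list) list => 'v" where "Th2 x w = th (Fo x) (pmap (th x) w)"

lemma th: "x \<in> OB A ==> v \<in> E x ==> th x v \<in> car (Fo x)" using bij_betwE[OF bij] by blast

lemma io: assumes x: "x \<in> OB A" shows "!!s. s \<in> car (Fo x) ==> io x s \<in> E x" "!!s. s \<in> car (Fo x) ==> th x (io x s) = s"
  "!!v. v \<in> E x ==> io x (th x v) = v" "!!s. s \<in> car (Fo x) ==> root B (io x s) = fn (Fo x) s"
proof -
 note b = bij_betw_imp_surj_on[OF bij[OF x]] and i = bij_betw_imp_inj_on[OF bij[OF x]]
 show 1: "!!s. s \<in> car (Fo x) ==> io x s \<in> E x" unfolding io_def using b inv_into_into by metis
 show 2: "!!s. s \<in> car (Fo x) ==> th x (io x s) = s" unfolding io_def using b f_inv_into_f by metis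
 show "!!v. v \<in> E x ==> io x (th x v) = v" unfolding io_def by (rule inv_into_f_f[OF i])
 show "root B (io x s) = fn (Fo x) s" if "s \<in> car (Fo x)" for s using rt[OF x 1[OF that]] 2[OF that] by simp
qed

lemma io_nat: assumes f: "f \<in> HOM A x y" and s: "s \<in> car (Fo x)" shows "io y (Fa f s) = pmap (ap f) (io x s)"
proof -
 note x = HOM_D(1)[OF f] and y = HOM_D(2)[OF f]
 have "pmap (ap f) (io x s) \<in> E y" using pmap_pel[OF io(1)[OF x s]] HOM_D(6,7)[OF f] by blast
 from io(3)[OF y this] show ?thesis using nat[OF f io(1)[OF x s]] io(2)[OF x s] by simp
qed

lemma pmap_th: assumes x: "x \<in> OB A" and w: "w \<in> E2 x" shows "pmap (th x) w \<in> E (Fo x)" by (rule pmap_pel[OF w]) (use th[OF x] rt[OF x] in blast)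

lemma th2: assumes x: "x \<in> OB A" shows "!!w. w \<in> E2 x ==> Th2 x w \<in> car (Fo (Fo x))" "!!w. w \<in> E2 x ==> fn (Fo (Fo x)) (Th2 x w) = root B w"
  "!!r. r \<in> car (Fo (Fo x)) ==> EX w:E2 x. Th2 x w = r" "inj_on (Th2 x) (E2 x)"
proof -
 note Fx = F(1)[OF x]
 show "!!w. w \<in> E2 x ==> Th2 x w \<in> car (Fo (Fo x))" unfolding Th2_def by (rule th[OF Fx pmap_th[OF x]])
 show "!!w. w \<in> E2 x ==> fn (Fo (Fo x)) (Th2 x w) = root B w" unfolding Th2_def using rt[OF Fx pmap_th[OF x]] by simp
 show "EX w:E2 x. Th2 x w = r" if r: "r \<in> car (Fo (Fo x))" for r
 proof
  note i = io(1)[OF Fx r]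
  show "pmap (io x) (io (Fo x) r) \<in> E2 x" by (rule pmap_pel[OF i]) (use io(1,4)[OF x] in blast)
  have "pmap (th x) (pmap (io x) (io (Fo x) r)) = io (Fo x) r" unfolding pmap_comp by (rule pmap_ident) (use pel_D(2)[OF i] io(2)[OF x] in auto)
  then show "Th2 x (pmap (io x) (io (Fo x) r)) = r" unfolding Th2_def using io(2)[OF Fx r] by simp
 qed
 have "pmap (io x) (io (Fo x) (Th2 x w)) = w" if w: "w \<in> E2 x" for w
 proof -
  have "pmap (io x) (pmap (th x) w) = w" unfolding pmap_comp by (rule pmap_ident) (use pel_D(2)[OF w] io(3)[OF x] in auto)
  then show ?thesis unfolding Th2_def using io(3)[OF Fx pmap_th[OF x w]] by simp
 qed
 then show "inj_on (Th2 x) (E2 x)" by (rule inj_on_inverseI)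
qed

lemma pmap_pmap_E2: assumes f: "f \<in> HOM A x y" and w: "w \<in> E2 x" shows "pmap (pmap (ap f)) w \<in> E2 y" "Th2 y (pmap (pmap (ap f)) w) = mV T (mA T f) (Th2 x w)"
proof -
 note x = HOM_D(1)[OF f] and y = HOM_D(2)[OF f]
 have p: "pmap (ap f) v \<in> E y" if "v \<in> E x" for v using pmap_pel[OF that] HOM_D(6,7)[OF f] by blast
 show "pmap (pmap (ap f)) w \<in> E2 y" by (rule pmap_pel[OF w]) (use p in simp)
 have "pmap (th y) (pmap (pmap (ap f)) w) = pmap (Fa f) (pmap (th x) w)" unfolding pmap_comp by (rule pmap_cong) (use pel_D(2)[OF w] nat[OF f] in auto)
 then show "Th2 y (pmap (pmap (ap f)) w) = mV T (mA T f) (Th2 x w)" unfolding Th2_def using nat[OF F(2)[OF f] pmap_th[OF x w]] by simp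
qed

lemma so': "b \<in> ops B ==> i <= ar B b ==> bd B b i \<in> A" by (rule sig_over_D[OF so])

text \<open>Transported along \<open>th\<close> and \<open>flat\<close>, \<open>mu\<close> is a
  cartesian transformation from the polynomial functor of \<open>tensor B B\<close> to that of
  \<open>B\<close>, hence the action of a signature morphism.\<close>

lemma multiplication: obtains m where "sig_mor A (tensor B B) A B m" "fob m = (\<lambda>a\<in>A. a)"
  "!!x w. x \<in> OB A ==> w \<in> E2 x ==> th x (mul m w) = ap (mu T x) (Th2 x w)"
proof -
 let ?P = "%x. pE (tensor B B) x"
 define ta where "ta x v = io x (ap (mu T x) (Th2 x (unflat B v)))" for x v
 have mc: "ap (mu T x) (Th2 x w) \<in> car (Fo x)" if "x \<in> OB A" "w \<in> E2 x" for x w by (rule HOM_D(6)[OF Td(8)[OF that(1)] th2(1)[OF that]])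
 have uf: "unflat B v \<in> E2 x" "flat (unflat B v) = v" if "v \<in> ?P x" for v x using unflat_pel[OF that] unflat_pelu(2)[OF pel_pelu[OF that]] .
 have fu: "flat w \<in> ?P x" "unflat B (flat w) = w" if "w \<in> E2 x" for w x using flat_pel[OF that] flat_pelu(2)[OF pel_pel_pelu[OF that]] .
 have ty: "ta x v \<in> E x & root B (ta x v) = root (tensor B B) v" if x: "x \<in> OB A" and v: "v \<in> ?P x" for x v
 proof -
  note w = uf[OF v]
  have "root B (ta x v) = root B (unflat B v)" unfolding ta_def using io(4)[OF x mc[OF x w(1)]] HOM_D(7)[OF Td(8)[OF x] th2(1)[OF x w(1)]] th2(2)[OF x w(1)] by simp
  also have "... = root (tensor B B) v" using root_flat[OF pel_pel_pelu[OF w(1)]] w(2) by simp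
  finally show ?thesis unfolding ta_def using io(1)[OF x mc[OF x w(1)]] by simp
 qed
 have nt: "ta y (pmap (ap k) v) = pmap (ap k) (ta x v)" if k: "k \<in> HOM A x y" and v: "v \<in> ?P x" for k x y v
 proof -
  note x = HOM_D(1)[OF k] and w = uf[OF v] note p = pmap_pmap_E2[OF k w(1)]
  have "unflat B (pmap (ap k) v) = pmap (pmap (ap k)) (unflat B v)" using fu(2)[OF p(1)] flat_pmap[of "ap k" "unflat B v"] w(2) by simp
  then show ?thesis unfolding ta_def using p(2) Td(9)[OF k th2(1)[OF x w(1)]] io_nat[OF k mc[OF x w(1)]] by simp
 qed
 have ct: "EX v':?P x. ta x v' = s & pmap (ap k) v' = v"
  if k: "k \<in> HOM A x y" and s: "s \<in> E x" and v: "v \<in> ?P y" and e: "pmap (ap k) s = ta y v" for k x y s v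
 proof -
  note x = HOM_D(1)[OF k] and y = HOM_D(2)[OF k] and w = uf[OF v]
  have "Fa k (th x s) = ap (mu T y) (Th2 y (unflat B v))" using nat[OF k s] e io(2)[OF y mc[OF y w(1)]] unfolding ta_def by simp
  from Td(14)[OF k th[OF x s] th2(1)[OF y w(1)] this]
  obtain c where c: "c \<in> car (Fo (Fo x))" "ap (mu T x) c = th x s" "mV T (mA T k) c = Th2 y (unflat B v)" by blast
  obtain w' where w': "w' \<in> E2 x" "Th2 x w' = c" using th2(3)[OF x c(1)] by blast
  note p = pmap_pmap_E2[OF k w'(1)]
  have "pmap (pmap (ap k)) w' = unflat B v" by (rule inj_onD[OF th2(4)[OF y] _ p(1) w(1)]) (use p(2) w'(2) c(3) in simp)
  then have "pmap (ap k) (flat w') = v" using flat_pmap[of "ap k" w'] w(2) by simp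
  moreover have "ta x (flat w') = s" unfolding ta_def fu(2)[OF w'(1)] w'(2) c(2) by (rule io(3)[OF x s])
  ultimately show ?thesis using fu(1)[OF w'(1)] by blast
 qed
 obtain m where m: "sig_mor A (tensor B B) A B m" "fob m = (\<lambda>a\<in>A. a)" "!!x v. x \<in> OB A ==> v \<in> ?P x ==> ta x v = act m v"
  by (rule cartesian_transformation_act[OF tensor_bd_in[OF so'] so' Td(1) ty nt ct]) (assumption | rule that; assumption)+
 show ?thesis
 proof (rule that[OF m(1,2)])
  fix x w assume x: "x \<in> OB A" and w: "w \<in> E2 x"
  have "mul m w = ta x (flat w)" unfolding mul_def by (rule m(3)[OF x fu(1)[OF w], symmetric])
  then show "th x (mul m w) = ap (mu T x) (Th2 x w)" unfolding ta_def fu(2)[OF w] using io(2)[OF x mc[OF x w]] by simp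
 qed
qed

text \<open>The polynomial functor of \<open>unit_sig A\<close> is the identity up to isomorphism,
  so \<open>eta\<close> becomes a cartesian transformation out of it and is represented in the same
  way.\<close>

lemma unit_element: obtains e where "sig_mor A (unit_sig A) A B e" "fob e = (\<lambda>a\<in>A. a)"
  "!!x z. x \<in> OB A ==> z \<in> car x ==> (fop e (fn x z), [z]) \<in> E x" "!!x z. x \<in> OB A ==> z \<in> car x ==> th x (fop e (fn x z), [z]) = ap (eta T x) z"
proof -
 let ?P = "%x. pE (unit_sig A) x"
 define ta :: "'v fn => 'v * 'v list => 'v * 'v list" where "ta x v = io x (ap (eta T x) (hd (snd v)))" for x v
 have P: "v \<in> ?P x <-> (EX z:car x. v = (fn x z, [z]))" if x: "x \<in> OB A" for x v
 proof
  assume v: "v \<in> ?P x"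
  note d = pel_D[OF v]
  have "fst v \<in> A" using d(1) by simp
  then have "map (fn x) (snd v) = [fst v]" using d(3) by simp
  then show "EX z:car x. v = (fn x z, [z])" using d(2) by (cases v) auto
 qed (auto simp: pel_def OB_D(5)[OF x])
 have ec: "ap (eta T x) z \<in> car (Fo x)" if "x \<in> OB A" "z \<in> car x" for x z by (rule HOM_D(6)[OF Td(6)[OF that(1)] that(2)])
 have ty: "ta x v \<in> E x & root B (ta x v) = root (unit_sig A) v" if x: "x \<in> OB A" and v: "v \<in> ?P x" for x v
 proof -
  obtain z where z: "z \<in> car x" "v = (fn x z, [z])" using v P[OF x] by blast
  show ?thesis unfolding ta_def z(2) using io(1,4)[OF x ec[OF x z(1)]] HOM_D(7)[OF Td(6)[OF x] z(1)] OB_D(5)[OF x z(1)] by simp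
 qed
 have nt: "ta y (pmap (ap k) v) = pmap (ap k) (ta x v)" if k: "k \<in> HOM A x y" and v: "v \<in> ?P x" for k x y v
 proof -
  note x = HOM_D(1)[OF k]
  obtain z where z: "z \<in> car x" "v = (fn x z, [z])" using v P[OF x] by blast
  show ?thesis unfolding ta_def z(2) using Td(7)[OF k z(1)] io_nat[OF k ec[OF x z(1)]] by simp
 qed
 have ct: "EX v':?P x. ta x v' = s & pmap (ap k) v' = v"
  if k: "k \<in> HOM A x y" and s: "s \<in> E x" and v: "v \<in> ?P y" and e: "pmap (ap k) s = ta y v" for k x y s v
 proof -
  note x = HOM_D(1)[OF k] and y = HOM_D(2)[OF k]
  obtain z where z: "z \<in> car y" "v = (fn y z, [z])" using v P[OF y] by blast
  have "Fa k (th x s) = ap (eta T y) z" using nat[OF k s] e io(2)[OF y ec[OF y z(1)]] unfolding ta_def z(2) by simp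
  from Td(13)[OF k th[OF x s] z(1) this]
  obtain c where c: "c \<in> car x" "ap (eta T x) c = th x s" "ap k c = z" by blast
  show ?thesis
  proof (intro bexI[of _ "(fn x c, [c])"] conjI)
   show "ta x (fn x c, [c]) = s" unfolding ta_def by (simp add: c(2) io(3)[OF x s])
   show "pmap (ap k) (fn x c, [c]) = v" unfolding z(2) using c(3) HOM_D(7)[OF k c(1)] by (simp add: pmap_def)
   show "(fn x c, [c]) \<in> ?P x" using P[OF x] c(1) by blast
  qed
 qed
 obtain e where e: "sig_mor A (unit_sig A) A B e" "fob e = (\<lambda>a\<in>A. a)" "!!x v. x \<in> OB A ==> v \<in> ?P x ==> ta x v = act e v"
  by (rule cartesian_transformation_act[OF _ so' Td(1) ty nt ct]) (simp | assumption | rule that; assumption)+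
 have a: "ta x (fn x z, [z]) = (fop e (fn x z), [z])" if x: "x \<in> OB A" and z: "z \<in> car x" for x z
  using e(3)[OF x, of "(fn x z, [z])"] P[OF x] z act_unit[OF sig_mor_D(1)[OF e(1)] OB_D(5)[OF x z]] by auto
 show ?thesis
 proof (rule that[OF e(1,2)])
  fix x z assume x: "x \<in> OB A" and z: "z \<in> car x"
  show "(fop e (fn x z), [z]) \<in> E x" "th x (fop e (fn x z), [z]) = ap (eta T x) z" unfolding a[OF x z, symmetric] ta_def using io(1,2)[OF x ec[OF x z]] by simp_all
 qed
qed

text \<open>Each monoid law is compared after applying the injective \<open>th x\<close>, where
  naturality of \<open>th\<close> turns it into the corresponding monad law. \<open>Th\<close> is
  \<open>th\<close> precomposed with decoding, as an arrow of the slice.\<close>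

lemma multicategory: obtains M Th where "multicategory (M :: 'v mcat)" "base M = A" "viso A (pmnd M) T Th"
proof -
 obtain m where m: "sig_mor A (tensor B B) A B m" "fob m = (\<lambda>a\<in>A. a)"
  "!!x w. x \<in> OB A ==> w \<in> E2 x ==> th x (mul m w) = ap (mu T x) (Th2 x w)" by (rule multiplication) (rule that; assumption)
 obtain e where e: "sig_mor A (unit_sig A) A B e" "fob e = (\<lambda>a\<in>A. a)" "!!x z. x \<in> OB A ==> z \<in> car x ==> (fop e (fn x z), [z]) \<in> E x"
  "!!x z. x \<in> OB A ==> z \<in> car x ==> th x (fop e (fn x z), [z]) = ap (eta T x) z" by (rule unit_element) (rule that; assumption)
 define M where "M = \<lparr>base = A, msig = B, mmul = m, munit = e\<rparr>"
 have Ms: "base M = A" "msig M = B" "mmul M = m" "munit M = e" unfolding M_def by simp_all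
 have me: "mul m w \<in> E x" if "x \<in> OB A" "w \<in> E2 x" for x w by (rule mul_pel[OF m(1,2) that(2) OB_D(5)[OF that(1)]])
 have inj: "v = v'" if "x \<in> OB A" "v \<in> E x" "v' \<in> E x" "th x v = th x v'" for x v v'
  using arg_cong[OF that(4), of "io x"] unfolding io(3)[OF that(1,2)] io(3)[OF that(1,3)] .
 have A1: "mul m (mul m w) = mul m (pmap (mul m) w)" if x: "x \<in> OB A" and w: "w \<in> pel B (E2 x) (root B)" for x w
 proof -
  note Fx = F(1)[OF x] note FFx = F(1)[OF Fx]
  have rm: "root B (mul m v) = root B v" if "v \<in> E2 x" for v by (rule root_mul[OF m(1,2) so pel_pel_pelu[OF that]])
  have a: "mul m w \<in> E2 x" by (rule mul_pel[OF m(1,2) w]) (use pel_D(1) sig_over_D[OF so] in blast)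
  have b: "pmap (mul m) w \<in> E2 x" by (rule pmap_pel[OF w]) (use me[OF x] rm in blast)
  have c: "pmap (pmap (th x)) w \<in> E2 (Fo x)" by (rule pmap_pel[OF w]) (use pmap_th[OF x] in simp)
  have d: "pmap (Th2 x) w \<in> E (Fo (Fo x))" by (rule pmap_pel[OF w]) (use th2(1,2)[OF x] in blast)
  have "th x (mul m (mul m w)) = ap (mu T x) (th (Fo x) (pmap (th x) (mul m w)))" using m(3)[OF x a] unfolding Th2_def .
  also have "pmap (th x) (mul m w) = mul m (pmap (pmap (th x)) w)" by (rule mul_pmap[OF sig_mor_D(1)[OF m(1)] pel_pel_pelu[OF w], symmetric])
  also have "th (Fo x) ... = ap (mu T (Fo x)) (th (Fo (Fo x)) (pmap (Th2 x) w))" unfolding m(3)[OF Fx c] Th2_def pmap_comp by (simp add: comp_def)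
  also have "ap (mu T x) ... = ap (mu T x) (Fa (mu T x) (th (Fo (Fo x)) (pmap (Th2 x) w)))" using Td(12)[OF x th[OF FFx d]] by simp
  also have "Fa (mu T x) (th (Fo (Fo x)) (pmap (Th2 x) w)) = th (Fo x) (pmap (ap (mu T x)) (pmap (Th2 x) w))" using nat[OF Td(8)[OF x] d] by simp
  also have "pmap (ap (mu T x)) (pmap (Th2 x) w) = pmap (th x) (pmap (mul m) w)" unfolding pmap_comp by (rule pmap_cong) (use pel_D(2)[OF w] m(3)[OF x] in auto)
  also have "ap (mu T x) (th (Fo x) ...) = th x (mul m (pmap (mul m) w))" using m(3)[OF x b] unfolding Th2_def by simp
  finally show ?thesis by (rule inj[OF x me[OF x a] me[OF x b]])
 qed
 have A2: "mul m (fop e (root B v), [v]) = v" if x: "x \<in> OB A" and v: "v \<in> E x" for x v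
 proof -
  note Fx = F(1)[OF x] and t = th[OF x v] note q = e(3,4)[OF Fx t, unfolded rt[OF x v]]
  have w: "(fop e (root B v), [v]) \<in> E2 x" using q(1) v by (simp add: pel_def rt[OF x v])
  show ?thesis
  proof (rule inj[OF x me[OF x w] v])
   show "th x (mul m (fop e (root B v), [v])) = th x v" unfolding m(3)[OF x w] Th2_def using q(2) Td(11)[OF x t] by (simp add: pmap_def)
  qed
 qed
 have A3: "mul m (units e B v) = v" if x: "x \<in> OB A" and v: "v \<in> E x" for x v
 proof -
  note d = pel_D[OF v]
  let ?u = "%z. (fop e (fn x z), [z])"
  have u: "units e B v = pmap ?u v" unfolding d(3)[symmetric] by (cases v) (simp add: pmap_def zip_map1 zip_same_conv_map)
  have "?u z \<in> E x & root B (?u z) = fn x z" if z: "z \<in> car x" for z using e(3)[OF x z] rt[OF x e(3)[OF x z]] e(4)[OF x z] HOM_D(7)[OF Td(6)[OF x] z] by simp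
  then have w: "pmap ?u v \<in> E2 x" by (intro pmap_pel[OF v]) blast
  have "pmap (th x) (pmap ?u v) = pmap (ap (eta T x)) v" unfolding pmap_comp by (rule pmap_cong) (use d(2) e(4)[OF x] in auto)
  then have "th x (mul m (pmap ?u v)) = th x v" unfolding m(3)[OF x w] Th2_def using nat[OF Td(6)[OF x] v] Td(10)[OF x th[OF x v]] by simp
  then show ?thesis unfolding u by (rule inj[OF x me[OF x w] v])
 qed
 \<comment> \<open>The finite sets of typed labels in \<open>multicategory_I\<close> are objects of
   the slice, so the laws just proved cover them.\<close>
 have ob: "(X, restrict t X, A) \<in> OB A" "pel B X t = E (X, restrict t X, A)" if "finite X" "t ` X <= A" for X :: "'v set" and t
  using OB_I[OF small_finite[OF that(1)] Td(1), of t] that(2) pel_cong[of X t "restrict t X" B] by auto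
 have mult: "multicategory M"
 proof (rule multicategory_I[where ?'x = 'v], unfold Ms)
  show "mcat_data A B m e" by unfold_locales (rule so m(1,2) e(1,2))+
 next
  fix X t and w :: "'v * ('v * ('v * 'v list) list) list"
  assume X: "finite X" "t ` X <= A" and w: "w \<in> pel B (pel B (pel B X t) (root B)) (root B)"
  show "mul m (mul m w) = mul m (pmap (mul m) w)" by (rule A1[OF ob(1)[OF X] w[unfolded ob(2)[OF X]]])
 next
  fix X t and v :: "'v * 'v list"
  assume X: "finite X" "t ` X <= A" and v: "v \<in> pel B X t"
  show "mul m (fop e (root B v), [v]) = v" "mul m (units e B v) = v" using A2[OF ob(1)[OF X] v[unfolded ob(2)[OF X]]] A3[OF ob(1)[OF X] v[unfolded ob(2)[OF X]]] .
 qed (rule Td(1) sB infinite_UNIV)+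
 interpret vs: vsig V A B using multicategory_vsig[OF mult] unfolding Ms .
 note ps = pmnd_simps(1)[of M, unfolded Ms] and pem = pmnd_eta_mu[OF mult, unfolded Ms]
 define Th where "Th x = slice_map (pob A B x) (%z. th x (dec z)) (Fo x)" for x
 have Th: "Th x \<in> HOM A (pob A B x) (Fo x)" if x: "x \<in> OB A" for x unfolding Th_def by (rule slice_map_HOM[OF vs.pob_OB[OF x] F(1)[OF x]])
   (simp add: th[OF x vs.dec_pob(1)] rt[OF x vs.dec_pob(1)] vs.ty_pob)
 have Tv: "ap (Th x) z = th x (dec z)" if "z \<in> car (pob A B x)" for x z unfolding Th_def using that by simp
 have "viso A (pmnd M) T Th" unfolding viso_def ps
 proof (intro conjI ballI allI impI)
  fix x assume x: "x \<in> OB A"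
  show "Th x \<in> HOM A (pO A B x) (Fo x)" using Th x by simp
  have "bij_betw (th x o dec) (car (pob A B x)) (car (Fo x))"
  proof (rule bij_betw_trans[OF _ bij[OF x]])
   show "bij_betw dec (car (pob A B x)) (E x)" by (rule bij_betw_byWitness[where f' = enc]) (auto simp: vs.dec_pob dec_enc)
  qed
  then show "bij_betw (ap (Th x)) (car (pO A B x)) (car (Fo x))" using x bij_betw_cong[of "car (pob A B x)" "ap (Th x)" "th x o dec"] by (simp add: Tv)
 next
  fix x y k t assume k: "k \<in> HOM A x y" and t: "t \<in> car (pO A B x)"
  note x = HOM_D(1)[OF k]
  have t: "t \<in> car (pob A B x)" using t x by simp
  note d = vs.dec_pob[OF t]
  show "ap (Th y) (pV A B k t) = Fa k (ap (Th x) t)" using vs.ap_pfun[OF k t] Tv[OF t] nat[OF k d(1)] vs.pmap_pob[OF k d(1)] by (simp add: Tv dec_enc)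
 next
  fix x z assume x: "x \<in> OB A" and z: "z \<in> car x"
  show "ap (Th x) (ap (eta (pmnd M) x) z) = ap (eta T x) z" using pem(2)[OF x z] e(3,4)[OF x z] by (simp add: Tv dec_enc)
 next
  fix x w assume x: "x \<in> OB A" and w: "w \<in> car (pO A B (pO A B x))"
  have w: "w \<in> car (pob A B (pob A B x))" using w x vs.pob_OB[OF x] by simp
  note d = vs.dec_pob(1)[OF w] note W = vs.pel_pob[OF d]
  have p: "pmap (ap (Th x)) (dec w) = pmap (th x) (pmap dec (dec w))" unfolding pmap_comp by (rule pmap_cong) (use pel_D(2)[OF d] in "simp add: Tv subset_iff")
  have "ap (Th x) (ap (mu (pmnd M) x) w) = ap (mu T x) (Th2 x (pmap dec (dec w)))" using pem(7)[OF x w] me[OF x W] m(3)[OF x W] by (simp add: Tv dec_enc)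
  also have "Th2 x (pmap dec (dec w)) = ap (Th (Fo x)) (ap (pA A B (Th x)) w)"
   unfolding Th2_def vs.ap_pfun[OF Th[OF x] w] p using pmap_th[OF x W] by (simp add: Tv dec_enc)
  finally show "ap (Th x) (ap (mu (pmnd M) x) w) = ap (mu T x) (ap (Th (Fo x)) (ap (pA A B (Th x)) w))" .
 qed
 with mult Ms(1) show ?thesis by (rule that)
qed

end

context universe
begin

lemma monad_is_polynomial: assumes T: "monad_obj (A :: 'v set, T)" obtains M Th where "multicategory (M :: 'v mcat)" "base M = A" "viso A (pmnd M) T Th"
proof -
 interpret fmonad V A T by unfold_locales (rule T)
 obtain B :: "('v, 'v) sig" and th where B: "sig_over A B" "small (ops B)" "!!x. x \<in> OB A ==> bij_betw (th x) (pE B x) (car (Fo x))"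
  "!!x v. x \<in> OB A ==> v \<in> pE B x ==> fn (Fo x) (th x v) = root B v" "!!x y f v. f \<in> HOM A x y ==> v \<in> pE B x ==> th y (pmap (ap f) v) = Fa f (th x v)"
  by (rule polynomial) (rule that; assumption)
 interpret poly V A T B th by unfold_locales (rule B; assumption)+
 show ?thesis by (rule multicategory) (rule that; assumption)
qed

section \<open>From isomorphisms on elements to vertical isomorphisms of \<open>MonC\<close>\<close>

lemma viso_inv: assumes T: "monad_obj (A :: 'v set, T)" and T': "monad_obj (A, T')" and v: "viso A T T' th"
 obtains th' where "viso A T' T th'" "!!x t. x \<in> OB A ==> t \<in> mE T x ==> ap (th' x) (ap (th x) t) = t"
  "!!x t. x \<in> OB A ==> t \<in> mE T' x ==> ap (th x) (ap (th' x) t) = t"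
proof -
 note d = monad_D[OF T] and d' = monad_D[OF T'] and vd = viso_D[OF v]
 note F = functor_D[OF d(5)] and F' = functor_D[OF d'(5)]
 let ?X = "%x. mE T x" and ?Y = "%x. mE T' x"
 define g where "g x = inv_into (?X x) (ap (th x))" for x
 have g: "g x t \<in> ?X x" "ap (th x) (g x t) = t" if "x \<in> OB A" "t \<in> ?Y x" for x t
 proof -
  have "t \<in> ap (th x) ` ?X x" using bij_betw_imp_surj_on[OF vd(2)[OF that(1)]] that(2) by simp
  then show "g x t \<in> ?X x" "ap (th x) (g x t) = t" unfolding g_def by (rule inv_into_into, rule f_inv_into_f)
 qed
 have g': "g x (ap (th x) t) = t" if "x \<in> OB A" "t \<in> ?X x" for x t unfolding g_def by (rule inv_into_f_f[OF bij_betw_imp_inj_on[OF vd(2)[OF that(1)]] that(2)])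
 define h where "h x = slice_map (mO T' x) (g x) (mO T x)" for x
 have h: "h x \<in> HOM A (mO T' x) (mO T x)" if x: "x \<in> OB A" for x unfolding h_def
  by (rule slice_map_HOM[OF F'(1)[OF x] F(1)[OF x]]) (use g[OF x] HOM_D(7)[OF vd(1)[OF x]] in metis)
 have hv: "ap (h x) t = g x t" if "t \<in> ?Y x" for x t unfolding h_def using that by simp
 \<comment> \<open>A value of the inverse is found by exhibiting a preimage under
   \<open>th x\<close>; the laws for \<open>h\<close> are reduced in this way to those for
   \<open>th\<close>.\<close>
 have eq: "ap (h x) s = r" if x: "x \<in> OB A" and r: "r \<in> ?X x" and e: "ap (th x) r = s" for x r s using hv[OF HOM_D(6)[OF vd(1)[OF x] r]] g'[OF x r] e by simp
 show ?thesis
 proof (rule that)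
  show "viso A T' T h" unfolding viso_def
  proof (intro conjI ballI allI impI)
   fix x assume x: "x \<in> OB A"
   show "h x \<in> HOM A (mO T' x) (mO T x)" by (rule h[OF x])
   have "bij_betw (g x) (?Y x) (?X x)" unfolding g_def by (rule bij_betw_inv_into[OF vd(2)[OF x]])
   then show "bij_betw (ap (h x)) (?Y x) (?X x)" using bij_betw_cong[of "?Y x" "ap (h x)" "g x"] by (simp add: hv)
  next
   fix x y k t assume k: "k \<in> HOM A x y" and t: "t \<in> ?Y x"
   note x = HOM_D(1)[OF k] and y = HOM_D(2)[OF k]
   show "ap (h y) (mV T' k t) = mV T k (ap (h x) t)" unfolding hv[OF t]
    by (rule eq[OF y HOM_D(6)[OF F(2)[OF k] g(1)[OF x t]]]) (use vd(3)[OF k g(1)[OF x t]] g(2)[OF x t] in simp)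
  next
   fix x z assume x: "x \<in> OB A" and z: "z \<in> car x"
   show "ap (h x) (ap (eta T' x) z) = ap (eta T x) z" by (rule eq[OF x HOM_D(6)[OF d(6)[OF x] z] vd(4)[OF x z]])
  next
   fix x w assume x: "x \<in> OB A" and w: "w \<in> mE T' (mO T' x)"
   note Fx = F(1)[OF x] and Fx' = F'(1)[OF x]
   let ?w = "ap (h (mO T x)) (mV T' (h x) w)"
   have w1: "mV T' (h x) w \<in> ?Y (mO T x)" by (rule HOM_D(6)[OF F'(2)[OF h[OF x]] w])
   have w2: "?w \<in> ?X (mO T x)" by (rule HOM_D(6)[OF h[OF Fx] w1])
   have w3: "ap (th (mO T x)) ?w = mV T' (h x) w" unfolding hv[OF w1] by (rule g(2)[OF Fx w1])
   have "th x \<cdot>[A] h x = iO A (mO T' x)" by (rule HOM_eqI[OF Cmp_HOM(1)[OF h[OF x] vd(1)[OF x]] Idn_HOM(1)[OF Fx']])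
     (simp add: Cmp_HOM(2)[OF h[OF x] vd(1)[OF x]] Idn_HOM(2)[OF Fx'] hv g(2)[OF x])
   then have w4: "mV T' (th x) (mV T' (h x) w) = w" using F'(8)[OF h[OF x] vd(1)[OF x] w] F'(7)[OF Fx' w] by simp
   have "ap (th (mO T' x)) (mV T (th x) ?w) = w" using vd(3)[OF vd(1)[OF x] w2] w3 w4 by simp
   then have "ap (th x) (ap (mu T x) ?w) = ap (mu T' x) w" using vd(5)[OF x w2] by simp
   then show "ap (h x) (ap (mu T' x) w) = ap (mu T x) ?w" by (rule eq[OF x HOM_D(6)[OF d(8)[OF x] w2]])
  qed
 next
  show "ap (h x) (ap (th x) t) = t" if "x \<in> OB A" "t \<in> ?X x" for x t by (rule eq[OF that refl])
  show "ap (th x) (ap (h x) t) = t" if "x \<in> OB A" "t \<in> ?Y x" for x t unfolding hv[OF that(2)] by (rule g(2)[OF that])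
 qed
qed

text \<open>The canonical isomorphisms inserted by the two \<open>vert\<close> cancel against those
  of the composite, and \<open>th'\<close> after \<open>th\<close> remains.\<close>

lemma mon_comp_vert: assumes T: "monad_obj (A :: 'v set, T)" and T': "monad_obj (A, T')" and v: "viso A T T' th" and v': "viso A T' T th'"
  and i: "!!x t. x \<in> OB A ==> t \<in> mE T x ==> ap (th' x) (ap (th x) t) = t"
 shows "mon_comp (Idn SetC A) (vert A T' T th') (Idn SetC A) (vert A T T' th) T T = mon_id (A, T)"
proof -
 let ?I = "Idn SetC A"
 note sA = monad_D(1)[OF T] note F = functor_D[OF monad_D(5)[OF T]]
 have I: "?I \<in> Hom SetC A A" using category.Idn_Hom[OF category_SetC] sA by (simp add: Obj_SetC)
 have II: "?I *[SetC] ?I = ?I" by (rule category.Cmp_Idn[OF category_SetC I])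
 note e = vert_emor[OF T T' v] and e' = vert_emor[OF T' T v']
 note mc = mon_comp_simp[OF I I T T' T e e', unfolded II] and mi = mon_id_emor[OF T]
 show ?thesis
 proof (rule extensionalityI[OF mc(1) emor_D(1)[OF mi(1)]])
  fix x assume x: "x \<in> OB A"
  note px = pb_obj_OB[OF I x] note pc = pb_comp_iso[OF I I x, unfolded II] and pi = pb_id_iso[OF x] and pi' = pb_id_iso[OF px]
  show "mon_comp ?I (vert A T' T th') ?I (vert A T T' th) T T x = mon_id (A, T) x"
  proof (rule HOM_pb_eqI[OF I mc(2)[OF x] emor_D(2)[OF mi(1) x]])
   fix t assume t: "t \<in> mE T (pb ?I x)"
   let ?t = "mV T (pb_comp_to ?I ?I x) t"
   have t1: "?t \<in> mE T (pb ?I (pb ?I x))" by (rule HOM_D(6)[OF F(2)[OF pc(2)] t])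
   let ?s = "mV T (pb_id_from (pb ?I x)) ?t"
   have s: "?s \<in> mE T (pb ?I x)" by (rule HOM_D(6)[OF F(2)[OF pi'(4)] t1])
   have c: "pb_id_from (pb ?I x) \<cdot>[A] pb_comp_to ?I ?I x = iO A (pb ?I x)"
   proof (rule HOM_eqI[OF Cmp_HOM(1)[OF pc(2) pi'(4)] Idn_HOM(1)[OF px]])
    fix z assume z: "z \<in> car (pb ?I x)"
    have "fn ?I (vfst z) = vfst z" using pb_D(1)[OF I z] by (simp add: Idn_SetC)
    then show "ap (pb_id_from (pb ?I x) \<cdot>[A] pb_comp_to ?I ?I x) z = ap (iO A (pb ?I x)) z"
     using Cmp_HOM(2)[OF pc(2) pi'(4) z] pc(3)[OF z] pi'(5)[OF HOM_D(6)[OF pc(2) z]] Idn_HOM(2)[OF px z] pb_D(4)[OF I z] by simp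
   qed
   have st: "?s = t" using F(8)[OF pc(2) pi'(4) t] F(7)[OF px t] c by simp
   have r: "vsnd (ap (vert A T T' th (pb ?I x)) ?t) = ap (th (pb ?I x)) t" using vert_simp(2)[OF T T' v px t1] st by simp
   have rc: "ap (th (pb ?I x)) t \<in> mE T' (pb ?I x)" by (rule HOM_D(6)[OF viso_D(1)[OF v px] t])
   have "vsnd (ap (vert A T' T th' x) (ap (th (pb ?I x)) t)) = mV T (pb_id_from x) t"
    using vert_simp(2)[OF T' T v' x rc] viso_D(3)[OF v pi(4) t] i[OF x HOM_D(6)[OF F(2)[OF pi(4)] t]] by simp
   then show "vsnd (ap (mon_comp ?I (vert A T' T th') ?I (vert A T T' th) T T x) t) = vsnd (ap (mon_id (A, T) x) t)" using mc(3)[OF x t] r mi(2)[OF x t] by simp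
  qed
 qed
qed

lemma vertical_iso: assumes T: "monad_obj (A :: 'v set, T)"
 obtains M f where "multicategory (M :: 'v mcat)" "base M = A" "is_iso MonC f" "f \<in> Hom MonC (A, pmnd M) (A, T)" "fst (snd f) = Idn SetC A"
proof -
 obtain M Th where M: "multicategory (M :: 'v mcat)" "base M = A" "viso A (pmnd M) T Th" by (rule monad_is_polynomial[OF T])
 let ?P = "pmnd M" and ?I = "Idn SetC A"
 have P: "monad_obj (A, ?P)" using pmnd_obj[OF M(1)] M(2) by simp
 obtain Th' where v': "viso A T ?P Th'" "!!x t. x \<in> OB A ==> t \<in> mE ?P x ==> ap (Th' x) (ap (Th x) t) = t"
  "!!x t. x \<in> OB A ==> t \<in> mE T x ==> ap (Th x) (ap (Th' x) t) = t" by (rule viso_inv[OF P T M(3)]) (rule that; assumption)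
 have I: "?I \<in> Hom SetC A A" using category.Idn_Hom[OF category_SetC] monad_D(1)[OF T] by (simp add: Obj_SetC)
 have II: "?I *[SetC] ?I = ?I" by (rule category.Cmp_Idn[OF category_SetC I])
 let ?f = "((A, ?P), ?I, vert A ?P T Th, (A, T))" and ?g = "((A, T), ?I, vert A T ?P Th', (A, ?P))"
 have f: "?f \<in> Hom MonC (A, ?P) (A, T)" unfolding Hom_MonC using P T I vert_emor[OF P T M(3)] by simp
 have g: "?g \<in> Hom MonC (A, T) (A, ?P)" unfolding Hom_MonC using P T I vert_emor[OF T P v'(1)] by simp
 have "?g *[MonC] ?f = Idn MonC (A, ?P)" unfolding MonC_simps using mon_comp_vert[OF P T M(3) v'(1,2)] II by simp
 moreover have "?f *[MonC] ?g = Idn MonC (A, T)" unfolding MonC_simps using mon_comp_vert[OF T P v'(1) M(3) v'(3)] II by simp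
 ultimately have "is_iso MonC ?f" unfolding is_iso_def using f g by (auto simp: Hom_def MonC_simps)
 then show ?thesis using that M f by simp
qed

end

section \<open>Multicategories form a fibration\<close>

lemma unit_bd: assumes e: "sig_mor R (unit_sig R) R A e" "fob e = (\<lambda>x\<in>R. x)" and x: "x \<in> R"
 shows "!!i. i <= 1 ==> bd A (fop e x) i = x" "ar A (fop e x) = 1" "fop e x \<in> ops A"
proof -
 note d = sig_mor_D[OF e(1)]
 have pm: "perm e x permutes {1..1}" using d(4)[of x] x by simp
 have "perm e x 0 = 0" "perm e x 1 = 1" using permutes_not_in[OF pm, of 0] permutes_in_image[OF pm, of 1] by simp_all
 moreover have "i = 0 \<or> i = 1" if "i <= 1" for i :: nat using that by linarith
 ultimately have "perm e x i <= 1" if "i <= 1" for i using that by (metis le_numeral_extra(4) zero_le)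
 then show "bd A (fop e x) i = x" if "i <= 1" for i using d(5)[of x i] x that by (simp add: e(2))
 show "ar A (fop e x) = 1" "fop e x \<in> ops A" using d(2,3)[of x] x by simp_all
qed

locale sigpull = universe V for V :: "'v itself" +
 fixes R Q :: "'v set" and U :: "'v => 'v" and B :: "('v, 'v) sig" assumes soB: "sig_over Q B" and U: "U \<in> R ->E Q" and sO: "small R" and sB: "small (ops B)"
begin

text \<open>A pair \<open>(b, os)\<close> is the operation \<open>b\<close> with a lift \<open>os\<close> of its boundary along \<open>U\<close>, output first.\<close>

definition P :: "('v * 'v list) set" where "P = {(b, os). b \<in> ops B & length os = Suc (ar B b) & set os <= R & (ALL i<=ar B b. U (os ! i) = bd B b i)}"

definition pbk :: "('v, 'v) sig" where "pbk = \<lparr>ops = enc ` P, ar = (\<lambda>a\<in>enc ` P. ar B (fst (dec a))),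
  bd = (\<lambda>a\<in>enc ` P. \<lambda>i\<in>{0..ar B (fst (dec a))}. snd (dec a) ! i)\<rparr>"

abbreviation "pbk2 \<equiv> tensor pbk pbk"

abbreviation f :: "'v => 'v" where "f a \<equiv> fst (dec a :: 'v * 'v list)"

definition ph :: "('v, 'v, 'v, 'v) sigmor" where "ph = \<lparr>fop = (\<lambda>a\<in>ops pbk. f a), perm = (\<lambda>a\<in>ops pbk. id), fob = U\<rparr>"

lemma pbk: assumes "a \<in> ops pbk" shows "dec a \<in> P" "enc (dec a :: 'v * 'v list) = a" "ar pbk a = ar B (f a)"
  "!!i. i <= ar B (f a) ==> bd pbk a i = snd (dec a) ! i" "f a \<in> ops B"
  "!!i. i <= ar B (f a) ==> U (bd pbk a i) = bd B (f a) i" "!!i. i <= ar B (f a) ==> bd pbk a i \<in> R" "bdl B (f a) = map U (bdl pbk a)"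
proof -
 obtain p where p: "p \<in> P" "a = enc p" using assms unfolding pbk_def by auto
 show 1: "dec a \<in> P" "enc (dec a :: 'v * 'v list) = a" "f a \<in> ops B" using p by (auto simp: P_def dec_enc)
 show 2: "ar pbk a = ar B (f a)" and 3: "!!i. i <= ar B (f a) ==> bd pbk a i = snd (dec a) ! i" using assms by (simp_all add: pbk_def)
 have d: "length (snd (dec a)) = Suc (ar B (f a))" "set (snd (dec a)) <= R" "!!i. i <= ar B (f a) ==> U (snd (dec a) ! i) = bd B (f a) i" using 1(1) by (auto simp: P_def)
 show 4: "!!i. i <= ar B (f a) ==> U (bd pbk a i) = bd B (f a) i" using 3 d(3) by simp
 show "bd pbk a i \<in> R" if "i <= ar B (f a)" for i using 3[OF that] d(1,2) that nth_mem[of i "snd (dec a)"] by auto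
 show "bdl B (f a) = map U (bdl pbk a)" unfolding bdl_def 2 using 4 by simp
qed

lemma pbk_eqI: assumes a: "a \<in> ops pbk" "a' \<in> ops pbk" and e: "f a = f a'" "!!i. i <= ar B (f a) ==> bd pbk a i = bd pbk a' i" shows "a = a'"
proof -
 have l: "length (snd (dec a :: 'v * 'v list)) = Suc (ar B (f a))" "length (snd (dec a' :: 'v * 'v list)) = Suc (ar B (f a))"
  using pbk(1)[OF a(1)] pbk(1)[OF a(2)] e(1) by (auto simp: P_def)
 have "(snd (dec a :: 'v * 'v list)) = snd (dec a')"
 proof (rule nth_equalityI)
  fix i assume "i < length (snd (dec a :: 'v * 'v list))"
  then have i: "i <= ar B (f a)" using l by simp
  show "snd (dec a) ! i = snd (dec a' :: 'v * 'v list) ! i" using pbk(4)[OF a(1) i] pbk(4)[OF a(2) i[unfolded e(1)]] e(2)[OF i] by simp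
 qed (simp add: l)
 then have "dec a = (dec a' :: 'v * 'v list)" using e(1) by (rule prod_eqI[rotated])
 from arg_cong[OF this, of enc] show ?thesis unfolding pbk(2)[OF a(1)] pbk(2)[OF a(2)] .
qed

lemma so: "sig_over R pbk"
proof -
 have "bd pbk a \<in> {0..ar pbk a} ->E R" if a: "a \<in> ops pbk" for a
 proof (rule PiE_I)
  fix i assume "i \<in> {0..ar pbk a}"
  then show "bd pbk a i \<in> R" using pbk(3,7)[OF a] by simp
 next
  fix i assume "i \<notin> {0..ar pbk a}"
  then show "bd pbk a i = undefined" using a pbk(3)[OF a] by (simp add: pbk_def)
 qed
 moreover have "ar pbk \<in> extensional (ops pbk)" "bd pbk \<in> extensional (ops pbk)" by (simp_all add: pbk_def)
 ultimately show ?thesis unfolding sig_over_def PiE_iff by blast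
qed

lemma small_pbk: "small (ops pbk)" unfolding pbk_def by (simp, rule small_mono[OF small_enc[OF sB sO]]) (auto simp: P_def)

lemma phi: "sig_mor R pbk Q B ph" "!!v. v \<in> pelu pbk ==> act ph v = (f (fst v), snd v)" "!!a. a \<in> ops pbk ==> fop ph a = f a" "fob ph = U"
proof -
 show "sig_mor R pbk Q B ph" unfolding sig_mor_def using U pbk(3,5,6) by (auto simp: ph_def permutes_id)
 show 1: "!!a. a \<in> ops pbk ==> fop ph a = f a" "fob ph = U" by (simp_all add: ph_def)
 show "act ph v = (f (fst v), snd v)" if v: "v \<in> pelu pbk" for v :: "'v * 'x list"
 proof -
  note d = pelu_D[OF v]
  have "map (%j. snd v ! (j - 1)) [1..<Suc (length (snd v))] = snd v" by (rule nth_equalityI) (simp_all del: upt_Suc)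
  then show ?thesis using d by (cases v) (simp add: act_def ph_def)
 qed
qed

text \<open>For a typed labelling the lifted boundary is redundant information: its inputs are the
  types of the labels and its output is the root. What is left is seen by \<open>act ph\<close>, so
  equations between elements of the pullback with equal roots may be checked in the
  original.\<close>

lemma reflect:
 fixes v :: "'v * 'x list" assumes v: "v \<in> pel pbk X t" "v' \<in> pel pbk X t" "root pbk v = root pbk v'" "act ph v = act ph v'" shows "v = v'"
proof -
 note d = pel_D[OF v(1)] and d' = pel_D[OF v(2)]
 have e: "f (fst v) = f (fst v')" "snd v = snd v'" using v(4) phi(2)[OF pel_pelu[OF v(1)]] phi(2)[OF pel_pelu[OF v(2)]] by simp_all
 have b: "bdl pbk (fst v) = bdl pbk (fst v')" using d(3) d'(3) e(2) by simp
 have "fst v = fst v'"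
 proof (rule pbk_eqI[OF d(1) d'(1) e(1)])
  fix i assume i: "i <= ar B (f (fst v))"
  show "bd pbk (fst v) i = bd pbk (fst v') i"
  proof (cases i)
   case (Suc k) then show ?thesis using arg_cong[OF b, of "%l. l ! k"] i pbk(3)[OF d(1)] pbk(3)[OF d'(1)] e(1) by simp
  qed (use v(3) in simp)
 qed
 then show ?thesis using e(2) by (rule prod_eqI)
qed

text \<open>The boundary of the lifted operation is forced to be the image under \<open>w\<close> of
  the permuted boundary, because \<open>ph\<close> has identity permutations. The range starts at 0
  to include the output, which the permutation fixes.\<close>

definition lft :: "('v => 'v) => ('c, 'v) sig => ('c, 'v, 'v, 'v) sigmor => ('c, 'v, 'v, 'v) sigmor" where
 "lft w C ps = \<lparr>fop = (\<lambda>a\<in>ops C. enc (fop ps a, map (%i. w (bd C a (perm ps a i))) [0..<Suc (ar C a)])), perm = perm ps, fob = w\<rparr>"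

text \<open>Existence of factorisations through \<open>ph\<close>; with \<open>lft_unique\<close> it
  says that \<open>ph\<close> is a cartesian arrow of signatures over \<open>U\<close>.\<close>

lemma lft:
 fixes C :: "('c, 'v) sig" assumes so: "sig_over S C" and p: "sig_mor S C Q B ps" and w: "w \<in> S ->E R" and e: "ALL x:S. fob ps x = U (w x)"
 shows "sig_mor S C R pbk (lft w C ps)" "fob (lft w C ps) = w" "!!a. a \<in> ops C ==> fop ph (fop (lft w C ps) a) = fop ps a" "sig_comp S C ph (lft w C ps) = ps"
proof -
 note d = sig_mor_D[OF p]
 have pi: "perm ps a i <= ar C a" if "a \<in> ops C" "i <= ar C a" for a i
  using permutes_in_image[OF d(4)[OF that(1)], of i] permutes_not_in[OF d(4)[OF that(1)], of 0] that by (cases i) auto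
 have wb: "w (bd C a (perm ps a i)) \<in> R" "U (w (bd C a (perm ps a i))) = bd B (fop ps a) i" if "a \<in> ops C" "i <= ar C a" for a i
  using sig_over_D[OF so that(1) pi[OF that]] w e d(5)[OF that] by auto
 let ?l = "%a. (fop ps a, map (%i. w (bd C a (perm ps a i))) [0..<Suc (ar C a)])"
 have inP: "?l a \<in> P" if a: "a \<in> ops C" for a using d(2,3)[OF a] wb[OF a] by (auto simp: P_def simp del: upt_Suc)
 then have ip: "enc (?l a) \<in> ops pbk" if "a \<in> ops C" for a using that by (simp add: pbk_def)
 have bp: "bd pbk (enc (?l a)) i = w (bd C a (perm ps a i))" if "a \<in> ops C" "i <= ar C a" for a i
  using pbk(4)[OF ip[OF that(1)], of i] d(3)[OF that(1)] that(2) by (simp add: dec_enc del: upt_Suc)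
 show 1: "sig_mor S C R pbk (lft w C ps)" unfolding sig_mor_def
 proof (intro conjI ballI)
  show "fop (lft w C ps) \<in> ops C ->E ops pbk" using ip by (auto simp: lft_def)
  show "perm (lft w C ps) \<in> extensional (ops C)" using d(1) by (simp add: lft_def premor_def)
  show "fob (lft w C ps) \<in> S ->E R" using w by (simp add: lft_def)
  fix a assume a: "a \<in> ops C"
  show "perm (lft w C ps) a permutes {1..ar C a}" using d(4)[OF a] by (simp add: lft_def)
  show "ar pbk (fop (lft w C ps) a) = ar C a" using a pbk(3)[OF ip[OF a]] d(3)[OF a] by (simp add: lft_def dec_enc del: upt_Suc)
  fix i assume "i \<in> {0..ar C a}"
  then show "fob (lft w C ps) (bd C a (perm (lft w C ps) a i)) = bd pbk (fop (lft w C ps) a) i" using bp[OF a] a by (simp add: lft_def del: upt_Suc)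
 qed
 show 2: "fob (lft w C ps) = w" by (simp add: lft_def)
 show 3: "!!a. a \<in> ops C ==> fop ph (fop (lft w C ps) a) = fop ps a" using ip by (simp add: lft_def phi(3) dec_enc del: upt_Suc)
 have x: "fop ps \<in> extensional (ops C)" "perm ps \<in> extensional (ops C)" "fob ps \<in> extensional S" using p by (auto simp: sig_mor_def PiE_iff)
 have "fop (sig_comp S C ph (lft w C ps)) = fop ps" by (rule extensionalityI[OF _ x(1)]) (simp_all add: sig_comp_def compose_eq 3)
 moreover have "perm (sig_comp S C ph (lft w C ps)) = perm ps" by (rule extensionalityI[OF _ x(2)]) (use ip in "simp_all add: sig_comp_def lft_def ph_def del: upt_Suc")
 moreover have "fob (sig_comp S C ph (lft w C ps)) = fob ps" by (rule extensionalityI[OF _ x(3)]) (simp_all add: sig_comp_def compose_eq 2 phi(4) e)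
 ultimately show "sig_comp S C ph (lft w C ps) = ps" by (cases ps, cases "sig_comp S C ph (lft w C ps)") simp
qed

lemma lft_unique: assumes x: "sig_mor S C R pbk ch" "sig_mor S C R pbk ch'" "fob ch = fob ch'" "sig_comp S C ph ch = sig_comp S C ph ch'" shows "ch = ch'"
proof -
 note d = sig_mor_D[OF x(1)] and d' = sig_mor_D[OF x(2)]
 have pe: "perm ch a = perm ch' a" if a: "a \<in> ops C" for a using arg_cong[OF x(4), of "%s. perm s a"] d(2)[OF a] d'(2)[OF a] a by (simp add: sig_comp_def ph_def)
 have fe: "fop ch a = fop ch' a" if a: "a \<in> ops C" for a
 proof (rule pbk_eqI[OF d(2)[OF a] d'(2)[OF a]])
  show e: "f (fop ch a) = f (fop ch' a)" using arg_cong[OF x(4), of "%s. fop s a"] d(2)[OF a] d'(2)[OF a] a by (simp add: sig_comp_def compose_eq phi(3))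
  fix i assume "i <= ar B (f (fop ch a))"
  then have i: "i <= ar C a" using d(3)[OF a] pbk(3)[OF d(2)[OF a]] by simp
  show "bd pbk (fop ch a) i = bd pbk (fop ch' a) i" using d(5)[OF a i] d'(5)[OF a i] pe[OF a] x(3) by simp
 qed
 have "fop ch = fop ch'" by (rule extensionalityI[of _ "ops C"]) (use x(1,2) fe in "auto simp: sig_mor_def PiE_iff")
 moreover have "perm ch = perm ch'" by (rule extensionalityI[of _ "ops C"]) (use x(1,2) pe in "auto simp: sig_mor_def")
 ultimately show ?thesis using x(3) by (cases ch, cases ch') simp
qed

end

section \<open>The monoid structure on the pulled back signature\<close>

locale multpull = sigpull V R "base N" U "msig N" for V :: "'v itself" and R U and N :: "'v mcat" + assumes N: "multicategory N"
begin

abbreviation "B \<equiv> msig N"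
abbreviation "m \<equiv> mmul N"
abbreviation "e \<equiv> munit N"

text \<open>The tensor square of \<open>ph\<close>. All permutations of \<open>ph\<close> are
  identities, so no block permutation appears.\<close>

definition sg :: "('v * 'v list, 'v * 'v list, 'v, 'v) sigmor" where
 "sg = \<lparr>fop = (\<lambda>s\<in>ops (pbk2). (f (fst s), map f (snd s))), perm = (\<lambda>s\<in>ops (pbk2). id), fob = U\<rparr>"

text \<open>The structure is forced: for \<open>ph\<close> to be a morphism, multiplication and unit
  must be the lifts, along the identity of \<open>R\<close>, of those of \<open>N\<close> composed
  with \<open>sg\<close> and with the map of units.\<close>

definition M :: "'v mcat" where "M = \<lparr>base = R, msig = pbk, mmul = lft (\<lambda>x\<in>R. x) (pbk2) (sig_comp R (pbk2) m sg),
  munit = lft (\<lambda>x\<in>R. x) (unit_sig R) (sig_comp R (unit_sig R) e (unit_mor R U))\<rparr>"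

abbreviation "m' \<equiv> mmul M"
abbreviation "e' \<equiv> munit M"

lemma Ms [simp]: "base M = R" "msig M = pbk" by (simp_all add: M_def)

lemmas Nd = multicategory_D[OF N]

lemma N_data: "mcat_data (base N) B m e" by (rule Nd(1))

interpretation N: mcat_data "base N" B m e by (rule N_data)

lemma sigma: "sig_mor R (pbk2) (base N) (tensor B B) sg" "!!w. w \<in> pel2 pbk ==> act sg (flat w) = flat (act ph (pmap (act ph) w))"
proof -
 have t: "(f a, map f as) \<in> ops (tensor B B)" "ar (tensor B B) (f a, map f as) = ar (pbk2) (a, as)"
  "!!i. i <= ar (pbk2) (a, as) ==> U (bd (pbk2) (a, as) i) = bd (tensor B B) (f a, map f as) i" if s: "(a, as) \<in> ops (pbk2)" for a as
 proof -
  note d = pel_D[OF s[unfolded ops_tensor], unfolded fst_conv snd_conv]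
  have as: "b \<in> ops pbk" if "b \<in> set as" for b using d(2) that by blast
  have "map (%b. bd B b 0) (map f as) = map U (map (%b. bd pbk b 0) as)" using pbk(6)[OF as, of _ 0] by simp
  then show o: "(f a, map f as) \<in> ops (tensor B B)" unfolding ops_tensor pel_def using d(1,3) pbk(5,8) as by auto
  note ts = tensor_simps[OF s] and to = tensor_simps[OF o]
  show ar: "ar (tensor B B) (f a, map f as) = ar (pbk2) (a, as)" unfolding ts(1) to(1) by (rule arg_cong[of _ _ sum_list]) (use pbk(3)[OF as] in simp)
  have "bdl (tensor B B) (f a, map f as) = map U (bdl (pbk2) (a, as))" unfolding ts(3) to(3) map_concat map_map
   by (rule arg_cong[of _ _ concat]) (use pbk(8)[OF as] in simp)
  then have b: "bdl (tensor B B) (f a, map f as) ! k = U (bdl (pbk2) (a, as) ! k)" if "k < ar (pbk2) (a, as)" for k using that by simp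
  fix i assume i: "i <= ar (pbk2) (a, as)"
  show "U (bd (pbk2) (a, as) i) = bd (tensor B B) (f a, map f as) i"
  proof (cases i)
   case 0 then show ?thesis using ts(2) to(2) pbk(6)[OF d(1), of 0] by simp
  next
   case (Suc k) then show ?thesis using b[of k] i ar by simp
  qed
 qed
 show "sig_mor R (pbk2) (base N) (tensor B B) sg" unfolding sig_mor_def
 proof (intro conjI ballI)
  fix s assume s: "s \<in> ops (pbk2)"
  then have s': "(fst s, snd s) \<in> ops (pbk2)" by simp
  show "perm sg s permutes {1..ar (pbk2) s}" using s by (simp add: sg_def permutes_id)
  show "ar (tensor B B) (fop sg s) = ar (pbk2) s" using s t(2)[OF s'] by (simp add: sg_def)
  fix i assume "i \<in> {0..ar (pbk2) s}"
  then show "fob sg (bd (pbk2) s (perm sg s i)) = bd (tensor B B) (fop sg s) i" using s t(3)[OF s', of i] by (simp add: sg_def)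
 next
  show "fop sg \<in> ops (pbk2) ->E ops (tensor B B)"
  proof (rule PiE_I)
   fix s assume s: "s \<in> ops (pbk2)"
   then show "fop sg s \<in> ops (tensor B B)" using t(1)[of "fst s" "snd s"] by (simp add: sg_def)
  qed (simp add: sg_def)
 qed (use U in "simp_all add: sg_def")
 fix w :: "'v * ('v * 'x list) list" assume w: "w \<in> pel2 pbk"
 note fp = flat_pelu(1)[OF w] and d = pel_D[OF w]
 have "map (%j. snd (flat w) ! (j - 1)) [1..<Suc (length (snd (flat w)))] = snd (flat w)" by (rule nth_equalityI) (simp_all del: upt_Suc)
 then have "act sg (flat w) = ((f (fst w), map f (map fst (snd w))), concat (map snd (snd w)))"
  using pelu_D(1)[OF fp] by (simp add: act_def sg_def flat_def case_prod_beta)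
 moreover have "pmap (act ph) w = pmap (%v. (f (fst v), snd v)) w" by (rule pmap_cong) (use d(2) phi(2) in blast)
 moreover have "pmap (%v. (f (fst v), snd v)) w \<in> pelu pbk" by (rule pmap_pelu[OF pel_pelu[OF w]])
 ultimately show "act sg (flat w) = flat (act ph (pmap (act ph) w))" by (simp add: phi(2) flat_def case_prod_beta comp_def)
qed

lemma unitU: "sig_mor R (unit_sig R) (base N) (unit_sig (base N)) (unit_mor R U)"
 using U unfolding sig_mor_def unit_mor_def by (auto simp: permutes_id le_Suc_eq PiE_iff extensional_restrict)

lemma so2: "s \<in> ops (pbk2) ==> i <= ar (pbk2) s ==> bd (pbk2) s i \<in> R" by (rule tensor_bd_in[OF sig_over_D[OF so]])

lemma data: "mcat_data R pbk m' e'" "multicat_mor M N ph"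
proof -
 have c: "compose R (\<lambda>x\<in>base N. x) U x = U ((\<lambda>x\<in>R. x) x)" if "x \<in> R" for x using that U by (auto simp: compose_eq)
 have i: "(\<lambda>x\<in>R. x) \<in> R ->E R" by auto
 let ?p = "sig_comp R (pbk2) m sg" and ?q = "sig_comp R (unit_sig R) e (unit_mor R U)"
 have so2': "sig_over R (pbk2)"
 proof -
  have "bd (pbk2) s \<in> {0..ar (pbk2) s} ->E R" if s: "s \<in> ops (pbk2)" for s
  proof (rule PiE_I)
   fix i assume "i \<in> {0..ar (pbk2) s}"
   then show "bd (pbk2) s i \<in> R" using so2[OF s] by simp
  next
   fix i assume "i \<notin> {0..ar (pbk2) s}"
   then show "bd (pbk2) s i = undefined" using s by (cases s) (simp add: tensor_def Let_def)
  qed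
  moreover have "ar (pbk2) \<in> extensional (ops (pbk2))" "bd (pbk2) \<in> extensional (ops (pbk2))" by (simp_all add: tensor_def Let_def)
  ultimately show ?thesis unfolding sig_over_def PiE_iff by blast
 qed
 have u: "sig_over R (unit_sig R)" by (auto simp: sig_over_def unit_sig_def)
 note p = sig_comp_mor[OF so2' sigma(1) N.m] and q = sig_comp_mor[OF u unitU N.e]
 have "fob sg = U" "fob (unit_mor R U) = U" using U by (auto simp: sg_def unit_mor_def PiE_iff extensional_restrict)
 then have fp: "ALL x:R. fob ?p x = U ((\<lambda>x\<in>R. x) x)" "ALL x:R. fob ?q x = U ((\<lambda>x\<in>R. x) x)" using p(3) q(3) N.fm N.fe c by simp_all
 note lm = lft[OF so2' p(1) i fp(1)] and le = lft[OF u q(1) i fp(2)]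
 have me: "m' = lft (\<lambda>x\<in>R. x) (pbk2) ?p" "e' = lft (\<lambda>x\<in>R. x) (unit_sig R) ?q" unfolding M_def mcat.simps by (rule refl)+
 show md: "mcat_data R pbk m' e'" unfolding mcat_data_def me by (intro conjI so lm(1,2) le(1,2))
 show "multicat_mor M N ph"
 proof (rule multicat_mor_iff(4)[where ?'y = 'v], unfold Ms)
  fix X t and w :: "'v * ('v * 'v list) list"
  assume w: "w \<in> pel pbk (pel pbk X t) (root pbk)"
  note w' = pel_pel_pelu[OF w] note fw = flat_pelu(1)[OF w']
  have "act ph (mul m' w) = act (sig_comp R (pbk2) ph m') (flat w)" unfolding mul_def me by (rule sig_comp_mor(2)[OF so2' lm(1) phi(1) fw, symmetric])
  also have "sig_comp R (pbk2) ph m' = ?p" unfolding me by (rule lm(4))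
  also have "act ?p (flat w) = act m (act sg (flat w))" by (rule p(2)[OF fw])
  also have "... = mul m (act ph (pmap (act ph) w))" unfolding sigma(2)[OF w'] mul_def ..
  finally show "act ph (mul m' w) = mul m (act ph (pmap (act ph) w))" .
 next
  fix x assume x: "x \<in> R"
  have "x \<in> ops (unit_sig R)" using x by simp
  then have "fop ph (fop e' x) = fop ?q x" unfolding me by (rule le(3))
  then show "fop ph (fop e' x) = fop e (fob ph x)" using x by (simp add: sig_comp_def compose_eq unit_mor_def phi(4))
 qed (rule md N_data infinite_UNIV phi(1))+
qed

interpretation D: mcat_data R pbk m' e' by (rule data)

lemma phi_mul: "w \<in> pel2 pbk ==> act ph (mul m' w) = mul m (act ph (pmap (act ph) w))" and phi_unit: "x \<in> R ==> fop ph (fop e' x) = fop e (U x)"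
 using multicat_mor_iff(1,2)[OF _ N_data data(2), of w for w] multicat_mor_iff(2)[OF _ N_data data(2)] data(1) by (simp_all add: phi(4))

lemma root_phi: "v \<in> pelu pbk ==> root B (act ph v) = U (root pbk v)" using sig_mor_D(6)[OF phi(1), of "fst v"] phi(4) pelu_D(1)[of v pbk] by simp

text \<open>Both sides of each law carry labels of the same types and have the same root, and after
  \<open>act ph\<close> they agree by the law in \<open>N\<close>; \<open>reflect\<close>
  concludes.\<close>

lemma multicategory_M: "multicategory M"
proof (rule multicategory_I[where ?'x = 'v], unfold Ms)
 show "mcat_data R pbk m' e'" by (rule data)
next
 fix X t and w :: "'v * ('v * ('v * 'v list) list) list"
 assume t: "t ` X <= R" and w: "w \<in> pel pbk (pel pbk (pel pbk X t) (root pbk)) (root pbk)"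
 have t': "!!x. x \<in> X ==> t x \<in> R" using t by blast
 have rO: "root pbk v \<in> R" if "v \<in> pelu pbk" for v :: "'v * 'x list" using sig_over_D[OF so] pelu_D(1)[OF that] by blast
 note pm = sig_mor_D(1)[OF D.m] and pp = sig_mor_D(1)[OF phi(1)]
 have a: "mul m' w \<in> pel pbk (pel pbk X t) (root pbk)" by (rule mul_pel[OF D.m D.fm w]) (use rO pel_pelu in blast)
 have rm: "root pbk (mul m' v) = root pbk v" if "v \<in> pel2 pbk" for v :: "'v * ('v * 'x list) list" by (rule root_mul[OF D.m D.fm so that])
 have b: "pmap (mul m') w \<in> pel pbk (pel pbk X t) (root pbk)" by (rule pmap_pel[OF w]) (intro conjI rm[OF pel_pel_pelu] mul_pel[OF D.m D.fm _ t'])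
 have w1: "w \<in> pel2 pbk" by (rule pel_pel_pelu[OF w])
 have w2: "pmap (pmap (act ph)) w \<in> pel2 pbk" by (rule pmap_pmap_pel[OF w1])
 let ?W = "act ph (pmap (act ph) (pmap (pmap (act ph)) w))"
 have W: "?W \<in> pel B (pel2 B) (root B)"
 proof -
  have ap: "act ph (pmap (act ph) v) \<in> pel2 B" if v: "v \<in> pel pbk (pel pbk X t) (root pbk)" for v
  proof -
   have "pmap (act ph) (act ph v) \<in> pel2 B"
   proof (rule pmap_pel[OF act_pel[OF phi(1) v]])
    fix y assume "y \<in> pel pbk X t"
    from pel_pelu[OF this] show "act ph y \<in> pelu B & root B (act ph y) = (fob ph o root pbk) y" using act_pelu[OF phi(1), of y] root_phi[of y] phi(4) by simp
   qed
   then show ?thesis unfolding act_pmap[OF pp pel_pelu[OF v]] .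
  qed
  have "pmap (act ph o pmap (act ph)) (act ph w) \<in> pel B (pel2 B) (root B)"
  proof (rule pmap_pel[OF act_pel[OF phi(1) w]])
   fix y assume y: "y \<in> pel pbk (pel pbk X t) (root pbk)"
   show "(act ph o pmap (act ph)) y \<in> pel2 B & root B ((act ph o pmap (act ph)) y) = (fob ph o root pbk) y"
    using ap[OF y] root_phi[OF pmap_pelu[OF pel_pelu[OF y]], of "act ph"] phi(4) by simp
  qed
  then show ?thesis unfolding pmap_comp act_pmap[OF pp pel_pelu[OF w]] .
 qed
 have "act ph (mul m' (mul m' w)) = mul m (act ph (mul m' (pmap (pmap (act ph)) w)))" unfolding phi_mul[OF pel_pel_pelu[OF a]] mul_pmap[OF pm w1] ..
 also have "... = mul m (mul m ?W)" unfolding phi_mul[OF w2] ..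
 also have "... = mul m (pmap (mul m) ?W)" by (rule Nd(4)[OF W])
 also have "pmap (mul m) ?W = act ph (pmap (act ph) (pmap (mul m') w))"
 proof -
  have "pmap (mul m) ?W = act ph (pmap (mul m) (pmap (act ph) (pmap (pmap (act ph)) w)))" by (rule act_pmap[OF pp, symmetric]) (intro pmap_pelu pel_pelu[OF w])
  also have "pmap (mul m) (pmap (act ph) (pmap (pmap (act ph)) w)) = pmap (act ph) (pmap (mul m') w)" unfolding pmap_comp
  proof (rule pmap_cong)
   fix v assume "v \<in> set (snd w)"
   then have "v \<in> pel2 pbk" using pel_D(2)[OF w] pel_pel_pelu by blast
   from phi_mul[OF this] show "(mul m o (act ph o pmap (act ph))) v = (act ph o mul m') v" by simp
  qed
  finally show ?thesis .
 qed
 also have "mul m ... = act ph (mul m' (pmap (mul m') w))" by (rule phi_mul[OF pel_pel_pelu[OF b], symmetric])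
 finally show "mul m' (mul m' w) = mul m' (pmap (mul m') w)" by (intro reflect[OF mul_pel[OF D.m D.fm a t'] mul_pel[OF D.m D.fm b t']])
   (simp_all add: rm[OF pel_pel_pelu[OF a]] rm[OF pel_pel_pelu[OF b]] rm[OF w1])
next
 fix X t and v :: "'v * 'v list"
 assume t: "t ` X <= R" and v: "v \<in> pel pbk X t"
 have t': "!!x. x \<in> X ==> t x \<in> R" using t by blast
 note d = pel_D[OF v] and pv = pel_pelu[OF v]
 have r: "root pbk v \<in> R" by (rule sig_over_D[OF so d(1)]) simp
 note pm = sig_mor_D(1)[OF D.m] and ub = unit_bd[OF D.e D.fe]
 have one: "(fop e' x, [z]) \<in> pelu pbk" "act ph (fop e' x, [z]) = (fop e (U x), [z])" if "x \<in> R" for x and z :: 'y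
 proof -
  show 1: "(fop e' x, [z]) \<in> pelu pbk" using ub(2,3)[OF that] by (simp add: pelu_def)
  show "act ph (fop e' x, [z]) = (fop e (U x), [z])" using phi(2)[OF 1] phi(3)[OF ub(3)[OF that]] phi_unit[OF that] by simp
 qed
 have rm: "root pbk (mul m' v) = root pbk v" if "v \<in> pel2 pbk" for v :: "'v * ('v * 'v list) list" by (rule root_mul[OF D.m D.fm so that])
 have bl: "bdl pbk (fop e' x) = [x]" if "x \<in> R" for x using ub(1)[OF that, of 1] ub(2)[OF that] by (simp add: bdl_def upt_rec)
 have w: "(fop e' (root pbk v), [v]) \<in> pel pbk (pel pbk X t) (root pbk)" using ub(3)[OF r] bl[OF r] v by (simp add: pel_def)
 show "mul m' (fop e' (root pbk v), [v]) = v"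
 proof (rule reflect[OF mul_pel[OF D.m D.fm w t'] v])
  show "root pbk (mul m' (fop e' (root pbk v), [v])) = root pbk v" using rm[OF pel_pel_pelu[OF w]] ub(1)[OF r, of 0] by simp
  have "act ph (mul m' (fop e' (root pbk v), [v])) = mul m (act ph (fop e' (root pbk v), [act ph v]))" using phi_mul[OF pel_pel_pelu[OF w]] by (simp add: pmap_def)
  also have "... = act ph v" using one(2)[OF r, of "act ph v"] root_phi[OF pv] Nd(5)[OF act_pelu[OF phi(1) pv]] by simp
  finally show "act ph (mul m' (fop e' (root pbk v), [v])) = act ph v" .
 qed
 let ?u = "%z. (fop e' (t z), [z])"
 have u: "units e' pbk v = pmap ?u v" unfolding d(3)[symmetric] by (cases v) (simp add: pmap_def zip_map1 zip_same_conv_map)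
 have w: "pmap ?u v \<in> pel pbk (pel pbk X t) (root pbk)"
 proof (rule pmap_pel[OF v], intro conjI)
  fix z assume z: "z \<in> X"
  show "?u z \<in> pel pbk X t" using ub(3)[OF t'[OF z]] bl[OF t'[OF z]] z by (simp add: pel_def)
  show "root pbk (?u z) = t z" using ub(1)[OF t'[OF z], of 0] by simp
 qed
 show "mul m' (units e' pbk v) = v" unfolding u
 proof (rule reflect[OF mul_pel[OF D.m D.fm w t'] v])
  show "root pbk (mul m' (pmap ?u v)) = root pbk v" using rm[OF pel_pel_pelu[OF w]] by simp
  have pz: "pmap (act ph) (pmap ?u v) = pmap (%z. (fop e (U (t z)), [z])) v" unfolding pmap_comp by (rule pmap_cong) (use d(2) t' in "simp add: subset_iff one(2)")
  have "bdl B (fst (act ph v)) = map (U o t) (snd (act ph v))" using phi(2)[OF pv] pbk(8)[OF d(1)] d(3) by (simp flip: map_map)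
  then have "units e B (act ph v) = pmap (%z. (fop e (U (t z)), [z])) (act ph v)" by (cases "act ph v") (simp add: pmap_def zip_map1 zip_same_conv_map)
  also have "... = act ph (pmap (act ph) (pmap ?u v))" unfolding pz by (rule act_pmap[OF sig_mor_D(1)[OF phi(1)] pv, symmetric])
  finally have "act ph (mul m' (pmap ?u v)) = mul m (units e B (act ph v))" using phi_mul[OF pel_pel_pelu[OF w]] by simp
  then show "act ph (mul m' (pmap ?u v)) = act ph v" using Nd(6)[OF act_pelu[OF phi(1) pv]] by simp
 qed
qed (rule sO small_pbk infinite_UNIV)+

text \<open>The factorisation exists and is unique among signature morphisms, so only its
  compatibility with the structure is at stake; for the multiplication this can be tested after
  \<open>act ph\<close> by \<open>reflect\<close>.\<close>

lemma factor: assumes L: "multicategory (L :: 'v mcat)" and p: "multicat_mor L N ps" and w: "w \<in> base L ->E R" and e: "ALL x:base L. fob ps x = U (w x)"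
 shows "EX! ch. multicat_mor L M ch & fob ch = w & sig_comp (base L) (msig L) ph ch = ps"
proof -
 note Ld = multicategory_D[OF L]
 interpret L: mcat_data "base L" "msig L" "mmul L" "munit L" by (rule Ld(1))
 note sm = multicat_mor_iff(3)[OF Ld(1) N_data p]
 let ?ch = "lft w (msig L) ps"
 note l = lft[OF L.so sm w e]
 note pc = sig_mor_D(1)[OF l(1)] and pp = sig_mor_D(1)[OF phi(1)]
 have ac: "act ph (act ?ch v) = act ps v" if "v \<in> pelu (msig L)" for v :: "'v * 'x list" using sig_comp_mor(2)[OF L.so l(1) phi(1) that] l(4) by simp
 have rc: "root pbk (act ?ch v) = w (root (msig L) v)" if "v \<in> pelu (msig L)" for v :: "'v * 'x list" using sig_mor_D(6)[OF l(1)] l(2) pelu_D(1)[OF that] by simp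
 have "multicat_mor L M ?ch"
 proof (rule multicat_mor_iff(4)[where ?'y = 'v], unfold Ms)
  fix X t and y :: "'v * ('v * 'v list) list"
  assume t: "t ` X <= base L" and y: "y \<in> pel (msig L) (pel (msig L) X t) (root (msig L))"
  have t1: "!!x. x \<in> X ==> t x \<in> base L" using t by blast
  have t2: "!!x. x \<in> X ==> (w o t) x \<in> R" using t1 w by auto
  note y1 = pel_pel_pelu[OF y] note ye = pel_pelu[OF y]
  note my = mul_pel[OF L.m L.fm y t1]
  let ?W = "act ?ch (pmap (act ?ch) y)"
  have "pmap (act ?ch) (act ?ch y) \<in> pel pbk (pel pbk X (w o t)) (root pbk)"
   by (rule pmap_pel[OF act_pel[OF l(1) y]]) (use act_pel[OF l(1)] rc[OF pel_pelu] l(2) in auto)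
  then have W: "?W \<in> pel pbk (pel pbk X (w o t)) (root pbk)" using act_pmap[OF pc ye, of "act ?ch"] by simp
  show "act ?ch (mul (mmul L) y) = mul m' ?W"
  proof (rule reflect[OF _ mul_pel[OF D.m D.fm W t2]])
   show "act ?ch (mul (mmul L) y) \<in> pel pbk X (w o t)" using act_pel[OF l(1) my] l(2) by simp
   show "root pbk (act ?ch (mul (mmul L) y)) = root pbk (mul m' ?W)"
    using rc[OF pel_pelu[OF my]] root_mul[OF L.m L.fm L.so y1] root_mul[OF D.m D.fm so pel_pel_pelu[OF W]]
     rc[OF pmap_pelu[OF ye], of "act ?ch"] by simp
   have "act ph (pmap (act ph) ?W) = act ph (act ?ch (pmap (act ph) (pmap (act ?ch) y)))" using act_pmap[OF pc pmap_pelu[OF ye], of "act ph" "act ?ch"] by simp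
   also have "... = act ps (pmap (act ph) (pmap (act ?ch) y))" by (rule ac[OF pmap_pelu[OF pmap_pelu[OF ye]]])
   also have "pmap (act ph) (pmap (act ?ch) y) = pmap (act ps) y" unfolding pmap_comp by (rule pmap_cong) (use pel_D(2)[OF y1] in "simp add: subset_iff ac")
   finally have "act ph (mul m' ?W) = mul m (act ps (pmap (act ps) y))" using phi_mul[OF pel_pel_pelu[OF W]] by simp
   also have "... = act ps (mul (mmul L) y)" by (rule multicat_mor_iff(1)[OF Ld(1) N_data p y1, symmetric])
   finally show "act ph (act ?ch (mul (mmul L) y)) = act ph (mul m' ?W)" using ac[OF pel_pelu[OF my]] by simp
  qed
 next
  fix x assume x: "x \<in> base L"
  have wx: "w x \<in> R" using w x by auto
  note b = unit_bd[OF L.e L.fe x] and b' = unit_bd[OF D.e D.fe wx]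
  note lc = sig_mor_D[OF l(1)] and o = b(3)
  show "fop ?ch (fop (munit L) x) = fop e' (fob ?ch x)" unfolding l(2)
  \<comment> \<open>An operation of \<open>pbk\<close> is known from its underlying operation and
    its boundary, and for a unit the boundary has positions 0 and 1 only.\<close>
  proof (rule pbk_eqI[OF lc(2)[OF o] b'(3)])
   show fe: "f (fop ?ch (fop (munit L) x)) = f (fop e' (w x))" using l(3)[OF o] phi(3)[OF lc(2)[OF o]] phi(3)[OF b'(3)] phi_unit[OF wx]
     multicat_mor_iff(2)[OF Ld(1) N_data p x] bspec[OF e x] by simp
   fix i assume "i <= ar B (f (fop ?ch (fop (munit L) x)))"
   then have i: "i <= 1" using fe pbk(3)[OF b'(3)] b'(2) by simp
   have "perm ?ch (fop (munit L) x) i <= 1" using permutes_in_image[OF lc(4)[OF o], of i] permutes_not_in[OF lc(4)[OF o], of 0] i b(2) by (cases i) auto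
   then show "bd pbk (fop ?ch (fop (munit L) x)) i = bd pbk (fop e' (w x)) i" using lc(5)[OF o, of i] i b(2) b(1) b'(1)[OF i] l(2) by simp
  qed
 qed (rule Ld(1) data infinite_UNIV l(1))+
 then show ?thesis
 proof (intro ex1I[of _ ?ch] conjI l(2,4))
  fix ch assume c: "multicat_mor L M ch & fob ch = w & sig_comp (base L) (msig L) ph ch = ps"
  then have "sig_mor (base L) (msig L) R pbk ch" using multicat_mor_iff(3)[OF Ld(1), of M] data(1) by simp
  then show "ch = ?ch" by (rule lft_unique[OF _ l(1)]) (use c l(2,4) in simp_all)
 qed
qed

end

section \<open>Fully faithful and vertically essentially surjective functors\<close>

text \<open>The preimages \<open>g\<close> and the isomorphisms \<open>b\<close> are chosen
  beforehand, which makes the quasi-inverse a function of them. Verticality is assumed of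
  \<open>b\<close>; that of \<open>bi\<close> follows (\<open>vbi\<close>).\<close>

locale vertical_equivalence =
 E: category E + E': category E' + B: category B for E :: "('o, 'a) cat" and E' :: "('q, 'c) cat" and B :: "('p, 'b) cat" +
 fixes P :: "('o, 'a, 'p, 'b) fctr" and P' :: "('q, 'c, 'p, 'b) fctr" and F :: "('o, 'a, 'q, 'c) fctr" and g :: "'q => 'o" and b bi :: "'q => 'c"
 assumes P: "is_functor E B P" and P': "is_functor E' B P'" and F: "is_functor E E' F" and PF: "cF E P' F = P"
  and ff: "x \<in> Obj E ==> y \<in> Obj E ==> bij_betw (amap F) (Hom E x y) (Hom E' (omap F x) (omap F y))" and g: "x' \<in> Obj E' ==> g x' \<in> Obj E"
  and b: "x' \<in> Obj E' ==> b x' \<in> Hom E' (omap F (g x')) x'" and bi: "x' \<in> Obj E' ==> bi x' \<in> Hom E' x' (omap F (g x'))"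
  and bib: "x' \<in> Obj E' ==> bi x' *[E'] b x' = Idn E' (omap F (g x'))" and bbi: "x' \<in> Obj E' ==> b x' *[E'] bi x' = Idn E' x'"
  and vb: "x' \<in> Obj E' ==> amap P' (b x') = Idn B (omap P' x')"
begin

abbreviation "Fo \<equiv> omap F"
abbreviation "Fa \<equiv> amap F"

definition L :: "'o => 'o => 'c => 'a" where "L x y = inv_into (Hom E x y) Fa"

lemmas Fh = functor_Hom[OF F]
lemmas Ph' = functor_Hom[OF P']

lemma L: assumes "x \<in> Obj E" "y \<in> Obj E" "k \<in> Hom E' (Fo x) (Fo y)" shows "L x y k \<in> Hom E x y" "Fa (L x y k) = k"
 using bij_betw_imp_surj_on[OF ff[OF assms(1,2)]] assms(3) inv_into_into[of k Fa "Hom E x y"] f_inv_into_f[of k Fa "Hom E x y"] unfolding L_def by simp_all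

lemma faithful: assumes "f \<in> Hom E x y" "h \<in> Hom E x y" "Fa f = Fa h" shows "f = h"
 using bij_betw_imp_inj_on[OF ff[OF E.Hom_Obj[OF assms(1)]]] assms by (simp add: inj_on_eq_iff)

lemma PFo: "x \<in> Obj E ==> omap P' (Fo x) = omap P x" and PFa: "f \<in> Hom E x y ==> amap P' (Fa f) = amap P f" using PF by (auto simp: comp_functor_def Hom_def)

text \<open>A vertical arrow is sent to an identity, whose two ends coincide.\<close>

lemma Po: assumes x: "x \<in> Obj E'" shows "omap P (g x) = omap P' x"
proof -
 have "Idn B (omap P' x) \<in> Hom B (omap P' (Fo (g x))) (omap P' x)" using Ph'(1)[OF b[OF x]] vb[OF x] by simp
 moreover have "Idn B (omap P' x) \<in> Hom B (omap P' x) (omap P' x)" by (rule B.Idn_Hom[OF Ph'(2)[OF x]])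
 ultimately show ?thesis using PFo[OF g[OF x]] by (simp add: Hom_def)
qed

lemma vbi: assumes x: "x \<in> Obj E'" shows "amap P' (bi x) = Idn B (omap P' x)"
proof -
 note h = Ph'(1)[OF bi[OF x], unfolded PFo[OF g[OF x]] Po[OF x]]
 have "Idn B (omap P' x) = amap P' (bi x) *[B] amap P' (b x)" using Ph'(4)[OF b[OF x] bi[OF x]] bib[OF x] Ph'(3)[OF Fh(2)[OF g[OF x]]] PFo[OF g[OF x]] Po[OF x] by simp
 then show ?thesis using B.Cmp_Idn[OF h] vb[OF x] by simp
qed

text \<open>Arrow part of the quasi-inverse: the arrow is conjugated with the chosen isomorphisms
  and then pulled through the full and faithful \<open>F\<close>.\<close>

definition conj :: "'q => 'q => 'c => 'a" where "conj x y f = L (g x) (g y) (bi y *[E'] f *[E'] b x)"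

lemma conj: assumes f: "f \<in> Hom E' x y" shows "conj x y f \<in> Hom E (g x) (g y)" "Fa (conj x y f) = bi y *[E'] f *[E'] b x" "amap P (conj x y f) = amap P' f"
  "b y *[E'] Fa (conj x y f) = f *[E'] b x"
proof -
 note x = E'.Hom_Obj(1)[OF f] and y = E'.Hom_Obj(2)[OF f]
 note fb = E'.Cmp_Hom[OF b[OF x] f] note h = E'.Cmp_Hom[OF fb bi[OF y]]
 show 1: "conj x y f \<in> Hom E (g x) (g y)" and 2: "Fa (conj x y f) = bi y *[E'] f *[E'] b x" using L[OF g[OF x] g[OF y] h] unfolding conj_def .
 have "amap P (conj x y f) = amap P' (bi y) *[B] amap P' f *[B] amap P' (b x)" using PFa[OF 1] 2 Ph'(4)[OF fb bi[OF y]] Ph'(4)[OF b[OF x] f] by simp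
 then show "amap P (conj x y f) = amap P' f" using vb[OF x] vbi[OF y] B.Cmp_Idn[OF Ph'(1)[OF f]] B.Idn_Cmp[OF Ph'(1)[OF f]] by simp
 show "b y *[E'] Fa (conj x y f) = f *[E'] b x" unfolding 2 using E'.Cmp_assoc[OF fb bi[OF y] b[OF y]] bbi[OF y] E'.Idn_Cmp[OF fb] by simp
qed

definition G :: "('q, 'c, 'o, 'a) fctr" where "G = \<lparr>omap = (\<lambda>x\<in>Obj E'. g x), amap = (\<lambda>f\<in>Arr E'. conj (Src E' f) (Tgt E' f) f)\<rparr>"

lemma G_simps: "x \<in> Obj E' ==> omap G x = g x" "f \<in> Hom E' x y ==> amap G f = conj x y f" by (auto simp: G_def Hom_def)

lemma G: "is_functor E' E G"
proof (rule functor_HomI)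
 show "omap G \<in> Obj E' ->E Obj E" using g by (auto simp: G_def)
 show "amap G f \<in> Hom E (omap G x) (omap G y)" if f: "f \<in> Hom E' x y" for f x y using conj(1)[OF f] f E'.Hom_Obj[OF f] by (simp add: G_simps)
 show "amap G (Idn E' x) = Idn E (omap G x)" if x: "x \<in> Obj E'" for x
 proof -
  note i = E'.Idn_Hom[OF x]
  have "Fa (conj x x (Idn E' x)) = Fa (Idn E (g x))" using conj(2)[OF i] E'.Idn_Cmp[OF b[OF x]] bib[OF x] Fh(3)[OF g[OF x]] by simp
  from faithful[OF conj(1)[OF i] E.Idn_Hom[OF g[OF x]] this] show ?thesis using x i by (simp add: G_simps)
 qed
 fix f h x y z assume f: "f \<in> Hom E' x y" and h: "h \<in> Hom E' y z"
 note x = E'.Hom_Obj(1)[OF f] and y = E'.Hom_Obj(2)[OF f] and z = E'.Hom_Obj(2)[OF h]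
 note hf = E'.Cmp_Hom[OF f h] note fb = E'.Cmp_Hom[OF b[OF x] f] and hb = E'.Cmp_Hom[OF b[OF y] h]
 note Cf = Fh(1)[OF conj(1)[OF f]]
 have "Fa (conj y z h *[E] conj x y f) = bi z *[E'] (h *[E'] b y) *[E'] Fa (conj x y f)"
  using Fh(4)[OF conj(1)[OF f] conj(1)[OF h]] conj(2)[OF h] E'.Cmp_assoc[OF Cf hb bi[OF z]] by simp
 also have "(h *[E'] b y) *[E'] Fa (conj x y f) = (h *[E'] f) *[E'] b x" using E'.Cmp_assoc[OF Cf b[OF y] h] conj(4)[OF f] E'.Cmp_assoc[OF b[OF x] f h] by simp
 finally have "Fa (conj x z (h *[E'] f)) = Fa (conj y z h *[E] conj x y f)" using conj(2)[OF hf] by simp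
 from faithful[OF conj(1)[OF hf] E.Cmp_Hom[OF conj(1)[OF f] conj(1)[OF h]] this]
 show "amap G (h *[E'] f) = amap G h *[E] amap G f" using f h hf by (simp add: G_simps)
qed (simp_all add: E.category_axioms E'.category_axioms G_def)

lemma nat_isoI: assumes H: "is_functor C D H" and K: "is_functor C D K" and e: "al \<in> extensional (Obj C)"
  and a: "!!x. x \<in> Obj C ==> al x \<in> Hom D (omap H x) (omap K x)" and n: "!!f x y. f \<in> Hom C x y ==> amap K f *[D] al x = al y *[D] amap H f"
  and i: "!!x. x \<in> Obj C ==> EX k:Hom D (omap K x) (omap H x). k *[D] al x = Idn D (omap H x) & al x *[D] k = Idn D (omap K x)" shows "nat_iso C D H K al"
proof -
 have "is_iso D (al x)" if "x \<in> Obj C" for x using a[OF that] i[OF that] by (simp add: is_iso_def Hom_def)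
 moreover have "amap K f *[D] al (Src C f) = al (Tgt C f) *[D] amap H f" if "f \<in> Arr C" for f by (rule n) (simp add: Hom_def that)
 ultimately show ?thesis unfolding nat_iso_def nat_trans_def using H K e a by blast
qed

lemma equivalent: "equivalent_over B E P E' P'"
proof -
 \<comment> \<open>The unit at \<open>x\<close> is the arrow that \<open>F\<close> sends to
   \<open>bi (Fo x)\<close>; its laws are verified after applying the faithful
   \<open>F\<close>.\<close>
 let ?al = "\<lambda>x\<in>Obj E. L x (g (Fo x)) (bi (Fo x))" and ?be = "\<lambda>x\<in>Obj E'. b x"
 have al: "L x (g (Fo x)) (bi (Fo x)) \<in> Hom E x (g (Fo x))" "Fa (L x (g (Fo x)) (bi (Fo x))) = bi (Fo x)" if x: "x \<in> Obj E" for x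
  using L[OF x g[OF Fh(2)[OF x]] bi[OF Fh(2)[OF x]]] .
 have al': "L (g (Fo x)) x (b (Fo x)) \<in> Hom E (g (Fo x)) x" "Fa (L (g (Fo x)) x (b (Fo x))) = b (Fo x)" if x: "x \<in> Obj E" for x
  using L[OF g[OF Fh(2)[OF x]] x b[OF Fh(2)[OF x]]] .
 have "nat_iso E E (id_functor E) (cF E G F) ?al"
 proof (rule nat_isoI[OF id_functor[OF E.category_axioms] functor_compose[OF F G]])
  fix x assume x: "x \<in> Obj E"
  note Fx = Fh(2)[OF x] note gx = g[OF Fx]
  have o: "omap (id_functor E) x = x" "omap (cF E G F) x = g (Fo x)" using x Fx by (simp_all add: id_functor_def comp_functor_def G_simps)
  show "?al x \<in> Hom E (omap (id_functor E) x) (omap (cF E G F) x)" unfolding o using al(1) x by simp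
  have "L (g (Fo x)) x (b (Fo x)) *[E] L x (g (Fo x)) (bi (Fo x)) = Idn E x" by (rule faithful[OF E.Cmp_Hom[OF al(1)[OF x] al'(1)[OF x]] E.Idn_Hom[OF x]])
    (simp add: Fh(4)[OF al(1)[OF x] al'(1)[OF x]] al(2)[OF x] al'(2)[OF x] bbi[OF Fx] Fh(3)[OF x])
  moreover have "L x (g (Fo x)) (bi (Fo x)) *[E] L (g (Fo x)) x (b (Fo x)) = Idn E (g (Fo x))"
   by (rule faithful[OF E.Cmp_Hom[OF al'(1)[OF x] al(1)[OF x]] E.Idn_Hom[OF gx]])
    (simp add: Fh(4)[OF al'(1)[OF x] al(1)[OF x]] al(2)[OF x] al'(2)[OF x] bib[OF Fx] Fh(3)[OF gx])
  ultimately show "EX k:Hom E (omap (cF E G F) x) (omap (id_functor E) x). k *[E] ?al x = Idn E (omap (id_functor E) x) & ?al x *[E] k = Idn E (omap (cF E G F) x)"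
   unfolding o using al'(1)[OF x] x by auto
 next
  fix f x y assume f: "f \<in> Hom E x y"
  note x = E.Hom_Obj(1)[OF f] and y = E.Hom_Obj(2)[OF f] and Ff = Fh(1)[OF f]
  note Fx = Fh(2)[OF x] and Fy = Fh(2)[OF y]
  have o: "amap (id_functor E) f = f" "amap (cF E G F) f = conj (Fo x) (Fo y) (Fa f)" using f Ff by (simp_all add: id_functor_def comp_functor_def Hom_def G_def)
  note c = conj[OF Ff] and fb = E'.Cmp_Hom[OF b[OF Fx] Ff]
  have "Fa (conj (Fo x) (Fo y) (Fa f) *[E] L x (g (Fo x)) (bi (Fo x))) = (bi (Fo y) *[E'] (Fa f *[E'] b (Fo x))) *[E'] bi (Fo x)"
   using Fh(4)[OF al(1)[OF x] c(1)] c(2) al(2)[OF x] by simp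
  also have "... = bi (Fo y) *[E'] Fa f" using E'.Cmp_assoc[OF bi[OF Fx] fb bi[OF Fy]] E'.Cmp_assoc[OF bi[OF Fx] b[OF Fx] Ff] bbi[OF Fx] E'.Cmp_Idn[OF Ff] by simp
  also have "... = Fa (L y (g (Fo y)) (bi (Fo y)) *[E] f)" using Fh(4)[OF f al(1)[OF y]] al(2)[OF y] by simp
  finally have "conj (Fo x) (Fo y) (Fa f) *[E] L x (g (Fo x)) (bi (Fo x)) = L y (g (Fo y)) (bi (Fo y)) *[E] f"
   by (rule faithful[OF E.Cmp_Hom[OF al(1)[OF x] c(1)] E.Cmp_Hom[OF f al(1)[OF y]]])
  then show "amap (cF E G F) f *[E] ?al x = ?al y *[E] amap (id_functor E) f" unfolding o using x y by simp
 qed simp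
 moreover have "nat_iso E' E' (cF E' F G) (id_functor E') ?be"
 proof (rule nat_isoI[OF functor_compose[OF G F] id_functor[OF E'.category_axioms]])
  fix x assume x: "x \<in> Obj E'"
  have o: "omap (id_functor E') x = x" "omap (cF E' F G) x = Fo (g x)" using x by (simp_all add: id_functor_def comp_functor_def G_simps)
  show "?be x \<in> Hom E' (omap (cF E' F G) x) (omap (id_functor E') x)" unfolding o using b x by simp
  show "EX k:Hom E' (omap (id_functor E') x) (omap (cF E' F G) x). k *[E'] ?be x = Idn E' (omap (cF E' F G) x) & ?be x *[E'] k = Idn E' (omap (id_functor E') x)"
   unfolding o using bi[OF x] bib[OF x] bbi[OF x] x by auto
 next
  fix f x y assume f: "f \<in> Hom E' x y"
  have "amap (id_functor E') f = f" "amap (cF E' F G) f = Fa (conj x y f)" using f by (simp_all add: id_functor_def comp_functor_def Hom_def G_def)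
  then show "amap (id_functor E') f *[E'] ?be x = ?be y *[E'] amap (cF E' F G) f" using conj(4)[OF f] E'.Hom_Obj[OF f] by simp
 qed simp
 moreover have "cF E' P G = P'"
 proof -
  have x: "omap P' \<in> extensional (Obj E')" "amap P' \<in> extensional (Arr E')" using P' by (auto simp: is_functor_def PiE_iff)
  have "omap (cF E' P G) = omap P'" by (rule extensionalityI[OF _ x(1)]) (simp_all add: comp_functor_def G_simps Po)
  moreover have "amap (cF E' P G) = amap P'"
  proof (rule extensionalityI[OF _ x(2)])
   fix f assume "f \<in> Arr E'"
   then have "f \<in> Hom E' (Src E' f) (Tgt E' f)" by (simp add: Hom_def)
   from conj(3)[OF this] show "amap (cF E' P G) f = amap P' f" using \<open>f \<in> Arr E'\<close> by (simp add: comp_functor_def G_def)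
  qed (simp add: comp_functor_def)
  ultimately show ?thesis by (cases P', cases "cF E' P G") simp
 qed
 moreover have "amap P (?al x) = Idn B (omap P x)" if x: "x \<in> Obj E" for x using PFa[OF al(1)[OF x]] al(2)[OF x] vbi[OF Fh(2)[OF x]] PFo[OF x] x by simp
 ultimately show ?thesis unfolding equivalent_over_def using F G PF vb by (intro exI[of _ F] exI[of _ G] exI[of _ ?al] exI[of _ ?be]) simp
qed

text \<open>A cartesian lift at \<open>x'\<close> is the image under \<open>F\<close> of one at
  \<open>g x'\<close>, followed by the vertical isomorphism \<open>b x'\<close>. Test arrows are
  moved to \<open>E\<close> by \<open>conj\<close>, factored there, and moved back.\<close>

lemma fibration_transfer: assumes fib: "fibration E B P" shows "fibration E' B P'" unfolding fibration_def
proof (intro conjI ballI impI P')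
 fix x' u assume x': "x' \<in> Obj E'" and u: "u \<in> Arr B" "Tgt B u = omap P' x'"
 obtain f where f: "cartesian_arrow E B P f" "Tgt E f = g x'" "amap P f = u" using fib g[OF x'] u Po[OF x'] unfolding fibration_def by metis
 define z where "z = Src E f"
 have fh: "f \<in> Hom E z (g x')" using f(1,2) by (simp add: cartesian_arrow_def Hom_def z_def)
 note z = E.Hom_Obj(1)[OF fh] and Ff = Fh(1)[OF fh]
 let ?f = "b x' *[E'] Fa f"
 have f': "?f \<in> Hom E' (Fo z) x'" by (rule E'.Cmp_Hom[OF Ff b[OF x']])
 have Pf: "amap P' ?f = u" using Ph'(4)[OF Ff b[OF x']] vb[OF x'] PFa[OF fh] f(3) B.Idn_Cmp[OF Ph'(1)[OF Ff, unfolded PFo[OF g[OF x']] Po[OF x']]] by simp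
 have "cartesian_arrow E' B P' ?f" unfolding cartesian_arrow_def
 proof (intro conjI ballI impI)
  show "?f \<in> Arr E'" using f' by (simp add: Hom_def)
  fix k w assume k: "k \<in> Arr E'" and w: "w \<in> Hom B (omap P' (Src E' k)) (omap P' (Src E' ?f))" and e: "Tgt E' k = Tgt E' ?f & amap P' k = amap P' ?f *[B] w"
  define y where "y = Src E' k"
  have kh: "k \<in> Hom E' y x'" using k e f' by (simp add: Hom_def y_def)
  have sf: "Src E' ?f = Fo z" using f' by (simp add: Hom_def)
  have w: "w \<in> Hom B (omap P' y) (omap P z)" using w sf PFo[OF z] by (simp add: y_def)
  note y = E'.Hom_Obj(1)[OF kh] and c = conj[OF kh]
  have "EX! h. h \<in> Hom E (Src E (conj y x' k)) (Src E f) & amap P h = w & f *[E] h = conj y x' k"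
  proof -
   have "conj y x' k \<in> Arr E" "Src E (conj y x' k) = g y" "Tgt E (conj y x' k) = Tgt E f" using c(1) f(2) by (auto simp: Hom_def)
   moreover have "amap P (conj y x' k) = amap P f *[B] w" using c(3) e Pf f(3) by simp
   moreover have "w \<in> Hom B (omap P (Src E (conj y x' k))) (omap P (Src E f))" using w Po[OF y] calculation(2) by (simp add: z_def)
   ultimately show ?thesis using f(1) unfolding cartesian_arrow_def by blast
  qed
  moreover have "Src E (conj y x' k) = g y" using c(1) by (simp add: Hom_def)
  ultimately have ex: "EX! h. h \<in> Hom E (g y) z & amap P h = w & f *[E] h = conj y x' k" by (simp add: z_def)
  then obtain h where h: "h \<in> Hom E (g y) z" "amap P h = w" "f *[E] h = conj y x' k" by blast
  note Fhh = Fh(1)[OF h(1)] and yi = bi[OF y]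
  have "EX! h. h \<in> Hom E' y (Fo z) & amap P' h = w & ?f *[E'] h = k"
  proof (rule ex1I[of _ "Fa h *[E'] bi y"], intro conjI)
   show t: "Fa h *[E'] bi y \<in> Hom E' y (Fo z)" by (rule E'.Cmp_Hom[OF yi Fhh])
   show "amap P' (Fa h *[E'] bi y) = w" using Ph'(4)[OF yi Fhh] PFa[OF h(1)] h(2) vbi[OF y] B.Cmp_Idn[OF w] by simp
   have "?f *[E'] Fa h *[E'] bi y = (b x' *[E'] Fa (conj y x' k)) *[E'] bi y"
    using E'.Cmp_assoc[OF yi Fhh f'] E'.Cmp_assoc[OF Fhh Ff b[OF x']] Fh(4)[OF h(1) fh] h(3) by simp
   also have "... = k" unfolding c(4) using E'.Cmp_assoc[OF yi b[OF y] kh] bbi[OF y] E'.Cmp_Idn[OF kh] by simp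
   finally show "?f *[E'] Fa h *[E'] bi y = k" .
  next
   fix r assume r: "r \<in> Hom E' y (Fo z) & amap P' r = w & ?f *[E'] r = k"
   then have rh: "r \<in> Hom E' y (Fo z)" and rw: "amap P' r = w" and rk: "?f *[E'] r = k" by simp_all
   \<comment> \<open>For uniqueness, a competing factorisation \<open>r\<close> is composed with
     \<open>b y\<close> and pulled back through \<open>F\<close>, which gives a competitor of
     \<open>h\<close> in \<open>E\<close>.\<close>
   note rb = E'.Cmp_Hom[OF b[OF y] rh]
   note l = L[OF g[OF y] z rb]
   have pl: "amap P (L (g y) z (r *[E'] b y)) = w" using PFa[OF l(1)] l(2) Ph'(4)[OF b[OF y] rh] vb[OF y] rw B.Cmp_Idn[OF w] by simp
   note frb = E'.Cmp_Hom[OF rb Ff]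
   have "Fa f *[E'] r *[E'] b y = bi x' *[E'] b x' *[E'] Fa f *[E'] r *[E'] b y" using E'.Cmp_assoc[OF frb b[OF x'] bi[OF x']] bib[OF x'] E'.Idn_Cmp[OF frb] by simp
   also have "b x' *[E'] Fa f *[E'] r *[E'] b y = k *[E'] b y" using E'.Cmp_assoc[OF rb Ff b[OF x']] E'.Cmp_assoc[OF b[OF y] rh f'] rk by simp
   finally have "Fa (f *[E] L (g y) z (r *[E'] b y)) = Fa (conj y x' k)" using Fh(4)[OF l(1) fh] l(2) c(2) by simp
   from faithful[OF E.Cmp_Hom[OF l(1) fh] c(1) this]
   have "L (g y) z (r *[E'] b y) = h" using ex l(1) pl h by blast
   then have "Fa h = r *[E'] b y" using l(2) by simp
   then show "r = Fa h *[E'] bi y" using E'.Cmp_assoc[OF yi b[OF y] rh] bbi[OF y] E'.Cmp_Idn[OF rh] by simp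
  qed
  then show "EX! h. h \<in> Hom E' (Src E' k) (Src E' ?f) & amap P' h = w & ?f *[E'] h = k" unfolding sf y_def .
 qed
 moreover have "Tgt E' ?f = x'" using f' by (simp add: Hom_def)
 ultimately show "EX f. cartesian_arrow E' B P' f & Tgt E' f = x' & amap P' f = u" using Pf by blast
qed

end

section \<open>The equivalence\<close>

context universe
begin

lemma mult_proj: "is_functor MU SetC mult_proj"
proof (rule functor_HomI[OF category_MultC category_SetC])
 show "omap mult_proj \<in> Obj MU ->E Obj SetC" using multicategory_D(2) by (auto simp: mult_proj_def MultC_simps Obj_SetC)
 have a: "amap mult_proj (M, ph, N) = (base M, fob ph, base N)" if "multicategory M" "multicategory N" "multicat_mor M N ph" for M N :: "'v mcat" and ph
  using that by (simp add: mult_proj_def MultC_def)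
 have o: "omap mult_proj M = base M" if "multicategory M" for M :: "'v mcat" using that by (simp add: mult_proj_def MultC_simps)
 show "amap mult_proj f \<in> Hom SetC (omap mult_proj M) (omap mult_proj N)" if f: "f \<in> Hom MultC M N" for f and M N :: "'v mcat"
  using f a o multicat_mor_hom[of M N] unfolding Hom_MultC by auto
 show "amap mult_proj (Idn MultC M) = Idn SetC (omap mult_proj M)" if "M \<in> Obj MultC" for M :: "'v mcat"
  using that a multicat_mor_id[of M] o by (simp add: MultC_simps Idn_SetC sig_id_def)
 show "amap mult_proj (g *[MultC] f) = amap mult_proj g *[SetC] amap mult_proj f"
  if f: "f \<in> Hom MultC M N" and g: "g \<in> Hom MultC N K" for f g and M N K :: "'v mcat"
 proof -
  obtain ph ps where fg: "f = (M, ph, N)" "g = (N, ps, K)" "multicat_mor M N ph" "multicat_mor N K ps"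
   and m: "multicategory M" "multicategory N" "multicategory K" using f g unfolding Hom_MultC by blast
  show ?thesis unfolding fg(1,2) MultC_simps a[OF m(1,2) fg(3)] a[OF m(2,3) fg(4)] a[OF m(1,3) multicat_mor_comp[OF m fg(3,4)]] by (simp add: Cmp_SetC sig_comp_def)
 qed
qed (simp add: mult_proj_def)

lemma mon_proj: "is_functor MO SetC mon_proj"
proof (rule functor_HomI[OF category_MonC category_SetC])
 show "omap mon_proj \<in> Obj MO ->E Obj SetC" using monad_D(1) by (auto simp: mon_proj_def MonC_simps Obj_SetC)
 have a: "amap mon_proj (X, u, f, Y) = u" if "(X, u, f, Y) \<in> Hom MonC X Y" for X Y :: "'v mobj" and u f using that by (simp add: mon_proj_def Hom_def)
 have o: "omap mon_proj X = fst X" if "monad_obj X" for X :: "'v mobj" using that by (simp add: mon_proj_def MonC_simps)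
 show "amap mon_proj f \<in> Hom SetC (omap mon_proj X) (omap mon_proj Y)" if f: "f \<in> Hom MonC X Y" for f and X Y :: "'v mobj"
 proof -
  obtain u k where f': "f = (X, u, k, Y)" "u \<in> Hom SetC (fst X) (fst Y)" "monad_obj X" "monad_obj Y" using f unfolding Hom_MonC by blast
  show ?thesis using a[OF f[unfolded f'(1)]] f' o by simp
 qed
 show "amap mon_proj (Idn MonC X) = Idn SetC (omap mon_proj X)" if "X \<in> Obj MonC" for X :: "'v mobj"
  using a[OF category.Idn_Hom[OF category_MonC that, unfolded MonC_simps]] that o by (simp add: MonC_simps)
 show "amap mon_proj (g *[MonC] f) = amap mon_proj g *[SetC] amap mon_proj f" if f: "f \<in> Hom MonC X Y" and g: "g \<in> Hom MonC Y Z" for f g and X Y Z :: "'v mobj"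
 proof -
  obtain u k v l where fg: "f = (X, u, k, Y)" "g = (Y, v, l, Z)" using f g unfolding Hom_MonC by blast
  show ?thesis using a[OF f[unfolded fg(1)]] a[OF g[unfolded fg(2)]]
    a[OF category.Cmp_Hom[OF category_MonC f g, unfolded fg MonC_simps]] unfolding fg MonC_simps by simp
 qed
qed (simp add: mon_proj_def)

lemma mfunctor_over: "cF MU mon_proj mfunctor = mult_proj"
proof -
 note h = functor_Hom[OF mfunctor]
 have a: "amap (cF MultC mon_proj mfunctor) F = amap mult_proj F" if F: "F \<in> Arr MultC" for F :: "'v mcarr"
 proof -
  obtain M ph N where F': "F = (M, ph, N)" by (cases F)
  have "amap mfunctor F \<in> Arr MonC" using h(1)[of F M N] F unfolding F' by (simp add: Hom_def MultC_simps)
  then show ?thesis using F unfolding F' by (simp add: comp_functor_def mult_proj_def mon_proj_def mfunctor_def)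
 qed
 have "amap (cF MultC mon_proj mfunctor) = amap (mult_proj :: ('v mcat, 'v mcarr, 'v set, 'v fn) fctr)"
  by (rule extensionalityI[of _ "Arr MultC", OF _ _ a]) (simp_all add: comp_functor_def mult_proj_def extensional_def)
 moreover have "omap (cF MultC mon_proj mfunctor) = omap (mult_proj :: ('v mcat, 'v mcarr, 'v set, 'v fn) fctr)" by (intro extensionalityI[of _ "Obj MultC"])
   (auto simp: comp_functor_def mult_proj_def mon_proj_def mfunctor_def MultC_simps MonC_simps dest: pmnd_obj)
 ultimately show ?thesis by (simp add: comp_functor_def mult_proj_def)
qed

lemma mfunctor_bij: assumes M: "multicategory (M :: 'v mcat)" and N: "multicategory N"
 shows "bij_betw (amap mfunctor) (Hom MultC M N) (Hom MonC (omap mfunctor M) (omap mfunctor N))"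
proof -
 have o: "omap mfunctor M = (base M, pmnd M)" "omap mfunctor N = (base N, pmnd N)" using M N by (simp_all add: mfunctor_def MultC_simps)
 have a: "amap mfunctor (M, ph, N) = ((base M, pmnd M), (base M, fob ph, base N), fmor M N ph, (base N, pmnd N))"
  if "multicat_mor M N ph" for ph using that M N by (simp add: mfunctor_def MultC_def)
 show ?thesis
 proof (rule bij_betw_imageI)
  show "inj_on (amap mfunctor) (Hom MultC M N)"
  proof (rule inj_onI)
   fix f f' assume f: "f \<in> Hom MultC M N" "f' \<in> Hom MultC M N" "amap mfunctor f = amap mfunctor f'"
   then obtain ph ps where p: "f = (M, ph, N)" "f' = (M, ps, N)" "multicat_mor M N ph" "multicat_mor M N ps" unfolding Hom_MultC by blast
   have "fob ph = fob ps" "fmor M N ph = fmor M N ps" using f(3) unfolding p(1,2) a[OF p(3)] a[OF p(4)] by simp_all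
   then show "f = f'" using fmor_faithful[OF M N p(3,4)] p(1,2) by simp
  qed
  show "amap mfunctor ` Hom MultC M N = Hom MonC (omap mfunctor M) (omap mfunctor N)"
  proof (intro subset_antisym subsetI)
   fix k assume "k \<in> amap mfunctor ` Hom MultC M N"
   then show "k \<in> Hom MonC (omap mfunctor M) (omap mfunctor N)" using functor_Hom(1)[OF mfunctor] by blast
  next
   fix k assume "k \<in> Hom MonC (omap mfunctor M) (omap mfunctor N)"
   then obtain u f where k: "k = ((base M, pmnd M), u, f, (base N, pmnd N))" "u \<in> Hom SetC (base M) (base N)"
    "emor u (base M) (base N) (pmnd M) (pmnd N) f" unfolding o Hom_MonC by auto
   obtain ph where p: "multicat_mor M N ph" "u = (base M, fob ph, base N)" "fmor M N ph = f" by (rule fmor_full[OF M N k(2,3)])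
   have "k = amap mfunctor (M, ph, N)" unfolding a[OF p(1)] k(1) p(2,3) ..
   moreover have "(M, ph, N) \<in> Hom MultC M N" unfolding Hom_MultC using M N p(1) by blast
   ultimately show "k \<in> amap mfunctor ` Hom MultC M N" by blast
  qed
 qed
qed

lemma mult_fibration: "fibration MU SetC mult_proj" unfolding fibration_def
proof (intro conjI ballI impI mult_proj)
 fix N :: "'v mcat" and u :: "'v fn" assume "N \<in> Obj MultC" and u: "u \<in> Arr SetC" "Tgt SetC u = omap mult_proj N"
 then have N: "multicategory N" and oN: "omap mult_proj N = base N" by (simp_all add: MultC_simps mult_proj_def)
 define O' U where "O' = fst u" and "U = fn u"
 have u': "u = (O', U, base N)" using u(2) oN by (cases u) (simp add: O'_def U_def)
 have U: "U \<in> O' ->E base N" "small O'" using u(1) oN unfolding Arr_SetC u' by simp_all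
 note Nd = multicategory_D[OF N]
 interpret multpull V O' U N by unfold_locales (use Nd(1) U Nd(3) N in "simp_all add: mcat_data_def")
 have ar: "(L, ps, K) \<in> Arr MultC <-> multicategory L & multicategory K & multicat_mor L K ps" for L K :: "'v mcat" and ps by (simp add: MultC_def)
 have am: "amap mult_proj (L, ps, K) = (base L, fob ps, base K)" if "multicategory L" "multicategory K" "multicat_mor L K ps" for L K :: "'v mcat" and ps
  using that by (simp add: mult_proj_def ar)
 have om: "omap mult_proj L = base L" if "multicategory L" for L :: "'v mcat" using that by (simp add: mult_proj_def MultC_simps)
 note mM = multicategory_M and mp = data(2)
 have "cartesian_arrow MultC SetC mult_proj (M, ph, N)" unfolding cartesian_arrow_def
 proof (intro conjI ballI impI)
  show "(M, ph, N) \<in> Arr MultC" using mM mp N ar by simp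
  fix k :: "'v mcarr" and w assume k: "k \<in> Arr MultC" and w: "w \<in> Hom SetC (omap mult_proj (Src MultC k)) (omap mult_proj (Src MultC (M, ph, N)))"
   and e: "Tgt MultC k = Tgt MultC (M, ph, N) & amap mult_proj k = amap mult_proj (M, ph, N) *[SetC] w"
  obtain L ps where k': "k = (L, ps, N)" using e by (cases k) (simp add: MultC_simps)
  have L: "multicategory L" "multicat_mor L N ps" using k ar unfolding k' by simp_all
  have "w \<in> Hom SetC (base L) O'" using w om[OF L(1)] om[OF mM] unfolding k' by (simp add: MultC_simps)
  then obtain h where h: "w = (base L, h, O')" "h \<in> base L ->E O'" unfolding Hom_SetC by blast
  have "fob ps = compose (base L) U h" using e am[OF L(1) N L(2)] am[OF mM N mp] phi(4) unfolding k' h(1) by (simp add: Cmp_SetC)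
  then have e': "ALL x:base L. fob ps x = U (h x)" by (simp add: compose_eq)
  from factor[OF L h(2) e'] obtain ch where c: "multicat_mor L M ch" "fob ch = h" "sig_comp (base L) (msig L) ph ch = ps"
   and c': "!!ch'. multicat_mor L M ch' ==> fob ch' = h ==> sig_comp (base L) (msig L) ph ch' = ps ==> ch' = ch" by blast
  have "EX! r. r \<in> Hom MultC L M & amap mult_proj r = w & (M, ph, N) *[MultC] r = k"
  proof (rule ex1I[of _ "(L, ch, M)"], intro conjI)
   show "(L, ch, M) \<in> Hom MultC L M" unfolding Hom_MultC using L(1) mM c(1) by blast
   show "amap mult_proj (L, ch, M) = w" unfolding am[OF L(1) mM c(1)] h(1) using c(2) by simp
   show "(M, ph, N) *[MultC] (L, ch, M) = k" unfolding MultC_simps k' using c(3) by simp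
  next
   fix r assume r: "r \<in> Hom MultC L M & amap mult_proj r = w & (M, ph, N) *[MultC] r = k"
   then obtain ch' where r': "r = (L, ch', M)" "multicat_mor L M ch'" unfolding Hom_MultC by blast
   have "fob ch' = h" "sig_comp (base L) (msig L) ph ch' = ps" using r am[OF L(1) mM r'(2)] unfolding r'(1) h(1) k' MultC_simps by simp_all
   then show "r = (L, ch, M)" using c'[OF r'(2)] r'(1) by simp
  qed
  then show "EX! r. r \<in> Hom MultC (Src MultC k) (Src MultC (M, ph, N)) & amap mult_proj r = w & (M, ph, N) *[MultC] r = k" unfolding k' by (simp add: MultC_simps)
 qed
 moreover have "Tgt MultC (M, ph, N) = N" by (simp add: MultC_simps)
 moreover have "amap mult_proj (M, ph, N) = u" unfolding am[OF mM N mp] u' phi(4) by simp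
 ultimately show "EX f. cartesian_arrow MultC SetC mult_proj f & Tgt MultC f = N & amap mult_proj f = u" by blast
qed

lemma mon_fibration_equivalent: "fibration MO SetC mon_proj" "equivalent_over SetC MU mult_proj MO mon_proj"
proof -
 have "ALL X:Obj MO. EX p. fst p \<in> Obj MultC & fst (snd p) \<in> Hom MonC (omap mfunctor (fst p)) X & snd (snd p) \<in> Hom MonC X (omap mfunctor (fst p)) &
  snd (snd p) *[MonC] fst (snd p) = Idn MonC (omap mfunctor (fst p)) & fst (snd p) *[MonC] snd (snd p) = Idn MonC X &
  amap mon_proj (fst (snd p)) = Idn SetC (omap mon_proj X)"
 proof
  fix X :: "'v mobj" assume X: "X \<in> Obj MonC"
  obtain A T where AT: "X = (A, T)" by (cases X)
  have T: "monad_obj (A, T)" using X unfolding AT by (simp add: MonC_simps)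
  obtain M f where M: "multicategory M" "base M = A" "is_iso MonC f" "f \<in> Hom MonC (A, pmnd M) (A, T)" "fst (snd f) = Idn SetC A" by (rule vertical_iso[OF T])
  have o: "omap mfunctor M = (A, pmnd M)" using M(1,2) by (simp add: mfunctor_def MultC_simps)
  have st: "f \<in> Arr MonC" "Src MonC f = (A, pmnd M)" "Tgt MonC f = (A, T)" using M(4) by (auto simp: Hom_def)
  obtain k where k: "k \<in> Hom MonC (A, T) (A, pmnd M)" "k *[MonC] f = Idn MonC (A, pmnd M)" "f *[MonC] k = Idn MonC (A, T)"
   using M(3) unfolding is_iso_def st(2,3) by blast
  have "amap mon_proj f = Idn SetC (omap mon_proj (A, T))" using st(1) M(5) T by (simp add: mon_proj_def MonC_simps case_prod_beta)
  then show "EX p. fst p \<in> Obj MultC & fst (snd p) \<in> Hom MonC (omap mfunctor (fst p)) X & snd (snd p) \<in> Hom MonC X (omap mfunctor (fst p)) &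
   snd (snd p) *[MonC] fst (snd p) = Idn MonC (omap mfunctor (fst p)) & fst (snd p) *[MonC] snd (snd p) = Idn MonC X &
   amap mon_proj (fst (snd p)) = Idn SetC (omap mon_proj X)" using M(1,4) k unfolding AT by (intro exI[of _ "(M, f, k)"]) (simp add: o MultC_simps(1))
 qed
 from bchoice[OF this] obtain p where p: "ALL X:Obj MO. fst (p X) \<in> Obj MultC & fst (snd (p X)) \<in> Hom MonC (omap mfunctor (fst (p X))) X &
  snd (snd (p X)) \<in> Hom MonC X (omap mfunctor (fst (p X))) & snd (snd (p X)) *[MonC] fst (snd (p X)) = Idn MonC (omap mfunctor (fst (p X))) &
  fst (snd (p X)) *[MonC] snd (snd (p X)) = Idn MonC X & amap mon_proj (fst (snd (p X))) = Idn SetC (omap mon_proj X)" ..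
 interpret vertical_equivalence MultC MonC SetC mult_proj mon_proj mfunctor "%X. fst (p X)" "%X. fst (snd (p X))" "%X. snd (snd (p X))"
  by (intro vertical_equivalence.intro category_MultC category_MonC category_SetC vertical_equivalence_axioms.intro
    mult_proj mon_proj mfunctor mfunctor_over mfunctor_bij) (use p in "simp_all add: MultC_simps(1)")
 show "fibration MO SetC mon_proj" by (rule fibration_transfer[OF mult_fibration])
 show "equivalent_over SetC MU mult_proj MO mon_proj" by (rule equivalent)
qed

end

theorem corollary6p13:
 assumes "grothendieck_universe TYPE('v)"
 shows "fibration (MultC :: ('v mcat, 'v mcarr) cat) SetC mult_proj \<and>
    fibration (MonC :: ('v mobj, 'v marr) cat) SetC mon_proj \<and>
    equivalent_over SetC (MultC :: ('v mcat, 'v mcarr) cat) mult_proj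
               (MonC :: ('v mobj, 'v marr) cat) mon_proj"
proof -
 interpret universe "TYPE('v)" by unfold_locales (rule assms)
 show ?thesis using mult_fibration mon_fibration_equivalent by blast
qed

end
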